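(* Assume that $q$ is odd. For every $n\ge1$, the algebraic group $\mathrm{PGL}_{2,\mathbb C_\infty}^{\,n}$ is $p$-sparse.
   Context: $q$ is a power of a prime $p$, and $\mathbb C_\infty$ is the completion of an algebraic closure of $\mathbb F_q((1/T))$ (a complete algebraically closed non-archimedean field of characteristic $p$). Let $G$ be a smooth connected algebraic group over $\mathbb C_\infty$ with identity $e$, and $G^{\mathrm{an}}$ its rigid analytification. A reduced irreducible rigid analytic germ $\Sigma\subset(G^{\mathrm{an}},e)$ is called a subgroup germ if the morphism $\delta\colon G\times G\to G$, $(a,b)\mapsto a^{-1}b$, satisfies $\delta(\Sigma\times\Sigma)\subset\Sigma$ as germs at $(e,e)$. The group $G$ is called $p$-sparse if every subgroup germ $\Sigma\subset(G^{\mathrm{an}},e)$ with $\dim\Sigma<\dim G$ is contained in the germ of a proper connected algebraic subgroup, i.e. there exists a connected algebraic subgroup $H\subsetneq G$ with $\Sigma\subset(H^{\mathrm{an}},e)$. *)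

theory Defs
  imports
    "HOL-Analysis.Analysis"
    "HOL-Algebra.Product_Groups"
    "HOL-Computational_Algebra.Computational_Algebra"
begin

section \<open>The field $\mathbb{C}_\infty$\<close>

text \<open>
  Complete non-archimedean fields. The absolute value of \<open>x\<close> is \<open>dist x 0\<close>; it is not a
  \<open>norm\<close> in the sense of the library, since such a field need not be a real algebra.
\<close>

class ultrametric_field = field + complete_space +
  assumes dist_translate: "dist (x + z) (y + z) = dist x y"
    and dist_mult_0: "dist (x * y) 0 = dist x 0 * dist y 0"
    and dist_add_0_le_max: "dist (x + y) 0 \<le> max (dist x 0) (dist y 0)"

text \<open>
  A model of $\mathbb{C}_\infty$. The finite field \<open>'f\<close> is $\mathbb{F}_q$, the uniformiser
  \<open>fls_X\<close> plays the role of $1/T$, and \<open>\<iota>\<close> is the embedding of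
  $\mathbb{F}_q((1/T))$, normalised by $|T| = q$. Completeness and algebraic closedness
  are in the sort of \<open>'k\<close>; the last assumption says that the algebraic closure of the image of
  \<open>\<iota>\<close> in \<open>'k\<close> is dense.
\<close>

locale C_infinity =
  fixes q :: nat
    and \<iota> :: "'f :: {field, finite} fls \<Rightarrow> 'k :: {alg_closed_field, ultrametric_field}"
  assumes card_eq: "CARD('f) = q"
    and embed_one: "\<iota> 1 = 1"
    and embed_add: "\<iota> (f + g) = \<iota> f + \<iota> g"
    and embed_mult: "\<iota> (f * g) = \<iota> f * \<iota> g"
    and embed_abs: "f \<noteq> 0 \<Longrightarrow> dist (\<iota> f) 0 = real q powi (- fls_subdegree f)"
    and dense_algebraic:
      "closure {x. \<exists>p. p \<noteq> 0 \<and> (\<forall>i. coeff p i \<in> range \<iota>) \<and> poly p x = 0} = UNIV"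


section \<open>Irreducibility and Krull dimension\<close>

text \<open>
  Both notions are relative to a family \<open>C\<close> of closed sets and an inclusion preorder \<open>R\<close> on sets, so
  as to apply to Zariski closed sets (with \<open>\<subseteq>\<close>) and to germs of analytic sets
  (with inclusion near a point).
\<close>

definition irreducible_in ::
    "('a set \<Rightarrow> bool) \<Rightarrow> ('a set \<Rightarrow> 'a set \<Rightarrow> bool) \<Rightarrow> 'a set \<Rightarrow> bool" where
  "irreducible_in C R X \<longleftrightarrow>
     C X \<and> \<not> R X {} \<and>
     (\<forall>Y Z. C Y \<and> C Z \<and> R X (Y \<union> Z) \<longrightarrow> R X Y \<or> R X Z)"

definition krull_dim ::
    "('a set \<Rightarrow> bool) \<Rightarrow> ('a set \<Rightarrow> 'a set \<Rightarrow> bool) \<Rightarrow> 'a set \<Rightarrow> enat" where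
  "krull_dim C R X =
     Sup {enat k | k. \<exists>c :: nat \<Rightarrow> 'a set.
            (\<forall>i\<le>k. irreducible_in C R (c i) \<and> R (c i) X) \<and>
            (\<forall>i<k. R (c i) (c (Suc i)) \<and> \<not> R (c (Suc i)) (c i))}"


section \<open>Affine algebraic groups\<close>

text \<open>
  An affine algebraic group over an algebraically closed field \<open>'k\<close> is given by the group \<open>G\<close> of
  its points together with its coordinate ring \<open>A\<close>, a ring of functions on \<open>carrier G\<close>. The
  elements of \<open>A\<close> are total functions, whose values outside \<open>carrier G\<close> are never used. As \<open>A\<close>
  consists of functions on points, such a group is reduced, hence smooth.
\<close>

inductive_set generated_algebra :: "('a \<Rightarrow> 'k) set \<Rightarrow> ('a \<Rightarrow> 'k :: comm_ring_1) set"
  for S where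
    const: "(\<lambda>_. c) \<in> generated_algebra S"
  | gen: "f \<in> S \<Longrightarrow> f \<in> generated_algebra S"
  | add: "f \<in> generated_algebra S \<Longrightarrow> g \<in> generated_algebra S \<Longrightarrow>
            (\<lambda>x. f x + g x) \<in> generated_algebra S"
  | mult: "f \<in> generated_algebra S \<Longrightarrow> g \<in> generated_algebra S \<Longrightarrow>
            (\<lambda>x. f x * g x) \<in> generated_algebra S"

definition zariski_topology :: "('a, 'm) monoid_scheme \<Rightarrow> ('a \<Rightarrow> 'k :: field) set \<Rightarrow> 'a topology"
  where "zariski_topology G A = topology_generated_by {{x \<in> carrier G. f x \<noteq> 0} | f. f \<in> A}"

definition algebraic_dim :: "('a, 'm) monoid_scheme \<Rightarrow> ('a \<Rightarrow> 'k :: field) set \<Rightarrow> enat" where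
  "algebraic_dim G A = krull_dim (closedin (zariski_topology G A)) (\<subseteq>) (carrier G)"

definition connected_algebraic_subgroup ::
    "('a, 'm) monoid_scheme \<Rightarrow> ('a \<Rightarrow> 'k :: field) set \<Rightarrow> 'a set \<Rightarrow> bool" where
  "connected_algebraic_subgroup G A H \<longleftrightarrow>
     subgroup H G \<and> closedin (zariski_topology G A) H \<and> connectedin (zariski_topology G A) H"


section \<open>Germs of rigid analytic sets at the identity\<close>

definition analytic_topology ::
    "('a, 'm) monoid_scheme \<Rightarrow> ('a \<Rightarrow> 'k :: ultrametric_field) set \<Rightarrow> 'a topology" where
  "analytic_topology G A =
     topology_generated_by {{x \<in> carrier G. f x \<in> U} | f U. f \<in> A \<and> open U}"

definition near_one ::
    "('a, 'm) monoid_scheme \<Rightarrow> ('a \<Rightarrow> 'k :: ultrametric_field) set \<Rightarrow> 'a filter" where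
  "near_one G A = nhdsin (analytic_topology G A) \<one>\<^bsub>G\<^esub>"

text \<open>
  \<open>f\<close> represents an element of the local ring of $G^{\mathrm{an}}$ at the identity: near the
  identity it is $F(h_1 - h_1(e), \dots, h_N - h_N(e))$ for regular functions $h_i$ and a power
  series $F = \sum_\alpha c_\alpha y^\alpha$ with positive radius of convergence. The $h_i$ may be
  taken among any larger list of regular functions, in particular among generators of \<open>A\<close>, that is,
  coordinates of a closed embedding of \<open>G\<close> into an affine space.
\<close>

definition analytic_near_one ::
    "('a, 'm) monoid_scheme \<Rightarrow> ('a \<Rightarrow> 'k :: ultrametric_field) set \<Rightarrow> ('a \<Rightarrow> 'k) \<Rightarrow> bool" where
  "analytic_near_one G A f \<longleftrightarrow>
     (\<exists>(N :: nat) (h :: nat \<Rightarrow> 'a \<Rightarrow> 'k) (c :: (nat \<Rightarrow> nat) \<Rightarrow> 'k) (r :: real) (B :: real).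
        (\<forall>i<N. h i \<in> A) \<and> r > 0 \<and>
        (\<forall>\<alpha> \<in> {..<N} \<rightarrow>\<^sub>E UNIV. dist (c \<alpha>) 0 * r ^ (\<Sum>i<N. \<alpha> i) \<le> B) \<and>
        (\<forall>\<^sub>F x in near_one G A.
           ((\<lambda>\<alpha>. c \<alpha> * (\<Prod>i<N. (h i x - h i \<one>\<^bsub>G\<^esub>) ^ \<alpha> i)) has_sum f x)
             ({..<N} \<rightarrow>\<^sub>E UNIV)))"

text \<open>
  Since \<open>'k\<close> is algebraically closed, reduced analytic germs are determined by their
  \<open>'k\<close>-rational points, so a germ is represented by a set of points, and only the trace of this
  set on small neighbourhoods of the identity matters.
\<close>

definition analytic_germ ::
    "('a, 'm) monoid_scheme \<Rightarrow> ('a \<Rightarrow> 'k :: ultrametric_field) set \<Rightarrow> 'a set \<Rightarrow> bool" where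
  "analytic_germ G A \<Sigma> \<longleftrightarrow>
     (\<exists>F. finite F \<and> (\<forall>f\<in>F. analytic_near_one G A f) \<and>
          (\<forall>\<^sub>F x in near_one G A. x \<in> \<Sigma> \<longleftrightarrow> (\<forall>f\<in>F. f x = 0)))"

definition germ_le ::
    "('a, 'm) monoid_scheme \<Rightarrow> ('a \<Rightarrow> 'k :: ultrametric_field) set \<Rightarrow> 'a set \<Rightarrow> 'a set \<Rightarrow> bool" where
  "germ_le G A \<Sigma> \<Sigma>' \<longleftrightarrow> (\<forall>\<^sub>F x in near_one G A. x \<in> \<Sigma> \<longrightarrow> x \<in> \<Sigma>')"

definition germ_dim ::
    "('a, 'm) monoid_scheme \<Rightarrow> ('a \<Rightarrow> 'k :: ultrametric_field) set \<Rightarrow> 'a set \<Rightarrow> enat" where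
  "germ_dim G A \<Sigma> = krull_dim (analytic_germ G A) (germ_le G A) \<Sigma>"

definition subgroup_germ ::
    "('a, 'm) monoid_scheme \<Rightarrow> ('a \<Rightarrow> 'k :: ultrametric_field) set \<Rightarrow> 'a set \<Rightarrow> bool" where
  "subgroup_germ G A \<Sigma> \<longleftrightarrow>
     irreducible_in (analytic_germ G A) (germ_le G A) \<Sigma> \<and>
     (\<forall>\<^sub>F (a, b) in near_one G A \<times>\<^sub>F near_one G A.
        a \<in> \<Sigma> \<longrightarrow> b \<in> \<Sigma> \<longrightarrow> inv\<^bsub>G\<^esub> a \<otimes>\<^bsub>G\<^esub> b \<in> \<Sigma>)"

text \<open>Used for connected \<open>G\<close> only.\<close>

definition p_sparse ::
    "('a, 'm) monoid_scheme \<Rightarrow> ('a \<Rightarrow> 'k :: {alg_closed_field, ultrametric_field}) set \<Rightarrow> bool" where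
  "p_sparse G A \<longleftrightarrow>
     (\<forall>\<Sigma>. subgroup_germ G A \<Sigma> \<and> germ_dim G A \<Sigma> < algebraic_dim G A \<longrightarrow>
        (\<exists>H. connected_algebraic_subgroup G A H \<and> H \<noteq> carrier G \<and> germ_le G A \<Sigma> H))"


section \<open>The algebraic groups $\mathrm{PGL}_2^n$\<close>

definition GL2 :: "('k :: field ^ 2 ^ 2) monoid" where
  "GL2 = \<lparr>carrier = {m. invertible m}, mult = (\<lambda>m m'. m ** m'), one = mat 1\<rparr>"

definition regular_GL2 :: "('k :: field ^ 2 ^ 2 \<Rightarrow> 'k) set" where
  "regular_GL2 =
     generated_algebra (insert (\<lambda>m. inverse (det m)) {(\<lambda>m. m $ i $ j) | i j. True})"

definition scalars_GL2 :: "('k :: field ^ 2 ^ 2) set" where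
  "scalars_GL2 = {mat c | c. c \<noteq> 0}"

definition PGL2 :: "('k :: field ^ 2 ^ 2) set monoid" where
  "PGL2 = GL2 Mod scalars_GL2"

text \<open>
  The regular functions on the quotient variety $\mathrm{GL}_2/\mathbb{G}_m$ are those functions
  whose pullback to $\mathrm{GL}_2$ is regular.
\<close>

definition regular_PGL2 :: "(('k :: field ^ 2 ^ 2) set \<Rightarrow> 'k) set" where
  "regular_PGL2 =
     {f. \<exists>h \<in> regular_GL2. \<forall>m \<in> carrier GL2. f (scalars_GL2 #>\<^bsub>GL2\<^esub> m) = h m}"

definition PGL2_power :: "nat \<Rightarrow> (nat \<Rightarrow> ('k :: field ^ 2 ^ 2) set) monoid" where
  "PGL2_power n = product_group {..<n} (\<lambda>_. PGL2)"

definition regular_PGL2_power :: "nat \<Rightarrow> ((nat \<Rightarrow> ('k :: field ^ 2 ^ 2) set) \<Rightarrow> 'k) set" where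
  "regular_PGL2_power n =
     generated_algebra {(\<lambda>x. f (x i)) | f i. f \<in> regular_PGL2 \<and> i < n}"

end

theory Submission
  imports Defs
begin

text \<open>
  Let \<open>\<Sigma>\<close> be a subgroup germ that is not contained in a proper connected algebraic subgroup. The Zariski
  closure of the trace of \<open>\<Sigma>\<close> on a small polydisc is a connected algebraic subgroup, so each such trace
  is Zariski dense. It is also smooth. Indeed, by homogeneity the convergent power series in
  suitably chosen coordinates that vanish on \<open>\<Sigma>\<close> are stable under partial derivatives, and then they
  are zero: Schwarz's lemma bounds them, and applying it to the \<open>p\<close>-th roots of their Frobenius
  components improves the bound indefinitely. So \<open>\<Sigma>\<close> is the graph of convergent power series.

  The tangent space of \<open>\<Sigma>\<close> is stable under the adjoint action of \<open>\<Sigma>\<close>, hence of $\mathrm{PGL}_2^n$ by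
  density, but its projection to some factor may be zero, as for the graph of the Frobenius. Taking
  \<open>p ^ m i\<close>-th roots of the coordinates of the \<open>i\<close>-th factor, with \<open>m i\<close> maximal such that \<open>\<Sigma>\<close> has a
  parametrization by \<open>p ^ m i\<close>-th powers in this factor, turns \<open>\<Sigma>\<close> into a local group for which all these
  projections are nonzero. As \<open>p\<close> is odd, its tangent space is then everything. Thus \<open>\<Sigma>\<close> is a
  neighbourhood of the identity, which contains a chain of irreducible germs of length \<open>3 * n\<close>, and
  \<open>3 * n\<close> is a bound for the dimension of $\mathrm{PGL}_2^n$.
\<close>

section \<open>Ultrametric absolute values\<close>

text \<open>In characteristic p there is no exponential map, a local group is not determined by its
  Lie algebra, and derivations kill all p-th powers, so Taylor expansion along a stable ideal stops
  short. The substitute is quantitative: sup norms on polydiscs, Cauchy estimates and p-th roots.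
  Hence convergent series are handled as uniform limits of polynomial functions and derivatives as
  first-order expansions with uniform error. All 4 n matrix entries serve as coordinates, although
  the group has dimension 3 n. Multiplication is then affine in each argument, at the cost of one
  scalar direction per factor, which lies in every tangent space that occurs. Normalising the entry
  (1, 1) to 1 removes it where roots are extracted and where coordinate germs are counted. Oddness
  of q enters as 2 \<noteq> 0: for p = 2 the matrices of trace zero contain the scalars and are
  stable under conjugation, so a stable tangent space containing the scalars could be proper. For
  odd p they meet the scalars only in 0.\<close>

definition vabs :: "'k :: ultrametric_field \<Rightarrow> real" where
  "vabs x = dist x 0"

lemma dist_vabs: "dist x y = vabs (x - y)"
  using dist_translate[of x "- y" y] by (simp add: vabs_def)

lemma vabs_0 [simp]: "vabs 0 = 0"
  and vabs_ge_0 [simp]: "vabs x \<ge> 0"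
  and vabs_eq_0_iff [simp]: "vabs x = 0 \<longleftrightarrow> x = 0"
  and vabs_le_0_iff [simp]: "vabs x \<le> 0 \<longleftrightarrow> x = 0"
  and vabs_pos_iff [simp]: "vabs x > 0 \<longleftrightarrow> x \<noteq> 0"
  by (auto simp: vabs_def)

lemma vabs_mult: "vabs (x * y) = vabs x * vabs y"
  by (simp add: vabs_def dist_mult_0)

lemma vabs_add_le_max: "vabs (x + y) \<le> max (vabs x) (vabs y)"
  by (simp add: vabs_def dist_add_0_le_max)

lemma vabs_1 [simp]: "vabs 1 = 1"
  using vabs_mult[of "1 :: 'a" 1] vabs_eq_0_iff[of "1 :: 'a"] by (simp del: vabs_eq_0_iff)

lemma vabs_power: "vabs (x ^ n) = vabs x ^ n"
  by (induction n) (simp_all add: vabs_mult)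

lemma vabs_minus_1 [simp]: "vabs (- 1) = 1"
proof -
  have "vabs (- 1 :: 'a) ^ 2 = 1"
    by (simp flip: vabs_power)
  then show ?thesis
    using vabs_ge_0[of "- 1 :: 'a"] unfolding power2_eq_1_iff by linarith
qed

lemma vabs_minus [simp]: "vabs (- x) = vabs x"
  using vabs_mult[of "- 1" x] by simp

lemma vabs_minus_commute: "vabs (x - y) = vabs (y - x)"
  using vabs_minus[of "x - y"] by simp

lemma vabs_inverse: "vabs (inverse x) = inverse (vabs x)"
proof (cases "x = 0")
  case False
  then have "vabs x * vabs (inverse x) = 1"
    by (simp flip: vabs_mult)
  then show ?thesis
    by (metis inverse_unique)
qed simp

lemma vabs_divide: "vabs (x / y) = vabs x / vabs y"
  by (simp add: divide_inverse vabs_mult vabs_inverse)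

lemma vabs_prod: "vabs (prod f A) = (\<Prod>a\<in>A. vabs (f a))"
  by (induction A rule: infinite_finite_induct) (simp_all add: vabs_mult)

lemma vabs_add_le: "vabs x \<le> M \<Longrightarrow> vabs y \<le> M \<Longrightarrow> vabs (x + y) \<le> M"
  using vabs_add_le_max[of x y] by linarith

lemma vabs_diff_le: "vabs x \<le> M \<Longrightarrow> vabs y \<le> M \<Longrightarrow> vabs (x - y) \<le> M"
  using vabs_add_le[of x M "- y"] by simp

lemma vabs_sum_le:
  assumes "\<And>a. a \<in> A \<Longrightarrow> vabs (f a) \<le> M" "M \<ge> 0"
  shows "vabs (sum f A) \<le> M"
  using assms(1) by (induction A rule: infinite_finite_induct) (auto intro: vabs_add_le assms(2))

lemma vabs_add_eq: "vabs y < vabs x \<Longrightarrow> vabs (x + y) = vabs x"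
  using vabs_add_le_max[of x y] vabs_add_le_max[of "x + y" "- y"] by simp

lemma vabs_eq_1I: "vabs (x - 1) < 1 \<Longrightarrow> vabs x = 1"
  using vabs_add_eq[of "x - 1" 1] by simp

lemma vabs_of_nat_le: "vabs (of_nat n) \<le> 1"
  by (induction n) (auto intro: vabs_add_le)

lemma eq_if_vabs_small:
  assumes "\<And>e. e > 0 \<Longrightarrow> vabs (x - y) \<le> e"
  shows "x = y"
  using field_le_epsilon[of "vabs (x - y)" 0] assms by auto

section \<open>Cauchy estimates for polynomials\<close>

text \<open>The parameter \<open>field_type\<close> fixes the field \<open>'k\<close>, so that
  \<open>radius\<close>, whose type does not mention it, still speaks of the values of this
  field.\<close>

locale nonarch_field =
  fixes field_type :: "'k :: {alg_closed_field, ultrametric_field} itself"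
    and p :: nat
  assumes char_eq: "CHAR('k) = p"
    and prime_p: "prime p"
    and nontrivial: "\<exists>c :: 'k. c \<noteq> 0 \<and> vabs c < 1"
begin

lemma prime_char: "prime CHAR('k)"
  by (simp add: char_eq prime_p)

lemmas frob_add = freshmans_dream[OF prime_char char_eq[symmetric]]
  and frob_pow_add = freshmans_dream'[OF prime_char refl, unfolded char_eq]
  and frob_pow_sum = freshmans_dream_sum'[OF prime_char refl, unfolded char_eq]

lemma frob_pow_diff: "(x - y) ^ (p ^ e) = x ^ (p ^ e) - (y :: 'k) ^ (p ^ e)"
  using frob_pow_add[of "x - y" y e] by simp

lemmas frob_diff = frob_pow_diff[of _ _ 1, simplified]

lemma of_nat_eq_0: "of_nat n = (0 :: 'k) \<longleftrightarrow> p dvd n"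
  by (simp add: of_nat_eq_0_iff_char_dvd char_eq)

lemma of_nat_p [simp]: "of_nat p = (0 :: 'k)"
  by (simp add: of_nat_eq_0)

lemma p_pos [simp]: "p > 0"
  using prime_p prime_gt_0_nat by blast

lemma p_gt_1: "p > 1"
  using prime_p prime_gt_1_nat by blast

lemma ex_root: "\<exists>y :: 'k. y ^ n = x" if "n > 0"
  using nth_root_exists[OF that] .

text \<open>\<open>n\<close> has an inverse \<open>x\<close> modulo \<open>p\<close>, so
  \<open>|n| |x| = 1\<close> in characteristic \<open>p\<close>, while both factors are at most
  1.\<close>

lemma vabs_of_nat_eq_1:
  assumes "\<not> p dvd n"
  shows "vabs (of_nat n :: 'k) = 1"
proof -
  have "coprime n p"
    using prime_imp_coprime[OF prime_p assms] by (simp add: coprime_commute)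
  moreover have "n \<noteq> 0"
    using assms by (cases n) auto
  ultimately obtain x y where xy: "n * x = p * y + 1"
    using bezout_nat[of n p] by auto
  have "(of_nat n :: 'k) * of_nat x = of_nat (p * y + 1)"
    by (simp only: xy[symmetric] of_nat_mult)
  also have "\<dots> = 1"
    by simp
  finally have "vabs (of_nat n :: 'k) * vabs (of_nat x :: 'k) = 1"
    by (simp flip: vabs_mult)
  then show ?thesis
    using vabs_of_nat_le[of n, where ?'a = 'k] vabs_of_nat_le[of x, where ?'a = 'k]
    by (smt (verit) mult_left_le mult_nonneg_nonneg vabs_ge_0)
qed

text \<open>The residue field is infinite: the powers of one root of unity of large prime order
  \<open>l \<noteq> p\<close> stay distinct modulo the maximal ideal.\<close>

lemma ex_separated_points:
  "\<exists>t :: nat \<Rightarrow> 'k. (\<forall>i. vabs (t i) \<le> 1) \<and> (\<forall>i<n. \<forall>j<n. i \<noteq> j \<longrightarrow> vabs (t i - t j) = 1)"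
proof -
  obtain l where l: "prime l" "l > max n p"
    using bigger_prime by blast
  have l0: "l > 1"
    using l prime_gt_1_nat by blast
  have ndvd: "\<not> p dvd l"
    using l prime_p by (metis max_less_iff_conj nat_neq_iff primes_dvd_imp_eq)
  \<comment> \<open>Its roots are the \<open>l\<close>-th roots of unity other than 1, because its
    value at 1 is \<open>l\<close>, which is not 0 in the field.\<close>
  define P :: "'k poly" where "P = (\<Sum>i<l. monom 1 i)"
  have "coeff P 1 \<noteq> 0"
    using l0 by (simp add: P_def coeff_sum if_distrib cong: if_cong)
  then have "degree P > 0"
    using le_degree by fastforce
  then obtain z where "poly P z = 0"
    using alg_closed_imp_poly_has_root by blast
  then have z: "(\<Sum>i<l. z ^ i) = 0"
    by (simp add: P_def poly_sum poly_monom)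
  have zl: "z ^ l = 1"
    using power_diff_1_eq[of z l] z by simp
  have "z \<noteq> 1"
    using z ndvd by (auto simp: of_nat_eq_0)
  have vz: "vabs z = 1"
  proof -
    have "vabs z ^ l = 1"
      using zl by (simp flip: vabs_power)
    then show ?thesis
      using l0 power_eq_imp_eq_base[of "vabs z" l 1] by simp
  qed
  \<comment> \<open>The powers of \<open>z ^ k\<close> sum to 0, so the differences
    \<open>(z ^ k) ^ i - 1\<close> sum to \<open>- l\<close>, which has absolute value 1. Each
    difference is divisible by \<open>z ^ k - 1\<close>, which therefore cannot be smaller than
    1.\<close>
  have zk: "vabs (z ^ k - 1) = 1" if kl: "0 < k" "k < l" for k
  proof -
    have ne: "z ^ k \<noteq> 1"
    proof
      assume zk1: "z ^ k = 1"
      have "coprime k l"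
        using kl l(1) prime_imp_coprime[of l k] nat_dvd_not_less[of k l] by (simp add: coprime_commute)
      then obtain x y where "k * x = l * y + 1"
        using bezout_nat[of k l] kl(1) by auto
      then have "z ^ (k * x) = z ^ (l * y) * z"
        by (simp add: power_add)
      then show False
        using zk1 zl \<open>z \<noteq> 1\<close> by (simp add: power_mult)
    qed
    have "(z ^ k) ^ l = (z ^ l) ^ k"
      by (simp add: mult.commute flip: power_mult)
    then have "(z ^ k) ^ l = 1"
      by (simp add: zl)
    then have s0: "(\<Sum>i<l. (z ^ k) ^ i) = 0"
      using power_diff_1_eq[of "z ^ k" l] ne by simp
    have le: "vabs (z ^ k - 1) \<le> 1"
      by (intro vabs_diff_le) (simp_all add: vabs_power vz)
    have "vabs ((z ^ k) ^ i - 1) \<le> vabs (z ^ k - 1)" for i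
    proof -
      have "vabs (\<Sum>j<i. (z ^ k) ^ j) \<le> 1"
        by (intro vabs_sum_le) (simp_all add: vabs_power vz)
      then show ?thesis
        by (subst power_diff_1_eq) (simp add: vabs_mult mult_left_le)
    qed
    then have "vabs (\<Sum>i<l. ((z ^ k) ^ i - 1)) \<le> vabs (z ^ k - 1)"
      by (intro vabs_sum_le) auto
    moreover have "(\<Sum>i<l. ((z ^ k) ^ i - 1)) = - of_nat l"
      using s0 by (simp add: sum_subtractf)
    ultimately show ?thesis
      using le vabs_of_nat_eq_1[OF ndvd] by simp
  qed
  show ?thesis
  proof (intro exI[of _ "\<lambda>i. z ^ i"] conjI allI impI)
    fix i j assume "i < n" "j < n" "i \<noteq> j"
    then show "vabs (z ^ i - z ^ j) = 1"
    proof (induction i j rule: linorder_wlog)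
      case (le i j)
      have "z ^ j = z ^ i * z ^ (j - i)"
        using le by (simp flip: power_add)
      then have "z ^ i - z ^ j = - (z ^ i * (z ^ (j - i) - 1))"
        by (simp add: algebra_simps)
      also have "vabs \<dots> = 1"
        using zk[of "j - i"] le l less_imp_diff_less[of j l i] by (simp add: vabs_mult vabs_power vz)
      finally show ?case .
    qed (simp add: vabs_minus_commute)
  qed (simp add: vabs_power vz)
qed

text \<open>Newton interpolation: division by \<open>X - t n\<close> lowers the degree, and the
  quotient obeys the same bound at the other nodes because their distance to \<open>t n\<close> is
  exactly 1.\<close>

lemma coeff_bound_of_separated:
  fixes q :: "'k poly"
  assumes "degree q < n" "\<And>i. i < n \<Longrightarrow> vabs (t i) \<le> 1"
    "\<And>i j. i < n \<Longrightarrow> j < n \<Longrightarrow> i \<noteq> j \<Longrightarrow> vabs (t i - t j) = 1"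
    "\<And>i. i < n \<Longrightarrow> vabs (poly q (t i)) \<le> M"
  shows "vabs (coeff q k) \<le> M"
  using assms
proof (induction n arbitrary: q k)
  case (Suc n)
  have M: "M \<ge> 0"
    using Suc.prems(4)[of n] vabs_ge_0[of "poly q (t n)"] by linarith
  define c where "c = t n"
  have eq: "[:- c, 1:] * synthetic_div q c + [:poly q c:] = q"
    using synthetic_div_correct'[of c q] .
  show ?case
  proof (cases "n = 0")
    case True
    then have "degree q = 0"
      using Suc.prems(1) by simp
    then obtain a where "q = [:a:]"
      by (meson degree_eq_zeroE)
    then show ?thesis
      using Suc.prems(4)[of 0] M by (simp add: coeff_pCons split: nat.split)
  next
    case False
    have IH: "vabs (coeff (synthetic_div q c) k) \<le> M" for k
    proof (rule Suc.IH)
      show "degree (synthetic_div q c) < n"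
        using Suc.prems(1) False by (simp add: degree_synthetic_div)
      fix i assume i: "i < n"
      have "poly q (t i) = (t i - c) * poly (synthetic_div q c) (t i) + poly q c"
        by (subst eq[symmetric]) (simp add: algebra_simps)
      then have "(t i - c) * poly (synthetic_div q c) (t i) = poly q (t i) - poly q c"
        by simp
      then have "vabs (t i - c) * vabs (poly (synthetic_div q c) (t i)) = vabs (poly q (t i) - poly q c)"
        by (simp flip: vabs_mult)
      also have "\<dots> \<le> M"
        using i Suc.prems(4)[of i] Suc.prems(4)[of n] by (intro vabs_diff_le) (auto simp: c_def)
      finally show "vabs (poly (synthetic_div q c) (t i)) \<le> M"
        using Suc.prems(3)[of i n] i by (simp add: c_def)
    qed (use Suc.prems in auto)
    have c: "vabs c \<le> 1" "vabs (poly q c) \<le> M"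
      using Suc.prems by (auto simp: c_def)
    have "coeff q k = (case k of 0 \<Rightarrow> poly q c - c * coeff (synthetic_div q c) 0
       | Suc l \<Rightarrow> coeff (synthetic_div q c) l - c * coeff (synthetic_div q c) (Suc l))"
      by (subst eq[symmetric]) (simp add: coeff_pCons algebra_simps split: nat.split)
    moreover have "vabs (c * coeff (synthetic_div q c) l) \<le> M" for l
      using mult_mono[OF c(1) IH[of l]] by (simp add: vabs_mult)
    ultimately show ?thesis
      using IH c by (auto split: nat.splits intro!: vabs_diff_le)
  qed
qed simp

text \<open>Scaling by \<open>d\<close> maps the unit disc onto the given disc, and on the unit disc
  finitely many points at mutual distance 1 already control all coefficients.\<close>

lemma cauchy_estimate:
  fixes q :: "'k poly" and d :: 'k
  assumes "\<And>x. vabs x \<le> vabs d \<Longrightarrow> vabs (poly q x) \<le> M"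
  shows "vabs (coeff q k) * vabs d ^ k \<le> M"
proof -
  define n where "n = Suc (degree (q \<circ>\<^sub>p [:0, d:]))"
  obtain t :: "nat \<Rightarrow> 'k" where t: "\<And>i. vabs (t i) \<le> 1"
    "\<And>i j. i < n \<Longrightarrow> j < n \<Longrightarrow> i \<noteq> j \<Longrightarrow> vabs (t i - t j) = 1"
    using ex_separated_points[of n] by blast
  have "vabs (coeff (q \<circ>\<^sub>p [:0, d:]) k) \<le> M"
  proof (rule coeff_bound_of_separated[of _ n t])
    fix i
    show "vabs (poly (q \<circ>\<^sub>p [:0, d:]) (t i)) \<le> M"
      using t(1)[of i] by (auto simp: poly_pcompose vabs_mult intro!: assms mult_left_le_one_le)
  qed (use t in \<open>auto simp: n_def\<close>)
  moreover have "coeff (q \<circ>\<^sub>p [:0, d:]) k = d ^ k * coeff q k"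
    using coeff_pcompose_monom_linear[of q d k] by (simp add: monom_Suc monom_0)
  ultimately show ?thesis
    by (simp add: vabs_mult vabs_power mult.commute)
qed

end

section \<open>Convergent power series on polydiscs\<close>

definition polydisc :: "'i set \<Rightarrow> real \<Rightarrow> ('i \<Rightarrow> 'k :: ultrametric_field) set" where
  "polydisc V r = {x. \<forall>i\<in>V. vabs (x i) \<le> r}"

text \<open>Products arise by multiplying with one variable power at a time, so an induction never
  meets a product of two unknown functions; \<open>polyfuns_mult\<close> recovers general products.
  Polynomials are taken as functions because only their values on polydiscs matter.\<close>

inductive_set polyfuns :: "('i \<Rightarrow> nat) \<Rightarrow> 'i set \<Rightarrow> (('i \<Rightarrow> 'k :: ultrametric_field) \<Rightarrow> 'k) set"
  for e V where
    const: "(\<lambda>_. c) \<in> polyfuns e V"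
  | add: "f \<in> polyfuns e V \<Longrightarrow> g \<in> polyfuns e V \<Longrightarrow> (\<lambda>x. f x + g x) \<in> polyfuns e V"
  | var_mult: "f \<in> polyfuns e V \<Longrightarrow> i \<in> V \<Longrightarrow> (\<lambda>x. x i ^ e i * f x) \<in> polyfuns e V"

text \<open>
  The uniform limits of polynomials on a closed polydisc form the Tate algebra of power series
  converging there. The exponents \<open>e\<close> serve to single out the power series in the powers
  \<open>x i ^ e i\<close> of the coordinates.
\<close>

definition tate :: "('i \<Rightarrow> nat) \<Rightarrow> 'i set \<Rightarrow> real \<Rightarrow> (('i \<Rightarrow> 'k :: ultrametric_field) \<Rightarrow> 'k) set" where
  "tate e V r =
     {f. \<forall>\<epsilon>>0. \<exists>P\<in>polyfuns e V. \<forall>x\<in>polydisc V r. vabs (f x - P x) \<le> \<epsilon>}"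

abbreviation convergent_on :: "'i set \<Rightarrow> real \<Rightarrow> (('i \<Rightarrow> 'k :: ultrametric_field) \<Rightarrow> 'k) set" where
  "convergent_on \<equiv> tate (\<lambda>_. Suc 0)"

lemma polydiscI: "(\<And>i. i \<in> V \<Longrightarrow> vabs (x i) \<le> r) \<Longrightarrow> x \<in> polydisc V r"
  and polydiscD: "x \<in> polydisc V r \<Longrightarrow> i \<in> V \<Longrightarrow> vabs (x i) \<le> r"
  by (auto simp: polydisc_def)

lemma polydisc_mono: "x \<in> polydisc W s \<Longrightarrow> V \<subseteq> W \<Longrightarrow> s \<le> r \<Longrightarrow> x \<in> polydisc V r"
  by (force simp: polydisc_def)

lemma polydisc_0 [simp]: "r \<ge> 0 \<Longrightarrow> (\<lambda>_. 0) \<in> polydisc V r"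
  by (simp add: polydisc_def)

lemma polydisc_add:
  "x \<in> polydisc V r \<Longrightarrow> y \<in> polydisc V s \<Longrightarrow> s \<le> r \<Longrightarrow> (\<lambda>i. x i + y i) \<in> polydisc V r"
  by (force simp: polydisc_def intro!: vabs_add_le)

lemma polydisc_cong: "x \<in> polydisc V r \<Longrightarrow> (\<And>i. i \<in> V \<Longrightarrow> y i = x i) \<Longrightarrow> y \<in> polydisc V r"
  by (simp add: polydisc_def)

lemma polyfuns_uminus: "f \<in> polyfuns e V \<Longrightarrow> (\<lambda>x. - f x) \<in> polyfuns e V"
proof (induction rule: polyfuns.induct)
  case (add f g)
  then show ?case
    using polyfuns.add[of "\<lambda>x. - f x" e V "\<lambda>x. - g x"] by simp
next
  case (var_mult f i)
  then show ?case
    using polyfuns.var_mult[of "\<lambda>x. - f x" e V i] by simp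
qed (rule polyfuns.const)

lemma polyfuns_diff:
  "f \<in> polyfuns e V \<Longrightarrow> g \<in> polyfuns e V \<Longrightarrow> (\<lambda>x. f x - g x) \<in> polyfuns e V"
  using polyfuns.add[of f e V "\<lambda>x. - g x"] by (simp add: polyfuns_uminus)

lemma polyfuns_mult:
  assumes "f \<in> polyfuns e V" and g: "g \<in> polyfuns e V"
  shows "(\<lambda>x. f x * g x) \<in> polyfuns e V"
  using assms(1)
proof (induction rule: polyfuns.induct)
  case (const c)
  from g show ?case
  proof (induction rule: polyfuns.induct)
    case (add f g)
    then show ?case
      using polyfuns.add[of "\<lambda>x. c * f x" e V "\<lambda>x. c * g x"] by (simp add: ring_distribs)
  next
    case (var_mult f i)
    then show ?case
      using polyfuns.var_mult[of "\<lambda>x. c * f x" e V i] by (simp add: mult.left_commute)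
  qed (rule polyfuns.const)
next
  case (add f h)
  then show ?case
    using polyfuns.add[of "\<lambda>x. f x * g x" e V "\<lambda>x. h x * g x"] by (simp add: ring_distribs)
next
  case (var_mult f i)
  then show ?case
    using polyfuns.var_mult[of "\<lambda>x. f x * g x" e V i] by (simp add: mult.assoc)
qed

lemma polyfuns_power: "f \<in> polyfuns e V \<Longrightarrow> (\<lambda>x. f x ^ n) \<in> polyfuns e V"
  by (induction n) (simp_all add: polyfuns_mult polyfuns.const)

lemma polyfuns_var: "i \<in> V \<Longrightarrow> (\<lambda>x. x i ^ e i) \<in> polyfuns e V"
  using polyfuns.var_mult[OF polyfuns.const[of 1]] by simp

lemma polyfuns_reduce:
  assumes "f \<in> polyfuns e V" "\<And>i. i \<in> V \<Longrightarrow> e' i dvd e i" "V \<subseteq> W"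
  shows "f \<in> polyfuns e' W"
  using assms(1)
proof (induction rule: polyfuns.induct)
  case (var_mult f i)
  then obtain k where k: "e i = e' i * k"
    using assms(2) by (meson dvdE)
  have "(\<lambda>x. (x i ^ e' i) ^ k) \<in> polyfuns e' W"
    using var_mult assms(3) by (intro polyfuns_power polyfuns_var) auto
  then show ?case
    using polyfuns_mult var_mult by (fastforce simp: k power_mult)
qed (auto intro: polyfuns.intros)

lemma polyfuns_bounded:
  assumes "f \<in> polyfuns e V" "r \<ge> 0"
  shows "\<exists>M\<ge>0. \<forall>x\<in>polydisc V r. vabs (f x) \<le> M"
  using assms(1)
proof (induction rule: polyfuns.induct)
  case (const c)
  then show ?case
    by (intro exI[of _ "vabs c"]) auto
next
  case (add f g)
  then obtain M N where "M \<ge> 0" "\<forall>x\<in>polydisc V r. vabs (f x) \<le> M" "\<forall>x\<in>polydisc V r. vabs (g x) \<le> N"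
    by blast
  then show ?case
    by (intro exI[of _ "max M N"]) (fastforce intro!: vabs_add_le)
next
  case (var_mult f i)
  then obtain M where "M \<ge> 0" "\<forall>x\<in>polydisc V r. vabs (f x) \<le> M"
    by blast
  then show ?case
    using var_mult assms(2)
    by (intro exI[of _ "r ^ e i * M"]) (auto simp: vabs_mult vabs_power polydisc_def intro!: mult_mono power_mono)
qed

lemma polyfuns_depends:
  "f \<in> polyfuns e V \<Longrightarrow> (\<And>i. i \<in> V \<Longrightarrow> x i = y i) \<Longrightarrow> f x = f y"
  by (induction rule: polyfuns.induct) auto

lemma tateE:
  assumes "f \<in> tate e V r" "\<epsilon> > 0"
  obtains P where "P \<in> polyfuns e V" "\<And>x. x \<in> polydisc V r \<Longrightarrow> vabs (f x - P x) \<le> \<epsilon>"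
  using assms by (auto simp: tate_def)

lemma tate_polyfuns: "f \<in> polyfuns e V \<Longrightarrow> f \<in> tate e V r"
  by (auto simp: tate_def intro!: bexI[of _ f])

lemma tate_const [simp, intro]: "(\<lambda>_. c) \<in> tate e V r"
  by (intro tate_polyfuns polyfuns.const)

lemma tate_var: "i \<in> V \<Longrightarrow> (\<lambda>x. x i) \<in> convergent_on V r"
  using tate_polyfuns[OF polyfuns_var[of i V "\<lambda>_. Suc 0"]] by simp

lemma tate_cong:
  "f \<in> tate e V r \<Longrightarrow> (\<And>x. x \<in> polydisc V r \<Longrightarrow> f x = g x) \<Longrightarrow> g \<in> tate e V r"
  by (auto simp: tate_def)

lemma tate_restrict:
  assumes "f \<in> tate e V r" "V \<subseteq> W" "s \<le> r" "\<And>i. i \<in> V \<Longrightarrow> e' i dvd e i"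
  shows "f \<in> tate e' W s"
  unfolding tate_def
proof safe
  fix \<epsilon> :: real assume "\<epsilon> > 0"
  then obtain P where "P \<in> polyfuns e V" "\<And>x. x \<in> polydisc V r \<Longrightarrow> vabs (f x - P x) \<le> \<epsilon>"
    using tateE[OF assms(1)] by blast
  then show "\<exists>P\<in>polyfuns e' W. \<forall>x\<in>polydisc W s. vabs (f x - P x) \<le> \<epsilon>"
    using polydisc_mono[OF _ assms(2,3)] polyfuns_reduce[of P e V e' W] assms(2,4) by (intro bexI[of _ P]) auto
qed

lemma tate_mono: "f \<in> tate e V r \<Longrightarrow> V \<subseteq> W \<Longrightarrow> s \<le> r \<Longrightarrow> f \<in> tate e W s"
  by (rule tate_restrict) auto

lemma tate_bounded:
  assumes "f \<in> tate e V r" "r \<ge> 0"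
  obtains M where "M > 0" "\<And>x. x \<in> polydisc V r \<Longrightarrow> vabs (f x) \<le> M"
proof -
  obtain P where P: "P \<in> polyfuns e V" "\<And>x. x \<in> polydisc V r \<Longrightarrow> vabs (f x - P x) \<le> 1"
    using tateE[OF assms(1)] zero_less_one by blast
  obtain M where M: "\<And>x. x \<in> polydisc V r \<Longrightarrow> vabs (P x) \<le> M"
    using polyfuns_bounded[OF P(1) assms(2)] by blast
  have "vabs (f x) \<le> max 1 M" if "x \<in> polydisc V r" for x
    using vabs_add_le_max[of "f x - P x" "P x"] P(2) M that by fastforce
  then show ?thesis
    by (intro that[of "max 1 M"]) auto
qed

lemma tate_closed:
  assumes "\<And>\<epsilon>. \<epsilon> > 0 \<Longrightarrow> \<exists>g\<in>tate e V r. \<forall>x\<in>polydisc V r. vabs (f x - g x) \<le> \<epsilon>"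
  shows "f \<in> tate e V r"
  unfolding tate_def
proof safe
  fix \<epsilon> :: real assume \<epsilon>: "\<epsilon> > 0"
  then obtain g where g: "g \<in> tate e V r" "\<And>x. x \<in> polydisc V r \<Longrightarrow> vabs (f x - g x) \<le> \<epsilon>"
    using assms by blast
  obtain P where P: "P \<in> polyfuns e V" "\<And>x. x \<in> polydisc V r \<Longrightarrow> vabs (g x - P x) \<le> \<epsilon>"
    using tateE[OF g(1) \<epsilon>] by blast
  have "vabs (f x - P x) \<le> \<epsilon>" if "x \<in> polydisc V r" for x
    using vabs_add_le[OF g(2) P(2), OF that that] by simp
  then show "\<exists>P\<in>polyfuns e V. \<forall>x\<in>polydisc V r. vabs (f x - P x) \<le> \<epsilon>"
    using P(1) by blast
qed

lemma tate_add:
  assumes "f \<in> tate e V r" "g \<in> tate e V r"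
  shows "(\<lambda>x. f x + g x) \<in> tate e V r"
  unfolding tate_def
proof safe
  fix \<epsilon> :: real assume \<epsilon>: "\<epsilon> > 0"
  obtain P where P: "P \<in> polyfuns e V" "\<And>x. x \<in> polydisc V r \<Longrightarrow> vabs (f x - P x) \<le> \<epsilon>"
    using tateE[OF assms(1) \<epsilon>] by blast
  obtain Q where Q: "Q \<in> polyfuns e V" "\<And>x. x \<in> polydisc V r \<Longrightarrow> vabs (g x - Q x) \<le> \<epsilon>"
    using tateE[OF assms(2) \<epsilon>] by blast
  have "vabs (f x + g x - (P x + Q x)) \<le> \<epsilon>" if "x \<in> polydisc V r" for x
    using vabs_add_le[OF P(2) Q(2), OF that that] by (simp add: algebra_simps)
  then show "\<exists>P\<in>polyfuns e V. \<forall>x\<in>polydisc V r. vabs (f x + g x - P x) \<le> \<epsilon>"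
    by (intro bexI[OF _ polyfuns.add[OF P(1) Q(1)]] ballI)
qed

lemma tate_mult:
  assumes "f \<in> tate e V r" "g \<in> tate e V r" "r \<ge> 0"
  shows "(\<lambda>x. f x * g x) \<in> tate e V r"
  unfolding tate_def
proof safe
  fix \<epsilon> :: real assume \<epsilon>: "\<epsilon> > 0"
  \<comment> \<open>In the splitting \<open>(f - P) g + P (g - Q)\<close> the tolerance for
    \<open>P\<close> depends on a bound of \<open>g\<close>, whereas the tolerance for
    \<open>Q\<close> has to wait until \<open>P\<close> is chosen and bounded.\<close>
  obtain M where M: "M > 0" "\<And>x. x \<in> polydisc V r \<Longrightarrow> vabs (g x) \<le> M"
    using tate_bounded[OF assms(2,3)] by blast
  obtain P where P: "P \<in> polyfuns e V" "\<And>x. x \<in> polydisc V r \<Longrightarrow> vabs (f x - P x) \<le> \<epsilon> / M"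
    using tateE[OF assms(1), of "\<epsilon> / M"] \<epsilon> M(1) by auto
  obtain N where N: "N > 0" "\<And>x. x \<in> polydisc V r \<Longrightarrow> vabs (P x) \<le> N"
    using tate_bounded[OF tate_polyfuns[OF P(1)] assms(3)] by blast
  obtain Q where Q: "Q \<in> polyfuns e V" "\<And>x. x \<in> polydisc V r \<Longrightarrow> vabs (g x - Q x) \<le> \<epsilon> / N"
    using tateE[OF assms(2), of "\<epsilon> / N"] \<epsilon> N(1) by auto
  have "vabs (f x * g x - P x * Q x) \<le> \<epsilon>" if x: "x \<in> polydisc V r" for x
  proof -
    have "vabs ((f x - P x) * g x) \<le> \<epsilon> / M * M" "vabs (P x * (g x - Q x)) \<le> N * (\<epsilon> / N)"
      unfolding vabs_mult using P(2)[OF x] M(1) M(2)[OF x] N(1) N(2)[OF x] Q(2)[OF x] \<epsilon>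
      by (intro mult_mono; simp)+
    then have "vabs ((f x - P x) * g x + P x * (g x - Q x)) \<le> \<epsilon>"
      using M(1) N(1) by (intro vabs_add_le) auto
    then show ?thesis
      by (simp add: algebra_simps)
  qed
  then show "\<exists>P\<in>polyfuns e V. \<forall>x\<in>polydisc V r. vabs (f x * g x - P x) \<le> \<epsilon>"
    by (intro bexI[OF _ polyfuns_mult[OF P(1) Q(1)]] ballI)
qed

lemma tate_uminus: "f \<in> tate e V r \<Longrightarrow> (\<lambda>x. - f x) \<in> tate e V r"
  unfolding tate_def
proof safe
  fix \<epsilon> :: real assume "\<forall>\<epsilon>>0. \<exists>P\<in>polyfuns e V. \<forall>x\<in>polydisc V r. vabs (f x - P x) \<le> \<epsilon>" "\<epsilon> > 0"
  then obtain P where P: "P \<in> polyfuns e V" "\<And>x. x \<in> polydisc V r \<Longrightarrow> vabs (f x - P x) \<le> \<epsilon>"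
    by blast
  then have "vabs (- f x - - P x) \<le> \<epsilon>" if "x \<in> polydisc V r" for x
    using that vabs_minus[of "f x - P x"] by (simp add: vabs_minus_commute)
  then show "\<exists>P\<in>polyfuns e V. \<forall>x\<in>polydisc V r. vabs (- f x - P x) \<le> \<epsilon>"
    by (intro bexI[OF _ polyfuns_uminus[OF P(1)]] ballI)
qed

lemma tate_diff: "f \<in> tate e V r \<Longrightarrow> g \<in> tate e V r \<Longrightarrow> (\<lambda>x. f x - g x) \<in> tate e V r"
  using tate_add[of f e V r "\<lambda>x. - g x"] by (simp add: tate_uminus)

lemma tate_sum: "(\<And>a. a \<in> A \<Longrightarrow> f a \<in> tate e V r) \<Longrightarrow> (\<lambda>x. \<Sum>a\<in>A. f a x) \<in> tate e V r"
  by (induction A rule: infinite_finite_induct) (simp_all add: tate_add)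

lemma tate_prod:
  "(\<And>a. a \<in> A \<Longrightarrow> f a \<in> tate e V r) \<Longrightarrow> r \<ge> 0 \<Longrightarrow> (\<lambda>x. \<Prod>a\<in>A. f a x) \<in> tate e V r"
  by (induction A rule: infinite_finite_induct) (simp_all add: tate_mult)

lemma tate_power: "f \<in> tate e V r \<Longrightarrow> r \<ge> 0 \<Longrightarrow> (\<lambda>x. f x ^ n) \<in> tate e V r"
  by (induction n) (simp_all add: tate_mult)

text \<open>For polynomial \<open>f\<close> this is closure under sums and products; a uniform
  approximation of \<open>f\<close> on the target polydisc carries over because
  \<open>\<phi>\<close> maps into it.\<close>

lemma tate_compose:
  assumes f: "f \<in> convergent_on V r"
    and \<phi>: "\<And>i. i \<in> V \<Longrightarrow> (\<lambda>t. \<phi> t i) \<in> tate e W s"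
    and maps: "\<And>t. t \<in> polydisc W s \<Longrightarrow> \<phi> t \<in> polydisc V r"
    and s: "s \<ge> 0"
  shows "(\<lambda>t. f (\<phi> t)) \<in> tate e W s"
proof (rule tate_closed)
  fix \<epsilon> :: real assume "\<epsilon> > 0"
  then obtain P where P: "P \<in> polyfuns (\<lambda>_. Suc 0) V" "\<And>x. x \<in> polydisc V r \<Longrightarrow> vabs (f x - P x) \<le> \<epsilon>"
    using tateE[OF f] by blast
  from P(1) have "(\<lambda>t. P (\<phi> t)) \<in> tate e W s"
    by (induction rule: polyfuns.induct) (simp_all add: tate_add tate_mult s \<phi>)
  then show "\<exists>g\<in>tate e W s. \<forall>t\<in>polydisc W s. vabs (f (\<phi> t) - g t) \<le> \<epsilon>"
    using P(2) maps by (intro bexI[where x = "\<lambda>t. P (\<phi> t)"]) auto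
qed

lemma tate_uniform_limit:
  fixes f :: "nat \<Rightarrow> ('i \<Rightarrow> 'k :: ultrametric_field) \<Rightarrow> 'k"
  assumes f: "\<And>n. f n \<in> tate e V r"
    and cauchy: "\<And>\<epsilon>. \<epsilon> > 0 \<Longrightarrow> \<exists>N. \<forall>m\<ge>N. \<forall>n\<ge>N. \<forall>x\<in>polydisc V r. vabs (f m x - f n x) \<le> \<epsilon>"
  obtains g where "g \<in> tate e V r"
    "\<And>\<epsilon>. \<epsilon> > 0 \<Longrightarrow> \<exists>N. \<forall>n\<ge>N. \<forall>x\<in>polydisc V r. vabs (g x - f n x) \<le> \<epsilon>"
proof -
  have "\<exists>l. (\<lambda>n. f n x) \<longlonglongrightarrow> l" if x: "x \<in> polydisc V r" for x
  proof -
    have "Cauchy (\<lambda>n. f n x)"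
    proof (rule CauchyI')
      fix \<epsilon> :: real assume "\<epsilon> > 0"
      then obtain N where "\<forall>m\<ge>N. \<forall>n\<ge>N. \<forall>x\<in>polydisc V r. vabs (f m x - f n x) \<le> \<epsilon> / 2"
        using cauchy[of "\<epsilon> / 2"] by auto
      then have "vabs (f m x - f n x) \<le> \<epsilon> / 2" if "m \<ge> N" "n > m" for m n
        using x that by simp
      then have "dist (f m x) (f n x) < \<epsilon>" if "m \<ge> N" "n > m" for m n
        using that \<open>\<epsilon> > 0\<close> unfolding dist_vabs by fastforce
      then show "\<exists>M. \<forall>m\<ge>M. \<forall>n>m. dist (f m x) (f n x) < \<epsilon>"
        by blast
    qed
    then show ?thesis
      using Cauchy_convergent convergent_def by blast
  qed
  then obtain g where g: "\<And>x. x \<in> polydisc V r \<Longrightarrow> (\<lambda>n. f n x) \<longlonglongrightarrow> g x"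
    by metis
  have lim: "\<exists>N. \<forall>n\<ge>N. \<forall>x\<in>polydisc V r. vabs (g x - f n x) \<le> \<epsilon>" if \<epsilon>: "\<epsilon> > 0" for \<epsilon>
  proof -
    obtain N where N: "\<forall>m\<ge>N. \<forall>n\<ge>N. \<forall>x\<in>polydisc V r. vabs (f m x - f n x) \<le> \<epsilon>"
      using cauchy[OF \<epsilon>] by blast
    have "vabs (g x - f n x) \<le> \<epsilon>" if nx: "n \<ge> N" "x \<in> polydisc V r" for n x
    proof -
      obtain M where "\<forall>m\<ge>M. dist (f m x) (g x) < \<epsilon>"
        using metric_LIMSEQ_D[OF g[OF nx(2)] \<epsilon>] by blast
      then have "dist (f (max M N) x) (g x) < \<epsilon>"
        by simp
      then have "vabs (g x - f (max M N) x) \<le> \<epsilon>"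
        by (simp add: dist_vabs vabs_minus_commute)
      moreover have "vabs (f (max M N) x - f n x) \<le> \<epsilon>"
        using N nx by auto
      ultimately show ?thesis
        using vabs_add_le[of "g x - f (max M N) x" \<epsilon> "f (max M N) x - f n x"] by simp
    qed
    then show ?thesis
      by blast
  qed
  have "g \<in> tate e V r"
  proof (rule tate_closed)
    fix \<epsilon> :: real assume "\<epsilon> > 0"
    then obtain N where "\<forall>n\<ge>N. \<forall>x\<in>polydisc V r. vabs (g x - f n x) \<le> \<epsilon>"
      using lim by blast
    then show "\<exists>h\<in>tate e V r. \<forall>x\<in>polydisc V r. vabs (g x - h x) \<le> \<epsilon>"
      using f by blast
  qed
  with lim show ?thesis
    using that by blast
qed

text \<open>The geometric series in \<open>1 - f\<close>; its error after \<open>n\<close> terms is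
  exactly \<open>|1 - f| ^ n\<close>, because \<open>|f| = 1\<close>.\<close>

lemma tate_inverse:
  assumes f: "f \<in> tate e V r" and small: "\<And>x. x \<in> polydisc V r \<Longrightarrow> vabs (f x - 1) \<le> \<theta>"
    and \<theta>: "\<theta> < 1" and r: "r \<ge> 0"
  shows "(\<lambda>x. inverse (f x)) \<in> tate e V r"
proof (rule tate_closed)
  fix \<epsilon> :: real assume \<epsilon>: "\<epsilon> > 0"
  have \<theta>0: "\<theta> \<ge> 0"
    using small[of "\<lambda>_. 0"] r vabs_ge_0 by (metis order_trans polydisc_0)
  obtain n where n: "\<theta> ^ n < \<epsilon>"
    using real_arch_pow_inv[OF \<epsilon> \<theta>] by blast
  have g: "(\<lambda>x. \<Sum>k<n. (1 - f x) ^ k) \<in> tate e V r"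
    by (intro tate_sum tate_power tate_diff f r tate_const)
  have "vabs (inverse (f x) - (\<Sum>k<n. (1 - f x) ^ k)) \<le> \<epsilon>" if x: "x \<in> polydisc V r" for x
  proof -
    have v: "vabs (f x) = 1"
      using small[OF x] \<theta> by (intro vabs_eq_1I) simp
    then have fx: "f x \<noteq> 0"
      by auto
    have "1 - (1 - f x) ^ n = f x * (\<Sum>k<n. (1 - f x) ^ k)"
      using one_diff_power_eq[of "1 - f x" n] by simp
    then have "inverse (f x) - (\<Sum>k<n. (1 - f x) ^ k) = inverse (f x) * (1 - f x) ^ n"
      using fx by (simp add: field_simps)
    then have "vabs (inverse (f x) - (\<Sum>k<n. (1 - f x) ^ k)) = vabs (f x - 1) ^ n"
      by (simp add: vabs_mult vabs_inverse v vabs_power vabs_minus_commute)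
    also have "\<dots> \<le> \<theta> ^ n"
      using small[OF x] by (intro power_mono) auto
    finally show ?thesis
      using n by simp
  qed
  then show "\<exists>g\<in>tate e V r. \<forall>x\<in>polydisc V r. vabs (inverse (f x) - g x) \<le> \<epsilon>"
    by (intro bexI[OF _ g] ballI)
qed

context nonarch_field
begin

text \<open>Cauchy's estimate rescales a polydisc of radius \<open>r\<close> to the unit polydisc,
  which takes a scalar whose absolute value is exactly \<open>r\<close>.\<close>

definition radius :: "real \<Rightarrow> bool" where
  "radius r \<longleftrightarrow> (\<exists>c :: 'k. c \<noteq> 0 \<and> vabs c = r)"

lemma radius_pos: "radius r \<Longrightarrow> r > 0"
  by (auto simp: radius_def)

lemma radius_vabs: "c \<noteq> 0 \<Longrightarrow> radius (vabs (c :: 'k))"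
  by (auto simp: radius_def)

lemma radius_power: "radius r \<Longrightarrow> radius (r ^ n)"
  unfolding radius_def by (metis power_not_zero vabs_power)

lemma radius_min: "radius r \<Longrightarrow> radius s \<Longrightarrow> radius (min r s)"
  by (simp add: min_def)

lemma ex_small: "\<epsilon> > 0 \<Longrightarrow> \<exists>c :: 'k. c \<noteq> 0 \<and> vabs c < \<epsilon>"
proof -
  assume "\<epsilon> > 0"
  obtain c :: 'k where c: "c \<noteq> 0" "vabs c < 1"
    using nontrivial by blast
  then obtain n where "vabs c ^ n < \<epsilon>"
    using real_arch_pow_inv \<open>\<epsilon> > 0\<close> by blast
  then show ?thesis
    using c by (intro exI[of _ "c ^ n"]) (simp add: vabs_power)
qed

lemma ex_radius_less: "\<epsilon> > 0 \<Longrightarrow> \<exists>r. radius r \<and> r < \<epsilon>"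
  using ex_small radius_vabs by blast

text \<open>The source of all uniqueness of first-order terms: a linear term of quadratic size
  vanishes, since a nontrivial absolute value provides nonzero \<open>c\<close> of arbitrarily small
  size.\<close>

lemma eq_0_if_small_bound:
  fixes y :: 'k
  assumes "r > 0" "\<And>c :: 'k. c \<noteq> 0 \<Longrightarrow> vabs c \<le> r \<Longrightarrow> vabs (c * y) \<le> C * vabs c ^ 2"
  shows "y = 0"
proof (rule ccontr)
  assume y: "y \<noteq> 0"
  define \<epsilon> where "\<epsilon> = min r (vabs y / (\<bar>C\<bar> + 1))"
  have "\<epsilon> > 0"
    using assms(1) y by (auto simp: \<epsilon>_def intro!: divide_pos_pos)
  then obtain c :: 'k where c: "c \<noteq> 0" "vabs c < \<epsilon>"
    using ex_small by blast
  then have "vabs c * vabs y \<le> vabs c * (C * vabs c)"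
    using assms(2)[of c] by (simp add: \<epsilon>_def vabs_mult power2_eq_square mult_ac)
  then have "vabs y \<le> C * vabs c"
    using c by simp
  also have "\<dots> \<le> (\<bar>C\<bar> + 1) * vabs c"
    by (intro mult_right_mono) auto
  also have "\<dots> < (\<bar>C\<bar> + 1) * (vabs y / (\<bar>C\<bar> + 1))"
    using c by (intro mult_strict_left_mono) (auto simp: \<epsilon>_def)
  finally show False
    by (simp add: add_nonneg_eq_0_iff)
qed

section \<open>Gradients\<close>

text \<open>The gradient is read off from restrictions to lines, as the linear coefficient of the
  one-variable polynomial \<open>c \<mapsto> P (x + c h)\<close>. In this form Cauchy's estimate in
  one variable bounds it.\<close>

definition poly_grad ::
  "'i set \<Rightarrow> (('i \<Rightarrow> 'k) \<Rightarrow> 'k) \<Rightarrow> ('i \<Rightarrow> ('i \<Rightarrow> 'k) \<Rightarrow> 'k) \<Rightarrow> bool" where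
  "poly_grad V P G \<longleftrightarrow> P \<in> polyfuns (\<lambda>_. Suc 0) V \<and> (\<forall>i\<in>V. G i \<in> polyfuns (\<lambda>_. Suc 0) V) \<and>
     (\<forall>x h. \<exists>q. (\<forall>c. poly q c = P (\<lambda>i. x i + c * h i)) \<and> coeff q 1 = (\<Sum>i\<in>V. G i x * h i))"

lemma coeff_linear_power:
  fixes a b :: 'k
  shows "coeff ([:a, b:] ^ n) 0 = a ^ n" "coeff ([:a, b:] ^ n) (Suc 0) = of_nat n * a ^ (n - 1) * b"
proof -
  show 0: "coeff ([:a, b:] ^ n) 0 = a ^ n" for n
    by (simp add: coeff_0_power)
  show "coeff ([:a, b:] ^ n) (Suc 0) = of_nat n * a ^ (n - 1) * b"
  proof (induction n)
    case (Suc n)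
    have "a * (of_nat n * a ^ (n - 1) * b) = of_nat n * a ^ n * b"
      by (cases n) simp_all
    then show ?case
      by (simp add: Suc 0 algebra_simps)
  qed simp
qed

text \<open>The second clause records that a derivation kills functions of \<open>x i ^ p\<close>.
  It survives uniform limits and becomes \<open>partial_0_if_exponent\<close>.\<close>

lemma ex_poly_grad:
  assumes "P \<in> polyfuns e V" "finite V"
  shows "\<exists>G. poly_grad V P G \<and> (\<forall>i\<in>V. p dvd e i \<longrightarrow> (\<forall>x. G i x = 0))"
  using assms(1)
proof (induction rule: polyfuns.induct)
  case (const c)
  show ?case
  proof (intro exI[of _ "\<lambda>_ _. 0"] conjI)
    have "\<exists>q. (\<forall>d. poly q d = c) \<and> coeff q 1 = 0"
      by (intro exI[of _ "[:c:]"]) auto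
    then show "poly_grad V (\<lambda>_. c) (\<lambda>_ _. 0)"
      unfolding poly_grad_def by (auto intro: polyfuns.const)
  qed auto
next
  case (add f g)
  then obtain F G where FG: "poly_grad V f F" "\<forall>i\<in>V. p dvd e i \<longrightarrow> (\<forall>x. F i x = 0)"
    "poly_grad V g G" "\<forall>i\<in>V. p dvd e i \<longrightarrow> (\<forall>x. G i x = 0)"
    by blast
  have "\<exists>q. (\<forall>c. poly q c = f (\<lambda>i. x i + c * h i) + g (\<lambda>i. x i + c * h i)) \<and>
          coeff q 1 = (\<Sum>i\<in>V. (F i x + G i x) * h i)" for x h
  proof -
    obtain q where "\<forall>c. poly q c = f (\<lambda>i. x i + c * h i)" "coeff q 1 = (\<Sum>i\<in>V. F i x * h i)"
      using FG(1) unfolding poly_grad_def by blast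
    moreover obtain q' where "\<forall>c. poly q' c = g (\<lambda>i. x i + c * h i)" "coeff q' 1 = (\<Sum>i\<in>V. G i x * h i)"
      using FG(3) unfolding poly_grad_def by blast
    ultimately show ?thesis
      by (intro exI[of _ "q + q'"]) (simp add: ring_distribs sum.distrib)
  qed
  then have "poly_grad V (\<lambda>x. f x + g x) (\<lambda>i x. F i x + G i x)"
    using FG(1,3) unfolding poly_grad_def by (simp add: polyfuns.add)
  then show ?case
    using FG(2,4) by (intro exI[of _ "\<lambda>i x. F i x + G i x"]) simp
next
  case (var_mult f j)
  then obtain F where F: "poly_grad V f F" "\<forall>i\<in>V. p dvd e i \<longrightarrow> (\<forall>x. F i x = 0)"
    by blast
  define G where "G = (\<lambda>i (x :: 'a \<Rightarrow> 'k). (if i = j then of_nat (e j) * x j ^ (e j - 1) * f x else 0) + x j ^ e j * F i x)"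
  have "\<exists>q. (\<forall>c. poly q c = (x j + c * h j) ^ e j * f (\<lambda>i. x i + c * h i)) \<and>
          coeff q 1 = (\<Sum>i\<in>V. G i x * h i)" for x h
  proof -
    obtain q where q: "\<forall>c. poly q c = f (\<lambda>i. x i + c * h i)" "coeff q 1 = (\<Sum>i\<in>V. F i x * h i)"
      using F(1) unfolding poly_grad_def by blast
    have q0: "coeff q 0 = f x"
      using q(1)[rule_format, of 0] by (simp add: poly_0_coeff_0)
    have "coeff ([:x j, h j:] ^ e j * q) 1
        = x j ^ e j * (\<Sum>i\<in>V. F i x * h i) + of_nat (e j) * x j ^ (e j - 1) * h j * f x"
      using q(2) by (simp add: coeff_mult coeff_linear_power q0)
    also have "\<dots> = (\<Sum>i\<in>V. G i x * h i)"
    proof -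
      have "(\<Sum>i\<in>V. G i x * h i) = (\<Sum>i\<in>V. (if i = j then of_nat (e j) * x j ^ (e j - 1) * f x * h j else 0)
          + x j ^ e j * (F i x * h i))"
        by (intro sum.cong) (auto simp: G_def ring_distribs)
      also have "\<dots> = of_nat (e j) * x j ^ (e j - 1) * f x * h j + x j ^ e j * (\<Sum>i\<in>V. F i x * h i)"
        using assms(2) \<open>j \<in> V\<close> by (simp add: sum.distrib sum_distrib_left)
      finally show ?thesis
        by (simp add: algebra_simps)
    qed
    finally show ?thesis
      using q(1) by (intro exI[of _ "[:x j, h j:] ^ e j * q"]) (simp add: algebra_simps)
  qed
  moreover have "G i \<in> polyfuns (\<lambda>_. Suc 0) V" if "i \<in> V" for i
  proof -
    have var: "(\<lambda>x. x j) \<in> polyfuns (\<lambda>_. Suc 0) V"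
      using polyfuns_var[OF var_mult.hyps(2), of "\<lambda>_. Suc 0"] by simp
    have "f \<in> polyfuns (\<lambda>_. Suc 0) V" "F i \<in> polyfuns (\<lambda>_. Suc 0) V"
      using F(1) that by (auto simp: poly_grad_def)
    then show ?thesis
      unfolding G_def
      by (cases "i = j") (auto intro!: polyfuns.add polyfuns_mult polyfuns_power polyfuns.const var)
  qed
  moreover have "(\<lambda>x. x j ^ e j * f x) \<in> polyfuns (\<lambda>_. Suc 0) V"
    using var_mult.hyps polyfuns_reduce[OF polyfuns.var_mult, of f e V j "\<lambda>_. Suc 0" V] by simp
  ultimately have "poly_grad V (\<lambda>x. x j ^ e j * f x) G"
    unfolding poly_grad_def by simp
  moreover have "\<forall>i\<in>V. p dvd e i \<longrightarrow> (\<forall>x. G i x = 0)"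
    using F(2) by (auto simp: G_def of_nat_eq_0)
  ultimately show ?case
    by blast
qed

lemma poly_grad_diff:
  assumes "poly_grad V f F" "poly_grad V g G"
  shows "poly_grad V (\<lambda>x. f x - g x) (\<lambda>i x. F i x - G i x)"
proof -
  have "\<exists>q. (\<forall>c. poly q c = f (\<lambda>i. x i + c * h i) - g (\<lambda>i. x i + c * h i)) \<and>
          coeff q 1 = (\<Sum>i\<in>V. (F i x - G i x) * h i)" for x h
  proof -
    obtain q where "\<forall>c. poly q c = f (\<lambda>i. x i + c * h i)" "coeff q 1 = (\<Sum>i\<in>V. F i x * h i)"
      using assms(1) unfolding poly_grad_def by blast
    moreover obtain q' where "\<forall>c. poly q' c = g (\<lambda>i. x i + c * h i)" "coeff q' 1 = (\<Sum>i\<in>V. G i x * h i)"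
      using assms(2) unfolding poly_grad_def by blast
    ultimately show ?thesis
      by (intro exI[of _ "q - q'"]) (simp add: ring_distribs sum_subtractf left_diff_distrib)
  qed
  then show ?thesis
    using assms unfolding poly_grad_def by (simp add: polyfuns_diff)
qed

lemma poly_bound:
  fixes q :: "'k poly"
  assumes "\<And>k. vabs (coeff q k) \<le> M" "vabs c \<le> 1"
  shows "vabs (poly q c) \<le> M"
  unfolding poly_altdef
proof (rule vabs_sum_le)
  show "M \<ge> 0"
    using assms(1)[of 0] vabs_ge_0 order_trans by blast
  show "vabs (coeff q k * c ^ k) \<le> M" for k
    using mult_mono[OF assms(1)[of k] power_le_one[OF vabs_ge_0 assms(2), of k]] \<open>M \<ge> 0\<close>
    by (simp add: vabs_mult vabs_power)
qed

text \<open>All coefficients of \<open>P\<close> along a line inside the polydisc are bounded by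
  \<open>M\<close>; shrinking the increment by the factor \<open>s / r\<close> gains one such factor
  for each order of the expansion.\<close>

lemma poly_grad_bounds:
  assumes grad: "poly_grad V P G" and fin: "finite V" and r: "radius r"
    and M: "\<And>x. x \<in> polydisc V r \<Longrightarrow> vabs (P x) \<le> M"
    and x: "x \<in> polydisc V r"
  shows "i \<in> V \<Longrightarrow> vabs (G i x) * r \<le> M"
    and "0 \<le> s \<Longrightarrow> s \<le> r \<Longrightarrow> h \<in> polydisc V s \<Longrightarrow>
           vabs (P (\<lambda>i. x i + h i) - P x) \<le> M * (s / r)"
    and "0 \<le> s \<Longrightarrow> s \<le> r \<Longrightarrow> h \<in> polydisc V s \<Longrightarrow>
           vabs (P (\<lambda>i. x i + h i) - P x - (\<Sum>i\<in>V. G i x * h i)) \<le> M * (s / r)\<^sup>2"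
proof -
  obtain d :: 'k where d: "d \<noteq> 0" "vabs d = r"
    using r by (auto simp: radius_def)
  have M0: "M \<ge> 0"
    using M[OF x] vabs_ge_0 order_trans by blast
  have expand: "\<exists>q. (\<forall>c. poly q c = P (\<lambda>i. x i + c * h i)) \<and> coeff q 0 = P x \<and>
       coeff q 1 = (\<Sum>i\<in>V. G i x * h i) \<and> (\<forall>k. vabs (coeff q k) \<le> M)"
    if h: "h \<in> polydisc V r" for h
  proof -
    obtain q where q: "\<forall>c. poly q c = P (\<lambda>i. x i + c * h i)" "coeff q 1 = (\<Sum>i\<in>V. G i x * h i)"
      using grad unfolding poly_grad_def by blast
    have "vabs (coeff q k) \<le> M" for k
    proof -
      have "vabs (coeff q k) * vabs (1 :: 'k) ^ k \<le> M"
      proof (rule cauchy_estimate)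
        fix c :: 'k assume c: "vabs c \<le> vabs (1 :: 'k)"
        have "vabs (c * h i) \<le> r" if "i \<in> V" for i
          using mult_mono[OF c polydiscD[OF h that]] by (simp add: vabs_mult)
        then have "(\<lambda>i. x i + c * h i) \<in> polydisc V r"
          by (auto intro!: polydiscI vabs_add_le polydiscD[OF x])
        then show "vabs (poly q c) \<le> M"
          using M q(1) by simp
      qed
      then show ?thesis
        by simp
    qed
    moreover have "coeff q 0 = P x"
      using q(1)[rule_format, of 0] by (simp add: poly_0_coeff_0)
    ultimately show ?thesis
      using q by blast
  qed
  show "vabs (G i x) * r \<le> M" if i: "i \<in> V"
  proof -
    have "(\<lambda>j. if j = i then d else 0) \<in> polydisc V r"
      using d by (auto simp: polydisc_def)
    then obtain q where "coeff q 1 = (\<Sum>j\<in>V. G j x * (if j = i then d else 0))" "vabs (coeff q 1) \<le> M"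
      using expand by metis
    then show ?thesis
      using fin i d by (simp add: if_distrib vabs_mult cong: if_cong)
  qed
  assume s: "0 \<le> s" "s \<le> r" and h: "h \<in> polydisc V s"
  \<comment> \<open>The number \<open>s\<close> need not be the absolute value of a scalar, so an
    entry of \<open>h\<close> of maximal size takes its place.\<close>
  obtain c :: 'k where c: "vabs c \<le> s" "\<And>i. i \<in> V \<Longrightarrow> vabs (h i) \<le> vabs c"
  proof (cases "V = {}")
    case True
    then show ?thesis
      using that[of 0] s by simp
  next
    case False
    define m where "m = Max ((\<lambda>i. vabs (h i)) ` V)"
    have "m \<in> (\<lambda>i. vabs (h i)) ` V"
      unfolding m_def using fin False by (intro Max_in) auto
    then obtain j where j: "j \<in> V" "m = vabs (h j)"
      by blast
    have "vabs (h i) \<le> vabs (h j)" if "i \<in> V" for i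
      using fin that unfolding j(2)[symmetric] m_def by (intro Max_ge) auto
    then show ?thesis
      using j polydiscD[OF h] that[of "h j"] by blast
  qed
  have "vabs (P (\<lambda>i. x i + h i) - P x) \<le> M * (s / r) \<and>
        vabs (P (\<lambda>i. x i + h i) - P x - (\<Sum>i\<in>V. G i x * h i)) \<le> M * (s / r)\<^sup>2"
  proof (cases "c = 0")
    case True
    then have h0: "h i = 0" if "i \<in> V" for i
      using c(2)[OF that] by simp
    have "P (\<lambda>i. x i + h i) = P x"
      by (rule polyfuns_depends[of P "\<lambda>_. Suc 0" V]) (use grad h0 in \<open>simp_all add: poly_grad_def\<close>)
    moreover have "(\<Sum>i\<in>V. G i x * h i) = 0"
      using h0 by (intro sum.neutral) simp
    ultimately show ?thesis
      using M0 s by simp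
  next
    case False
    \<comment> \<open>The direction \<open>h / u\<close> fills the polydisc of radius
      \<open>r\<close>, so the bound on coefficients applies to it; the point wanted is then reached
      at parameter \<open>u\<close>, with \<open>|u| \<le> s / r\<close>.\<close>
    define u where "u = c / d"
    have u: "vabs u = vabs c / r" "u \<noteq> 0" "vabs u \<le> 1"
      using d False c(1) s radius_pos[OF r] by (simp_all add: u_def vabs_divide)
    have "vabs (h i / u) \<le> r" if "i \<in> V" for i
      using c(2)[OF that] radius_pos[OF r] False by (simp add: vabs_divide u field_simps)
    then have "(\<lambda>i. h i / u) \<in> polydisc V r"
      by (intro polydiscI)
    then obtain q where q: "\<forall>c. poly q c = P (\<lambda>i. x i + c * (h i / u))" "coeff q 0 = P x"
      "coeff q 1 = (\<Sum>i\<in>V. G i x * (h i / u))" "\<And>k. vabs (coeff q k) \<le> M"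
      using expand by blast
    obtain a b q' where q': "q = pCons a (pCons b q')"
      by (metis pCons_cases)
    have "P (\<lambda>i. x i + h i) = poly q u"
      using q(1) u(2) by simp
    then have eq: "P (\<lambda>i. x i + h i) - P x = u * (poly (pCons b q') u)"
      using q(2) by (simp add: q')
    have "(\<Sum>i\<in>V. G i x * h i) = u * b"
      using q(3) u(2) by (simp add: q' sum_distrib_left)
    then have eq2: "P (\<lambda>i. x i + h i) - P x - (\<Sum>i\<in>V. G i x * h i) = u ^ 2 * poly q' u"
      unfolding eq by (simp add: algebra_simps power2_eq_square)
    have "vabs (coeff (pCons b q') k) \<le> M" "vabs (coeff q' k) \<le> M" for k
      using q(4)[of "Suc k"] q(4)[of "Suc (Suc k)"] by (simp_all add: q')
    then have "vabs (poly (pCons b q') u) \<le> M" "vabs (poly q' u) \<le> M"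
      using poly_bound u(3) by blast+
    moreover have "vabs u \<le> s / r"
      using c(1) radius_pos[OF r] by (simp add: u(1) divide_right_mono)
    ultimately have "vabs u * vabs (poly (pCons b q') u) \<le> s / r * M"
      "vabs u ^ 2 * vabs (poly q' u) \<le> (s / r) ^ 2 * M"
      using s radius_pos[OF r] by (intro mult_mono power_mono; simp)+
    then show ?thesis
      unfolding eq2 by (simp only: eq vabs_mult vabs_power mult.commute[of M])
  qed
  then show "vabs (P (\<lambda>i. x i + h i) - P x) \<le> M * (s / r)"
    and "vabs (P (\<lambda>i. x i + h i) - P x - (\<Sum>i\<in>V. G i x * h i)) \<le> M * (s / r)\<^sup>2"
    by blast+
qed

text \<open>The first bound of \<open>poly_grad_bounds\<close>, applied to differences of
  approximating polynomials, makes their gradients converge uniformly. All bounds depend on the sup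
  norm alone, hence pass to the limit.\<close>

lemma tate_gradient:
  fixes f :: "('i \<Rightarrow> 'k) \<Rightarrow> 'k"
  assumes f: "f \<in> tate e V r" and fin: "finite V" and r: "radius r"
    and M: "\<And>x. x \<in> polydisc V r \<Longrightarrow> vabs (f x) \<le> M"
  obtains G where "\<And>i. i \<in> V \<Longrightarrow> G i \<in> convergent_on V r"
    "\<And>i x. i \<in> V \<Longrightarrow> p dvd e i \<Longrightarrow> x \<in> polydisc V r \<Longrightarrow> G i x = 0"
    "\<And>i x. i \<in> V \<Longrightarrow> x \<in> polydisc V r \<Longrightarrow> vabs (G i x) * r \<le> M"
    "\<And>x s h. x \<in> polydisc V r \<Longrightarrow> 0 \<le> s \<Longrightarrow> s \<le> r \<Longrightarrow> h \<in> polydisc V s \<Longrightarrow>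
       vabs (f (\<lambda>i. x i + h i) - f x) \<le> M * (s / r)"
    "\<And>x s h. x \<in> polydisc V r \<Longrightarrow> 0 \<le> s \<Longrightarrow> s \<le> r \<Longrightarrow> h \<in> polydisc V s \<Longrightarrow>
       vabs (f (\<lambda>i. x i + h i) - f x - (\<Sum>i\<in>V. G i x * h i)) \<le> M * (s / r)\<^sup>2"
proof -
  have r0: "r > 0"
    using r by (rule radius_pos)
  have M0: "M \<ge> 0"
    using M[of "\<lambda>_. 0"] r0 order_trans[OF vabs_ge_0] by simp
  have "\<exists>P. P \<in> polyfuns e V \<and> (\<forall>x\<in>polydisc V r. vabs (f x - P x) \<le> 1 / real (Suc n))" for n
    by (rule tateE[OF f, of "1 / real (Suc n)"]) auto
  then obtain P where P: "\<And>n. P n \<in> polyfuns e V"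
    "\<And>n x. x \<in> polydisc V r \<Longrightarrow> vabs (f x - P n x) \<le> 1 / real (Suc n)"
    by metis
  obtain G where G: "\<And>n. poly_grad V (P n) (G n)"
    "\<And>n i x. i \<in> V \<Longrightarrow> p dvd e i \<Longrightarrow> G n i x = 0"
    using ex_poly_grad[OF P(1) fin] by metis
  have close: "vabs (f x - P n x) \<le> \<epsilon>" if "real (Suc N) \<ge> 1 / \<epsilon>" "n \<ge> N" "\<epsilon> > 0" "x \<in> polydisc V r" for \<epsilon> N n x
  proof -
    have "1 / real (Suc n) \<le> \<epsilon>"
      using that by (auto simp: field_simps intro: order_trans)
    then show ?thesis
      using P(2)[OF that(4)] order_trans by blast
  qed
  have Garch: "\<exists>N. real (Suc N) \<ge> 1 / \<epsilon>" for \<epsilon> :: real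
    by (meson less_eq_real_def less_trans lessI of_nat_less_iff reals_Archimedean2)
  have "\<exists>g. g \<in> convergent_on V r \<and>
     (\<forall>\<epsilon>>0. \<exists>N. \<forall>n\<ge>N. \<forall>x\<in>polydisc V r. vabs (g x - G n i x) \<le> \<epsilon>)" if i: "i \<in> V" for i
  proof (rule tate_uniform_limit)
    show "G n i \<in> convergent_on V r" for n
      using G(1)[of n] i unfolding poly_grad_def by (intro tate_polyfuns) auto
    fix \<epsilon> :: real assume "\<epsilon> > 0"
    then have er: "\<epsilon> * r > 0"
      using r0 by simp
    obtain N where N: "real (Suc N) \<ge> 1 / (\<epsilon> * r)"
      using Garch by blast
    have "vabs (G m i x - G n i x) \<le> \<epsilon>" if mn: "m \<ge> N" "n \<ge> N" "x \<in> polydisc V r" for m n x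
    proof -
      have "vabs (P m y - P n y) \<le> \<epsilon> * r" if y: "y \<in> polydisc V r" for y
        using vabs_diff_le[OF close[OF N mn(2) er y] close[OF N mn(1) er y]] by simp
      from poly_grad_bounds(1)[OF poly_grad_diff[OF G(1) G(1)] fin r this mn(3) i]
      have "vabs (G m i x - G n i x) * r \<le> \<epsilon> * r" .
      then show ?thesis
        using r0 by simp
    qed
    then show "\<exists>N. \<forall>m\<ge>N. \<forall>n\<ge>N. \<forall>x\<in>polydisc V r. vabs (G m i x - G n i x) \<le> \<epsilon>"
      by blast
  qed blast
  then obtain g where g: "\<And>i. i \<in> V \<Longrightarrow> g i \<in> convergent_on V r"
    "\<And>i \<epsilon>. i \<in> V \<Longrightarrow> \<epsilon> > 0 \<Longrightarrow> \<exists>N. \<forall>n\<ge>N. \<forall>x\<in>polydisc V r. vabs (g i x - G n i x) \<le> \<epsilon>"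
    by metis
  have approx: "\<exists>n. (\<forall>x\<in>polydisc V r. vabs (f x - P n x) \<le> \<epsilon>) \<and>
     (\<forall>i\<in>V. \<forall>x\<in>polydisc V r. vabs (g i x - G n i x) \<le> \<epsilon>)" if \<epsilon>: "\<epsilon> > 0" for \<epsilon>
  proof -
    obtain N where N: "real (Suc N) \<ge> 1 / \<epsilon>"
      using Garch by blast
    have "\<forall>i\<in>V. \<exists>N. \<forall>n\<ge>N. \<forall>x\<in>polydisc V r. vabs (g i x - G n i x) \<le> \<epsilon>"
      using g(2) \<epsilon> by blast
    then have "\<exists>N'. \<forall>i\<in>V. \<forall>n\<ge>N' i. \<forall>x\<in>polydisc V r. vabs (g i x - G n i x) \<le> \<epsilon>"
      by (rule bchoice)
    then obtain N' where N': "\<And>i n x. i \<in> V \<Longrightarrow> n \<ge> N' i \<Longrightarrow> x \<in> polydisc V r \<Longrightarrow> vabs (g i x - G n i x) \<le> \<epsilon>"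
      by blast
    define n where "n = N + (\<Sum>i\<in>V. N' i)"
    have "N' i \<le> n" if "i \<in> V" for i
      using member_le_sum[OF that, of N'] fin by (simp add: n_def)
    then show ?thesis
      using N' close[OF N _ \<epsilon>, of n] by (intro exI[of _ n]) (auto simp: n_def)
  qed
  have PM: "vabs (P n x) \<le> M + \<epsilon>" if "\<forall>x\<in>polydisc V r. vabs (f x - P n x) \<le> \<epsilon>" "x \<in> polydisc V r" "\<epsilon> > 0" for n x \<epsilon>
    using vabs_diff_le[of "f x" "M + \<epsilon>" "f x - P n x"] M[OF that(2)] that M0 by force
  show ?thesis
  proof (rule that[of g])
    show "g i \<in> convergent_on V r" if "i \<in> V" for i
      using g(1) that .
    fix i and x :: "'i \<Rightarrow> 'k" assume i: "i \<in> V" and x: "x \<in> polydisc V r"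
    show "g i x = 0" if "p dvd e i"
    proof (rule eq_if_vabs_small)
      fix \<epsilon> :: real assume "\<epsilon> > 0"
      then show "vabs (g i x - 0) \<le> \<epsilon>"
        using approx G(2)[OF i that] i x by fastforce
    qed
    have "vabs (g i x) * r \<le> M + \<epsilon>" if \<epsilon>: "\<epsilon> > 0" for \<epsilon>
    proof -
      define \<delta> where "\<delta> = min \<epsilon> (\<epsilon> / r)"
      have \<delta>: "\<delta> > 0" "\<delta> \<le> \<epsilon>" "\<delta> * r \<le> \<epsilon>"
        using \<epsilon> r0 by (auto simp: \<delta>_def min_def field_simps)
      obtain n where n: "\<forall>x\<in>polydisc V r. vabs (f x - P n x) \<le> \<delta>"
        "\<forall>i\<in>V. \<forall>x\<in>polydisc V r. vabs (g i x - G n i x) \<le> \<delta>"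
        using approx[OF \<delta>(1)] by blast
      have "vabs (G n i x) * r \<le> M + \<delta>"
        by (rule poly_grad_bounds(1)[OF G(1) fin r PM[OF n(1) _ \<delta>(1)] x i])
      then have "vabs (G n i x) \<le> (M + \<epsilon>) / r"
        using r0 \<delta> by (simp add: field_simps)
      moreover have "vabs (g i x - G n i x) \<le> (M + \<epsilon>) / r"
      proof (rule order_trans)
        show "vabs (g i x - G n i x) \<le> \<delta>"
          using n(2) i x by blast
        show "\<delta> \<le> (M + \<epsilon>) / r"
          using \<delta> M0 r0 by (simp add: field_simps)
      qed
      ultimately have "vabs (g i x) \<le> (M + \<epsilon>) / r"
        using vabs_add_le[of "g i x - G n i x" "(M + \<epsilon>) / r" "G n i x"] by simp
      then show ?thesis
        using r0 by (simp add: field_simps)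
    qed
    then show "vabs (g i x) * r \<le> M"
      by (rule field_le_epsilon)
  next
    fix x h :: "'i \<Rightarrow> 'k" and s assume x: "x \<in> polydisc V r" and s: "0 \<le> s" "s \<le> r" and h: "h \<in> polydisc V s"
    have xh: "(\<lambda>i. x i + h i) \<in> polydisc V r"
      using x h s(2) by (rule polydisc_add)
    have sr: "s / r \<le> 1" "s / r \<ge> 0"
      using s r0 by auto
    have both: "vabs (f (\<lambda>i. x i + h i) - f x) \<le> M * (s / r) + \<epsilon> \<and>
       vabs (f (\<lambda>i. x i + h i) - f x - (\<Sum>i\<in>V. g i x * h i)) \<le> M * (s / r)\<^sup>2 + \<epsilon>" if \<epsilon>: "\<epsilon> > 0" for \<epsilon>
    proof -
      \<comment> \<open>Both \<open>\<delta>\<close> and \<open>\<delta> * r\<close> are at most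
        \<open>\<epsilon>\<close>: the gradient is approximated up to \<open>\<delta>\<close> and
        multiplied by increments of size up to \<open>r\<close>.\<close>
      define \<delta> where "\<delta> = min \<epsilon> (\<epsilon> / r)"
      have \<delta>: "\<delta> > 0" "\<delta> \<le> \<epsilon>" "\<delta> * r \<le> \<epsilon>"
        using \<epsilon> r0 by (auto simp: \<delta>_def min_def field_simps)
      obtain n where n: "\<forall>x\<in>polydisc V r. vabs (f x - P n x) \<le> \<delta>"
        "\<forall>i\<in>V. \<forall>x\<in>polydisc V r. vabs (g i x - G n i x) \<le> \<delta>"
        using approx[OF \<delta>(1)] by blast
      note b = poly_grad_bounds(2,3)[OF G(1) fin r PM[OF n(1) _ \<delta>(1)] x s h]
      have b1: "vabs (P n (\<lambda>i. x i + h i) - P n x) \<le> M * (s / r) + \<epsilon>"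
      proof -
        have "(M + \<delta>) * (s / r) \<le> M * (s / r) + \<epsilon>"
          unfolding distrib_right using mult_left_le[of "s / r" \<delta>] sr \<delta> by linarith
        then show ?thesis
          using b(1) by linarith
      qed
      have b2: "vabs (P n (\<lambda>i. x i + h i) - P n x - (\<Sum>i\<in>V. G n i x * h i)) \<le> M * (s / r)\<^sup>2 + \<epsilon>"
      proof -
        have "(M + \<delta>) * (s / r)\<^sup>2 \<le> M * (s / r)\<^sup>2 + \<epsilon>"
          unfolding distrib_right using mult_left_le[of "(s / r)\<^sup>2" \<delta>] sr \<delta> power_le_one[of "s / r" 2] by linarith
        then show ?thesis
          using b(2) by linarith
      qed
      have d1: "vabs ((f (\<lambda>i. x i + h i) - P n (\<lambda>i. x i + h i)) - (f x - P n x)) \<le> \<epsilon>"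
        using bspec[OF n(1) xh] bspec[OF n(1) x] \<delta>(2)
        by (meson vabs_diff_le order_trans)
      have "vabs (\<Sum>i\<in>V. (g i x - G n i x) * h i) \<le> \<epsilon>"
      proof (rule vabs_sum_le)
        fix i assume i: "i \<in> V"
        have "vabs (g i x - G n i x) * vabs (h i) \<le> \<delta> * r"
          using n(2) i x polydiscD[OF h i] s \<delta> by (intro mult_mono) auto
        then show "vabs ((g i x - G n i x) * h i) \<le> \<epsilon>"
          using \<delta>(3) by (simp add: vabs_mult)
      qed (use \<epsilon> in simp)
      then have d2: "vabs ((\<Sum>i\<in>V. g i x * h i) - (\<Sum>i\<in>V. G n i x * h i)) \<le> \<epsilon>"
        by (simp add: left_diff_distrib sum_subtractf)
      have M1: "M * (s / r) \<ge> 0" "M * (s / r)\<^sup>2 \<ge> 0"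
        using M0 sr by (intro mult_nonneg_nonneg; simp)+
      have "vabs ((P n (\<lambda>i. x i + h i) - P n x) +
          ((f (\<lambda>i. x i + h i) - P n (\<lambda>i. x i + h i)) - (f x - P n x))) \<le> M * (s / r) + \<epsilon>"
        using b1 d1 M1 by (intro vabs_add_le) auto
      moreover have "vabs ((P n (\<lambda>i. x i + h i) - P n x - (\<Sum>i\<in>V. G n i x * h i)) +
          ((f (\<lambda>i. x i + h i) - P n (\<lambda>i. x i + h i)) - (f x - P n x))
          - ((\<Sum>i\<in>V. g i x * h i) - (\<Sum>i\<in>V. G n i x * h i))) \<le> M * (s / r)\<^sup>2 + \<epsilon>"
        using b2 d1 d2 M1 by (intro vabs_diff_le[OF vabs_add_le]) auto
      ultimately show ?thesis
        by (simp add: algebra_simps)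
    qed
    show "vabs (f (\<lambda>i. x i + h i) - f x) \<le> M * (s / r)"
      by (rule field_le_epsilon) (use both in blast)
    show "vabs (f (\<lambda>i. x i + h i) - f x - (\<Sum>i\<in>V. g i x * h i)) \<le> M * (s / r)\<^sup>2"
      by (rule field_le_epsilon) (use both in blast)
  qed
qed

text \<open>The remainder is quadratic and uniform in the base point, which is stronger than
  convergence of difference quotients and reduces the rules of calculus to ultrametric estimates. As
  a relation it determines \<open>g\<close> on the polydisc only, see
  \<open>partial_unique\<close>.\<close>

definition partial ::
  "'i set \<Rightarrow> real \<Rightarrow> 'i \<Rightarrow> (('i \<Rightarrow> 'k) \<Rightarrow> 'k) \<Rightarrow> (('i \<Rightarrow> 'k) \<Rightarrow> 'k) \<Rightarrow> bool" where
  "partial V r i f g \<longleftrightarrow> (\<exists>C. \<forall>x\<in>polydisc V r. \<forall>c. vabs c \<le> r \<longrightarrow>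
     vabs (f (x(i := x i + c)) - f x - c * g x) \<le> C * vabs c ^ 2)"

lemma partialE:
  assumes "partial V r i f g"
  obtains C where "C \<ge> 0" "\<And>x c. x \<in> polydisc V r \<Longrightarrow> vabs c \<le> r \<Longrightarrow>
     vabs (f (x(i := x i + c)) - f x - c * g x) \<le> C * vabs c ^ 2"
proof -
  obtain C where C: "\<And>x c. x \<in> polydisc V r \<Longrightarrow> vabs c \<le> r \<Longrightarrow>
     vabs (f (x(i := x i + c)) - f x - c * g x) \<le> C * vabs c ^ 2"
    using assms by (auto simp: partial_def)
  show ?thesis
  proof (rule that[of "max C 0"])
    fix x :: "'a \<Rightarrow> 'k" and c :: 'k assume "x \<in> polydisc V r" "vabs c \<le> r"
    then have "vabs (f (x(i := x i + c)) - f x - c * g x) \<le> C * vabs c ^ 2"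
      by (rule C)
    also have "\<dots> \<le> max C 0 * vabs c ^ 2"
      by (intro mult_right_mono) auto
    finally show "vabs (f (x(i := x i + c)) - f x - c * g x) \<le> max C 0 * vabs c ^ 2" .
  qed simp
qed

lemma polydisc_upd: "x \<in> polydisc V r \<Longrightarrow> vabs c \<le> r \<Longrightarrow> x(i := x i + c) \<in> polydisc V r"
  by (auto simp: polydisc_def intro!: vabs_add_le)

lemma partial_unique:
  assumes "partial V r i f g" "partial V r i f g'" "x \<in> polydisc V r" "r > 0"
  shows "g x = g' x"
proof -
  obtain C where C: "C \<ge> 0" "\<And>x c. x \<in> polydisc V r \<Longrightarrow> vabs c \<le> r \<Longrightarrow>
     vabs (f (x(i := x i + c)) - f x - c * g x) \<le> C * vabs c ^ 2"
    using partialE[OF assms(1)] by blast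
  obtain C' where C': "C' \<ge> 0" "\<And>x c. x \<in> polydisc V r \<Longrightarrow> vabs c \<le> r \<Longrightarrow>
     vabs (f (x(i := x i + c)) - f x - c * g' x) \<le> C' * vabs c ^ 2"
    using partialE[OF assms(2)] by blast
  have "g x - g' x = 0"
  proof (rule eq_0_if_small_bound[OF assms(4)])
    fix c :: 'k assume c: "vabs c \<le> r"
    have le: "C * vabs c ^ 2 \<le> (C + C') * vabs c ^ 2" "C' * vabs c ^ 2 \<le> (C + C') * vabs c ^ 2"
      using C(1) C'(1) by (simp_all add: mult_right_mono)
    have "c * (g x - g' x) = (f (x(i := x i + c)) - f x - c * g' x) - (f (x(i := x i + c)) - f x - c * g x)"
      by (simp add: algebra_simps)
    also have "vabs \<dots> \<le> (C + C') * vabs c ^ 2"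
      using order_trans[OF C(2)[OF assms(3) c] le(1)] order_trans[OF C'(2)[OF assms(3) c] le(2)]
      by (rule vabs_diff_le[rotated])
    finally show "vabs (c * (g x - g' x)) \<le> (C + C') * vabs c ^ 2" .
  qed
  then show ?thesis
    by simp
qed

lemma partial_cong:
  assumes "partial V r i f g" "\<And>x. x \<in> polydisc V r \<Longrightarrow> f x = f' x" "\<And>x. x \<in> polydisc V r \<Longrightarrow> g x = g' x"
  shows "partial V r i f' g'"
proof -
  obtain C where C: "C \<ge> 0" "\<And>x c. x \<in> polydisc V r \<Longrightarrow> vabs c \<le> r \<Longrightarrow>
     vabs (f (x(i := x i + c)) - f x - c * g x) \<le> C * vabs c ^ 2"
    using partialE[OF assms(1)] by blast
  show ?thesis
    unfolding partial_def
  proof (intro exI[of _ C] ballI allI impI)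
    fix x :: "'a \<Rightarrow> 'k" and c :: 'k assume x: "x \<in> polydisc V r" and c: "vabs c \<le> r"
    show "vabs (f' (x(i := x i + c)) - f' x - c * g' x) \<le> C * vabs c ^ 2"
      using C(2)[OF x c] unfolding assms(2)[OF x] assms(3)[OF x] assms(2)[OF polydisc_upd[OF x c]] .
  qed
qed

lemma partial_const: "partial V r i (\<lambda>_. c) (\<lambda>_. 0)"
  by (auto simp: partial_def intro!: exI[of _ 0])

lemma partial_var: "partial V r i (\<lambda>x. x i) (\<lambda>_. 1)"
  by (auto simp: partial_def intro!: exI[of _ 0])

lemma partial_add:
  assumes "partial V r i f f'" "partial V r i g g'"
  shows "partial V r i (\<lambda>x. f x + g x) (\<lambda>x. f' x + g' x)"
proof -
  obtain C where C: "C \<ge> 0" "\<And>x c. x \<in> polydisc V r \<Longrightarrow> vabs c \<le> r \<Longrightarrow>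
     vabs (f (x(i := x i + c)) - f x - c * f' x) \<le> C * vabs c ^ 2"
    using partialE[OF assms(1)] by blast
  obtain C' where C': "C' \<ge> 0" "\<And>x c. x \<in> polydisc V r \<Longrightarrow> vabs c \<le> r \<Longrightarrow>
     vabs (g (x(i := x i + c)) - g x - c * g' x) \<le> C' * vabs c ^ 2"
    using partialE[OF assms(2)] by blast
  have "vabs (f (x(i := x i + c)) + g (x(i := x i + c)) - (f x + g x) - c * (f' x + g' x)) \<le> (C + C') * vabs c ^ 2"
    if x: "x \<in> polydisc V r" and c: "vabs c \<le> r" for x c
  proof -
    have le: "C * vabs c ^ 2 \<le> (C + C') * vabs c ^ 2" "C' * vabs c ^ 2 \<le> (C + C') * vabs c ^ 2"
      using C(1) C'(1) by (simp_all add: mult_right_mono)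
    from vabs_add_le[OF order_trans[OF C(2)[OF x c] le(1)] order_trans[OF C'(2)[OF x c] le(2)]]
    show ?thesis
      by (simp add: algebra_simps)
  qed
  then show ?thesis
    unfolding partial_def by (intro exI[of _ "C + C'"]) blast
qed

lemma partial_sum:
  assumes "\<And>a. a \<in> A \<Longrightarrow> partial V r i (f a) (g a)"
  shows "partial V r i (\<lambda>x. \<Sum>a\<in>A. f a x) (\<lambda>x. \<Sum>a\<in>A. g a x)"
  using assms by (induction A rule: infinite_finite_induct) (simp_all add: partial_const partial_add)

lemma partial_lipschitz:
  assumes "partial V r i f f'" "f' \<in> tate e V r" "r > 0"
  obtains C where "C \<ge> 0" "\<And>x c. x \<in> polydisc V r \<Longrightarrow> vabs c \<le> r \<Longrightarrow>
     vabs (f (x(i := x i + c)) - f x) \<le> C * vabs c"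
proof -
  obtain C where C: "C \<ge> 0" "\<And>x c. x \<in> polydisc V r \<Longrightarrow> vabs c \<le> r \<Longrightarrow>
     vabs (f (x(i := x i + c)) - f x - c * f' x) \<le> C * vabs c ^ 2"
    using partialE[OF assms(1)] by blast
  obtain M where M: "M > 0" "\<And>x. x \<in> polydisc V r \<Longrightarrow> vabs (f' x) \<le> M"
    by (rule tate_bounded[OF assms(2) less_imp_le[OF assms(3)]]) (rule that)
  show ?thesis
  proof (rule that[of "C * r + M"])
    fix x :: "'a \<Rightarrow> 'k" and c :: 'k assume x: "x \<in> polydisc V r" and c: "vabs c \<le> r"
    have "C * vabs c ^ 2 \<le> C * (r * vabs c)"
      unfolding power2_eq_square using C(1) c by (intro mult_left_mono mult_right_mono) auto
    also have "\<dots> \<le> (C * r + M) * vabs c"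
      using M(1) by (simp add: algebra_simps)
    finally have 1: "vabs (f (x(i := x i + c)) - f x - c * f' x) \<le> (C * r + M) * vabs c"
      using C(2)[OF x c] by linarith
    have "vabs (c * f' x) \<le> vabs c * M"
      unfolding vabs_mult using M(2)[OF x] by (intro mult_left_mono) auto
    also have "\<dots> \<le> (C * r + M) * vabs c"
      using C(1) assms(3) by (simp add: algebra_simps)
    finally have 2: "vabs (c * f' x) \<le> (C * r + M) * vabs c" .
    show "vabs (f (x(i := x i + c)) - f x) \<le> (C * r + M) * vabs c"
      using vabs_add_le[OF 1 2] by simp
  qed (use C M assms(3) in auto)
qed

lemma partial_mult:
  assumes "partial V r i f f'" "partial V r i g g'" and r: "r > 0"
    and T: "f \<in> tate e1 V r" "g \<in> tate e2 V r" "f' \<in> tate e3 V r" "g' \<in> tate e4 V r"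
  shows "partial V r i (\<lambda>x. f x * g x) (\<lambda>x. f' x * g x + f x * g' x)"
proof -
  obtain C where C: "C \<ge> 0" "\<And>x c. x \<in> polydisc V r \<Longrightarrow> vabs c \<le> r \<Longrightarrow>
     vabs (f (x(i := x i + c)) - f x - c * f' x) \<le> C * vabs c ^ 2"
    using partialE[OF assms(1)] by blast
  obtain C' where C': "C' \<ge> 0" "\<And>x c. x \<in> polydisc V r \<Longrightarrow> vabs c \<le> r \<Longrightarrow>
     vabs (g (x(i := x i + c)) - g x - c * g' x) \<le> C' * vabs c ^ 2"
    using partialE[OF assms(2)] by blast
  obtain L where L: "L \<ge> 0" "\<And>x c. x \<in> polydisc V r \<Longrightarrow> vabs c \<le> r \<Longrightarrow>
     vabs (g (x(i := x i + c)) - g x) \<le> L * vabs c"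
    by (rule partial_lipschitz[OF assms(2) T(4) r]) (rule that)
  obtain F where F: "F > 0" "\<And>x. x \<in> polydisc V r \<Longrightarrow> vabs (f x) \<le> F"
    by (rule tate_bounded[OF T(1) less_imp_le[OF r]]) (rule that)
  obtain G where G: "G > 0" "\<And>x. x \<in> polydisc V r \<Longrightarrow> vabs (g x) \<le> G"
    by (rule tate_bounded[OF T(2) less_imp_le[OF r]]) (rule that)
  obtain F' where F': "F' > 0" "\<And>x. x \<in> polydisc V r \<Longrightarrow> vabs (f' x) \<le> F'"
    by (rule tate_bounded[OF T(3) less_imp_le[OF r]]) (rule that)
  define K where "K = G * C + F * C' + F' * L"
  have "G * C \<ge> 0" "F * C' \<ge> 0" "F' * L \<ge> 0"
    using C(1) C'(1) L(1) F(1) F'(1) G(1) by simp_all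
  then have K: "G * C \<le> K" "F * C' \<le> K" "F' * L \<le> K"
    unfolding K_def by linarith+
  have "vabs (f (x(i := x i + c)) * g (x(i := x i + c)) - f x * g x - c * (f' x * g x + f x * g' x)) \<le> K * vabs c ^ 2"
    if x: "x \<in> polydisc V r" and c: "vabs c \<le> r" for x c
  proof -
    have b1: "vabs (g (x(i := x i + c)) * (f (x(i := x i + c)) - f x - c * f' x)) \<le> G * (C * vabs c ^ 2)"
      unfolding vabs_mult using C(2)[OF x c] G(1) G(2)[OF polydisc_upd[OF x c]] by (intro mult_mono) auto
    have b2: "vabs (f x * (g (x(i := x i + c)) - g x - c * g' x)) \<le> F * (C' * vabs c ^ 2)"
      unfolding vabs_mult using C'(2)[OF x c] F(1) F(2)[OF x] by (intro mult_mono) auto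
    have b3: "vabs (c * f' x * (g (x(i := x i + c)) - g x)) \<le> vabs c * F' * (L * vabs c)"
      unfolding vabs_mult using L(2)[OF x c] F'(1) F'(2)[OF x] by (intro mult_mono) auto
    have Kc: "G * (C * vabs c ^ 2) \<le> K * vabs c ^ 2" "F * (C' * vabs c ^ 2) \<le> K * vabs c ^ 2"
      "vabs c * F' * (L * vabs c) \<le> K * vabs c ^ 2"
      using mult_right_mono[OF K(1), of "vabs c ^ 2"] mult_right_mono[OF K(2), of "vabs c ^ 2"]
        mult_right_mono[OF K(3), of "vabs c ^ 2"] by (simp_all add: mult_ac power2_eq_square)
    have "vabs (g (x(i := x i + c)) * (f (x(i := x i + c)) - f x - c * f' x)
       + f x * (g (x(i := x i + c)) - g x - c * g' x) + c * f' x * (g (x(i := x i + c)) - g x)) \<le> K * vabs c ^ 2"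
      using order_trans[OF b1 Kc(1)] order_trans[OF b2 Kc(2)] order_trans[OF b3 Kc(3)] by (rule vabs_add_le[OF vabs_add_le])
    then show ?thesis
      by (simp add: algebra_simps)
  qed
  then show ?thesis
    unfolding partial_def by (intro exI[of _ K]) blast
qed

lemma partial_of_gradient:
  fixes G :: "'i \<Rightarrow> ('i \<Rightarrow> 'k) \<Rightarrow> 'k"
  assumes "\<And>x s h. x \<in> polydisc V r \<Longrightarrow> 0 \<le> s \<Longrightarrow> s \<le> r \<Longrightarrow> h \<in> polydisc V s \<Longrightarrow>
       vabs (f (\<lambda>i. x i + h i) - f x - (\<Sum>i\<in>V. G i x * h i)) \<le> M * (s / r)\<^sup>2"
    and "finite V" "i \<in> V"
  shows "partial V r i f (G i)"
  unfolding partial_def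
proof (intro exI[of _ "M / r ^ 2"] ballI allI impI)
  fix x :: "'i \<Rightarrow> 'k" and c :: 'k assume x: "x \<in> polydisc V r" and c: "vabs c \<le> r"
  have upd: "(\<lambda>j. x j + (if j = i then c else 0)) = x(i := x i + c)"
    by auto
  have "(\<lambda>j. if j = i then c else 0) \<in> polydisc V (vabs c)"
    by (auto simp: polydisc_def)
  from assms(1)[OF x vabs_ge_0 c this]
  show "vabs (f (x(i := x i + c)) - f x - c * G i x) \<le> M / r\<^sup>2 * (vabs c)\<^sup>2"
    using assms(2,3) unfolding upd by (simp add: if_distrib power_divide mult.commute cong: if_cong)
qed

lemma ex_partial:
  assumes "f \<in> tate e V r" "finite V" "radius r" "i \<in> V"
  obtains g where "g \<in> convergent_on V r" "partial V r i f g"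
    "p dvd e i \<Longrightarrow> (\<And>x. x \<in> polydisc V r \<Longrightarrow> g x = 0)"
proof -
  obtain M where M: "M > 0" "\<And>x. x \<in> polydisc V r \<Longrightarrow> vabs (f x) \<le> M"
    by (rule tate_bounded[OF assms(1) less_imp_le[OF radius_pos[OF assms(3)]]]) (rule that)
  obtain G where G: "\<And>i. i \<in> V \<Longrightarrow> G i \<in> convergent_on V r"
    "\<And>i x. i \<in> V \<Longrightarrow> p dvd e i \<Longrightarrow> x \<in> polydisc V r \<Longrightarrow> G i x = 0"
    "\<And>i x. i \<in> V \<Longrightarrow> x \<in> polydisc V r \<Longrightarrow> vabs (G i x) * r \<le> M"
    "\<And>x s h. x \<in> polydisc V r \<Longrightarrow> 0 \<le> s \<Longrightarrow> s \<le> r \<Longrightarrow> h \<in> polydisc V s \<Longrightarrow>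
       vabs (f (\<lambda>i. x i + h i) - f x) \<le> M * (s / r)"
    "\<And>x s h. x \<in> polydisc V r \<Longrightarrow> 0 \<le> s \<Longrightarrow> s \<le> r \<Longrightarrow> h \<in> polydisc V s \<Longrightarrow>
       vabs (f (\<lambda>i. x i + h i) - f x - (\<Sum>i\<in>V. G i x * h i)) \<le> M * (s / r)\<^sup>2"
    by (rule tate_gradient[OF assms(1-3) M(2)]) (assumption, rule that)
  show ?thesis
  proof (rule that)
    show "G i \<in> convergent_on V r" "\<And>x. p dvd e i \<Longrightarrow> x \<in> polydisc V r \<Longrightarrow> G i x = 0"
      using G(1,2) assms(4) by blast+
    show "partial V r i f (G i)"
      by (rule partial_of_gradient[OF G(5) assms(2,4)])
  qed
qed

lemma partial_0_if_exponent:
  assumes "f \<in> tate e V r" "finite V" "radius r" "i \<in> V" "p dvd e i"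
  shows "partial V r i f (\<lambda>_. 0)"
proof -
  obtain g where g: "partial V r i f g" "\<And>x. x \<in> polydisc V r \<Longrightarrow> g x = 0"
    using ex_partial[OF assms(1-4)] assms(5) by metis
  show ?thesis
    by (rule partial_cong[OF g(1)]) (simp_all add: g(2))
qed

lemma partial_var_power:
  assumes "r > 0" "i \<in> V"
  shows "partial V r i (\<lambda>x. x i ^ n) (\<lambda>x. of_nat n * x i ^ (n - 1))"
proof (induction n)
  case (Suc n)
  have T: "(\<lambda>x. x i ^ m) \<in> convergent_on V r" for m
    using assms by (intro tate_power tate_var) auto
  have "partial V r i (\<lambda>x. x i * x i ^ n) (\<lambda>x. 1 * x i ^ n + x i * (of_nat n * x i ^ (n - 1)))"
    by (rule partial_mult[OF partial_var Suc _ tate_var T tate_const tate_mult[OF tate_const T]])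
      (use assms in auto)
  moreover have "1 * y ^ n + y * (of_nat n * y ^ (n - 1)) = of_nat (Suc n) * y ^ n" for y :: 'k
    by (cases n) (simp_all add: algebra_simps)
  ultimately show ?case
    by simp
qed (simp add: partial_const)

section \<open>Decomposition along the Frobenius\<close>

text \<open>The exponents of \<open>x i\<close> are divided by \<open>p\<close> with remainder
  \<open>k\<close>, so \<open>Q k\<close> collects the part of residue class \<open>k\<close> and
  involves \<open>x i\<close> only through \<open>x i ^ p\<close>.\<close>

lemma polyfuns_decomposition:
  fixes P :: "('i \<Rightarrow> 'k) \<Rightarrow> 'k"
  assumes "P \<in> polyfuns e V" "i \<in> V" "e i = Suc 0"
  shows "\<exists>Q. (\<forall>k<p. Q k \<in> polyfuns (e(i := p)) V) \<and> (\<forall>x. P x = (\<Sum>k<p. x i ^ k * Q k x))"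
  using assms(1)
proof (induction rule: polyfuns.induct)
  case (const c)
  have "(\<Sum>k<p. x i ^ k * (if k = 0 then c else 0)) = c" for x :: "'i \<Rightarrow> 'k"
    using sum.delta[of "{..<p}" 0 "\<lambda>_. c"] by (simp add: if_distrib cong: if_cong)
  then show ?case
    by (intro exI[of _ "\<lambda>k x. if k = 0 then c else 0"]) (auto intro: polyfuns.const)
next
  case (add f g)
  then obtain F G where "\<forall>k<p. F k \<in> polyfuns (e(i := p)) V" "\<forall>x. f x = (\<Sum>k<p. x i ^ k * F k x)"
    "\<forall>k<p. G k \<in> polyfuns (e(i := p)) V" "\<forall>x. g x = (\<Sum>k<p. x i ^ k * G k x)"
    by blast
  then show ?case
    by (intro exI[of _ "\<lambda>k x. F k x + G k x"]) (simp add: polyfuns.add sum.distrib ring_distribs del: fun_upd_apply)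
next
  case (var_mult f j)
  then obtain F where F: "\<forall>k<p. F k \<in> polyfuns (e(i := p)) V" "\<forall>x. f x = (\<Sum>k<p. x i ^ k * F k x)"
    by blast
  show ?case
  proof (cases "j = i")
    case False
    then have "(\<lambda>x. x j ^ e j * F k x) \<in> polyfuns (e(i := p)) V" if "k < p" for k
      using polyfuns.var_mult[of "F k" "e(i := p)" V j] F(1) that var_mult.hyps(2) by simp
    then show ?thesis
      using F(2) by (intro exI[of _ "\<lambda>k x. x j ^ e j * F k x"]) (simp add: sum_distrib_left mult_ac del: fun_upd_apply)
  next
    case True
    obtain m where m: "p = Suc m"
      using p_pos gr0_implies_Suc by blast
    \<comment> \<open>Multiplication by \<open>x i\<close> shifts the residue classes by one; the
      last class wraps around to class 0 and leaves a factor \<open>x i ^ p\<close>.\<close>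
    define G where "G = (\<lambda>k x. if k = 0 then x i ^ p * F m x else F (k - 1) x)"
    have "G k \<in> polyfuns (e(i := p)) V" if "k < p" for k
      using polyfuns.var_mult[of "F m" "e(i := p)" V i] F(1) that assms(2) m
      by (cases "k = 0") (auto simp: G_def)
    moreover have "x i ^ e i * f x = (\<Sum>k<p. x i ^ k * G k x)" for x
    proof -
      have "(\<Sum>k<p. x i ^ k * G k x) = G 0 x + (\<Sum>k<m. x i ^ Suc k * F k x)"
        unfolding m sum.lessThan_Suc_shift by (simp add: G_def)
      moreover have "x i ^ e i * f x = x i ^ p * F m x + (\<Sum>k<m. x i ^ Suc k * F k x)"
        unfolding F(2)[rule_format] m assms(3) by (simp add: sum_distrib_left algebra_simps)
      ultimately show ?thesis
        by (simp add: G_def)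
    qed
    ultimately show ?thesis
      using True by blast
  qed
qed

lemma polyfuns_univariate:
  fixes Q :: "('i \<Rightarrow> 'k) \<Rightarrow> 'k"
  assumes "Q \<in> polyfuns e V"
  shows "\<exists>q. \<forall>c. Q (x(i := c)) = poly q (c ^ e i)"
  using assms
proof (induction rule: polyfuns.induct)
  case (const c)
  then show ?case
    by (intro exI[of _ "[:c:]"]) simp
next
  case (add f g)
  then obtain q q' where "\<forall>c. f (x(i := c)) = poly q (c ^ e i)" "\<forall>c. g (x(i := c)) = poly q' (c ^ e i)"
    by blast
  then show ?case
    by (intro exI[of _ "q + q'"]) (simp del: fun_upd_apply)
next
  case (var_mult f j)
  then obtain q where "\<forall>c. f (x(i := c)) = poly q (c ^ e i)"
    by blast
  then show ?case
    by (intro exI[of _ "if j = i then pCons 0 q else smult (x j ^ e j) q"])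
      (simp del: fun_upd_apply add: fun_upd_same fun_upd_other)
qed

text \<open>The components cannot cancel each other, because they occupy different residue classes
  of the exponent of \<open>x i\<close> modulo \<open>p\<close>.\<close>

lemma decomposition_bound:
  fixes Q :: "nat \<Rightarrow> ('i \<Rightarrow> 'k) \<Rightarrow> 'k"
  assumes Q: "\<And>k. k < p \<Longrightarrow> Q k \<in> polyfuns e V" and e: "e i = p" and r: "radius r"
    and M: "\<And>x. x \<in> polydisc V r \<Longrightarrow> vabs (\<Sum>k<p. x i ^ k * Q k x) \<le> M"
    and x: "x \<in> polydisc V r" and i: "i \<in> V" and k: "k < p"
  shows "vabs (Q k x) * r ^ k \<le> M"
proof -
  obtain d :: 'k where d: "d \<noteq> 0" "vabs d = r"
    using r by (auto simp: radius_def)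
  have M0: "M \<ge> 0"
    using M[OF x] vabs_ge_0 order_trans by blast
  have "\<forall>k. \<exists>q. k < p \<longrightarrow> (\<forall>c. Q k (x(i := c)) = poly q (c ^ p))"
    using polyfuns_univariate[OF Q, of _ x i] e by metis
  then obtain q where q: "\<And>k c. k < p \<Longrightarrow> Q k (x(i := c)) = poly (q k) (c ^ p)"
    by metis
  \<comment> \<open>The sum restricted to the line through \<open>x\<close> in direction
    \<open>i\<close>. The exponents \<open>p * j + k\<close> with \<open>k < p\<close> are pairwise
    distinct, so Cauchy's estimate for \<open>R\<close> bounds every single coefficient of every
    \<open>q k\<close>.\<close>
  define R where "R = (\<Sum>k<p. \<Sum>j\<le>degree (q k). monom (coeff (q k) j) (p * j + k))"
  have R: "poly R c = (\<Sum>k<p. c ^ k * poly (q k) (c ^ p))" for c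
    unfolding R_def poly_sum poly_monom poly_altdef[of "q _"]
    by (simp only: sum_distrib_left power_add power_mult) (simp only: ac_simps)
  have "vabs (poly R c) \<le> M" if "vabs c \<le> vabs d" for c
  proof -
    have "x(i := c) \<in> polydisc V r"
      using x that d by (simp add: polydisc_def)
    from M[OF this] show ?thesis
      by (simp add: R q)
  qed
  then have bound: "vabs (coeff R l) * vabs d ^ l \<le> M" for l
    by (rule cauchy_estimate)
  have coeff: "coeff R (p * j + k) = coeff (q k) j" if j: "j \<le> degree (q k)" for j
  proof -
    have eq: "p * j' + k' = p * j + k \<longleftrightarrow> k' = k \<and> j' = j" if "k' < p" for j' k'
    proof
      assume eq: "p * j' + k' = p * j + k"
      then have "(p * j' + k') mod p = (p * j + k) mod p"
        by simp
      then have "k' = k"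
        using that k by simp
      with eq show "k' = k \<and> j' = j"
        using p_gt_1 by simp
    qed simp
    have "coeff R (p * j + k) = (\<Sum>k'<p. \<Sum>j'\<le>degree (q k'). if k' = k \<and> j' = j then coeff (q k') j' else 0)"
      unfolding R_def coeff_sum by (intro sum.cong refl) (simp add: eq)
    also have "\<dots> = (\<Sum>k'<p. if k' = k then \<Sum>j'\<le>degree (q k). if j' = j then coeff (q k) j' else 0 else 0)"
      by (intro sum.cong refl) (auto intro: sum.cong)
    also have "\<dots> = coeff (q k) j"
      using k j by simp
    finally show ?thesis .
  qed
  have xi: "vabs (x i) \<le> r"
    using polydiscD[OF x i] .
  have "vabs (Q k x * d ^ k) \<le> M"
  proof -
    have "Q k x = (\<Sum>j\<le>degree (q k). coeff (q k) j * (x i ^ p) ^ j)"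
      using q[OF k, of "x i"] by (simp add: poly_altdef)
    then have "Q k x * d ^ k = (\<Sum>j\<le>degree (q k). coeff (q k) j * (x i ^ p) ^ j * d ^ k)"
      by (simp add: sum_distrib_right)
    also have "vabs \<dots> \<le> M"
    proof (rule vabs_sum_le[OF _ M0])
      fix j assume "j \<in> {..degree (q k)}"
      then have "vabs (coeff (q k) j) * r ^ (p * j + k) \<le> M"
        using bound[of "p * j + k"] coeff d by simp
      moreover have "vabs (x i) ^ (p * j) * r ^ k \<le> r ^ (p * j + k)"
        using xi radius_pos[OF r] by (simp add: power_add mult_right_mono power_mono)
      ultimately show "vabs (coeff (q k) j * (x i ^ p) ^ j * d ^ k) \<le> M"
        using mult_left_mono[of "vabs (x i) ^ (p * j) * r ^ k" "r ^ (p * j + k)" "vabs (coeff (q k) j)"] d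
        by (simp add: vabs_mult vabs_power power_mult[symmetric] mult.assoc)
    qed
    finally show ?thesis .
  qed
  then show ?thesis
    using d by (simp add: vabs_mult vabs_power)
qed

lemma tate_approx_sequence:
  fixes f :: "('i \<Rightarrow> 'k) \<Rightarrow> 'k"
  assumes "f \<in> tate e V r"
  shows "\<exists>P :: nat \<Rightarrow> ('i \<Rightarrow> 'k) \<Rightarrow> 'k. (\<forall>n. P n \<in> polyfuns e V) \<and>
    (\<forall>\<epsilon>>0. \<exists>N. \<forall>n\<ge>N. \<forall>x\<in>polydisc V r. vabs (f x - P n x) \<le> \<epsilon>)"
proof -
  have "\<exists>P. P \<in> polyfuns e V \<and> (\<forall>x\<in>polydisc V r. vabs (f x - P x) \<le> 1 / real (Suc n))" for n
    by (rule tateE[OF assms, of "1 / real (Suc n)"]) auto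
  then obtain P where P: "\<And>n :: nat. P n \<in> polyfuns e V"
    "\<And>n x. x \<in> polydisc V r \<Longrightarrow> vabs (f x - P n x) \<le> 1 / real (Suc n)"
    by metis
  show ?thesis
  proof (intro exI[of _ P] conjI allI impI)
    show "P n \<in> polyfuns e V" for n
      by (rule P(1))
  next
    fix \<epsilon> :: real assume "\<epsilon> > 0"
    then obtain N where N: "inverse (real (Suc N)) < \<epsilon>"
      using reals_Archimedean by blast
    have "vabs (f x - P n x) \<le> \<epsilon>" if "n \<ge> N" "x \<in> polydisc V r" for n x
    proof -
      have "1 / real (Suc n) \<le> inverse (real (Suc N))"
        using that by (simp add: divide_simps)
      then show ?thesis
        using P(2)[OF that(2), of n] N by linarith
    qed
    then show "\<exists>N. \<forall>n\<ge>N. \<forall>x\<in>polydisc V r. vabs (f x - P n x) \<le> \<epsilon>"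
      by blast
  qed
qed

text \<open>The bound for polynomials is linear in the sup norm, so the components of an
  approximating sequence form Cauchy sequences themselves.\<close>

lemma tate_decomposition:
  fixes f :: "('i \<Rightarrow> 'k) \<Rightarrow> 'k"
  assumes f: "f \<in> tate e V r" and i: "i \<in> V" "e i = Suc 0" and r: "radius r"
    and M: "\<And>x. x \<in> polydisc V r \<Longrightarrow> vabs (f x) \<le> M"
  obtains F where "\<And>k. k < p \<Longrightarrow> F k \<in> tate (e(i := p)) V r"
    "\<And>x. x \<in> polydisc V r \<Longrightarrow> f x = (\<Sum>k<p. x i ^ k * F k x)"
    "\<And>k x. k < p \<Longrightarrow> x \<in> polydisc V r \<Longrightarrow> vabs (F k x) * r ^ k \<le> M"
proof -
  have r0: "r > 0"
    using r by (rule radius_pos)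
  have M0: "M \<ge> 0"
    using M[of "\<lambda>_. 0"] r0 order_trans[OF vabs_ge_0] by simp
  obtain P where P: "\<And>n :: nat. P n \<in> polyfuns e V"
    "\<And>\<epsilon>. \<epsilon> > 0 \<Longrightarrow> \<exists>N. \<forall>n\<ge>N. \<forall>x\<in>polydisc V r. vabs (f x - P n x) \<le> \<epsilon>"
    using tate_approx_sequence[OF f] by blast
  obtain Q where Q: "\<And>n k. k < p \<Longrightarrow> Q n k \<in> polyfuns (e(i := p)) V"
    "\<And>n x. P n x = (\<Sum>k<p. x i ^ k * Q n k x)"
    using polyfuns_decomposition[OF P(1) i] by metis
  have diff: "vabs (Q n k x - Q m k x) \<le> \<epsilon>"
    if nm: "\<forall>x\<in>polydisc V r. vabs (f x - P n x) \<le> \<epsilon> * r ^ k" "\<forall>x\<in>polydisc V r. vabs (f x - P m x) \<le> \<epsilon> * r ^ k"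
      and k: "k < p" and x: "x \<in> polydisc V r" for n m k x \<epsilon>
  proof -
    have "vabs (\<Sum>k<p. y i ^ k * (Q n k y - Q m k y)) \<le> \<epsilon> * r ^ k" if y: "y \<in> polydisc V r" for y
    proof -
      have "(\<Sum>k<p. y i ^ k * (Q n k y - Q m k y)) = (f y - P m y) - (f y - P n y)"
        by (simp add: Q(2) right_diff_distrib sum_subtractf)
      then show ?thesis
        using vabs_diff_le[OF bspec[OF nm(2) y] bspec[OF nm(1) y]] by simp
    qed
    then have "vabs (Q n k x - Q m k x) * r ^ k \<le> \<epsilon> * r ^ k"
      by (intro decomposition_bound[where Q = "\<lambda>k x. Q n k x - Q m k x" and e = "e(i := p)" and V = V and i = i])
        (use Q(1) r x i k in \<open>auto intro: polyfuns_diff\<close>)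
    then show ?thesis
      using r0 by simp
  qed
  have "\<exists>F. k < p \<longrightarrow> F \<in> tate (e(i := p)) V r \<and>
     (\<forall>\<epsilon>>0. \<exists>N. \<forall>n\<ge>N. \<forall>x\<in>polydisc V r. vabs (F x - Q n k x) \<le> \<epsilon>)" for k
  proof (cases "k < p")
    case True
    show ?thesis
    proof (rule tate_uniform_limit)
      show "Q n k \<in> tate (e(i := p)) V r" for n
        using Q(1)[OF True] by (rule tate_polyfuns)
      fix \<epsilon> :: real assume "\<epsilon> > 0"
      then obtain N where "\<forall>n\<ge>N. \<forall>x\<in>polydisc V r. vabs (f x - P n x) \<le> \<epsilon> * r ^ k"
        using P(2)[of "\<epsilon> * r ^ k"] r0 by auto
      then show "\<exists>N. \<forall>m\<ge>N. \<forall>n\<ge>N. \<forall>x\<in>polydisc V r. vabs (Q m k x - Q n k x) \<le> \<epsilon>"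
        using diff[OF _ _ True] by blast
    qed blast
  qed simp
  then obtain F where F: "\<And>k. k < p \<Longrightarrow> F k \<in> tate (e(i := p)) V r"
    "\<And>k \<epsilon>. k < p \<Longrightarrow> \<epsilon> > 0 \<Longrightarrow> \<exists>N. \<forall>n\<ge>N. \<forall>x\<in>polydisc V r. vabs (F k x - Q n k x) \<le> \<epsilon>"
    by metis
  have approx: "\<exists>n. (\<forall>x\<in>polydisc V r. vabs (f x - P n x) \<le> \<epsilon>) \<and>
     (\<forall>k<p. \<forall>x\<in>polydisc V r. vabs (F k x - Q n k x) \<le> \<epsilon>)" if \<epsilon>: "\<epsilon> > 0" for \<epsilon>
  proof -
    obtain N where N: "\<forall>n\<ge>N. \<forall>x\<in>polydisc V r. vabs (f x - P n x) \<le> \<epsilon>"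
      using P(2)[OF \<epsilon>] by blast
    have "\<forall>k\<in>{..<p}. \<exists>N. \<forall>n\<ge>N. \<forall>x\<in>polydisc V r. vabs (F k x - Q n k x) \<le> \<epsilon>"
      using F(2)[OF _ \<epsilon>] by blast
    then have "\<exists>N'. \<forall>k\<in>{..<p}. \<forall>n\<ge>N' k. \<forall>x\<in>polydisc V r. vabs (F k x - Q n k x) \<le> \<epsilon>"
      by (rule bchoice)
    then obtain N' where N': "\<And>k n x. k < p \<Longrightarrow> n \<ge> N' k \<Longrightarrow> x \<in> polydisc V r \<Longrightarrow> vabs (F k x - Q n k x) \<le> \<epsilon>"
      by blast
    define n where "n = N + (\<Sum>k<p. N' k)"
    have "N' k \<le> n" if "k < p" for k
      using member_le_sum[of k "{..<p}" N'] that by (simp add: n_def)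
    then show ?thesis
      using N N' by (intro exI[of _ n]) (auto simp: n_def)
  qed
  show ?thesis
  proof (rule that[of F])
    show "F k \<in> tate (e(i := p)) V r" if "k < p" for k
      using F(1) that .
  next
    fix x :: "'i \<Rightarrow> 'k" assume x: "x \<in> polydisc V r"
    have xi: "vabs (x i) \<le> r"
      using polydiscD[OF x i(1)] .
    show "f x = (\<Sum>k<p. x i ^ k * F k x)"
    proof (rule eq_if_vabs_small)
      fix \<epsilon> :: real assume \<epsilon>: "\<epsilon> > 0"
      \<comment> \<open>The power of \<open>max 1 r\<close> dominates \<open>r ^ k\<close> for all
        \<open>k < p\<close> at once, whether or not \<open>r\<close> exceeds 1.\<close>
      define \<delta> where "\<delta> = min \<epsilon> (\<epsilon> / max 1 r ^ p)"
      have "\<delta> > 0" "\<delta> \<le> \<epsilon>"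
        using \<epsilon> by (auto simp: \<delta>_def)
      have \<delta>: "\<delta> * r ^ k \<le> \<epsilon>" if "k < p" for k
      proof -
        have "r ^ k \<le> max 1 r ^ k"
          using r0 by (intro power_mono) auto
        also have "\<dots> \<le> max 1 r ^ p"
          using that by (intro power_increasing) auto
        finally have "\<delta> * r ^ k \<le> \<epsilon> / max 1 r ^ p * max 1 r ^ p"
          using \<epsilon> r0 by (intro mult_mono) (auto simp: \<delta>_def)
        then show ?thesis
          using r0 by simp
      qed
      obtain n where n: "\<forall>x\<in>polydisc V r. vabs (f x - P n x) \<le> \<delta>"
        "\<forall>k<p. \<forall>x\<in>polydisc V r. vabs (F k x - Q n k x) \<le> \<delta>"
        using approx[OF \<open>\<delta> > 0\<close>] by blast
      have "vabs (\<Sum>k<p. x i ^ k * (F k x - Q n k x)) \<le> \<epsilon>"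
      proof (rule vabs_sum_le)
        fix k assume "k \<in> {..<p}"
        then have "vabs (F k x - Q n k x) \<le> \<delta>" "\<delta> * r ^ k \<le> \<epsilon>"
          using n(2) x \<delta> by auto
        moreover have "vabs (x i) ^ k \<le> r ^ k"
          using xi by (intro power_mono) auto
        ultimately show "vabs (x i ^ k * (F k x - Q n k x)) \<le> \<epsilon>"
          using mult_mono[of "vabs (F k x - Q n k x)" \<delta> "vabs (x i) ^ k" "r ^ k"] \<open>\<delta> > 0\<close>
          by (simp add: vabs_mult vabs_power mult.commute)
      qed (use \<epsilon> in simp)
      moreover have "vabs (f x - P n x) \<le> \<epsilon>"
        using n(1) x \<open>\<delta> \<le> \<epsilon>\<close> by force
      moreover have "f x - (\<Sum>k<p. x i ^ k * F k x) = (f x - P n x) - (\<Sum>k<p. x i ^ k * (F k x - Q n k x))"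
        by (simp add: Q(2) right_diff_distrib sum_subtractf)
      ultimately show "vabs (f x - (\<Sum>k<p. x i ^ k * F k x)) \<le> \<epsilon>"
        by (simp only: vabs_diff_le)
    qed
  next
    fix k and x :: "'i \<Rightarrow> 'k" assume k: "k < p" and x: "x \<in> polydisc V r"
    show "vabs (F k x) * r ^ k \<le> M"
    proof (rule field_le_epsilon)
      fix \<epsilon> :: real assume \<epsilon>: "\<epsilon> > 0"
      define \<delta> where "\<delta> = min \<epsilon> (\<epsilon> / r ^ k)"
      have \<delta>: "\<delta> > 0" "\<delta> \<le> \<epsilon>" "\<delta> * r ^ k \<le> \<epsilon>"
        using \<epsilon> r0 by (auto simp: \<delta>_def min_def field_simps)
      obtain n where n: "\<forall>x\<in>polydisc V r. vabs (f x - P n x) \<le> \<delta>"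
        "\<forall>k<p. \<forall>x\<in>polydisc V r. vabs (F k x - Q n k x) \<le> \<delta>"
        using approx[OF \<delta>(1)] by blast
      have "vabs (\<Sum>k<p. y i ^ k * Q n k y) \<le> M + \<epsilon>" if y: "y \<in> polydisc V r" for y
      proof -
        have "vabs (f y - (f y - P n y)) \<le> M + \<epsilon>"
          by (rule vabs_diff_le) (use M[OF y] bspec[OF n(1) y] \<delta> \<epsilon> M0 in auto)
        then show ?thesis
          by (simp add: Q(2))
      qed
      then have "vabs (Q n k x) * r ^ k \<le> M + \<epsilon>"
        by (intro decomposition_bound[where Q = "\<lambda>k x. Q n k x" and e = "e(i := p)" and V = V and i = i])
          (use Q(1) r x i k in auto)
      moreover have "vabs (F k x - Q n k x) * r ^ k \<le> M + \<epsilon>"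
      proof -
        have "vabs (F k x - Q n k x) * r ^ k \<le> \<delta> * r ^ k"
          using n(2) k x r0 by (intro mult_right_mono) auto
        also have "\<dots> \<le> M + \<epsilon>"
          using \<delta>(3) M0 by linarith
        finally show ?thesis .
      qed
      ultimately have "vabs ((F k x - Q n k x) + Q n k x) \<le> (M + \<epsilon>) / r ^ k"
        using r0 by (intro vabs_add_le) (simp_all add: pos_le_divide_eq)
      then show "vabs (F k x) * r ^ k \<le> M + \<epsilon>"
        using r0 by (simp add: field_simps)
    qed
  qed
qed

text \<open>Coefficients have \<open>p\<close>-th roots in an algebraically closed field, and in
  characteristic \<open>p\<close> a sum of \<open>p\<close>-th powers is a \<open>p\<close>-th
  power.\<close>

lemma polyfuns_pth_root:
  fixes P :: "('i \<Rightarrow> 'k) \<Rightarrow> 'k"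
  assumes "P \<in> polyfuns e V" "\<And>i. i \<in> V \<Longrightarrow> e i = p"
  shows "\<exists>Q\<in>polyfuns (\<lambda>_. Suc 0) V. \<forall>x. P x = Q x ^ p"
  using assms(1)
proof (induction rule: polyfuns.induct)
  case (const c)
  obtain d where "d ^ p = c"
    using ex_root p_pos by blast
  then show ?case
    by (intro bexI[of _ "\<lambda>_. d"]) (auto intro: polyfuns.const)
next
  case (add f g)
  then obtain F G where FG: "F \<in> polyfuns (\<lambda>_. Suc 0) V" "\<forall>x. f x = F x ^ p" "G \<in> polyfuns (\<lambda>_. Suc 0) V" "\<forall>x. g x = G x ^ p"
    by blast
  show ?case
    by (rule bexI[OF _ polyfuns.add[OF FG(1,3)]]) (simp add: FG(2,4) frob_add)
next
  case (var_mult f i)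
  then obtain F where F: "F \<in> polyfuns (\<lambda>_. Suc 0) V" "\<forall>x. f x = F x ^ p"
    by blast
  show ?case
    by (rule bexI[OF _ polyfuns.var_mult[OF F(1) var_mult.hyps(2)]])
      (simp add: F(2) assms(2)[OF var_mult.hyps(2)] power_mult_distrib)
qed

lemma vabs_le_if_power_le: "vabs (x ^ n) \<le> M ^ n \<Longrightarrow> M \<ge> 0 \<Longrightarrow> n > 0 \<Longrightarrow> vabs x \<le> M"
  using power_le_imp_le_base[of "vabs x" "n - 1" M] by (simp add: vabs_power)

text \<open>Extracting \<open>p\<close>-th roots is uniformly continuous since
  \<open>|a - b| ^ p = |a ^ p - b ^ p|\<close>, so roots of polynomial approximations converge
  uniformly.\<close>

lemma tate_pth_root:
  fixes f :: "('i \<Rightarrow> 'k) \<Rightarrow> 'k"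
  assumes f: "f \<in> tate e V r" and e: "\<And>i. i \<in> V \<Longrightarrow> e i = p"
  obtains h where "h \<in> convergent_on V r" "\<And>x. x \<in> polydisc V r \<Longrightarrow> f x = h x ^ p"
proof -
  obtain P where P: "\<And>n :: nat. P n \<in> polyfuns e V"
    "\<And>\<epsilon>. \<epsilon> > 0 \<Longrightarrow> \<exists>N. \<forall>n\<ge>N. \<forall>x\<in>polydisc V r. vabs (f x - P n x) \<le> \<epsilon>"
    using tate_approx_sequence[OF f] by blast
  obtain Q where Q: "\<And>n. Q n \<in> polyfuns (\<lambda>_. Suc 0) V" "\<And>n x. P n x = Q n x ^ p"
    using polyfuns_pth_root[OF P(1) e] by metis
  obtain h where h: "h \<in> convergent_on V r"
    "\<And>\<epsilon>. \<epsilon> > 0 \<Longrightarrow> \<exists>N. \<forall>n\<ge>N. \<forall>x\<in>polydisc V r. vabs (h x - Q n x) \<le> \<epsilon>"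
  proof (rule tate_uniform_limit)
    show "Q n \<in> convergent_on V r" for n
      using Q(1) by (rule tate_polyfuns)
    fix \<epsilon> :: real assume \<epsilon>: "\<epsilon> > 0"
    then obtain N where N: "\<forall>n\<ge>N. \<forall>x\<in>polydisc V r. vabs (f x - P n x) \<le> \<epsilon> ^ p"
      using P(2)[of "\<epsilon> ^ p"] by auto
    have "vabs (Q m x - Q n x) \<le> \<epsilon>" if "m \<ge> N" "n \<ge> N" "x \<in> polydisc V r" for m n x
    proof (rule vabs_le_if_power_le)
      have "vabs ((f x - P n x) - (f x - P m x)) \<le> \<epsilon> ^ p"
        using N that vabs_diff_le[of "f x - P n x" "\<epsilon> ^ p" "f x - P m x"] by auto
      then show "vabs ((Q m x - Q n x) ^ p) \<le> \<epsilon> ^ p"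
        by (simp add: frob_diff Q(2))
    qed (use \<epsilon> in auto)
    then show "\<exists>N. \<forall>m\<ge>N. \<forall>n\<ge>N. \<forall>x\<in>polydisc V r. vabs (Q m x - Q n x) \<le> \<epsilon>"
      by blast
  qed (rule that)
  show ?thesis
  proof (rule that[OF h(1)])
    fix x :: "'i \<Rightarrow> 'k" assume x: "x \<in> polydisc V r"
    show "f x = h x ^ p"
    proof (rule eq_if_vabs_small)
      fix \<epsilon> :: real assume \<epsilon>: "\<epsilon> > 0"
      \<comment> \<open>The cap at 1 gives
        \<open>\<delta> ^ p \<le> \<delta> \<le> \<epsilon>\<close>.\<close>
      define \<delta> where "\<delta> = min 1 \<epsilon>"
      have \<delta>: "\<delta> > 0" "\<delta> \<le> 1" "\<delta> \<le> \<epsilon>"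
        using \<epsilon> by (auto simp: \<delta>_def)
      obtain N where N: "\<forall>n\<ge>N. \<forall>x\<in>polydisc V r. vabs (f x - P n x) \<le> \<epsilon>"
        using P(2)[OF \<epsilon>] by blast
      obtain N' where N': "\<forall>n\<ge>N'. \<forall>x\<in>polydisc V r. vabs (h x - Q n x) \<le> \<delta>"
        using h(2)[OF \<delta>(1)] by blast
      define n where "n = max N N'"
      have "vabs (h x - Q n x) ^ p \<le> \<delta> ^ p"
        using N' x by (intro power_mono) (auto simp: n_def)
      also have "\<dots> \<le> \<delta> ^ 1"
        using \<delta> p_gt_1 by (intro power_decreasing) auto
      finally have "vabs (h x ^ p - P n x) \<le> \<epsilon>"
        using \<delta> by (simp add: Q(2) vabs_power flip: frob_diff)
      moreover have "vabs (f x - P n x) \<le> \<epsilon>"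
        using N x by (auto simp: n_def)
      ultimately show "vabs (f x - h x ^ p) \<le> \<epsilon>"
        using vabs_diff_le[of "f x - P n x" \<epsilon> "h x ^ p - P n x"] by simp
    qed
  qed
qed

section \<open>A vanishing principle\<close>

lemma tate_lipschitz:
  fixes f :: "('i \<Rightarrow> 'k) \<Rightarrow> 'k"
  assumes "f \<in> tate e V r" "finite V" "radius r" "\<And>x. x \<in> polydisc V r \<Longrightarrow> vabs (f x) \<le> M"
    and "x \<in> polydisc V r" "0 \<le> s" "s \<le> r" "h \<in> polydisc V s"
  shows "vabs (f (\<lambda>i. x i + h i) - f x) \<le> M * (s / r)"
  by (rule tate_gradient[OF assms(1-4)]) (use assms(5-8) in blast)+

text \<open>In characteristic zero, Taylor expansion at a point of \<open>A\<close> would show at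
  once that functions vanishing on \<open>A\<close> are zero near that point. In characteristic
  \<open>p\<close> the condition says nothing about functions of the \<open>x i ^ p\<close>, whose
  partial derivatives vanish anyway.\<close>

definition derivation_stable :: "'i set \<Rightarrow> real \<Rightarrow> ('i \<Rightarrow> 'k) set \<Rightarrow> bool" where
  "derivation_stable V r A \<longleftrightarrow> A \<subseteq> polydisc V r \<and>
     (\<forall>f\<in>convergent_on V r. \<forall>i\<in>V. \<forall>g\<in>convergent_on V r.
        (\<forall>a\<in>A. f a = 0) \<and> partial V r i f g \<longrightarrow> (\<forall>a\<in>A. g a = 0))"

lemma derivation_stableD:
  "derivation_stable V r A \<Longrightarrow> f \<in> convergent_on V r \<Longrightarrow> (\<And>a. a \<in> A \<Longrightarrow> f a = 0) \<Longrightarrow> i \<in> V \<Longrightarrow>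
   g \<in> convergent_on V r \<Longrightarrow> partial V r i f g \<Longrightarrow> a \<in> A \<Longrightarrow> g a = 0"
  unfolding derivation_stable_def by blast

text \<open>Differentiation with respect to \<open>x i\<close> turns the components
  \<open>F k\<close> into \<open>k * F k\<close> and drops \<open>F 0\<close>, so induction on their
  number applies. The factors \<open>k\<close> are invertible because
  \<open>k \<le> m < p\<close>.\<close>

lemma components_vanish:
  fixes F :: "nat \<Rightarrow> ('i \<Rightarrow> 'k) \<Rightarrow> 'k"
  assumes A: "derivation_stable V r A" and r: "r > 0" and i: "i \<in> V" and "m < p"
    and "\<And>k. k \<le> m \<Longrightarrow> F k \<in> convergent_on V r" "\<And>k. k \<le> m \<Longrightarrow> partial V r i (F k) (\<lambda>_. 0)"
    and "\<And>a. a \<in> A \<Longrightarrow> (\<Sum>k\<le>m. a i ^ k * F k a) = 0"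
    and "k \<le> m" "a \<in> A"
  shows "F k a = 0"
  using assms(4-)
proof (induction m arbitrary: F k a)
  case 0
  then show ?case
    by force
next
  case (Suc m)
  have T: "(\<lambda>x. x i ^ n) \<in> convergent_on V r" for n
    using r i by (intro tate_power tate_var) auto
  \<comment> \<open>The derivative of the sum, reindexed so that it is again a sum of components,
    with one component fewer.\<close>
  define g where "g = (\<lambda>x. \<Sum>k\<le>m. x i ^ k * (of_nat (Suc k) * F (Suc k) x))"
  have g: "g \<in> convergent_on V r"
    unfolding g_def by (intro tate_sum tate_mult[OF T] tate_mult[OF tate_const]) (use Suc.prems(2) r in auto)
  define f where "f = (\<lambda>x :: 'i \<Rightarrow> 'k. \<Sum>k\<le>Suc m. x i ^ k * F k x)"
  have f: "f \<in> convergent_on V r"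
    unfolding f_def by (intro tate_sum tate_mult[OF T]) (use Suc.prems(2) r in auto)
  have "partial V r i f (\<lambda>x. \<Sum>k\<le>Suc m. of_nat k * x i ^ (k - 1) * F k x + x i ^ k * 0)"
    unfolding f_def
    by (intro partial_sum partial_mult[OF partial_var_power[OF r i]])
      (use Suc.prems(2,3) r in \<open>auto intro!: T tate_mult[OF tate_const T] tate_const\<close>)
  moreover have "(\<lambda>x. \<Sum>k\<le>Suc m. of_nat k * x i ^ (k - 1) * F k x + x i ^ k * 0) = g"
    by (auto simp: g_def sum.atMost_Suc_shift fun_eq_iff mult_ac simp del: sum.atMost_Suc intro!: sum.cong)
  ultimately have "partial V r i f g"
    by simp
  then have g0: "g a = 0" if "a \<in> A" for a
    using derivation_stableD[OF A f _ i g] Suc.prems(4) that by (auto simp: f_def)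
  have Suc0: "F (Suc k) a = 0" if "k \<le> m" "a \<in> A" for k a
  proof -
    have "partial V r i (\<lambda>x. of_nat (Suc k) * F (Suc k) x) (\<lambda>_. 0)" if "k \<le> m" for k
    proof -
      have "partial V r i (\<lambda>x. of_nat (Suc k) * F (Suc k) x) (\<lambda>x. 0 * F (Suc k) x + of_nat (Suc k) * 0)"
        by (rule partial_mult[OF partial_const Suc.prems(3) r tate_const Suc.prems(2) tate_const tate_const])
          (use that in auto)
      then show ?thesis
        by simp
    qed
    then have "of_nat (Suc k) * F (Suc k) a = 0"
      by (rule Suc.IH[of "\<lambda>k x. of_nat (Suc k) * F (Suc k) x", rotated 2])
        (use Suc.prems(1,2) that g0 r in \<open>auto simp: g_def intro!: tate_mult[OF tate_const]\<close>)
    moreover have "of_nat (Suc k) \<noteq> (0 :: 'k)"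
      unfolding of_nat_eq_0 using that Suc.prems(1) by (auto dest: dvd_imp_le)
    ultimately show ?thesis
      by simp
  qed
  show ?case
  proof (cases k)
    case 0
    have "(\<Sum>k\<le>Suc m. a i ^ k * F k a) = F 0 a"
      unfolding sum.atMost_Suc_shift using Suc0 Suc.prems(6) by simp
    then show ?thesis
      using Suc.prems(4,6) 0 by simp
  next
    case (Suc l)
    then show ?thesis
      using Suc0 Suc.prems by auto
  qed
qed

abbreviation frob_exponents :: "'i set \<Rightarrow> 'i \<Rightarrow> nat" where
  "frob_exponents W \<equiv> (\<lambda>j. if j \<in> W then p else Suc 0)"

lemma frob_exponents_insert: "(frob_exponents W)(i := p) = frob_exponents (insert i W)"
  by auto

text \<open>One variable after another is replaced by its \<open>p\<close>-th power. Stability under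
  derivations passes the vanishing on \<open>A\<close> to each component, and the ultrametric
  inequality reassembles the bound at \<open>x\<close> without loss.\<close>

lemma bound_from_frobenius_components:
  fixes x :: "'i \<Rightarrow> 'k"
  assumes A: "derivation_stable V r A" and r: "radius r" and fin: "finite V" and x: "x \<in> polydisc V r"
    and "finite W" "W \<subseteq> V"
    and "\<And>g. g \<in> tate (frob_exponents W) V r \<Longrightarrow> (\<And>a. a \<in> A \<Longrightarrow> g a = 0) \<Longrightarrow>
           (\<And>y. y \<in> polydisc V r \<Longrightarrow> vabs (g y) \<le> 1) \<Longrightarrow> vabs (g x) \<le> B"
    and "f \<in> convergent_on V r" "\<And>a. a \<in> A \<Longrightarrow> f a = 0" "\<And>y. y \<in> polydisc V r \<Longrightarrow> vabs (f y) \<le> 1"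
  shows "vabs (f x) \<le> B"
  using assms(5-7)
proof (induction W rule: finite_induct)
  case empty
  then show ?case
    using assms(8-10) by simp
next
  case (insert i W)
  have r0: "r > 0"
    using r by (rule radius_pos)
  obtain d :: 'k where d: "d \<noteq> 0" "vabs d = r"
    using r by (auto simp: radius_def)
  have i: "i \<in> V" "W \<subseteq> V"
    using insert.prems by auto
  show ?case
  proof (rule insert.IH[OF i(2)])
    fix g assume g: "g \<in> tate (frob_exponents W) V r" "\<And>a. a \<in> A \<Longrightarrow> g a = 0"
      "\<And>y. y \<in> polydisc V r \<Longrightarrow> vabs (g y) \<le> 1"
    have ei: "frob_exponents W i = Suc 0"
      using insert.hyps by simp
    obtain F where F: "\<And>k. k < p \<Longrightarrow> F k \<in> tate (frob_exponents (insert i W)) V r"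
      "\<And>x. x \<in> polydisc V r \<Longrightarrow> g x = (\<Sum>k<p. x i ^ k * F k x)"
      "\<And>k x. k < p \<Longrightarrow> x \<in> polydisc V r \<Longrightarrow> vabs (F k x) * r ^ k \<le> 1"
      using tate_decomposition[OF g(1) i(1) ei r g(3)] unfolding frob_exponents_insert by blast
    obtain m where m: "p = Suc m"
      using p_pos gr0_implies_Suc by blast
    have conv: "F k \<in> convergent_on V r" if "k < p" for k
      using tate_restrict[OF F(1)[OF that]] by simp
    have Ak: "A \<subseteq> polydisc V r"
      using A by (simp add: derivation_stable_def)
    have F0: "F k a = 0" if "k < p" "a \<in> A" for k a
    proof (rule components_vanish[where F = F and m = m and k = k, OF A r0 i(1)])
      show "m < p"
        using m by simp
      show "F k \<in> convergent_on V r" "partial V r i (F k) (\<lambda>_. 0)" if "k \<le> m" for k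
        using that m conv partial_0_if_exponent[OF F(1) fin r i(1)] by auto
      show "(\<Sum>k\<le>m. a i ^ k * F k a) = 0" if "a \<in> A" for a
        using F(2)[of a] g(2)[OF that] that Ak m by (auto simp: lessThan_Suc_atMost)
    qed (use that m in auto)
    \<comment> \<open>The factor \<open>d ^ k\<close> restores sup norm at most 1, which the
      hypothesis requires, since only \<open>|F k| r ^ k \<le> 1\<close> is known.\<close>
    have bound: "vabs (d ^ k * F k x) \<le> B" if k: "k < p" for k
    proof (rule insert.prems(2))
      show "(\<lambda>y. d ^ k * F k y) \<in> tate (frob_exponents (insert i W)) V r"
        using r0 F(1)[OF k] by (intro tate_mult[OF tate_const]) auto
      show "d ^ k * F k a = 0" if "a \<in> A" for a
        using F0 k that by simp
      show "vabs (d ^ k * F k y) \<le> 1" if "y \<in> polydisc V r" for y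
        using F(3)[OF k that] d by (simp add: vabs_mult vabs_power mult.commute)
    qed
    have "B \<ge> 0"
      using bound[of 0] p_pos vabs_ge_0 order_trans by blast
    have "vabs (\<Sum>k<p. x i ^ k * F k x) \<le> B"
    proof (rule vabs_sum_le[OF _ \<open>B \<ge> 0\<close>])
      fix k assume "k \<in> {..<p}"
      then have "r ^ k * vabs (F k x) \<le> B"
        using bound[of k] d by (simp add: vabs_mult vabs_power)
      moreover have "vabs (x i) ^ k * vabs (F k x) \<le> r ^ k * vabs (F k x)"
        using polydiscD[OF x i(1)] by (intro mult_right_mono power_mono) auto
      ultimately show "vabs (x i ^ k * F k x) \<le> B"
        by (simp add: vabs_mult vabs_power)
    qed
    then show "vabs (g x) \<le> B"
      using F(2)[OF x] by simp
  qed
qed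

text \<open>
  Schwarz's lemma gives the bound \<open>s / r\<close>; passing to the Frobenius components of \<open>f\<close>, whose
  \<open>p\<close>-th roots vanish on \<open>A\<close> as well, improves a bound \<open>B\<close> to \<open>B ^ p\<close>.
\<close>

theorem vanishing_principle:
  fixes f :: "('i \<Rightarrow> 'k) \<Rightarrow> 'k"
  assumes A: "derivation_stable V r A" "(\<lambda>_. 0) \<in> A" and r: "radius r" and fin: "finite V"
    and f: "f \<in> convergent_on V r" "\<And>a. a \<in> A \<Longrightarrow> f a = 0"
    and s: "0 \<le> s" "s < r" and x: "x \<in> polydisc V s"
  shows "f x = 0"
proof -
  have r0: "r > 0"
    using r by (rule radius_pos)
  have xr: "x \<in> polydisc V r"
    using polydisc_mono[OF x] s by auto
  have bound: "vabs (g x) \<le> (s / r) ^ (p ^ n)"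
    if "g \<in> convergent_on V r" "\<And>a. a \<in> A \<Longrightarrow> g a = 0" "\<And>y. y \<in> polydisc V r \<Longrightarrow> vabs (g y) \<le> 1" for g n
    using that
  proof (induction n arbitrary: g)
    case 0
    have "vabs (g (\<lambda>i. 0 + x i) - g (\<lambda>_. 0)) \<le> 1 * (s / r)"
      by (rule tate_lipschitz[OF 0(1) fin r 0(3)]) (use r0 s x in auto)
    then show ?case
      using 0(2)[OF A(2)] by simp
  next
    case (Suc n)
    show ?case
    proof (rule bound_from_frobenius_components[OF A(1) r fin xr fin subset_refl _ Suc.prems])
      fix h assume h: "h \<in> tate (frob_exponents V) V r" "\<And>a. a \<in> A \<Longrightarrow> h a = 0"
        "\<And>y. y \<in> polydisc V r \<Longrightarrow> vabs (h y) \<le> 1"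
      have e: "frob_exponents V i = p" if "i \<in> V" for i
        using that by simp
      obtain u where u: "u \<in> convergent_on V r" "\<And>x. x \<in> polydisc V r \<Longrightarrow> h x = u x ^ p"
        using tate_pth_root[OF h(1) e] by blast
      have "vabs (u x) \<le> (s / r) ^ (p ^ n)"
      proof (rule Suc.IH[OF u(1)])
        show "u a = 0" if "a \<in> A" for a
          using h(2)[OF that] u(2)[of a] that A(1) by (auto simp: derivation_stable_def)
        show "vabs (u y) \<le> 1" if "y \<in> polydisc V r" for y
        proof (rule vabs_le_if_power_le)
          show "vabs (u y ^ p) \<le> 1 ^ p"
            using h(3)[OF that] unfolding u(2)[OF that] by simp
        qed simp_all
      qed
      then have "vabs (u x) ^ p \<le> ((s / r) ^ (p ^ n)) ^ p"
        by (intro power_mono) auto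
      then show "vabs (h x) \<le> (s / r) ^ (p ^ Suc n)"
        using u(2)[OF xr] by (simp add: vabs_power mult.commute flip: power_mult)
    qed
  qed
  obtain M where M: "M > 0" "\<And>x. x \<in> polydisc V r \<Longrightarrow> vabs (f x) \<le> M"
    by (rule tate_bounded[OF f(1) less_imp_le[OF r0]]) (rule that)
  \<comment> \<open>The improvement of the bound needs sup norm at most 1, which scaling by
    \<open>c\<close> achieves.\<close>
  obtain c :: 'k where c: "c \<noteq> 0" "vabs c < 1 / M"
    using ex_small[of "1 / M"] M(1) by auto
  have "vabs (c * f x) \<le> (s / r) ^ (p ^ n)" for n
  proof (rule bound)
    show "(\<lambda>x. c * f x) \<in> convergent_on V r"
      using f(1) r0 by (intro tate_mult[OF tate_const]) auto
    show "vabs (c * f y) \<le> 1" if "y \<in> polydisc V r" for y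
    proof -
      have "vabs c * vabs (f y) \<le> 1 / M * M"
        using c M(1) M(2)[OF that] by (intro mult_mono) auto
      then show ?thesis
        using M(1) by (simp add: vabs_mult)
    qed
  qed (use f(2) in auto)
  have "c * f x = 0"
  proof (rule eq_if_vabs_small)
    fix \<epsilon> :: real assume "\<epsilon> > 0"
    then obtain n where n: "(s / r) ^ n < \<epsilon>"
      using real_arch_pow_inv[of \<epsilon> "s / r"] s by auto
    have "n \<le> p ^ n"
      using p_gt_1 by (simp add: less_imp_le)
    then have "(s / r) ^ (p ^ n) \<le> (s / r) ^ n"
      using s by (intro power_decreasing) auto
    then show "vabs (c * f x - 0) \<le> \<epsilon>"
      using \<open>\<And>n. vabs (c * f x) \<le> (s / r) ^ (p ^ n)\<close>[of n] n by simp
  qed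
  then show ?thesis
    using c by simp
qed

section \<open>Consequences: identity theorem, integrality, and p-th roots of functions with zero
  gradient\<close>

lemma derivation_stable_polydisc:
  assumes "radius r" "0 < s" "s \<le> r"
  shows "derivation_stable (V :: 'i set) r (polydisc V s)"
  unfolding derivation_stable_def
proof (intro conjI ballI impI)
  fix f g :: "('i \<Rightarrow> 'k) \<Rightarrow> 'k" and i and a :: "'i \<Rightarrow> 'k" assume f: "f \<in> convergent_on V r" and i: "i \<in> V" and g: "g \<in> convergent_on V r"
    and z: "(\<forall>a\<in>polydisc V s. f a = 0) \<and> partial V r i f g" and a: "a \<in> polydisc V s"
  obtain C where C: "C \<ge> 0" "\<And>x c. x \<in> polydisc V r \<Longrightarrow> vabs c \<le> r \<Longrightarrow>
     vabs (f (x(i := x i + c)) - f x - c * g x) \<le> C * vabs c ^ 2"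
    using partialE[of V r i f g] z by blast
  have ar: "a \<in> polydisc V r"
    using polydisc_mono[OF a] assms by auto
  show "g a = 0"
  proof (rule eq_0_if_small_bound[OF assms(2)])
    fix c :: 'k assume c: "vabs c \<le> s"
    have "f (a(i := a i + c)) = 0" "f a = 0"
      using z polydisc_upd[OF a c] a by auto
    then show "vabs (c * g a) \<le> C * vabs c ^ 2"
      using C(2)[OF ar, of c] c assms by simp
  qed
qed (use polydisc_mono[OF _ subset_refl assms(3)] in blast)

text \<open>The vanishing principle for a small polydisc in place of \<open>A\<close>. Its
  conclusion holds strictly inside the polydisc of convergence, hence \<open>t < r\<close>.\<close>

lemma tate_identity:
  fixes f :: "('i \<Rightarrow> 'k) \<Rightarrow> 'k"
  assumes "f \<in> convergent_on V r" "radius r" "finite V" "0 < s" "\<And>x. x \<in> polydisc V s \<Longrightarrow> f x = 0"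
    and "0 \<le> t" "t < r" "x \<in> polydisc V t"
  shows "f x = 0"
proof (rule vanishing_principle[OF _ _ assms(2,3,1) _ assms(6-8)])
  show "derivation_stable V r (polydisc V (min r s))"
    using assms radius_pos by (intro derivation_stable_polydisc) auto
  show "(\<lambda>_. 0) \<in> polydisc V (min r s)"
    using assms radius_pos[OF assms(2)] by simp
  show "f a = 0" if "a \<in> polydisc V (min r s)" for a
    using polydisc_mono[OF that, of V s] assms(5) by simp
qed

text \<open>Where \<open>f\<close> is nonzero it stays nonzero on a small polydisc, so
  \<open>g\<close> vanishes there, and the identity theorem for a translate of \<open>g\<close>
  spreads this to \<open>b\<close>.\<close>

lemma tate_no_zero_divisors:
  fixes f g :: "('i \<Rightarrow> 'k) \<Rightarrow> 'k"
  assumes f: "f \<in> convergent_on V r" and g: "g \<in> convergent_on V r" and r: "radius r" and fin: "finite V"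
    and fg: "\<And>x. x \<in> polydisc V r \<Longrightarrow> f x * g x = 0"
    and s: "0 \<le> s" "s < r"
  shows "(\<forall>x\<in>polydisc V s. f x = 0) \<or> (\<forall>x\<in>polydisc V s. g x = 0)"
proof (rule ccontr)
  assume "\<not> ?thesis"
  then obtain a b where a: "a \<in> polydisc V s" "f a \<noteq> 0" and b: "b \<in> polydisc V s" "g b \<noteq> 0"
    by blast
  have r0: "r > 0"
    using r by (rule radius_pos)
  have ar: "a \<in> polydisc V r"
    using polydisc_mono[OF a(1)] s by auto
  obtain M where M: "M > 0" "\<And>x. x \<in> polydisc V r \<Longrightarrow> vabs (f x) \<le> M"
    by (rule tate_bounded[OF f less_imp_le[OF r0]]) (rule that)
  \<comment> \<open>The factor 2 makes the Lipschitz bound \<open>M * (e / r)\<close> strictly less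
    than \<open>|f a|\<close>, so that \<open>f\<close> has no zero at distance up to
    \<open>e\<close> from \<open>a\<close>.\<close>
  define e where "e = min r (r * vabs (f a) / (2 * M))"
  have e: "0 < e" "e \<le> r" "M * (e / r) < vabs (f a)"
  proof -
    show "0 < e" "e \<le> r"
      using r0 M(1) a(2) by (simp_all add: e_def)
    have "M * (e / r) \<le> M * (r * vabs (f a) / (2 * M) / r)"
      using M(1) r0 by (intro mult_left_mono divide_right_mono) (auto simp: e_def)
    also have "\<dots> < vabs (f a)"
      using M(1) r0 a(2) by simp
    finally show "M * (e / r) < vabs (f a)" .
  qed
  define h where "h = (\<lambda>x. g (\<lambda>i. a i + x i))"
  have "h \<in> convergent_on V r"
    unfolding h_def
    by (rule tate_compose[OF g]) (use r0 polydisc_add[OF ar] in \<open>auto intro!: tate_add tate_const tate_var\<close>)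
  moreover have "h x = 0" if "x \<in> polydisc V e" for x
  proof -
    have "vabs (f (\<lambda>i. a i + x i) - f a) \<le> M * (e / r)"
      by (rule tate_lipschitz[OF f fin r M(2) ar _ _ that]) (use e in auto)
    then have "f (\<lambda>i. a i + x i) \<noteq> 0"
      using e(3) by auto
    moreover have "(\<lambda>i. a i + x i) \<in> polydisc V r"
      using polydisc_add[OF ar that e(2)] .
    ultimately show ?thesis
      using fg unfolding h_def by fastforce
  qed
  ultimately have "h (\<lambda>i. b i - a i) = 0"
    by (rule tate_identity[OF _ r fin e(1) _ s]) (use a b in \<open>auto simp: polydisc_def intro: vabs_diff_le\<close>)
  then show False
    using b(2) by (simp add: h_def)
qed

text \<open>A zero derivative in direction \<open>i\<close> kills all components but the one of
  residue class 0, so \<open>f\<close> is a function of \<open>x i ^ p\<close>. Once this holds for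
  every variable, the root exists. This is what a maximal Frobenius exponent is confronted with
  later.\<close>

lemma tate_pth_root_of_partials_0:
  fixes f :: "('i \<Rightarrow> 'k) \<Rightarrow> 'k"
  assumes f: "f \<in> convergent_on V r" and r: "radius r" and fin: "finite V"
    and d: "\<And>i. i \<in> V \<Longrightarrow> partial V r i f (\<lambda>_. 0)"
  obtains h where "h \<in> convergent_on V r" "\<And>x. x \<in> polydisc V r \<Longrightarrow> f x = h x ^ p"
proof -
  have r0: "r > 0"
    using r by (rule radius_pos)
  have "f \<in> tate (frob_exponents W) V r" if "finite W" "W \<subseteq> V" for W
    using that
  proof (induction W rule: finite_induct)
    case empty
    then show ?case
      using f by simp
  next
    case (insert i W)
    then have i: "i \<in> V" and fW: "f \<in> tate (frob_exponents W) V r"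
      by auto
    obtain M where M: "M > 0" "\<And>x. x \<in> polydisc V r \<Longrightarrow> vabs (f x) \<le> M"
      by (rule tate_bounded[OF f less_imp_le[OF r0]]) (rule that)
    have ei: "frob_exponents W i = Suc 0"
      using insert.hyps by simp
    obtain F where F: "\<And>k. k < p \<Longrightarrow> F k \<in> tate (frob_exponents (insert i W)) V r"
      "\<And>x. x \<in> polydisc V r \<Longrightarrow> f x = (\<Sum>k<p. x i ^ k * F k x)"
      "\<And>k x. k < p \<Longrightarrow> x \<in> polydisc V r \<Longrightarrow> vabs (F k x) * r ^ k \<le> M"
      using tate_decomposition[OF fW i ei r M(2)] unfolding frob_exponents_insert by blast
    obtain m where m: "p = Suc m"
      using p_pos gr0_implies_Suc by blast
    have conv: "F k \<in> convergent_on V r" if "k < p" for k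
      using tate_restrict[OF F(1)[OF that]] by simp
    have pF: "partial V r i (F k) (\<lambda>_. 0)" if "k < p" for k
      using partial_0_if_exponent[OF F(1)[OF that] fin r i] by simp
    have T: "(\<lambda>x. x i ^ n) \<in> convergent_on V r" for n
      using r0 i by (intro tate_power tate_var) auto
    have "partial V r i (\<lambda>x. \<Sum>k<p. x i ^ k * F k x) (\<lambda>x. \<Sum>k<p. of_nat k * x i ^ (k - 1) * F k x + x i ^ k * 0)"
      by (intro partial_sum partial_mult[OF partial_var_power[OF r0 i]])
        (use pF conv r0 in \<open>auto intro!: T tate_mult[OF tate_const T] tate_const\<close>)
    from partial_cong[OF this, of f "\<lambda>x. \<Sum>k<p. of_nat k * x i ^ (k - 1) * F k x + x i ^ k * 0"]
    have pf: "partial V r i f (\<lambda>x. \<Sum>k<p. of_nat k * x i ^ (k - 1) * F k x + x i ^ k * 0)"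
      using F(2) by simp
    have sum0: "(\<Sum>k<m. x i ^ k * (of_nat (Suc k) * F (Suc k) x)) = 0" if x: "x \<in> polydisc V r" for x
    proof -
      have "(\<Sum>k<p. of_nat k * x i ^ (k - 1) * F k x + x i ^ k * 0) = 0"
        using partial_unique[OF pf d[OF i] x r0] .
      then show ?thesis
        unfolding m sum.lessThan_Suc_shift by (simp add: mult_ac)
    qed
    have F0: "F (Suc k) x = 0" if k: "k < m" and x: "x \<in> polydisc V r" for k x
    proof -
      obtain l where l: "m = Suc l"
        using k gr0_implies_Suc[of m] by auto
      \<comment> \<open>Here \<open>components_vanish\<close> is applied with the whole polydisc as
        \<open>A\<close>, to the components of the derivative of \<open>f\<close>, whose number is
        \<open>p - 1\<close>.\<close>
      have "of_nat (Suc k) * F (Suc k) x = 0"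
      proof (rule components_vanish[where F = "\<lambda>k x. of_nat (Suc k) * F (Suc k) x" and A = "polydisc V r" and m = l])
        show "derivation_stable V r (polydisc V r)"
          using derivation_stable_polydisc[OF r r0] by simp
        fix j assume "j \<le> l"
        then have j: "Suc j < p"
          using l m by simp
        show "(\<lambda>x. of_nat (Suc j) * F (Suc j) x) \<in> convergent_on V r"
          using conv[OF j] r0 by (intro tate_mult[OF tate_const]) auto
        have "partial V r i (\<lambda>x. of_nat (Suc j) * F (Suc j) x) (\<lambda>x. 0 * F (Suc j) x + of_nat (Suc j) * 0)"
          by (rule partial_mult[OF partial_const pF[OF j] r0 tate_const conv[OF j] tate_const tate_const])
        then show "partial V r i (\<lambda>x. of_nat (Suc j) * F (Suc j) x) (\<lambda>_. 0)"
          by simp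
      next
        fix y :: "'i \<Rightarrow> 'k" assume "y \<in> polydisc V r"
        then show "(\<Sum>k\<le>l. y i ^ k * (of_nat (Suc k) * F (Suc k) y)) = 0"
          using sum0 l by (simp add: lessThan_Suc_atMost)
      qed (use r0 i x k l m in auto)
      moreover have "of_nat (Suc k) \<noteq> (0 :: 'k)"
        unfolding of_nat_eq_0 using k m by (auto dest: dvd_imp_le)
      ultimately show ?thesis
        by simp
    qed
    have "F 0 x = f x" if x: "x \<in> polydisc V r" for x
    proof -
      have "f x = F 0 x + (\<Sum>k<m. x i ^ Suc k * F (Suc k) x)"
        using F(2)[OF x] unfolding m sum.lessThan_Suc_shift by simp
      also have "(\<Sum>k<m. x i ^ Suc k * F (Suc k) x) = 0"
        using F0 x by (intro sum.neutral) simp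
      finally show ?thesis
        by simp
    qed
    with F(1)[OF p_pos] show ?case
      by (rule tate_cong)
  qed
  from this[OF fin subset_refl] show ?thesis
    by (rule tate_pth_root) (simp, rule that)
qed

text \<open>Schwarz's lemma for the root \<open>g\<close> gives \<open>s / r\<close>, and its
  \<open>p ^ m\<close>-th power is at most \<open>(s / r) ^ m\<close>. Consequently a nonzero
  function that vanishes at the origin cannot have convergent \<open>p ^ m\<close>-th roots for all
  \<open>m\<close>.\<close>

lemma tate_pow_root_decay:
  fixes f :: "('i \<Rightarrow> 'k) \<Rightarrow> 'k"
  assumes g: "g \<in> convergent_on V r" "\<And>x. x \<in> polydisc V r \<Longrightarrow> f x = g x ^ (p ^ m)"
    and r: "radius r" and fin: "finite V" and f0: "f (\<lambda>_. 0) = 0"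
    and f1: "\<And>x. x \<in> polydisc V r \<Longrightarrow> vabs (f x) \<le> 1"
    and s: "0 \<le> s" "s \<le> r" and x: "x \<in> polydisc V s"
  shows "vabs (f x) \<le> (s / r) ^ m"
proof -
  have r0: "r > 0"
    using r by (rule radius_pos)
  have xr: "x \<in> polydisc V r"
    using polydisc_mono[OF x] s by auto
  have pm: "p ^ m > 0"
    by simp
  have g0: "g (\<lambda>_. 0) = 0"
    using g(2)[of "\<lambda>_. 0"] f0 r0 by simp
  have g1: "vabs (g y) \<le> 1" if "y \<in> polydisc V r" for y
  proof (rule vabs_le_if_power_le)
    show "vabs (g y ^ (p ^ m)) \<le> 1 ^ (p ^ m)"
      using f1[OF that] unfolding g(2)[OF that] by simp
  qed simp_all
  have "vabs (g (\<lambda>i. 0 + x i) - g (\<lambda>_. 0)) \<le> 1 * (s / r)"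
    by (rule tate_lipschitz[OF g(1) fin r g1]) (use r0 s x in auto)
  then have "vabs (g x) ^ (p ^ m) \<le> (s / r) ^ (p ^ m)"
    using g0 by (intro power_mono) auto
  also have "\<dots> \<le> (s / r) ^ m"
    using s r0 p_gt_1 by (intro power_decreasing) (auto simp: less_imp_le)
  finally show ?thesis
    using g(2)[OF xr] by (simp add: vabs_power)
qed

section \<open>Smoothness of local groups\<close>

text \<open>The differential at the origin alone, whereas \<open>partial\<close> is uniform in the
  base point. Values of \<open>l\<close> outside \<open>V\<close> are arbitrary.\<close>

definition linear_part :: "'i set \<Rightarrow> real \<Rightarrow> (('i \<Rightarrow> 'k) \<Rightarrow> 'k) \<Rightarrow> ('i \<Rightarrow> 'k) \<Rightarrow> bool" where
  "linear_part V r f l \<longleftrightarrow> (\<exists>C. \<forall>s h. 0 \<le> s \<longrightarrow> s \<le> r \<longrightarrow> h \<in> polydisc V s \<longrightarrow>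
     vabs (f h - f (\<lambda>_. 0) - (\<Sum>i\<in>V. l i * h i)) \<le> C * s\<^sup>2)"

definition vanishing_ideal :: "'i set \<Rightarrow> ('i \<Rightarrow> 'k) set \<Rightarrow> real \<Rightarrow> (('i \<Rightarrow> 'k) \<Rightarrow> 'k) set" where
  "vanishing_ideal V S r = {f \<in> convergent_on V r. \<forall>x\<in>S \<inter> polydisc V r. f x = 0}"

text \<open>The annihilator of the tangent space of the germ of \<open>S\<close> at the origin. The
  radius may vary with the function, so that two functions can be added after restriction to a
  common polydisc.\<close>

definition conormal :: "'i set \<Rightarrow> ('i \<Rightarrow> 'k) set \<Rightarrow> real \<Rightarrow> ('i \<Rightarrow> 'k) set" where
  "conormal V S r0 = {l. \<exists>r f. radius r \<and> r \<le> r0 \<and> f \<in> vanishing_ideal V S r \<and> linear_part V r f l}"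

text \<open>
  The right translations are affine in the coordinates, with linear part close to the identity.
\<close>

definition local_group ::
  "'i set \<Rightarrow> real \<Rightarrow> ('i \<Rightarrow> 'k) set \<Rightarrow> (('i \<Rightarrow> 'k) \<Rightarrow> 'i \<Rightarrow> 'i \<Rightarrow> 'k) \<Rightarrow> bool" where
  "local_group V r0 S B \<longleftrightarrow> (\<lambda>_. 0) \<in> S \<and>
     (\<forall>s\<le>r0. \<forall>a\<in>S \<inter> polydisc V s. (\<forall>i\<in>V. \<forall>j\<in>V. vabs (B a i j) \<le> s) \<and>
        (\<forall>x\<in>S \<inter> polydisc V s. (\<lambda>i. a i + x i + (\<Sum>j\<in>V. B a i j * x j)) \<in> S))"

lemma conormalI:
  "radius r \<Longrightarrow> r \<le> r0 \<Longrightarrow> f \<in> vanishing_ideal V S r \<Longrightarrow> linear_part V r f l \<Longrightarrow> l \<in> conormal V S r0"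
  unfolding conormal_def by blast

lemma linear_part_restrict: "linear_part V r f l \<Longrightarrow> s \<le> r \<Longrightarrow> linear_part V s f l"
  unfolding linear_part_def by (meson order_trans)

lemma vanishing_ideal_restrict: "f \<in> vanishing_ideal V S r \<Longrightarrow> s \<le> r \<Longrightarrow> f \<in> vanishing_ideal V S s"
  unfolding vanishing_ideal_def using tate_mono[of f _ V r V s] polydisc_mono[of _ V s V r] by blast

lemma linear_part_add:
  assumes "linear_part V r f l" "linear_part V r g m"
  shows "linear_part V r (\<lambda>x. f x + c * g x) (\<lambda>i. l i + c * m i)"
proof -
  obtain C where C: "\<And>s h. 0 \<le> s \<Longrightarrow> s \<le> r \<Longrightarrow> h \<in> polydisc V s \<Longrightarrow>
     vabs (f h - f (\<lambda>_. 0) - (\<Sum>i\<in>V. l i * h i)) \<le> C * s\<^sup>2"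
    using assms(1) unfolding linear_part_def by blast
  obtain D where D: "\<And>s h. 0 \<le> s \<Longrightarrow> s \<le> r \<Longrightarrow> h \<in> polydisc V s \<Longrightarrow>
     vabs (g h - g (\<lambda>_. 0) - (\<Sum>i\<in>V. m i * h i)) \<le> D * s\<^sup>2"
    using assms(2) unfolding linear_part_def by blast
  define E where "E = max C (vabs c * D)"
  have "vabs (f h + c * g h - (f (\<lambda>_. 0) + c * g (\<lambda>_. 0)) - (\<Sum>i\<in>V. (l i + c * m i) * h i)) \<le> E * s\<^sup>2"
    if s: "0 \<le> s" "s \<le> r" and h: "h \<in> polydisc V s" for s h
  proof -
    have "vabs (f h - f (\<lambda>_. 0) - (\<Sum>i\<in>V. l i * h i)) \<le> E * s\<^sup>2"
      by (rule order_trans[OF C[OF s h]]) (auto simp: E_def intro: mult_right_mono)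
    moreover have "vabs (c * (g h - g (\<lambda>_. 0) - (\<Sum>i\<in>V. m i * h i))) \<le> E * s\<^sup>2"
    proof -
      have "vabs (c * (g h - g (\<lambda>_. 0) - (\<Sum>i\<in>V. m i * h i))) \<le> vabs c * (D * s\<^sup>2)"
        unfolding vabs_mult by (intro mult_left_mono D s h) simp
      also have "\<dots> \<le> E * s\<^sup>2"
        unfolding mult.assoc[symmetric] by (intro mult_right_mono) (auto simp: E_def)
      finally show ?thesis .
    qed
    ultimately have "vabs ((f h - f (\<lambda>_. 0) - (\<Sum>i\<in>V. l i * h i)) + c * (g h - g (\<lambda>_. 0) - (\<Sum>i\<in>V. m i * h i))) \<le> E * s\<^sup>2"
      by (rule vabs_add_le)
    moreover have "(\<Sum>i\<in>V. (l i + c * m i) * h i) = (\<Sum>i\<in>V. l i * h i) + c * (\<Sum>i\<in>V. m i * h i)"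
      by (simp add: distrib_right sum.distrib sum_distrib_left mult.assoc)
    ultimately show ?thesis
      by (simp add: algebra_simps)
  qed
  then show ?thesis
    unfolding linear_part_def by blast
qed

lemma conormal_add:
  assumes "l \<in> conormal V S r0" "m \<in> conormal V S r0"
  shows "(\<lambda>i. l i + c * m i) \<in> conormal V S r0"
proof -
  obtain r f where f: "radius r" "r \<le> r0" "f \<in> vanishing_ideal V S r" "linear_part V r f l"
    using assms(1) unfolding conormal_def by blast
  obtain s g where g: "radius s" "s \<le> r0" "g \<in> vanishing_ideal V S s" "linear_part V s g m"
    using assms(2) unfolding conormal_def by blast
  define t where "t = min r s"
  have t: "radius t" "t \<le> r" "t \<le> s"
    using f(1) g(1) by (auto simp: t_def radius_min)
  have "f \<in> vanishing_ideal V S t" "g \<in> vanishing_ideal V S t"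
    using vanishing_ideal_restrict f(3) g(3) t by blast+
  then have "(\<lambda>x. f x + c * g x) \<in> vanishing_ideal V S t"
    using radius_pos[OF t(1)] by (auto simp: vanishing_ideal_def intro!: tate_add tate_mult[OF tate_const])
  moreover have "linear_part V t (\<lambda>x. f x + c * g x) (\<lambda>i. l i + c * m i)"
    by (rule linear_part_add[OF linear_part_restrict[OF f(4) t(2)] linear_part_restrict[OF g(4) t(3)]])
  ultimately show ?thesis
    by (rule conormalI[OF t(1) order_trans[OF t(2) f(2)]])
qed

lemma conormal_0: "radius r0 \<Longrightarrow> (\<lambda>_. 0) \<in> conormal V S r0"
proof -
  assume "radius r0"
  moreover have "(\<lambda>_. 0) \<in> vanishing_ideal V S r0" "linear_part V r0 (\<lambda>_. 0) (\<lambda>_. 0)"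
    by (auto simp: vanishing_ideal_def linear_part_def intro!: exI[of _ 0])
  ultimately show ?thesis
    using conormalI by blast
qed

text \<open>A reduced echelon basis of \<open>L\<close>: a set \<open>Y\<close> of coordinates of
  maximal size that admits dual elements in \<open>L\<close>. An element of \<open>L\<close> that
  vanishes on \<open>Y\<close> but not on \<open>V\<close> would enlarge it.\<close>

lemma ex_pivots:
  fixes L :: "('i \<Rightarrow> 'k) set"
  assumes fin: "finite V" and add: "\<And>l m c. l \<in> L \<Longrightarrow> m \<in> L \<Longrightarrow> (\<lambda>i. l i + c * m i) \<in> L"
    and zero: "(\<lambda>_. 0) \<in> L"
  obtains Y l where "Y \<subseteq> V" "\<And>y. y \<in> Y \<Longrightarrow> l y \<in> L"
    "\<And>y z. y \<in> Y \<Longrightarrow> z \<in> Y \<Longrightarrow> l y z = (if y = z then 1 else 0)"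
    "\<And>m i. m \<in> L \<Longrightarrow> \<forall>y\<in>Y. m y = 0 \<Longrightarrow> i \<in> V \<Longrightarrow> m i = 0"
proof -
  define good where "good = (\<lambda>Y. Y \<subseteq> V \<and> (\<exists>l. \<forall>y\<in>Y. l y \<in> L \<and> (\<forall>z\<in>Y. l y z = (if y = z then 1 else 0))))"
  have "good {}"
    by (simp add: good_def)
  moreover have "\<forall>Y. good Y \<longrightarrow> card Y < Suc (card V)"
    using card_mono[OF fin] by (simp add: good_def le_imp_less_Suc)
  ultimately have "\<exists>Y. good Y \<and> (\<forall>Z. good Z \<longrightarrow> card Z \<le> card Y)"
    by (rule ex_has_greatest_nat)
  then obtain Y where Y: "good Y" "\<And>Z. good Z \<Longrightarrow> card Z \<le> card Y"
    by blast
  obtain l where l: "\<And>y. y \<in> Y \<Longrightarrow> l y \<in> L" "\<And>y z. y \<in> Y \<Longrightarrow> z \<in> Y \<Longrightarrow> l y z = (if y = z then 1 else 0)"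
    using Y(1) unfolding good_def by blast
  have YV: "Y \<subseteq> V"
    using Y(1) by (simp add: good_def)
  have "m t = 0" if m: "m \<in> L" "\<forall>y\<in>Y. m y = 0" "t \<in> V" for m t
  proof (rule ccontr)
    assume mt: "m t \<noteq> 0"
    then have tY: "t \<notin> Y"
      using m(2) by blast
    \<comment> \<open>One elimination step: \<open>m\<close> is normalised at the new pivot
      \<open>t\<close> and subtracted from the old basis elements so that they vanish there. Their
      values on \<open>Y\<close> do not change, because \<open>m\<close> vanishes on
      \<open>Y\<close>.\<close>
    define l' where "l' = (\<lambda>y i. if y = t then 0 + (1 / m t) * m i else l y i + (- l y t / m t) * m i)"
    have "l' y \<in> L" if "y \<in> insert t Y" for y
    proof (cases "y = t")
      case True
      then show ?thesis
        using add[OF zero m(1), of "1 / m t"] by (simp add: l'_def)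
    next
      case False
      then show ?thesis
        using add[OF l(1) m(1), of y "- l y t / m t"] that by (simp add: l'_def)
    qed
    moreover have "l' y z = (if y = z then 1 else 0)" if "y \<in> insert t Y" "z \<in> insert t Y" for y z
      using that mt tY l(2) m(2) by (auto simp: l'_def)
    ultimately have "good (insert t Y)"
      unfolding good_def using YV m(3) by blast
    from Y(2)[OF this] show False
      using tY finite_subset[OF YV fin] by simp
  qed
  with YV l show ?thesis
    by (rule that)
qed

text \<open>An element of \<open>L\<close> equals the combination of the \<open>l y\<close> with its
  own pivot values as coefficients, because the difference lies in \<open>L\<close> and vanishes at
  all pivots.\<close>

lemma pivot_bound:
  fixes L :: "('i \<Rightarrow> 'k) set"
  assumes fin: "finite V" and add: "\<And>l m c. l \<in> L \<Longrightarrow> m \<in> L \<Longrightarrow> (\<lambda>i. l i + c * m i) \<in> L"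
    and zero: "(\<lambda>_. 0) \<in> L"
    and Y: "Y \<subseteq> V" "\<And>y. y \<in> Y \<Longrightarrow> l y \<in> L"
    "\<And>y z. y \<in> Y \<Longrightarrow> z \<in> Y \<Longrightarrow> l y z = (if y = z then 1 else 0)"
    "\<And>m i. m \<in> L \<Longrightarrow> (\<And>y. y \<in> Y \<Longrightarrow> m y = 0) \<Longrightarrow> i \<in> V \<Longrightarrow> m i = 0"
    and C: "\<And>y i. y \<in> Y \<Longrightarrow> i \<in> V \<Longrightarrow> vabs (l y i) \<le> C" "C \<ge> 0"
    and m: "m \<in> L" "\<And>y. y \<in> Y \<Longrightarrow> vabs (m y) \<le> b" "b \<ge> 0" and i: "i \<in> V"
  shows "vabs (m i) \<le> C * b"
proof -
  have finY: "finite Y"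
    using finite_subset[OF Y(1) fin] .
  have "(\<lambda>i. m i + (\<Sum>y\<in>Z. - m y * l y i)) \<in> L" if "finite Z" "Z \<subseteq> Y" for Z
    using that
  proof (induction Z rule: finite_induct)
    case (insert y Z)
    then show ?case
      using add[of "\<lambda>i. m i + (\<Sum>y\<in>Z. - m y * l y i)" "l y" "- m y"] Y(2) by (simp add: algebra_simps)
  qed (use m(1) in simp)
  from Y(4)[OF this[OF finY subset_refl] _ i]
  have "m i + (\<Sum>y\<in>Y. - m y * l y i) = 0"
  proof -
    have "m z + (\<Sum>y\<in>Y. - m y * l y z) = 0" if "z \<in> Y" for z
    proof -
      have "(\<Sum>y\<in>Y. - m y * l y z) = (\<Sum>y\<in>Y. if y = z then - m y else 0)"
        using that by (intro sum.cong refl) (simp add: Y(3))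
      then show ?thesis
        using that finY by simp
    qed
    then show ?thesis
      using \<open>(\<And>y. y \<in> Y \<Longrightarrow> m y + (\<Sum>y'\<in>Y. - m y' * l y' y) = 0) \<Longrightarrow> m i + (\<Sum>y\<in>Y. - m y * l y i) = 0\<close> by blast
  qed
  then have "m i = (\<Sum>y\<in>Y. m y * l y i)"
    by (simp add: sum_negf)
  also have "vabs \<dots> \<le> C * b"
  proof (rule vabs_sum_le)
    fix y assume "y \<in> Y"
    then show "vabs (m y * l y i) \<le> C * b"
      using mult_mono[OF m(2) C(1), of y y i] i C(2) m(3) by (simp add: vabs_mult mult.commute)
  qed (use C(2) m(3) in simp)
  finally show ?thesis .
qed

text \<open>
  The vanishing principle applies to functions of the free coordinates: the translate by \<open>a\<close> of such
  a function that vanishes on \<open>S\<close> has its linear part in the conormal space, and that linear part is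
  too close to the differential at \<open>a\<close>, which does not involve the pivots.
\<close>

lemma local_group_derivation_stable:
  fixes S :: "('i \<Rightarrow> 'k) set"
  assumes S: "local_group V r0 S B" and fin: "finite V" and r0: "radius r0"
    and Y: "Y \<subseteq> V" "\<And>y. y \<in> Y \<Longrightarrow> l y \<in> conormal V S r0"
    "\<And>y z. y \<in> Y \<Longrightarrow> z \<in> Y \<Longrightarrow> l y z = (if y = z then 1 else 0)"
    "\<And>m i. m \<in> conormal V S r0 \<Longrightarrow> (\<And>y. y \<in> Y \<Longrightarrow> m y = 0) \<Longrightarrow> i \<in> V \<Longrightarrow> m i = 0"
    and C: "\<And>y i. y \<in> Y \<Longrightarrow> i \<in> V \<Longrightarrow> vabs (l y i) \<le> C" "C \<ge> 1"
    and r: "radius r" "r \<le> r0" "C * r < 1"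
  shows "derivation_stable (V - Y) r (S \<inter> polydisc V r)"
  unfolding derivation_stable_def
proof (intro conjI ballI impI)
  show "S \<inter> polydisc V r \<subseteq> polydisc (V - Y) r"
    by (auto simp: polydisc_def)
  fix g g' :: "('i \<Rightarrow> 'k) \<Rightarrow> 'k" and i and a :: "'i \<Rightarrow> 'k"
  assume g: "g \<in> convergent_on (V - Y) r" and i: "i \<in> V - Y"
    and z: "(\<forall>a\<in>S \<inter> polydisc V r. g a = 0) \<and> partial (V - Y) r i g g'"
    and a: "a \<in> S \<inter> polydisc V r"
  have rpos: "r > 0"
    using r(1) by (rule radius_pos)
  have finVY: "finite (V - Y)"
    using fin by simp
  have r1: "r < 1"
    using r(3) mult_right_mono[OF C(2) less_imp_le[OF rpos]] by linarith
  have aD: "a \<in> polydisc V r" "a \<in> polydisc (V - Y) r"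
    using a by (auto simp: polydisc_def)
  have B: "\<And>i j. i \<in> V \<Longrightarrow> j \<in> V \<Longrightarrow> vabs (B a i j) \<le> r"
    and trans: "\<And>x. x \<in> S \<inter> polydisc V r \<Longrightarrow> (\<lambda>i. a i + x i + (\<Sum>j\<in>V. B a i j * x j)) \<in> S"
    using S a r(2) unfolding local_group_def by blast+
  \<comment> \<open>The linear part of the translation is the identity plus a matrix with entries
    smaller than 1, so it preserves polydiscs of every radius.\<close>
  have disp: "(\<lambda>i. h i + (\<Sum>j\<in>V. B a i j * h j)) \<in> polydisc V t" if h: "h \<in> polydisc V t" and t: "t \<ge> 0" for h t
  proof (rule polydiscI)
    fix i assume i: "i \<in> V"
    have "vabs (\<Sum>j\<in>V. B a i j * h j) \<le> t"
    proof (rule vabs_sum_le[OF _ t])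
      fix j assume j: "j \<in> V"
      have "vabs (B a i j) \<le> 1"
        using B[OF i j] r1 by linarith
      then have "vabs (B a i j) * vabs (h j) \<le> 1 * t"
        using polydiscD[OF h j] t by (intro mult_mono) auto
      then show "vabs (B a i j * h j) \<le> t"
        by (simp add: vabs_mult)
    qed
    then show "vabs (h i + (\<Sum>j\<in>V. B a i j * h j)) \<le> t"
      using polydiscD[OF h i] by (rule vabs_add_le[rotated])
  qed
  obtain M where M: "M > 0" "\<And>x. x \<in> polydisc (V - Y) r \<Longrightarrow> vabs (g x) \<le> M"
    by (rule tate_bounded[OF g less_imp_le[OF rpos]]) (rule that)
  obtain G where G': "\<And>i. i \<in> V - Y \<Longrightarrow> G i \<in> convergent_on (V - Y) r"
    "\<And>i x. i \<in> V - Y \<Longrightarrow> p dvd Suc 0 \<Longrightarrow> x \<in> polydisc (V - Y) r \<Longrightarrow> G i x = 0"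
    "\<And>i x. i \<in> V - Y \<Longrightarrow> x \<in> polydisc (V - Y) r \<Longrightarrow> vabs (G i x) * r \<le> M"
    "\<And>x s h. x \<in> polydisc (V - Y) r \<Longrightarrow> 0 \<le> s \<Longrightarrow> s \<le> r \<Longrightarrow> h \<in> polydisc (V - Y) s \<Longrightarrow>
       vabs (g (\<lambda>i. x i + h i) - g x) \<le> M * (s / r)"
    "\<And>x s h. x \<in> polydisc (V - Y) r \<Longrightarrow> 0 \<le> s \<Longrightarrow> s \<le> r \<Longrightarrow> h \<in> polydisc (V - Y) s \<Longrightarrow>
       vabs (g (\<lambda>i. x i + h i) - g x - (\<Sum>i\<in>V - Y. G i x * h i)) \<le> M * (s / r)\<^sup>2"
    by (rule tate_gradient[OF g finVY r(1) M(2)]) (assumption, rule that)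
  note G = G'(1,5)
  have Gg': "g' a = G i a"
    using partial_unique[OF _ partial_of_gradient[OF G(2) finVY i] aD(2) rpos] z by blast
  \<comment> \<open>The function \<open>g\<close> after translation by \<open>a\<close>. It vanishes
    on \<open>S\<close> near the origin because \<open>S\<close> is closed under the translation, so
    its differential \<open>m\<close> at the origin is conormal.\<close>
  define k where "k = (\<lambda>x. g (\<lambda>i. a i + x i + (\<Sum>j\<in>V. B a i j * x j)))"
  define m where "m = (\<lambda>j. (if j \<in> V - Y then G j a else 0) + (\<Sum>i\<in>V - Y. G i a * B a i j))"
  have shift: "(\<lambda>i. a i + x i + (\<Sum>j\<in>V. B a i j * x j)) \<in> polydisc V r" if "x \<in> polydisc V r" for x
    using polydisc_add[OF aD(1) disp[OF that less_imp_le[OF rpos]] order_refl] by (simp add: add.assoc)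
  have k: "k \<in> vanishing_ideal V S r"
  proof -
    have "k \<in> convergent_on V r"
      unfolding k_def
    proof (rule tate_compose[OF g])
      show "(\<lambda>x. a i + x i + (\<Sum>j\<in>V. B a i j * x j)) \<in> convergent_on V r" if "i \<in> V - Y" for i
        using that rpos by (intro tate_add tate_const tate_var tate_sum tate_mult[OF tate_const]) auto
      show "(\<lambda>i. a i + x i + (\<Sum>j\<in>V. B a i j * x j)) \<in> polydisc (V - Y) r" if "x \<in> polydisc V r" for x
        using polydisc_mono[OF shift[OF that]] by blast
    qed (use rpos in simp)
    moreover have "k x = 0" if "x \<in> S \<inter> polydisc V r" for x
      using z trans[OF that] shift[of x] that unfolding k_def by blast
    ultimately show ?thesis
      by (simp add: vanishing_ideal_def)
  qed
  have "linear_part V r k m"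
    unfolding linear_part_def
  proof (intro exI allI impI)
    fix s and h :: "'i \<Rightarrow> 'k" assume s: "0 \<le> s" "s \<le> r" and h: "h \<in> polydisc V s"
    have h': "(\<lambda>i. h i + (\<Sum>j\<in>V. B a i j * h j)) \<in> polydisc (V - Y) s"
      using polydisc_mono[OF disp[OF h s(1)]] by blast
    have "(\<Sum>i\<in>V - Y. G i a * (h i + (\<Sum>j\<in>V. B a i j * h j)))
        = (\<Sum>i\<in>V - Y. G i a * h i) + (\<Sum>i\<in>V - Y. \<Sum>j\<in>V. G i a * B a i j * h j)"
      by (simp add: distrib_left sum.distrib sum_distrib_left mult.assoc)
    also have "(\<Sum>i\<in>V - Y. \<Sum>j\<in>V. G i a * B a i j * h j) = (\<Sum>j\<in>V. (\<Sum>i\<in>V - Y. G i a * B a i j) * h j)"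
      by (subst sum.swap) (simp add: sum_distrib_right)
    also have "(\<Sum>i\<in>V - Y. G i a * h i) = (\<Sum>j\<in>V. (if j \<in> V - Y then G j a else 0) * h j)"
      using fin by (intro sum.mono_neutral_cong_left) auto
    finally have eq: "(\<Sum>i\<in>V - Y. G i a * (h i + (\<Sum>j\<in>V. B a i j * h j))) = (\<Sum>j\<in>V. m j * h j)"
      by (simp add: m_def distrib_right sum.distrib)
    have "vabs (g (\<lambda>i. a i + (h i + (\<Sum>j\<in>V. B a i j * h j))) - g a
        - (\<Sum>i\<in>V - Y. G i a * (h i + (\<Sum>j\<in>V. B a i j * h j)))) \<le> M * (s / r)\<^sup>2"
      by (rule G(2)[OF aD(2) s h'])
    then show "vabs (k h - k (\<lambda>_. 0) - (\<Sum>i\<in>V. m i * h i)) \<le> M / r\<^sup>2 * s\<^sup>2"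
      by (simp add: k_def eq add.assoc power_divide)
  qed
  with k have mL: "m \<in> conormal V S r0"
    by (rule conormalI[OF r(1,2)])
  have "G j a = 0" if "j \<in> V - Y" for j
  proof (rule ccontr)
    assume Gj: "G j a \<noteq> 0"
    \<comment> \<open>At a pivot, \<open>m\<close> consists of the contribution of
      \<open>B a\<close> only, which is at most \<open>r * \<mu>\<close>; by
      \<open>pivot_bound\<close> all of \<open>m\<close> is at most \<open>C * r * \<mu>\<close>.
      Since \<open>G j a\<close> differs from \<open>m j\<close> by a term of this size,
      \<open>\<mu> \<le> C * r * \<mu>\<close>, which forces \<open>\<mu> = 0\<close>.\<close>
    define \<mu> where "\<mu> = Max ((\<lambda>j. vabs (G j a)) ` (V - Y))"
    have "\<mu> \<in> (\<lambda>j. vabs (G j a)) ` (V - Y)"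
      unfolding \<mu>_def using finVY that by (intro Max_in) auto
    then obtain j0 where j0: "j0 \<in> V - Y" "\<mu> = vabs (G j0 a)"
      by blast
    have le: "vabs (G j a) \<le> \<mu>" if "j \<in> V - Y" for j
      unfolding \<mu>_def using finVY that by (intro Max_ge) auto
    have \<mu>0: "\<mu> > 0"
      using le[OF that] Gj by (metis less_le_trans vabs_pos_iff)
    have sumle: "vabs (\<Sum>i\<in>V - Y. G i a * B a i j) \<le> r * \<mu>" if "j \<in> V" for j
    proof (rule vabs_sum_le)
      fix i assume "i \<in> V - Y"
      then show "vabs (G i a * B a i j) \<le> r * \<mu>"
        using mult_mono[OF le B, of i i j] that \<mu>0 by (simp add: vabs_mult mult.commute)
    qed (use rpos \<mu>0 in simp)
    have "vabs (m i) \<le> C * (r * \<mu>)" if "i \<in> V" for i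
    proof (rule pivot_bound[where L = "conormal V S r0" and V = V and l = l and Y = Y])
      show "(\<lambda>i. l i + c * m i) \<in> conormal V S r0" if "l \<in> conormal V S r0" "m \<in> conormal V S r0" for l m c
        using conormal_add[OF that] .
      show "m i = 0" if "m \<in> conormal V S r0" "\<And>y. y \<in> Y \<Longrightarrow> m y = 0" "i \<in> V" for m i
        using Y(4) that by blast
      show "vabs (m y) \<le> r * \<mu>" if "y \<in> Y" for y
        using sumle[of y] that Y(1) by (auto simp: m_def)
    qed (use fin Y(1-3) conormal_0[OF r0] C mL rpos \<mu>0 that in auto)
    then have "vabs (m j0) \<le> C * r * \<mu>"
      using j0 by (simp add: mult.assoc)
    moreover have "vabs (\<Sum>i\<in>V - Y. G i a * B a i j0) \<le> C * r * \<mu>"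
    proof -
      have "r * \<mu> \<le> C * r * \<mu>"
        using C(2) rpos \<mu>0 by simp
      then show ?thesis
        using sumle[of j0] j0 by auto
    qed
    moreover have "G j0 a = m j0 - (\<Sum>i\<in>V - Y. G i a * B a i j0)"
      using j0 by (simp add: m_def)
    ultimately have "\<mu> \<le> C * r * \<mu>"
      using vabs_diff_le j0(2) by metis
    then show False
      using r(3) \<mu>0 by simp
  qed
  then show "g' a = 0"
    using Gg' i by simp
qed

section \<open>Implicit functions\<close>

lemma linear_part_unique:
  assumes "linear_part V r f l" "linear_part V r f m" "finite V" "r > 0" "i \<in> V"
  shows "l i = m i"
proof -
  obtain C where C: "\<And>s h. 0 \<le> s \<Longrightarrow> s \<le> r \<Longrightarrow> h \<in> polydisc V s \<Longrightarrow>
     vabs (f h - f (\<lambda>_. 0) - (\<Sum>i\<in>V. l i * h i)) \<le> C * s\<^sup>2"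
    using assms(1) unfolding linear_part_def by blast
  obtain D where D: "\<And>s h. 0 \<le> s \<Longrightarrow> s \<le> r \<Longrightarrow> h \<in> polydisc V s \<Longrightarrow>
     vabs (f h - f (\<lambda>_. 0) - (\<Sum>i\<in>V. m i * h i)) \<le> D * s\<^sup>2"
    using assms(2) unfolding linear_part_def by blast
  have "l i - m i = 0"
  proof (rule eq_0_if_small_bound[OF assms(4)])
    fix c :: 'k assume c: "vabs c \<le> r"
    define h where "h = (\<lambda>j. if j = i then c else 0)"
    have h: "h \<in> polydisc V (vabs c)"
      by (auto simp: h_def polydisc_def)
    have sum: "(\<Sum>j\<in>V. w j * h j) = w i * c" for w
      using assms(3,5) by (simp add: h_def if_distrib cong: if_cong)
    have "vabs ((f h - f (\<lambda>_. 0) - (\<Sum>i\<in>V. m i * h i)) - (f h - f (\<lambda>_. 0) - (\<Sum>i\<in>V. l i * h i)))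
       \<le> max C D * (vabs c)\<^sup>2"
      by (rule vabs_diff_le; rule order_trans[OF D[OF vabs_ge_0 c h]] order_trans[OF C[OF vabs_ge_0 c h]])
        (auto intro: mult_right_mono)
    then show "vabs (c * (l i - m i)) \<le> max C D * (vabs c)\<^sup>2"
      unfolding sum[of l] sum[of m] by (simp add: algebra_simps)
  qed
  then show ?thesis
    by simp
qed

text \<open>Strict differentiability at the origin: moving the base point by \<open>s\<close>
  changes the gradient by at most a constant times \<open>s\<close>, so the factor
  \<open>M * s / r^2\<close> can be made small. This is what lets an iteration with frozen
  derivative contract.\<close>

lemma strict_derivative_bound:
  fixes f :: "('i \<Rightarrow> 'k) \<Rightarrow> 'k"
  assumes f: "f \<in> convergent_on V r" and fin: "finite V" and r: "radius r"
    and M: "\<And>x. x \<in> polydisc V r \<Longrightarrow> vabs (f x) \<le> M"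
    and l: "linear_part V r f l"
    and s: "0 \<le> s" "s \<le> r" and x: "x \<in> polydisc V s"
    and d: "0 \<le> d" "d \<le> s" and h: "h \<in> polydisc V d"
  shows "vabs (f (\<lambda>i. x i + h i) - f x - (\<Sum>i\<in>V. l i * h i)) \<le> M * s / r\<^sup>2 * d"
    and "i \<in> V \<Longrightarrow> vabs (l i) * r \<le> M"
proof -
  have r0: "r > 0"
    using r by (rule radius_pos)
  have M0: "M \<ge> 0"
    using M[of "\<lambda>_. 0"] r0 order_trans[OF vabs_ge_0] by simp
  have xr: "x \<in> polydisc V r"
    using polydisc_mono[OF x subset_refl s(2)] .
  obtain G where G: "\<And>i. i \<in> V \<Longrightarrow> G i \<in> convergent_on V r"
    "\<And>i x. i \<in> V \<Longrightarrow> p dvd Suc 0 \<Longrightarrow> x \<in> polydisc V r \<Longrightarrow> G i x = 0"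
    "\<And>i x. i \<in> V \<Longrightarrow> x \<in> polydisc V r \<Longrightarrow> vabs (G i x) * r \<le> M"
    "\<And>x s h. x \<in> polydisc V r \<Longrightarrow> 0 \<le> s \<Longrightarrow> s \<le> r \<Longrightarrow> h \<in> polydisc V s \<Longrightarrow>
       vabs (f (\<lambda>i. x i + h i) - f x) \<le> M * (s / r)"
    "\<And>x s h. x \<in> polydisc V r \<Longrightarrow> 0 \<le> s \<Longrightarrow> s \<le> r \<Longrightarrow> h \<in> polydisc V s \<Longrightarrow>
       vabs (f (\<lambda>i. x i + h i) - f x - (\<Sum>i\<in>V. G i x * h i)) \<le> M * (s / r)\<^sup>2"
    by (rule tate_gradient[OF f fin r M]) (assumption, rule that)
  have "linear_part V r f (\<lambda>i. G i (\<lambda>_. 0))"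
    unfolding linear_part_def
  proof (intro exI allI impI)
    fix t and h :: "'i \<Rightarrow> 'k" assume "0 \<le> t" "t \<le> r" "h \<in> polydisc V t"
    then show "vabs (f h - f (\<lambda>_. 0) - (\<Sum>i\<in>V. G i (\<lambda>_. 0) * h i)) \<le> M / r\<^sup>2 * t\<^sup>2"
      using G(5)[of "\<lambda>_. 0" t h] r0 by (simp add: power_divide)
  qed
  then have lG: "l i = G i (\<lambda>_. 0)" if "i \<in> V" for i
    using linear_part_unique[OF l _ fin r0 that] by blast
  show "vabs (l i) * r \<le> M" if "i \<in> V"
    using G(3)[OF that, of "\<lambda>_. 0"] lG[OF that] r0 by simp
  have b1: "vabs (f (\<lambda>i. x i + h i) - f x - (\<Sum>i\<in>V. G i x * h i)) \<le> M * s / r\<^sup>2 * d"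
  proof -
    have "M * (d / r)\<^sup>2 \<le> M * s / r\<^sup>2 * d"
      using M0 d r0 by (simp add: power_divide power2_eq_square divide_right_mono mult_left_mono mult_right_mono mult.assoc)
    then show ?thesis
      using G(5)[OF xr d(1) _ h] d s by simp
  qed
  have "vabs (\<Sum>i\<in>V. (G i x - l i) * h i) \<le> M * s / r\<^sup>2 * d"
  proof (rule vabs_sum_le)
    fix i assume i: "i \<in> V"
    have "vabs (G i (\<lambda>i. 0 + x i) - G i (\<lambda>_. 0)) \<le> M / r * (s / r)"
      by (rule tate_lipschitz[OF G(1)[OF i] fin r]) (use G(3)[OF i] r0 s x in \<open>auto simp: field_simps\<close>)
    then have "vabs (G i x - l i) \<le> M * s / r\<^sup>2"
      using lG[OF i] by (simp add: power2_eq_square)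
    then have "vabs (G i x - l i) * vabs (h i) \<le> M * s / r\<^sup>2 * d"
      using polydiscD[OF h i] M0 s by (intro mult_mono) auto
    then show "vabs ((G i x - l i) * h i) \<le> M * s / r\<^sup>2 * d"
      by (simp add: vabs_mult)
  qed (use M0 s d in simp)
  from vabs_add_le[OF b1 this]
  show "vabs (f (\<lambda>i. x i + h i) - f x - (\<Sum>i\<in>V. l i * h i)) \<le> M * s / r\<^sup>2 * d"
    by (simp add: left_diff_distrib sum_subtractf add_diff_eq)
qed

text \<open>The derivative with respect to the coordinates in \<open>Y\<close> is the identity at
  the origin, so the iteration \<open>x y \<mapsto> x y - f y x\<close> contracts. The uniform limit
  stays in the Tate algebra of the free coordinates. On the polydisc \<open>\<phi>\<close> ignores
  the pivot entries of its argument, hence \<open>\<phi> x = x\<close> expresses that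
  \<open>x\<close> lies on the graph. That conversely the graph satisfies further equations is left
  to the vanishing principle.\<close>

lemma implicit_function:
  fixes f :: "'i \<Rightarrow> ('i \<Rightarrow> 'k) \<Rightarrow> 'k"
  assumes fin: "finite V" and Y: "Y \<subseteq> V" and r: "radius r"
    and f: "\<And>y. y \<in> Y \<Longrightarrow> f y \<in> convergent_on V r" "\<And>y. y \<in> Y \<Longrightarrow> f y (\<lambda>_. 0) = 0"
    and l: "\<And>y. y \<in> Y \<Longrightarrow> linear_part V r (f y) (l y)"
      "\<And>y z. y \<in> Y \<Longrightarrow> z \<in> Y \<Longrightarrow> l y z = (if y = z then 1 else 0)"
  obtains \<phi> s where "radius s" "s \<le> r" "\<And>t i. i \<notin> Y \<Longrightarrow> \<phi> t i = t i"
    "\<And>i. i \<in> V \<Longrightarrow> (\<lambda>t. \<phi> t i) \<in> convergent_on (V - Y) s"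
    "\<And>t. t \<in> polydisc (V - Y) s \<Longrightarrow> \<phi> t \<in> polydisc V r"
    "\<And>x i. x \<in> polydisc V s \<Longrightarrow> \<forall>y\<in>Y. f y x = 0 \<Longrightarrow> \<phi> x i = x i"
proof -
  have r0: "r > 0"
    using r by (rule radius_pos)
  have finY: "finite Y"
    using finite_subset[OF Y fin] .
  have "\<exists>M>0. \<forall>x\<in>polydisc V r. vabs (f y x) \<le> M" if "y \<in> Y" for y
    using tate_bounded[OF f(1)[OF that] less_imp_le[OF r0]] by metis
  then obtain N where N: "\<And>y x. y \<in> Y \<Longrightarrow> x \<in> polydisc V r \<Longrightarrow> vabs (f y x) \<le> N y" "\<And>y. y \<in> Y \<Longrightarrow> N y > 0"
    by metis
  define M where "M = 1 + (\<Sum>y\<in>Y. N y)"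
  have M: "vabs (f y x) \<le> M" if "y \<in> Y" "x \<in> polydisc V r" for y x
    using N(1)[OF that] member_le_sum[of y Y N] N(2) finY that by (force simp: M_def less_imp_le)
  have M0: "M > 0"
    using N(2) by (simp add: M_def add_pos_nonneg sum_nonneg less_imp_le)
  \<comment> \<open>The bound on \<open>s\<close> makes the contraction factor
    \<open>\<theta>\<close> less than 1.\<close>
  obtain s where s: "radius s" "s < min r (r\<^sup>2 / (2 * M))"
    using ex_radius_less[of "min r (r\<^sup>2 / (2 * M))"] r0 M0 by auto
  define \<theta> where "\<theta> = M * s / r\<^sup>2"
  have s0: "s > 0"
    using s(1) by (rule radius_pos)
  have \<theta>: "0 \<le> \<theta>" "\<theta> < 1"
  proof -
    show "0 \<le> \<theta>"
      using M0 s0 by (simp add: \<theta>_def)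
    have "2 * (M * s) < r\<^sup>2"
      using s(2) M0 by (simp add: field_simps)
    then have "M * s < r\<^sup>2"
      using mult_pos_pos[OF M0 s0] by linarith
    then show "\<theta> < 1"
      using r0 by (simp add: \<theta>_def)
  qed
  \<comment> \<open>The parameters are restricted further, so that the first correction, the value
    of \<open>f y\<close> at the starting point, has size at most \<open>s\<close> and the iteration
    never leaves the polydisc of radius \<open>s\<close>.\<close>
  obtain s1 where s1: "radius s1" "s1 < min s (s * r / M)"
    using ex_radius_less[of "min s (s * r / M)"] r0 s0 M0 by auto
  have s10: "s1 > 0"
    using s1(1) by (rule radius_pos)
  have strict: "vabs (f y x' - f y x - (x' y - x y)) \<le> \<theta> * d"
    if y: "y \<in> Y" and x: "x \<in> polydisc V s" and d: "0 \<le> d" "d \<le> s"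
      and x': "\<And>i. i \<in> Y \<Longrightarrow> vabs (x' i - x i) \<le> d" "\<And>i. i \<in> V - Y \<Longrightarrow> x' i = x i" for x x' y d
  proof -
    have "vabs (f y (\<lambda>i. x i + (x' i - x i)) - f y x - (\<Sum>i\<in>V. l y i * (x' i - x i))) \<le> M * s / r\<^sup>2 * d"
      by (rule strict_derivative_bound[OF f(1)[OF y] fin r M[OF y] l(1)[OF y]])
        (use s s0 x d x' Y in \<open>auto simp: polydisc_def\<close>, metis DiffI cancel_comm_monoid_add_class.diff_cancel vabs_0)
    moreover have "(\<Sum>i\<in>V. l y i * (x' i - x i)) = (\<Sum>i\<in>Y. l y i * (x' i - x i))"
      using fin Y x'(2) by (intro sum.mono_neutral_right) auto
    moreover have "\<dots> = (\<Sum>i\<in>Y. if i = y then x' y - x y else 0)"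
      using y by (intro sum.cong refl) (simp add: l(2))
    ultimately show ?thesis
      using y finY by (simp add: \<theta>_def)
  qed
  define ext where "ext = (\<lambda>(w :: 'i \<Rightarrow> 'k) (t :: 'i \<Rightarrow> 'k) i. if i \<in> Y then w i else t i)"
  \<comment> \<open>The pivot coordinates start at 0 and are corrected by \<open>- f i\<close>,
    while the free coordinates keep the values given by \<open>t\<close>.\<close>
  define \<Phi> where "\<Phi> = (\<lambda>n t. ((\<lambda>x. ext (\<lambda>i. x i - f i x) t) ^^ n) (ext (\<lambda>_. 0) t))"
  have \<Phi>0: "\<Phi> 0 t i = (if i \<in> Y then 0 else t i)" for t i
    by (simp add: \<Phi>_def ext_def)
  have \<Phi>Suc: "\<Phi> (Suc n) t i = (if i \<in> Y then \<Phi> n t i - f i (\<Phi> n t) else t i)" for n t i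
    by (simp add: \<Phi>_def ext_def)
  have \<Phi>out: "\<Phi> n t i = t i" if "i \<notin> Y" for n t i
    using that by (cases n) (simp_all add: \<Phi>0 \<Phi>Suc)
  have \<Phi>0_disc: "\<Phi> 0 t \<in> polydisc V s1" if "t \<in> polydisc (V - Y) s1" for t
    using that s10 by (auto simp: polydisc_def \<Phi>0)
  have f\<Phi>0: "vabs (f y (\<Phi> 0 t)) \<le> s" if y: "y \<in> Y" and t: "t \<in> polydisc (V - Y) s1" for y t
  proof -
    have "vabs (f y (\<lambda>i. 0 + \<Phi> 0 t i) - f y (\<lambda>_. 0)) \<le> M * (s1 / r)"
      by (rule tate_lipschitz[OF f(1)[OF y] fin r M[OF y]]) (use \<Phi>0_disc[OF t] s1 s s10 r0 in auto)
    moreover have "M * (s1 / r) \<le> s"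
      using s1(2) M0 r0 by (simp add: field_simps)
    ultimately show ?thesis
      using f(2)[OF y] by simp
  qed
  have \<Phi>disc: "\<Phi> n t \<in> polydisc V s" if t: "t \<in> polydisc (V - Y) s1" for n t
  proof (induction n)
    case 0
    show ?case
      using polydisc_mono[OF \<Phi>0_disc[OF t]] s1 by auto
  next
    case (Suc n)
    show ?case
    proof (rule polydiscI)
      fix i assume i: "i \<in> V"
      show "vabs (\<Phi> (Suc n) t i) \<le> s"
      proof (cases "i \<in> Y")
        case False
        then show ?thesis
          using polydiscD[OF t, of i] i s1 by (simp add: \<Phi>out)
      next
        case True
        have "vabs (f i (\<Phi> n t) - f i (\<Phi> 0 t) - (\<Phi> n t i - \<Phi> 0 t i)) \<le> \<theta> * s"
        proof (rule strict[OF True])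
          show "\<Phi> 0 t \<in> polydisc V s"
            using polydisc_mono[OF \<Phi>0_disc[OF t]] s1 by auto
          show "vabs (\<Phi> n t j - \<Phi> 0 t j) \<le> s" if "j \<in> Y" for j
            using polydiscD[OF Suc, of j] that Y by (auto simp: \<Phi>0)
        qed (use s0 in \<open>auto simp: \<Phi>out\<close>)
        also have "\<theta> * s \<le> s"
          using \<theta> s0 by simp
        finally have "vabs (- (f i (\<Phi> n t) - f i (\<Phi> 0 t) - (\<Phi> n t i - \<Phi> 0 t i)) - f i (\<Phi> 0 t)) \<le> s"
          using f\<Phi>0[OF True t] by (intro vabs_diff_le) (simp only: vabs_minus)
        then show ?thesis
          using True by (simp add: \<Phi>Suc \<Phi>0)
      qed
    qed
  qed
  have \<Phi>step: "vabs (\<Phi> (Suc n) t i - \<Phi> n t i) \<le> \<theta> ^ n * s" if t: "t \<in> polydisc (V - Y) s1" and i: "i \<in> V" for n t i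
    using i
  proof (induction n arbitrary: i)
    case 0
    then show ?case
      using vabs_diff_le[OF polydiscD[OF \<Phi>disc[OF t] 0, of "Suc 0"] polydiscD[OF \<Phi>disc[OF t] 0, of 0]] by simp
  next
    case (Suc n)
    show ?case
    proof (cases "i \<in> Y")
      case False
      then show ?thesis
        using \<theta> s0 by (simp add: \<Phi>out)
    next
      case True
      have "\<theta> ^ n * s \<le> s"
        using \<theta> s0 by (simp add: power_le_one)
      then have "vabs (f i (\<Phi> (Suc n) t) - f i (\<Phi> n t) - (\<Phi> (Suc n) t i - \<Phi> n t i)) \<le> \<theta> * (\<theta> ^ n * s)"
        using Suc.IH Y \<theta>(1) s0 by (intro strict[OF True \<Phi>disc[OF t]]) (auto simp: \<Phi>out)
      moreover have "\<Phi> (Suc (Suc n)) t i - \<Phi> (Suc n) t i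
          = - (f i (\<Phi> (Suc n) t) - f i (\<Phi> n t) - (\<Phi> (Suc n) t i - \<Phi> n t i))"
        using True by (simp add: \<Phi>Suc[of "Suc n"]) (simp add: \<Phi>Suc)
      ultimately show ?thesis
        by (simp only: vabs_minus power_Suc mult.assoc)
    qed
  qed
  have \<Phi>T: "(\<lambda>t. \<Phi> n t i) \<in> convergent_on (V - Y) s1" if "i \<in> V" for n i
    using that
  proof (induction n arbitrary: i)
    case 0
    then show ?case
      by (cases "i \<in> Y") (simp_all add: \<Phi>0 tate_var)
  next
    case (Suc n)
    show ?case
    proof (cases "i \<in> Y")
      case True
      have "(\<lambda>t. f i (\<Phi> n t)) \<in> convergent_on (V - Y) s1"
        by (rule tate_compose[OF f(1)[OF True]])
          (use Suc.IH polydisc_mono[OF \<Phi>disc subset_refl] s s10 in auto)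
      then show ?thesis
        using Suc True by (simp add: \<Phi>Suc tate_diff)
    qed (use Suc in \<open>simp add: \<Phi>Suc tate_var\<close>)
  qed
  have tail: "vabs (\<Phi> m t i - \<Phi> n t i) \<le> \<theta> ^ N * s"
    if t: "t \<in> polydisc (V - Y) s1" and i: "i \<in> V" and mn: "N \<le> m" "N \<le> n" for m n N t i
  proof -
    have "vabs (\<Phi> k t i - \<Phi> N t i) \<le> \<theta> ^ N * s" if "N \<le> k" for k
      using that
    proof (induction k rule: dec_induct)
      case base
      then show ?case
        using \<theta> s0 by simp
    next
      case (step k)
      have "\<theta> ^ k * s \<le> \<theta> ^ N * s"
        using step(1) \<theta> s0 by (intro mult_right_mono power_decreasing) auto
      then show ?case
        using vabs_add_le[OF order_trans[OF \<Phi>step[OF t i, of k]] step(3)] by simp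
    qed
    from vabs_diff_le[OF this[OF mn(1)] this[OF mn(2)]] show ?thesis
      by simp
  qed
  have small: "\<exists>N. \<theta> ^ N * s \<le> \<epsilon>" if \<epsilon>: "\<epsilon> > 0" for \<epsilon>
  proof -
    obtain N where "\<theta> ^ N < \<epsilon> / s"
      using real_arch_pow_inv[of "\<epsilon> / s" \<theta>] \<epsilon> s0 \<theta> by auto
    then show ?thesis
      using s0 by (intro exI[of _ N]) (simp add: field_simps)
  qed
  have "\<exists>g. g \<in> convergent_on (V - Y) s1 \<and>
     (\<forall>\<epsilon>>0. \<exists>N. \<forall>n\<ge>N. \<forall>t\<in>polydisc (V - Y) s1. vabs (g t - \<Phi> n t i) \<le> \<epsilon>)" if i: "i \<in> V" for i
  proof (rule tate_uniform_limit)
    show "(\<lambda>t. \<Phi> n t i) \<in> convergent_on (V - Y) s1" for n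
      using \<Phi>T[OF i] .
    fix \<epsilon> :: real assume "\<epsilon> > 0"
    then obtain N where N: "\<theta> ^ N * s \<le> \<epsilon>"
      using small by blast
    show "\<exists>N. \<forall>m\<ge>N. \<forall>n\<ge>N. \<forall>t\<in>polydisc (V - Y) s1. vabs (\<Phi> m t i - \<Phi> n t i) \<le> \<epsilon>"
      using order_trans[OF tail[OF _ i] N] by blast
  qed blast
  then obtain g where g: "\<And>i. i \<in> V \<Longrightarrow> g i \<in> convergent_on (V - Y) s1"
    "\<And>i \<epsilon>. i \<in> V \<Longrightarrow> \<epsilon> > 0 \<Longrightarrow> \<exists>N. \<forall>n\<ge>N. \<forall>t\<in>polydisc (V - Y) s1. vabs (g i t - \<Phi> n t i) \<le> \<epsilon>"
    by metis
  define \<phi> where "\<phi> = (\<lambda>t i. if i \<in> Y then g i t else t i)"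
  have conv: "\<exists>N. \<forall>n\<ge>N. \<forall>t\<in>polydisc (V - Y) s1. vabs (\<phi> t i - \<Phi> n t i) \<le> \<epsilon>" if "\<epsilon> > 0" "i \<in> V" for \<epsilon> i
    using g(2)[OF that(2,1)] that by (cases "i \<in> Y") (simp_all add: \<phi>_def \<Phi>out)
  have \<phi>disc: "\<phi> t \<in> polydisc V s" if t: "t \<in> polydisc (V - Y) s1" for t
  proof (rule polydiscI)
    fix i assume i: "i \<in> V"
    obtain N where "\<forall>n\<ge>N. \<forall>t\<in>polydisc (V - Y) s1. vabs (\<phi> t i - \<Phi> n t i) \<le> s"
      using conv[OF s0 i] by blast
    then have "vabs (\<phi> t i - \<Phi> N t i) \<le> s"
      using t by blast
    from vabs_add_le[OF this polydiscD[OF \<Phi>disc[OF t, of N] i]] show "vabs (\<phi> t i) \<le> s"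
      by simp
  qed
  have zero: "x i = \<phi> x i"
    if x: "x \<in> polydisc V s1" and fx: "\<And>y. y \<in> Y \<Longrightarrow> f y x = 0" and i: "i \<in> V" for x i
  proof -
    have xs: "x \<in> polydisc V s"
      using polydisc_mono[OF x] s1 by auto
    have xt: "x \<in> polydisc (V - Y) s1"
      using polydisc_mono[OF x] by auto
    have "vabs (x i - \<Phi> n x i) \<le> \<theta> ^ n * s" if "i \<in> V" for n i
      using that
    proof (induction n arbitrary: i)
      case 0
      then show ?case
        using vabs_diff_le[OF polydiscD[OF xs 0] polydiscD[OF \<Phi>disc[OF xt] 0, of 0]] by simp
    next
      case (Suc n)
      show ?case
      proof (cases "i \<in> Y")
        case False
        then show ?thesis
          using \<theta> s0 by (simp add: \<Phi>out)
      next
        case True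
        have "\<theta> ^ n * s \<le> s"
          using \<theta> s0 by (simp add: power_le_one)
        then have "vabs (f i x - f i (\<Phi> n x) - (x i - \<Phi> n x i)) \<le> \<theta> * (\<theta> ^ n * s)"
          using Suc.IH Y \<theta>(1) s0 by (intro strict[OF True \<Phi>disc[OF xt]]) (auto simp: \<Phi>out)
        moreover have "x i - \<Phi> (Suc n) x i = - (f i x - f i (\<Phi> n x) - (x i - \<Phi> n x i))"
          using True fx by (simp add: \<Phi>Suc)
        ultimately show ?thesis
          by (simp only: vabs_minus power_Suc mult.assoc)
      qed
    qed
    show ?thesis
    proof (rule eq_if_vabs_small)
      fix \<epsilon> :: real assume \<epsilon>: "\<epsilon> > 0"
      obtain N where N: "\<forall>n\<ge>N. \<forall>t\<in>polydisc (V - Y) s1. vabs (\<phi> t i - \<Phi> n t i) \<le> \<epsilon>"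
        using conv[OF \<epsilon> i] by blast
      obtain N' where N': "\<theta> ^ N' * s \<le> \<epsilon>"
        using small[OF \<epsilon>] by blast
      define n where "n = max N N'"
      have "\<theta> ^ n * s \<le> \<theta> ^ N' * s"
        using \<theta> s0 by (intro mult_right_mono power_decreasing) (auto simp: n_def)
      then have "vabs (x i - \<Phi> n x i) \<le> \<epsilon>"
        using \<open>\<And>n i. i \<in> V \<Longrightarrow> vabs (x i - \<Phi> n x i) \<le> \<theta> ^ n * s\<close>[OF i, of n] N' by linarith
      moreover have "vabs (\<phi> x i - \<Phi> n x i) \<le> \<epsilon>"
        using N xt by (simp add: n_def)
      ultimately show "vabs (x i - \<phi> x i) \<le> \<epsilon>"
        using vabs_diff_le[of "x i - \<Phi> n x i" \<epsilon> "\<phi> x i - \<Phi> n x i"] by simp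
    qed
  qed
  show ?thesis
  proof (rule that[of s1 \<phi>])
    show "radius s1" "s1 \<le> r"
      using s1 s by auto
    show "\<phi> t i = t i" if "i \<notin> Y" for t i
      using that by (simp add: \<phi>_def)
    show "(\<lambda>t. \<phi> t i) \<in> convergent_on (V - Y) s1" if "i \<in> V" for i
      using g(1)[OF that] that by (cases "i \<in> Y") (simp_all add: \<phi>_def tate_var)
    show "\<phi> t \<in> polydisc V r" if "t \<in> polydisc (V - Y) s1" for t
      using polydisc_mono[OF \<phi>disc[OF that]] s by auto
    show "\<phi> x i = x i" if "x \<in> polydisc V s1" "\<forall>y\<in>Y. f y x = 0" for x i
    proof (cases "i \<in> Y")
      case True
      then show ?thesis
        using zero[OF that(1)] that(2) Y by auto
    qed (simp add: \<phi>_def)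
  qed
qed

text \<open>With a common bound \<open>M\<close> of the components, the Lipschitz estimate shows
  that \<open>\<sigma> < r * s / M\<close> is small enough.\<close>

lemma tate_map_continuous_0:
  fixes \<phi> :: "('j \<Rightarrow> 'k) \<Rightarrow> 'i \<Rightarrow> 'k"
  assumes T: "\<And>i. i \<in> V \<Longrightarrow> (\<lambda>t. \<phi> t i) \<in> convergent_on W s"
    and 0: "\<And>i. i \<in> V \<Longrightarrow> \<phi> (\<lambda>_. 0) i = 0"
    and fin: "finite V" "finite W" and s: "radius s" and r: "r > 0" and b: "b > 0"
  obtains \<sigma> where "radius \<sigma>" "\<sigma> \<le> s" "\<sigma> < b" "\<And>t. t \<in> polydisc W \<sigma> \<Longrightarrow> \<phi> t \<in> polydisc V r"
proof -
  have s0: "s > 0"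
    using s by (rule radius_pos)
  have "\<exists>M>0. \<forall>t\<in>polydisc W s. vabs (\<phi> t i) \<le> M" if "i \<in> V" for i
    using tate_bounded[OF T[OF that] less_imp_le[OF s0]] by metis
  then obtain N where N: "\<And>i t. i \<in> V \<Longrightarrow> t \<in> polydisc W s \<Longrightarrow> vabs (\<phi> t i) \<le> N i" "\<And>i. i \<in> V \<Longrightarrow> N i > 0"
    by metis
  define M where "M = 1 + (\<Sum>i\<in>V. N i)"
  have M0: "M > 0"
    using N(2) by (simp add: M_def add_pos_nonneg sum_nonneg less_imp_le)
  have M: "vabs (\<phi> t i) \<le> M" if "i \<in> V" "t \<in> polydisc W s" for i t
    using N(1)[OF that] member_le_sum[of i V N] N(2) fin that by (force simp: M_def less_imp_le)
  obtain \<sigma> where \<sigma>: "radius \<sigma>" "\<sigma> < min (min s b) (r * s / M)"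
    using ex_radius_less[of "min (min s b) (r * s / M)"] s0 b r M0 by auto
  have \<sigma>0: "\<sigma> > 0"
    using \<sigma>(1) by (rule radius_pos)
  show ?thesis
  proof (rule that[OF \<sigma>(1)])
    fix t :: "'j \<Rightarrow> 'k" assume t: "t \<in> polydisc W \<sigma>"
    show "\<phi> t \<in> polydisc V r"
    proof (rule polydiscI)
      fix i assume i: "i \<in> V"
      have "vabs (\<phi> (\<lambda>j. 0 + t j) i - \<phi> (\<lambda>_. 0) i) \<le> M * (\<sigma> / s)"
        by (rule tate_lipschitz[OF T[OF i] fin(2) s M[OF i]]) (use t s0 \<sigma> \<sigma>0 in auto)
      also have "M * (\<sigma> / s) \<le> r"
        using \<sigma>(2) M0 s0 by (simp add: field_simps)
      finally show "vabs (\<phi> t i) \<le> r"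
        using 0[OF i] by simp
    qed
  qed (use \<sigma> in auto)
qed

text \<open>With the pivots of the conormal space as dependent coordinates, \<open>S\<close> lies on
  a graph near the origin. Pulled back to the free coordinates, every function that vanishes on
  \<open>S\<close> satisfies the vanishing principle, so it vanishes on the graph too. In this sense
  the germ is the graph, and there are no equations beyond those of the pivots.\<close>

theorem local_group_parametrization:
  fixes S :: "('i \<Rightarrow> 'k) set"
  assumes S: "local_group V r0 S B" and fin: "finite V" and r0: "radius r0"
  obtains Y \<phi> s where "Y \<subseteq> V" "\<And>y. y \<in> Y \<Longrightarrow> \<exists>m\<in>conormal V S r0. m y \<noteq> 0"
    "radius s" "s \<le> r0" "\<And>t i. i \<notin> Y \<Longrightarrow> \<phi> t i = t i"
    "\<And>i. i \<in> V \<Longrightarrow> (\<lambda>t. \<phi> t i) \<in> convergent_on (V - Y) s"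
    "\<And>t. t \<in> polydisc (V - Y) s \<Longrightarrow> \<phi> t \<in> polydisc V r0"
    "\<And>x i. x \<in> S \<inter> polydisc V s \<Longrightarrow> \<phi> x i = x i"
    "\<And>r f. radius r \<Longrightarrow> r \<le> r0 \<Longrightarrow> f \<in> vanishing_ideal V S r \<Longrightarrow>
       \<exists>d>0. \<forall>t\<in>polydisc (V - Y) d. f (\<phi> t) = 0"
proof -
  have r00: "r0 > 0"
    using r0 by (rule radius_pos)
  have zS: "(\<lambda>_. 0) \<in> S"
    using S by (simp add: local_group_def)
  obtain Y l where Y: "Y \<subseteq> V" "\<And>y. y \<in> Y \<Longrightarrow> l y \<in> conormal V S r0"
    "\<And>y z. y \<in> Y \<Longrightarrow> z \<in> Y \<Longrightarrow> l y z = (if y = z then 1 else 0)"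
    "\<And>m i. m \<in> conormal V S r0 \<Longrightarrow> \<forall>y\<in>Y. m y = 0 \<Longrightarrow> i \<in> V \<Longrightarrow> m i = 0"
  proof (rule ex_pivots[OF fin _ conormal_0[OF r0, of V S]])
    show "(\<lambda>i. l i + c * m i) \<in> conormal V S r0" if "l \<in> conormal V S r0" "m \<in> conormal V S r0" for l m c
      using conormal_add[OF that] .
  qed (rule that)
  have finY: "finite Y"
    using finite_subset[OF Y(1) fin] .
  have "\<forall>y\<in>Y. \<exists>r f. radius r \<and> r \<le> r0 \<and> f \<in> vanishing_ideal V S r \<and> linear_part V r f (l y)"
    using Y(2) by (auto simp: conormal_def)
  then obtain \<rho> f where f: "\<And>y. y \<in> Y \<Longrightarrow> radius (\<rho> y)" "\<And>y. y \<in> Y \<Longrightarrow> \<rho> y \<le> r0"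
    "\<And>y. y \<in> Y \<Longrightarrow> f y \<in> vanishing_ideal V S (\<rho> y)" "\<And>y. y \<in> Y \<Longrightarrow> linear_part V (\<rho> y) (f y) (l y)"
    by metis
  define m where "m = Min (insert r0 (\<rho> ` Y))"
  have "m > 0"
    using finY r00 f(1) radius_pos by (auto simp: m_def)
  then obtain s0 where s0: "radius s0" "s0 < m"
    using ex_radius_less by blast
  have s0le: "s0 \<le> r0" "\<And>y. y \<in> Y \<Longrightarrow> s0 \<le> \<rho> y"
    using s0(2) finY by (auto simp: m_def less_imp_le)
  have s00: "s0 > 0"
    using s0(1) by (rule radius_pos)
  have fs: "f y \<in> vanishing_ideal V S s0" "linear_part V s0 (f y) (l y)" if "y \<in> Y" for y
    using vanishing_ideal_restrict[OF f(3)[OF that] s0le(2)[OF that]]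
      linear_part_restrict[OF f(4)[OF that] s0le(2)[OF that]] by blast+
  have f0: "f y (\<lambda>_. 0) = 0" if "y \<in> Y" for y
    using fs(1)[OF that] zS s00 by (simp add: vanishing_ideal_def)
  have fT: "f y \<in> convergent_on V s0" if "y \<in> Y" for y
    using fs(1)[OF that] by (simp add: vanishing_ideal_def)
  obtain \<phi> s where \<phi>: "radius s" "s \<le> s0" "\<And>t i. i \<notin> Y \<Longrightarrow> \<phi> t i = t i"
    "\<And>i. i \<in> V \<Longrightarrow> (\<lambda>t. \<phi> t i) \<in> convergent_on (V - Y) s"
    "\<And>t. t \<in> polydisc (V - Y) s \<Longrightarrow> \<phi> t \<in> polydisc V s0"
    "\<And>x i. x \<in> polydisc V s \<Longrightarrow> \<forall>y\<in>Y. f y x = 0 \<Longrightarrow> \<phi> x i = x i"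
    by (rule implicit_function[OF fin Y(1) s0(1) fT f0 fs(2) Y(3)]) (assumption, assumption, assumption, assumption, assumption, rule that)
  have sp: "s > 0"
    using \<phi>(1) by (rule radius_pos)
  have \<phi>S: "\<phi> x i = x i" if "x \<in> S \<inter> polydisc V s" for x i
  proof (rule \<phi>(6))
    show "\<forall>y\<in>Y. f y x = 0"
      using fs(1) that polydisc_mono[of x V s V s0] \<phi>(2) by (auto simp: vanishing_ideal_def)
  qed (use that in simp)
  define C where "C = 1 + (\<Sum>y\<in>Y. \<Sum>i\<in>V. vabs (l y i))"
  have C: "vabs (l y i) \<le> C" if "y \<in> Y" "i \<in> V" for y i
  proof -
    have "vabs (l y i) \<le> (\<Sum>i\<in>V. vabs (l y i))"
      using member_le_sum[of i V "\<lambda>i. vabs (l y i)"] fin that by simp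
    also have "\<dots> \<le> (\<Sum>y\<in>Y. \<Sum>i\<in>V. vabs (l y i))"
      using member_le_sum[of y Y "\<lambda>y. \<Sum>i\<in>V. vabs (l y i)"] finY that by (simp add: sum_nonneg)
    finally show ?thesis
      by (simp add: C_def)
  qed
  have C1: "C \<ge> 1"
    by (simp add: C_def sum_nonneg)
  show ?thesis
  proof (rule that[of Y s \<phi>])
    show "\<exists>m\<in>conormal V S r0. m y \<noteq> 0" if "y \<in> Y" for y
      using Y(2)[OF that] Y(3)[OF that that] by (intro bexI[of _ "l y"]) auto
    show "\<phi> t \<in> polydisc V r0" if "t \<in> polydisc (V - Y) s" for t
      using polydisc_mono[OF \<phi>(5)[OF that]] s0le by blast
    show "\<exists>d>0. \<forall>t\<in>polydisc (V - Y) d. g (\<phi> t) = 0"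
      if r: "radius r" "r \<le> r0" and g: "g \<in> vanishing_ideal V S r" for r g
    proof -
      have rp: "r > 0"
        using r(1) by (rule radius_pos)
      \<comment> \<open>The bound \<open>1 / C\<close>, with \<open>C\<close> an upper bound for the
        entries of the reduced basis, is the smallness that
        \<open>local_group_derivation_stable\<close> asks for.\<close>
      obtain \<sigma> where \<sigma>: "radius \<sigma>" "\<sigma> \<le> s" "\<sigma> < min r (1 / C)"
        "\<And>t. t \<in> polydisc (V - Y) \<sigma> \<Longrightarrow> \<phi> t \<in> polydisc V r"
      proof (rule tate_map_continuous_0[OF \<phi>(4) _ fin _ \<phi>(1) rp, where b = "min r (1 / C)"])
        show "\<phi> (\<lambda>_. 0) i = 0" for i
          using \<phi>S[of "\<lambda>_. 0" i] zS sp by simp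
      qed (use fin rp C1 in auto)
      have \<sigma>0: "\<sigma> > 0"
        using \<sigma>(1) by (rule radius_pos)
      \<comment> \<open>A convergent power series in the free coordinates; it vanishes on
        \<open>S\<close> near the origin because \<open>\<phi>\<close> fixes these points.\<close>
      define h where "h = (\<lambda>t. g (\<phi> t))"
      have hT: "h \<in> convergent_on (V - Y) \<sigma>"
        unfolding h_def
      proof (rule tate_compose[where f = g and \<phi> = \<phi> and V = V and r = r])
        show "g \<in> convergent_on V r"
          using g by (simp add: vanishing_ideal_def)
        show "(\<lambda>t. \<phi> t i) \<in> convergent_on (V - Y) \<sigma>" if "i \<in> V" for i
          using tate_mono[OF \<phi>(4)[OF that] subset_refl \<sigma>(2)] .
      qed (use \<sigma> \<sigma>0 in auto)
      have stable: "derivation_stable (V - Y) \<sigma> (S \<inter> polydisc V \<sigma>)"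
      proof (rule local_group_derivation_stable[OF S fin r0 Y(1-3) _ C C1 \<sigma>(1)])
        show "m i = 0" if "m \<in> conormal V S r0" "\<And>y. y \<in> Y \<Longrightarrow> m y = 0" "i \<in> V" for m i
          using Y(4) that by blast
      qed (use \<sigma> \<phi>(2) s0le C1 in \<open>auto simp: field_simps\<close>)
      obtain d where d: "radius d" "d < \<sigma>"
        using ex_radius_less[OF \<sigma>0] by blast
      have "h t = 0" if t: "t \<in> polydisc (V - Y) d" for t
      proof (rule vanishing_principle[OF stable _ \<sigma>(1) _ hT _ _ d(2) t])
        fix a assume a: "a \<in> S \<inter> polydisc V \<sigma>"
        then have "\<phi> a = a"
          using \<phi>S polydisc_mono[of a V \<sigma> V s] \<sigma>(2) by auto
        moreover have "a \<in> polydisc V r"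
          using a polydisc_mono[of a V \<sigma> V r] \<sigma>(3) by auto
        ultimately show "h a = 0"
          using g a by (auto simp: h_def vanishing_ideal_def)
      qed (use zS \<sigma>0 fin radius_pos[OF d(1)] in auto)
      then show ?thesis
        using radius_pos[OF d(1)] by (auto simp: h_def)
    qed
  qed (use Y \<phi> \<phi>S s0le in auto)
qed

end

no_notation fps_nth (infixl \<open>$\<close> 75)

section \<open>The groups $\mathrm{PGL}_2^n$\<close>

definition mat2 :: "'k \<Rightarrow> 'k \<Rightarrow> 'k \<Rightarrow> 'k \<Rightarrow> 'k :: zero ^ 2 ^ 2" where
  "mat2 a b c d = vector [vector [a, b], vector [c, d]]"

lemma mat2_nth [simp]:
  "mat2 a b c d $ 1 $ 1 = a" "mat2 a b c d $ 1 $ 2 = b" "mat2 a b c d $ 2 $ 1 = c" "mat2 a b c d $ 2 $ 2 = d"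
  by (simp_all add: mat2_def)

lemma mat2_eqI:
  "A $ 1 $ 1 = B $ 1 $ 1 \<Longrightarrow> A $ 1 $ 2 = B $ 1 $ 2 \<Longrightarrow> A $ 2 $ 1 = B $ 2 $ 1 \<Longrightarrow> A $ 2 $ 2 = B $ 2 $ 2 \<Longrightarrow>
   (A :: 'k ^ 2 ^ 2) = B"
  unfolding vec_eq_iff forall_2 by blast

lemma mult2_nth: "(A ** B) $ i $ j = A $ i $ 1 * B $ 1 $ j + A $ i $ 2 * (B :: 'k :: semiring_1 ^ 2 ^ 2) $ 2 $ j"
  by (simp add: matrix_matrix_mult_def sum_2)

lemma mat_nth: "mat c $ i $ j = (if i = j then c else 0)"
  by (simp add: mat_def)

lemma scalar_mult_nth: "(mat c ** B) $ i $ j = c * (B :: 'k :: semiring_1 ^ 2 ^ 2) $ i $ j"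
  using exhaust_2[of i] by (auto simp: mult2_nth mat_nth)

lemma scalar_mult_commute: "A ** mat c = mat c ** (A :: 'k :: comm_ring_1 ^ 2 ^ 2)"
  by (rule mat2_eqI) (simp_all add: mult2_nth mat_nth)

lemma det_scalar_mult: "det (mat c ** A) = c ^ 2 * det (A :: 'k :: comm_ring_1 ^ 2 ^ 2)"
  by (simp add: det_2 scalar_mult_nth power2_eq_square algebra_simps)

text \<open>The adjugate divided by the determinant, written out so that the entries of the inverse
  are visibly regular and compatible with Frobenius powers.\<close>

definition inv2 :: "'k :: field ^ 2 ^ 2 \<Rightarrow> 'k ^ 2 ^ 2" where
  "inv2 A = mat2 (inverse (det A) * A $ 2 $ 2) (- inverse (det A) * A $ 1 $ 2)
              (- inverse (det A) * A $ 2 $ 1) (inverse (det A) * A $ 1 $ 1)"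

lemma inv2_left: "invertible A \<Longrightarrow> inv2 A ** A = mat 1"
  and inv2_right: "invertible A \<Longrightarrow> A ** inv2 A = mat 1"
proof -
  assume "invertible A"
  then have "inverse (det A) * (A $ 1 $ 1 * A $ 2 $ 2 - A $ 1 $ 2 * A $ 2 $ 1) = 1"
    by (simp add: invertible_det_nz flip: det_2)
  then show "inv2 A ** A = mat 1" "A ** inv2 A = mat 1"
    by (intro mat2_eqI; simp add: mult2_nth mat_nth inv2_def algebra_simps)+
qed

lemma invertible_inv2: "invertible A \<Longrightarrow> invertible (inv2 A)"
  unfolding invertible_def[of "inv2 A"] using inv2_left inv2_right by blast

lemma det_inv2: "invertible A \<Longrightarrow> det (inv2 A) = inverse (det A)"
  using det_mul[of "inv2 A" A] by (simp add: inv2_left invertible_det_nz field_simps)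

lemma group_GL2: "group GL2"
proof (rule groupI)
  fix x y z :: "'a ^ 2 ^ 2"
  show "x \<otimes>\<^bsub>GL2\<^esub> y \<otimes>\<^bsub>GL2\<^esub> z = x \<otimes>\<^bsub>GL2\<^esub> (y \<otimes>\<^bsub>GL2\<^esub> z)"
    by (simp add: GL2_def matrix_mul_assoc)
  assume "x \<in> carrier GL2"
  then show "\<exists>y\<in>carrier GL2. y \<otimes>\<^bsub>GL2\<^esub> x = \<one>\<^bsub>GL2\<^esub>"
    by (intro bexI[of _ "inv2 x"]) (simp_all add: GL2_def inv2_left invertible_inv2)
qed (auto simp: GL2_def det_mul invertible_det_nz)

lemma inv_GL2: "invertible A \<Longrightarrow> inv\<^bsub>GL2\<^esub> A = inv2 A"
  by (rule group.inv_equality[OF group_GL2]) (simp_all add: GL2_def inv2_left invertible_inv2)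

lemma invertible_scalar: "c \<noteq> 0 \<Longrightarrow> invertible (mat c :: 'k :: field ^ 2 ^ 2)"
  by (simp add: invertible_det_nz det_2 mat_nth)

lemma normal_scalars: "(scalars_GL2 :: ('k :: field ^ 2 ^ 2) set) \<lhd> GL2"
proof -
  have mult: "mat c ** mat d = (mat (c * d) :: 'k ^ 2 ^ 2)" for c d
    by (rule mat2_eqI) (simp_all add: scalar_mult_nth mat_nth)
  have sub: "subgroup (scalars_GL2 :: ('k ^ 2 ^ 2) set) GL2"
  proof (rule group.subgroupI[OF group_GL2])
    show "(scalars_GL2 :: ('k ^ 2 ^ 2) set) \<subseteq> carrier GL2"
      by (auto simp: scalars_GL2_def GL2_def invertible_scalar)
    show "(scalars_GL2 :: ('k ^ 2 ^ 2) set) \<noteq> {}"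
      by (auto simp: scalars_GL2_def intro: exI[of _ 1])
    fix a :: "'k ^ 2 ^ 2" assume "a \<in> scalars_GL2"
    then obtain c where c: "a = mat c" "c \<noteq> 0"
      by (auto simp: scalars_GL2_def)
    have "inv\<^bsub>GL2\<^esub> a = mat (inverse c)"
      by (rule group.inv_equality[OF group_GL2]) (use c in \<open>simp_all add: GL2_def mult invertible_scalar\<close>)
    then show "inv\<^bsub>GL2\<^esub> a \<in> scalars_GL2"
      using c by (auto simp: scalars_GL2_def)
    fix b :: "'k ^ 2 ^ 2" assume "b \<in> scalars_GL2"
    then obtain d where "b = mat d" "d \<noteq> 0"
      by (auto simp: scalars_GL2_def)
    then show "a \<otimes>\<^bsub>GL2\<^esub> b \<in> scalars_GL2"
      using c by (auto simp: GL2_def mult scalars_GL2_def)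
  qed
  have "x \<otimes>\<^bsub>GL2\<^esub> h \<otimes>\<^bsub>GL2\<^esub> inv\<^bsub>GL2\<^esub> x \<in> scalars_GL2" if x: "x \<in> carrier GL2" and h: "h \<in> scalars_GL2" for x h :: "'k ^ 2 ^ 2"
  proof -
    obtain c where c: "h = mat c" "c \<noteq> 0"
      using h by (auto simp: scalars_GL2_def)
    have "invertible x"
      using x by (simp add: GL2_def)
    have "x ** mat c ** inv2 x = mat c ** (x ** inv2 x)"
      by (simp only: scalar_mult_commute[of x] matrix_mul_assoc)
    with \<open>invertible x\<close> have "x ** h ** inv\<^bsub>GL2\<^esub> x = h"
      by (simp add: c inv_GL2 inv2_right)
    then show ?thesis
      using h by (simp add: GL2_def)
  qed
  with sub show ?thesis
    by (simp add: group.normal_inv_iff[OF group_GL2])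
qed

definition pgl_class :: "'k :: field ^ 2 ^ 2 \<Rightarrow> ('k ^ 2 ^ 2) set" where
  "pgl_class m = scalars_GL2 #>\<^bsub>GL2\<^esub> m"

lemma pgl_class_eq: "pgl_class m = {mat c ** m | c. c \<noteq> 0}"
  by (auto simp: pgl_class_def r_coset_def scalars_GL2_def GL2_def)

lemma pgl_class_self: "m \<in> pgl_class m"
  unfolding pgl_class_eq by (auto intro!: exI[of _ 1])

lemma pgl_class_scalar:
  assumes "c \<noteq> 0"
  shows "pgl_class (mat c ** m) = pgl_class m"
proof -
  have eq: "mat d ** (mat c ** m) = mat (d * c) ** m" for d
    by (rule mat2_eqI) (simp_all add: scalar_mult_nth)
  show ?thesis
  proof (intro equalityI subsetI)
    fix x assume "x \<in> pgl_class (mat c ** m)"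
    then obtain d where "d \<noteq> 0" "x = mat (d * c) ** m"
      unfolding pgl_class_eq eq by blast
    then show "x \<in> pgl_class m"
      unfolding pgl_class_eq using assms by (intro CollectI exI[of _ "d * c"]) simp
  next
    fix x assume "x \<in> pgl_class m"
    then obtain d where "d \<noteq> 0" "x = mat d ** m"
      unfolding pgl_class_eq by blast
    then show "x \<in> pgl_class (mat c ** m)"
      unfolding pgl_class_eq eq using assms by (intro CollectI exI[of _ "d / c"]) simp
  qed
qed

lemma group_PGL2: "group PGL2"
  unfolding PGL2_def by (rule normal.factorgroup_is_group[OF normal_scalars])

lemma carrier_PGL2: "carrier PGL2 = pgl_class ` {m. invertible m}"
  by (auto simp: PGL2_def FactGroup_def RCOSETS_def pgl_class_def GL2_def)

lemma one_PGL2: "\<one>\<^bsub>PGL2\<^esub> = pgl_class (mat 1)"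
  by (auto simp: PGL2_def FactGroup_def pgl_class_eq scalars_GL2_def)

lemma mult_PGL2:
  "invertible a \<Longrightarrow> invertible b \<Longrightarrow> pgl_class a \<otimes>\<^bsub>PGL2\<^esub> pgl_class b = pgl_class (a ** b)"
  using normal.rcos_sum[OF normal_scalars, of a b]
  by (simp add: PGL2_def FactGroup_def pgl_class_def GL2_def)

lemma inv_PGL2: "invertible a \<Longrightarrow> inv\<^bsub>PGL2\<^esub> (pgl_class a) = pgl_class (inv2 a)"
  by (rule group.inv_equality[OF group_PGL2])
    (simp_all add: mult_PGL2 invertible_inv2 inv2_left one_PGL2 carrier_PGL2)

definition tuple_class :: "nat \<Rightarrow> (nat \<Rightarrow> 'k :: field ^ 2 ^ 2) \<Rightarrow> nat \<Rightarrow> ('k ^ 2 ^ 2) set" where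
  "tuple_class n m = (\<lambda>i\<in>{..<n}. pgl_class (m i))"

lemma tuple_class_nth: "i < n \<Longrightarrow> tuple_class n m i = pgl_class (m i)"
  by (simp add: tuple_class_def)

lemma tuple_class_cong: "(\<And>i. i < n \<Longrightarrow> pgl_class (m i) = pgl_class (m' i)) \<Longrightarrow> tuple_class n m = tuple_class n m'"
  unfolding tuple_class_def by (rule restrict_ext) simp

lemma group_PGL2_power: "group (PGL2_power n)"
  by (simp add: PGL2_power_def group_PGL2)

lemma tuple_class_in_carrier:
  "(\<And>i. i < n \<Longrightarrow> invertible (m i)) \<Longrightarrow> tuple_class n m \<in> carrier (PGL2_power n)"
  by (auto simp: PGL2_power_def tuple_class_def carrier_PGL2)

lemma carrier_PGL2_powerE:
  assumes "x \<in> carrier (PGL2_power n)"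
  obtains m where "\<And>i. invertible (m i)" "x = tuple_class n m"
proof -
  have "\<forall>i. \<exists>m. invertible m \<and> (i < n \<longrightarrow> x i = pgl_class m)"
  proof
    fix i
    show "\<exists>m. invertible m \<and> (i < n \<longrightarrow> x i = pgl_class m)"
    proof (cases "i < n")
      case True
      then have "x i \<in> carrier PGL2"
        using assms by (auto simp: PGL2_power_def)
      then show ?thesis
        by (auto simp: carrier_PGL2)
    qed (auto intro: exI[of _ "mat 1"] simp: invertible_det_nz)
  qed
  then obtain m where m: "\<And>i. invertible (m i)" "\<And>i. i < n \<Longrightarrow> x i = pgl_class (m i)"
    by metis
  have "x = tuple_class n m"
    using assms m(2) by (intro ext) (auto simp: PGL2_power_def tuple_class_def PiE_iff extensional_def)
  with m(1) show ?thesis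
    using that by blast
qed

lemma one_PGL2_power: "\<one>\<^bsub>PGL2_power n\<^esub> = tuple_class n (\<lambda>_. mat 1)"
  by (auto simp: PGL2_power_def tuple_class_def one_PGL2)

lemma mult_PGL2_power:
  "(\<And>i. i < n \<Longrightarrow> invertible (a i)) \<Longrightarrow> (\<And>i. i < n \<Longrightarrow> invertible (b i)) \<Longrightarrow>
   tuple_class n a \<otimes>\<^bsub>PGL2_power n\<^esub> tuple_class n b = tuple_class n (\<lambda>i. a i ** b i)"
  by (auto simp: PGL2_power_def tuple_class_def mult_PGL2 intro!: restrict_ext)

lemma inv_PGL2_power:
  assumes "\<And>i. i < n \<Longrightarrow> invertible (a i)"
  shows "inv\<^bsub>PGL2_power n\<^esub> tuple_class n a = tuple_class n (\<lambda>i. inv2 (a i))"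
  by (rule group.inv_equality[OF group_PGL2_power])
    (use assms in \<open>auto simp: mult_PGL2_power invertible_inv2 inv2_left one_PGL2_power
       intro!: tuple_class_in_carrier tuple_class_cong\<close>)

section \<open>Regular functions\<close>

text \<open>Regular functions are total, but identities such as the multiplicativity of an inverse
  matrix hold at invertible matrices only; agreement there is all that counts.\<close>

definition agrees_regular_GL2 :: "('k :: field ^ 2 ^ 2 \<Rightarrow> 'k) \<Rightarrow> bool" where
  "agrees_regular_GL2 f \<longleftrightarrow> (\<exists>h\<in>regular_GL2. \<forall>m. invertible m \<longrightarrow> f m = h m)"

lemma agrees_regular_GL2_intros:
  "agrees_regular_GL2 (\<lambda>_. c)"
  "agrees_regular_GL2 (\<lambda>m. inverse (det m))"
  "agrees_regular_GL2 (\<lambda>m. m $ i $ j)"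
  "agrees_regular_GL2 f \<Longrightarrow> agrees_regular_GL2 g \<Longrightarrow> agrees_regular_GL2 (\<lambda>m. f m + g m)"
  "agrees_regular_GL2 f \<Longrightarrow> agrees_regular_GL2 g \<Longrightarrow> agrees_regular_GL2 (\<lambda>m. f m * g m)"
proof -
  show "agrees_regular_GL2 (\<lambda>_. c)"
    unfolding agrees_regular_GL2_def regular_GL2_def by (rule bexI[OF _ generated_algebra.const[of c]]) simp
  show "agrees_regular_GL2 (\<lambda>m. inverse (det m))"
    unfolding agrees_regular_GL2_def regular_GL2_def
    by (rule bexI[OF _ generated_algebra.gen[where f = "\<lambda>m. inverse (det m)"]]) auto
  show "agrees_regular_GL2 (\<lambda>m. m $ i $ j)"
    unfolding agrees_regular_GL2_def regular_GL2_def
    by (rule bexI[OF _ generated_algebra.gen[where f = "\<lambda>m. m $ i $ j"]]) auto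
  assume "agrees_regular_GL2 f" "agrees_regular_GL2 g"
  then obtain u v where u: "u \<in> regular_GL2" "\<And>m. invertible m \<Longrightarrow> f m = u m"
    and v: "v \<in> regular_GL2" "\<And>m. invertible m \<Longrightarrow> g m = v m"
    unfolding agrees_regular_GL2_def by metis
  show "agrees_regular_GL2 (\<lambda>m. f m + g m)"
    unfolding agrees_regular_GL2_def
    by (rule bexI[OF _ generated_algebra.add[OF u(1)[unfolded regular_GL2_def] v(1)[unfolded regular_GL2_def], folded regular_GL2_def]])
      (simp add: u(2) v(2))
  show "agrees_regular_GL2 (\<lambda>m. f m * g m)"
    unfolding agrees_regular_GL2_def
    by (rule bexI[OF _ generated_algebra.mult[OF u(1)[unfolded regular_GL2_def] v(1)[unfolded regular_GL2_def], folded regular_GL2_def]])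
      (simp add: u(2) v(2))
qed

lemma regular_GL2_compose:
  assumes "f \<in> regular_GL2" "\<And>i j. agrees_regular_GL2 (\<lambda>m. \<psi> m $ i $ j)"
    "agrees_regular_GL2 (\<lambda>m. inverse (det (\<psi> m)))"
  shows "agrees_regular_GL2 (\<lambda>m. f (\<psi> m))"
  using assms(1) unfolding regular_GL2_def
proof (induction rule: generated_algebra.induct)
  case (gen f)
  then show ?case
    using assms(2,3) by auto
qed (auto intro: agrees_regular_GL2_intros)

lemma agrees_regular_GL2_cong:
  "agrees_regular_GL2 f \<Longrightarrow> (\<And>m. invertible m \<Longrightarrow> f m = g m) \<Longrightarrow> agrees_regular_GL2 g"
  unfolding agrees_regular_GL2_def by metis

lemma regular_PGL2_iff: "f \<in> regular_PGL2 \<longleftrightarrow> agrees_regular_GL2 (\<lambda>m. f (pgl_class m))"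
  by (simp add: regular_PGL2_def agrees_regular_GL2_def pgl_class_def GL2_def)

text \<open>The closure argument below freezes one argument of \<open>inv a \<otimes> b\<close> at a
  time, so it works with one-variable translates such as this one and the one in
  \<open>regular_PGL2_inv_mult\<close>.\<close>

lemma regular_PGL2_left_mult:
  assumes f: "f \<in> regular_PGL2" and C: "C \<in> carrier PGL2"
  shows "(\<lambda>X. f (C \<otimes>\<^bsub>PGL2\<^esub> X)) \<in> regular_PGL2"
proof -
  obtain a where a: "invertible a" "C = pgl_class a"
    using C by (auto simp: carrier_PGL2)
  obtain h where h: "h \<in> regular_GL2" "\<And>m. invertible m \<Longrightarrow> f (pgl_class m) = h m"
    using f unfolding regular_PGL2_iff agrees_regular_GL2_def by metis
  have "agrees_regular_GL2 (\<lambda>m. h (a ** m))"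
  proof (rule regular_GL2_compose[OF h(1)])
    show "agrees_regular_GL2 (\<lambda>m. (a ** m) $ i $ j)" for i j
      unfolding mult2_nth by (intro agrees_regular_GL2_intros)
    show "agrees_regular_GL2 (\<lambda>m. inverse (det (a ** m)))"
      unfolding det_mul inverse_mult_distrib by (intro agrees_regular_GL2_intros)
  qed
  then show ?thesis
    unfolding regular_PGL2_iff
    by (rule agrees_regular_GL2_cong) (simp add: a mult_PGL2 h(2) invertible_mult)
qed

lemma regular_PGL2_inv_mult:
  assumes f: "f \<in> regular_PGL2" and C: "C \<in> carrier PGL2"
  shows "(\<lambda>X. f (inv\<^bsub>PGL2\<^esub> X \<otimes>\<^bsub>PGL2\<^esub> C)) \<in> regular_PGL2"
proof -
  obtain a where a: "invertible a" "C = pgl_class a"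
    using C by (auto simp: carrier_PGL2)
  obtain h where h: "h \<in> regular_GL2" "\<And>m. invertible m \<Longrightarrow> f (pgl_class m) = h m"
    using f unfolding regular_PGL2_iff agrees_regular_GL2_def by metis
  have inv: "agrees_regular_GL2 (\<lambda>m. inv2 m $ i $ j)" for i j
  proof -
    have "agrees_regular_GL2 (\<lambda>m. c * inverse (det m) * m $ k $ l)" for c k l
      by (intro agrees_regular_GL2_intros)
    from this[of 1] this[of "-1"] show ?thesis
      using exhaust_2[of i] exhaust_2[of j] by (auto simp: inv2_def)
  qed
  have det: "agrees_regular_GL2 (\<lambda>m. inverse (det (inv2 m)))"
  proof (rule agrees_regular_GL2_cong)
    show "agrees_regular_GL2 (\<lambda>m. m $ 1 $ 1 * m $ 2 $ 2 + (- 1) * (m $ 1 $ 2 * m $ 2 $ 1))"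
      by (intro agrees_regular_GL2_intros)
  qed (simp add: det_inv2, simp add: det_2)
  have "agrees_regular_GL2 (\<lambda>m. h (inv2 m ** a))"
  proof (rule regular_GL2_compose[OF h(1)])
    show "agrees_regular_GL2 (\<lambda>m. (inv2 m ** a) $ i $ j)" for i j
      unfolding mult2_nth by (intro agrees_regular_GL2_intros inv)
    show "agrees_regular_GL2 (\<lambda>m. inverse (det (inv2 m ** a)))"
      unfolding det_mul inverse_mult_distrib by (intro agrees_regular_GL2_intros det)
  qed
  then show ?thesis
    unfolding regular_PGL2_iff
    by (rule agrees_regular_GL2_cong) (simp add: a mult_PGL2 inv_PGL2 h(2) invertible_mult invertible_inv2)
qed

lemma regular_PGL2_power_intros:
  "(\<lambda>_. c) \<in> regular_PGL2_power n"
  "u \<in> regular_PGL2 \<Longrightarrow> i < n \<Longrightarrow> (\<lambda>x. u (x i)) \<in> regular_PGL2_power n"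
  "f \<in> regular_PGL2_power n \<Longrightarrow> g \<in> regular_PGL2_power n \<Longrightarrow> (\<lambda>x. f x + g x) \<in> regular_PGL2_power n"
  "f \<in> regular_PGL2_power n \<Longrightarrow> g \<in> regular_PGL2_power n \<Longrightarrow> (\<lambda>x. f x * g x) \<in> regular_PGL2_power n"
  unfolding regular_PGL2_power_def by (auto intro: generated_algebra.intros)

lemma regular_PGL2_power_power:
  "f \<in> regular_PGL2_power n \<Longrightarrow> (\<lambda>x. f x ^ k) \<in> regular_PGL2_power n"
  by (induction k) (simp_all add: regular_PGL2_power_intros)

lemma regular_PGL2_power_sum:
  "(\<And>a. a \<in> A \<Longrightarrow> f a \<in> regular_PGL2_power n) \<Longrightarrow> (\<lambda>x. \<Sum>a\<in>A. f a x) \<in> regular_PGL2_power n"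
  by (induction A rule: infinite_finite_induct) (simp_all add: regular_PGL2_power_intros)

lemma regular_PGL2_power_compose:
  assumes "f \<in> regular_PGL2_power n"
    and "\<And>u i. u \<in> regular_PGL2 \<Longrightarrow> i < n \<Longrightarrow> \<exists>v\<in>regular_PGL2. \<forall>x\<in>carrier (PGL2_power n). u (\<psi> x i) = v (x i)"
  shows "\<exists>g\<in>regular_PGL2_power n. \<forall>x\<in>carrier (PGL2_power n). f (\<psi> x) = g x"
  using assms(1) unfolding regular_PGL2_power_def
proof (induction rule: generated_algebra.induct)
  case (const c)
  show ?case
    by (rule bexI[OF _ generated_algebra.const[of c]]) simp
next
  case (gen f)
  then obtain u i where u: "u \<in> regular_PGL2" "i < n" "f = (\<lambda>x. u (x i))"
    by blast
  obtain v where v: "v \<in> regular_PGL2" "\<forall>x\<in>carrier (PGL2_power n). u (\<psi> x i) = v (x i)"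
    using assms(2)[OF u(1,2)] by blast
  show ?case
    by (rule bexI[OF _ generated_algebra.gen[where f = "\<lambda>x. v (x i)"]]) (use u v in auto)
next
  case (add f g)
  then obtain f' g' where "f' \<in> generated_algebra {\<lambda>x. f (x i) | f i. f \<in> regular_PGL2 \<and> i < n}"
    "\<forall>x\<in>carrier (PGL2_power n). f (\<psi> x) = f' x"
    "g' \<in> generated_algebra {\<lambda>x. f (x i) | f i. f \<in> regular_PGL2 \<and> i < n}"
    "\<forall>x\<in>carrier (PGL2_power n). g (\<psi> x) = g' x"
    by blast
  note fg = this
  show ?case
    by (rule bexI[OF _ generated_algebra.add[OF fg(1,3)]]) (simp add: fg(2,4))
next
  case (mult f g)
  then obtain f' g' where "f' \<in> generated_algebra {\<lambda>x. f (x i) | f i. f \<in> regular_PGL2 \<and> i < n}"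
    "\<forall>x\<in>carrier (PGL2_power n). f (\<psi> x) = f' x"
    "g' \<in> generated_algebra {\<lambda>x. f (x i) | f i. f \<in> regular_PGL2 \<and> i < n}"
    "\<forall>x\<in>carrier (PGL2_power n). g (\<psi> x) = g' x"
    by blast
  note fg = this
  show ?case
    by (rule bexI[OF _ generated_algebra.mult[OF fg(1,3)]]) (simp add: fg(2,4))
qed

lemma regular_PGL2_power_left_mult:
  fixes f :: "(nat \<Rightarrow> ('k :: field ^ 2 ^ 2) set) \<Rightarrow> 'k"
  assumes f: "f \<in> regular_PGL2_power n" and b: "b \<in> carrier (PGL2_power n)"
  shows "\<exists>g\<in>regular_PGL2_power n. \<forall>x\<in>carrier (PGL2_power n). f (b \<otimes>\<^bsub>PGL2_power n\<^esub> x) = g x"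
proof (rule regular_PGL2_power_compose[OF f])
  fix u :: "('k ^ 2 ^ 2) set \<Rightarrow> 'k" and i assume u: "u \<in> regular_PGL2" and i: "i < n"
  then have "b i \<in> carrier PGL2"
    using b by (auto simp: PGL2_power_def)
  from regular_PGL2_left_mult[OF u this]
  show "\<exists>v\<in>regular_PGL2. \<forall>x\<in>carrier (PGL2_power n). u ((b \<otimes>\<^bsub>PGL2_power n\<^esub> x) i) = v (x i)"
    by (rule bexI[rotated]) (use i in \<open>simp add: PGL2_power_def\<close>)
qed

lemma regular_PGL2_power_inv_mult:
  fixes f :: "(nat \<Rightarrow> ('k :: field ^ 2 ^ 2) set) \<Rightarrow> 'k"
  assumes f: "f \<in> regular_PGL2_power n" and b: "b \<in> carrier (PGL2_power n)"
  shows "\<exists>g\<in>regular_PGL2_power n. \<forall>x\<in>carrier (PGL2_power n).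
           f (inv\<^bsub>PGL2_power n\<^esub> x \<otimes>\<^bsub>PGL2_power n\<^esub> b) = g x"
proof (rule regular_PGL2_power_compose[OF f])
  fix u :: "('k ^ 2 ^ 2) set \<Rightarrow> 'k" and i assume u: "u \<in> regular_PGL2" and i: "i < n"
  then have "b i \<in> carrier PGL2"
    using b by (auto simp: PGL2_power_def)
  from regular_PGL2_inv_mult[OF u this]
  show "\<exists>v\<in>regular_PGL2. \<forall>x\<in>carrier (PGL2_power n). u ((inv\<^bsub>PGL2_power n\<^esub> x \<otimes>\<^bsub>PGL2_power n\<^esub> b) i) = v (x i)"
    by (rule bexI[rotated]) (use i in \<open>auto simp: PGL2_power_def group_PGL2 PiE_iff\<close>)
qed

text \<open>Numerator and determinant are both homogeneous of degree 2, so the quotient is invariant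
  under scalars and the choice of a representative is harmless.\<close>

definition entry_ratio :: "2 \<Rightarrow> 2 \<Rightarrow> 2 \<Rightarrow> 2 \<Rightarrow> ('k :: field ^ 2 ^ 2) set \<Rightarrow> 'k" where
  "entry_ratio i j k l C = (let m = (SOME m. m \<in> C) in m $ i $ j * m $ k $ l * inverse (det m))"

lemma entry_ratio_class:
  "entry_ratio i j k l (pgl_class m) = m $ i $ j * m $ k $ l * inverse (det m)"
proof -
  have "(SOME m'. m' \<in> pgl_class m) \<in> pgl_class m"
    using pgl_class_self by (rule someI)
  then obtain c where c: "c \<noteq> 0" "(SOME m'. m' \<in> pgl_class m) = mat c ** m"
    by (auto simp: pgl_class_eq)
  show ?thesis
    unfolding entry_ratio_def c(2) using c(1)
    by (simp add: det_scalar_mult scalar_mult_nth power2_eq_square field_simps)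
qed

lemma entry_ratio_regular: "entry_ratio i j k l \<in> regular_PGL2"
  unfolding regular_PGL2_iff entry_ratio_class by (intro agrees_regular_GL2_intros)

section \<open>Zariski closures\<close>

text \<open>Closure of \<open>A\<close> under products makes the sets where some
  \<open>f \<in> A\<close> is nonzero stable under intersection, so they form a basis and not merely
  a subbasis.\<close>

lemma zariski_closed_iff:
  assumes one: "(\<lambda>_. 1) \<in> A" and mult: "\<And>f g. f \<in> A \<Longrightarrow> g \<in> A \<Longrightarrow> (\<lambda>x. f x * g x) \<in> A"
  shows "closedin (zariski_topology G A) C \<longleftrightarrow>
     C \<subseteq> carrier G \<and> (\<forall>x\<in>carrier G - C. \<exists>f\<in>A. f x \<noteq> 0 \<and> (\<forall>y\<in>C. f y = 0))"
proof -
  let ?S = "{{x \<in> carrier G. f x \<noteq> 0} | f. f \<in> A}"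
  have "{x \<in> carrier G. (\<lambda>_. 1 :: 'b) x \<noteq> 0} \<in> ?S"
    by (intro CollectI exI[of _ "\<lambda>_. 1"] conjI refl one)
  then have top: "topspace (zariski_topology G A) = carrier G"
    unfolding zariski_topology_def topology_generated_by_topspace by auto
  have "\<exists>f\<in>A. f x \<noteq> 0 \<and> {y \<in> carrier G. f y \<noteq> 0} \<subseteq> U" if "generate_topology_on ?S U" "x \<in> U" for x U
    using that
  proof (induction arbitrary: x rule: generate_topology_on.induct)
    case Empty
    then show ?case
      by simp
  next
    case (Int U V)
    obtain f where f: "f \<in> A" "f x \<noteq> 0" "{y \<in> carrier G. f y \<noteq> 0} \<subseteq> U"
      using Int.IH(1)[of x] Int.prems by blast
    obtain g where g: "g \<in> A" "g x \<noteq> 0" "{y \<in> carrier G. g y \<noteq> 0} \<subseteq> V"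
      using Int.IH(2)[of x] Int.prems by blast
    show ?case
      by (rule bexI[OF _ mult[OF f(1) g(1)]]) (use f g in auto)
  next
    case (UN K)
    then obtain W where W: "W \<in> K" "x \<in> W"
      by blast
    then obtain f where "f \<in> A" "f x \<noteq> 0" "{y \<in> carrier G. f y \<noteq> 0} \<subseteq> W"
      using UN.IH by blast
    then show ?case
      using W(1) by (intro bexI[of _ f]) auto
  next
    case (Basis s)
    then obtain f where "f \<in> A" "s = {y \<in> carrier G. f y \<noteq> 0}"
      by blast
    then show ?case
      using Basis.prems by (intro bexI[of _ f]) auto
  qed
  moreover have "generate_topology_on ?S U" if U: "U \<subseteq> carrier G" "\<forall>x\<in>U. \<exists>f\<in>A. f x \<noteq> 0 \<and> {y \<in> carrier G. f y \<noteq> 0} \<subseteq> U" for U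
  proof -
    have "generate_topology_on ?S (\<Union>{W. W \<in> ?S \<and> W \<subseteq> U})"
      by (intro generate_topology_on.UN generate_topology_on.Basis) blast
    moreover have "\<Union>{W. W \<in> ?S \<and> W \<subseteq> U} = U"
    proof (intro equalityI subsetI)
      fix x assume x: "x \<in> U"
      then obtain f where f: "f \<in> A" "f x \<noteq> 0" "{y \<in> carrier G. f y \<noteq> 0} \<subseteq> U"
        using U(2) by blast
      then have "{y \<in> carrier G. f y \<noteq> 0} \<in> {W. W \<in> ?S \<and> W \<subseteq> U}"
        by (intro CollectI conjI exI[of _ f] refl)
      then show "x \<in> \<Union>{W. W \<in> ?S \<and> W \<subseteq> U}"
        by (rule UnionI) (use f x U(1) in auto)
    qed auto
    ultimately show ?thesis
      by simp
  qed
  ultimately have "openin (zariski_topology G A) U \<longleftrightarrow>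
      U \<subseteq> carrier G \<and> (\<forall>x\<in>U. \<exists>f\<in>A. f x \<noteq> 0 \<and> {y \<in> carrier G. f y \<noteq> 0} \<subseteq> U)" for U
    using openin_subset[of "zariski_topology G A" U, unfolded top]
    unfolding zariski_topology_def openin_topology_generated_by_iff by (intro iffI conjI ballI) simp_all
  then have "closedin (zariski_topology G A) C \<longleftrightarrow> C \<subseteq> carrier G \<and>
      (\<forall>x\<in>carrier G - C. \<exists>f\<in>A. f x \<noteq> 0 \<and> {y \<in> carrier G. f y \<noteq> 0} \<subseteq> carrier G - C)"
    unfolding closedin_def top by (simp add: Diff_subset)
  also have "\<dots> \<longleftrightarrow> C \<subseteq> carrier G \<and> (\<forall>x\<in>carrier G - C. \<exists>f\<in>A. f x \<noteq> 0 \<and> (\<forall>y\<in>C. f y = 0))"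
  proof (rule conj_cong[OF refl])
    assume "C \<subseteq> carrier G"
    then have "{y \<in> carrier G. f y \<noteq> 0} \<subseteq> carrier G - C \<longleftrightarrow> (\<forall>y\<in>C. f y = 0)" for f :: "'a \<Rightarrow> 'b"
      by auto
    then show "(\<forall>x\<in>carrier G - C. \<exists>f\<in>A. f x \<noteq> 0 \<and> {y \<in> carrier G. f y \<noteq> 0} \<subseteq> carrier G - C) \<longleftrightarrow>
        (\<forall>x\<in>carrier G - C. \<exists>f\<in>A. f x \<noteq> 0 \<and> (\<forall>y\<in>C. f y = 0))"
      by simp
  qed
  finally show ?thesis .
qed

lemma zariski_closed_PGL2_power:
  fixes C :: "(nat \<Rightarrow> ('k :: field ^ 2 ^ 2) set) set"
  shows "closedin (zariski_topology (PGL2_power n) (regular_PGL2_power n)) C \<longleftrightarrow>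
     C \<subseteq> carrier (PGL2_power n) \<and>
     (\<forall>x\<in>carrier (PGL2_power n) - C. \<exists>f\<in>regular_PGL2_power n. f x \<noteq> 0 \<and> (\<forall>y\<in>C. f y = 0))"
  by (rule zariski_closed_iff; rule regular_PGL2_power_intros; assumption)

definition zariski_closure ::
    "nat \<Rightarrow> (nat \<Rightarrow> ('k :: field ^ 2 ^ 2) set) set \<Rightarrow> (nat \<Rightarrow> ('k ^ 2 ^ 2) set) set" where
  "zariski_closure n B = {x \<in> carrier (PGL2_power n).
     \<forall>f\<in>regular_PGL2_power n. (\<forall>b\<in>B. f b = 0) \<longrightarrow> f x = 0}"

lemma closedin_zariski_closure:
  assumes "B \<subseteq> carrier (PGL2_power n)"
  shows "closedin (zariski_topology (PGL2_power n) (regular_PGL2_power n)) (zariski_closure n B)"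
  unfolding zariski_closed_PGL2_power by (auto simp: zariski_closure_def)

text \<open>The usual two steps: for fixed \<open>b \<in> B\<close> the condition on
  \<open>x\<close> is closed and holds on \<open>B\<close>, hence on the closure; then
  \<open>x\<close> in the closure is fixed and the second argument varies in the same way.\<close>

lemma subgroup_zariski_closure:
  fixes B :: "(nat \<Rightarrow> ('k :: field ^ 2 ^ 2) set) set"
  assumes B: "B \<subseteq> carrier (PGL2_power n)" "\<one>\<^bsub>PGL2_power n\<^esub> \<in> B"
    "\<And>a b. a \<in> B \<Longrightarrow> b \<in> B \<Longrightarrow> inv\<^bsub>PGL2_power n\<^esub> a \<otimes>\<^bsub>PGL2_power n\<^esub> b \<in> B"
  shows "subgroup (zariski_closure n B) (PGL2_power n)"
proof -
  let ?G = "PGL2_power n :: (nat \<Rightarrow> ('k ^ 2 ^ 2) set) monoid"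
  let ?Z = "zariski_closure n B"
  interpret group ?G
    by (rule group_PGL2_power)
  have ZG: "?Z \<subseteq> carrier ?G" and BZ: "B \<subseteq> ?Z"
    using B(1) by (auto simp: zariski_closure_def)
  have 1: "inv\<^bsub>?G\<^esub> x \<otimes>\<^bsub>?G\<^esub> b \<in> ?Z" if x: "x \<in> ?Z" and b: "b \<in> B" for x b
    unfolding zariski_closure_def
  proof (intro CollectI conjI ballI impI)
    show "inv\<^bsub>?G\<^esub> x \<otimes>\<^bsub>?G\<^esub> b \<in> carrier ?G"
      using x b ZG B(1) by blast
    fix f :: "(nat \<Rightarrow> ('k ^ 2 ^ 2) set) \<Rightarrow> 'k"
    assume f: "f \<in> regular_PGL2_power n" "\<forall>b\<in>B. f b = 0"
    obtain g where g: "g \<in> regular_PGL2_power n" "\<forall>x\<in>carrier ?G. f (inv\<^bsub>?G\<^esub> x \<otimes>\<^bsub>?G\<^esub> b) = g x"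
      using regular_PGL2_power_inv_mult[OF f(1)] b B(1) by blast
    have "g a = 0" if "a \<in> B" for a
      using bspec[OF g(2), of a] f(2) B(1) B(3)[OF that b] that by auto
    then have "g x = 0"
      using x g(1) by (simp add: zariski_closure_def)
    then show "f (inv\<^bsub>?G\<^esub> x \<otimes>\<^bsub>?G\<^esub> b) = 0"
      using g(2) x ZG by auto
  qed
  have 2: "inv\<^bsub>?G\<^esub> x \<otimes>\<^bsub>?G\<^esub> z \<in> ?Z" if x: "x \<in> ?Z" and z: "z \<in> ?Z" for x z
    unfolding zariski_closure_def
  proof (intro CollectI conjI ballI impI)
    show "inv\<^bsub>?G\<^esub> x \<otimes>\<^bsub>?G\<^esub> z \<in> carrier ?G"
      using x z ZG by blast
    fix f :: "(nat \<Rightarrow> ('k ^ 2 ^ 2) set) \<Rightarrow> 'k"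
    assume f: "f \<in> regular_PGL2_power n" "\<forall>b\<in>B. f b = 0"
    have "inv\<^bsub>?G\<^esub> x \<in> carrier ?G"
      using x ZG by blast
    then obtain g where g: "g \<in> regular_PGL2_power n" "\<forall>z\<in>carrier ?G. f (inv\<^bsub>?G\<^esub> x \<otimes>\<^bsub>?G\<^esub> z) = g z"
      using regular_PGL2_power_left_mult[OF f(1)] by blast
    have "g a = 0" if "a \<in> B" for a
    proof -
      have "f (inv\<^bsub>?G\<^esub> x \<otimes>\<^bsub>?G\<^esub> a) = 0"
        using 1[OF x that] f by (simp add: zariski_closure_def)
      then show ?thesis
        using bspec[OF g(2), of a] that B(1) by auto
    qed
    then have "g z = 0"
      using z g(1) by (simp add: zariski_closure_def)
    then show "f (inv\<^bsub>?G\<^esub> x \<otimes>\<^bsub>?G\<^esub> z) = 0"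
      using g(2) z ZG by auto
  qed
  have one: "\<one>\<^bsub>?G\<^esub> \<in> ?Z"
    using BZ B(2) by blast
  have inv: "inv\<^bsub>?G\<^esub> x \<in> ?Z" if "x \<in> ?Z" for x
    using 2[OF that one] that ZG by (simp add: subset_iff)
  show ?thesis
  proof (rule subgroupI)
    show "x \<otimes>\<^bsub>?G\<^esub> y \<in> ?Z" if "x \<in> ?Z" "y \<in> ?Z" for x y
      using 2[OF inv[OF that(1)] that(2)] that(1) ZG by (simp add: subset_iff)
  qed (use ZG one inv in auto)
qed

text \<open>The hypothesis says that the vanishing ideal of \<open>B\<close> is prime, so the
  closure is irreducible and in particular connected.\<close>

lemma connectedin_zariski_closure:
  assumes B: "B \<subseteq> carrier (PGL2_power n)"
    and irred: "\<And>f g. f \<in> regular_PGL2_power n \<Longrightarrow> g \<in> regular_PGL2_power n \<Longrightarrow>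
      (\<forall>b\<in>B. f b * g b = 0) \<Longrightarrow> (\<forall>b\<in>B. f b = 0) \<or> (\<forall>b\<in>B. g b = 0)"
  shows "connectedin (zariski_topology (PGL2_power n) (regular_PGL2_power n)) (zariski_closure n B)"
proof -
  let ?T = "zariski_topology (PGL2_power n) (regular_PGL2_power n :: ((nat \<Rightarrow> ('a ^ 2 ^ 2) set) \<Rightarrow> 'a) set)"
  let ?Z = "zariski_closure n B"
  have sub: "?Z \<subseteq> topspace ?T"
    using closedin_subset[OF closedin_zariski_closure[OF B]] .
  have "?Z \<subseteq> E1 \<or> ?Z \<subseteq> E2" if E: "closedin ?T E1" "closedin ?T E2" "?Z \<subseteq> E1 \<union> E2" for E1 E2
  proof (rule ccontr)
    assume "\<not> ?thesis"
    then obtain x y where x: "x \<in> ?Z" "x \<notin> E1" and y: "y \<in> ?Z" "y \<notin> E2"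
      by blast
    have "x \<in> carrier (PGL2_power n)" "y \<in> carrier (PGL2_power n)"
      using x(1) y(1) by (auto simp: zariski_closure_def)
    then obtain f g where f: "f \<in> regular_PGL2_power n" "f x \<noteq> 0" "\<forall>z\<in>E1. f z = 0"
      and g: "g \<in> regular_PGL2_power n" "g y \<noteq> 0" "\<forall>z\<in>E2. g z = 0"
      using E(1,2) x(2) y(2) unfolding zariski_closed_PGL2_power by blast
    have "B \<subseteq> ?Z"
      using B by (auto simp: zariski_closure_def)
    then have "\<forall>b\<in>B. f b * g b = 0"
      using E(3) f(3) g(3) by auto
    then have "(\<forall>b\<in>B. f b = 0) \<or> (\<forall>b\<in>B. g b = 0)"
      using irred f(1) g(1) by blast
    then show False
      using x(1) y(1) f g by (auto simp: zariski_closure_def)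
  qed
  note irreducible = this
  show ?thesis
    unfolding connectedin_closedin
  proof (intro conjI sub notI)
    assume "\<exists>E1 E2. closedin ?T E1 \<and> closedin ?T E2 \<and> ?Z \<subseteq> E1 \<union> E2 \<and> E1 \<inter> E2 \<inter> ?Z = {} \<and>
        E1 \<inter> ?Z \<noteq> {} \<and> E2 \<inter> ?Z \<noteq> {}"
    then obtain E1 E2 where E: "closedin ?T E1" "closedin ?T E2" "?Z \<subseteq> E1 \<union> E2"
      "E1 \<inter> E2 \<inter> ?Z = {}" "E1 \<inter> ?Z \<noteq> {}" "E2 \<inter> ?Z \<noteq> {}"
      by (elim exE conjE) (rule that)
    show False
      using irreducible[OF E(1-3)]
    proof
      assume "?Z \<subseteq> E1"
      with E(4,6) show False
        by (auto simp only: set_eq_iff)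
    next
      assume "?Z \<subseteq> E2"
      with E(4,5) show False
        by (auto simp only: set_eq_iff)
    qed
  qed
qed

section \<open>The dimension of $\mathrm{PGL}_2^n$\<close>

text \<open>Elimination of one coordinate at a time. The vectors are a family indexed by
  \<open>L\<close>, so equal vectors with different indices count separately.\<close>

lemma ex_linear_dependence:
  fixes \<kappa> :: "'a \<Rightarrow> 'e \<Rightarrow> 'k :: field"
  assumes "finite E" "finite L" "card E < card L"
  shows "\<exists>w. (\<exists>a\<in>L. w a \<noteq> 0) \<and> (\<forall>e\<in>E. (\<Sum>a\<in>L. w a * \<kappa> a e) = 0)"
  using assms
proof (induction E arbitrary: L \<kappa> rule: finite_induct)
  case empty
  then obtain a where "a \<in> L"
    by fastforce
  then show ?case
    by (intro exI[of _ "\<lambda>_. 1"]) auto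
next
  case (insert e E)
  show ?case
  proof (cases "\<forall>a\<in>L. \<kappa> a e = 0")
    case True
    then show ?thesis
      using insert.IH[of L \<kappa>] insert.prems insert.hyps by auto
  next
    case False
    then obtain a0 where a0: "a0 \<in> L" "\<kappa> a0 e \<noteq> 0"
      by blast
    have "card E < card (L - {a0})"
      using insert.prems insert.hyps a0 by simp
    then obtain w where w: "\<exists>a\<in>L - {a0}. w a \<noteq> 0"
      "\<forall>d\<in>E. (\<Sum>a\<in>L - {a0}. w a * (\<kappa> a d - \<kappa> a e / \<kappa> a0 e * \<kappa> a0 d)) = 0"
      using insert.IH[of "L - {a0}" "\<lambda>a d. \<kappa> a d - \<kappa> a e / \<kappa> a0 e * \<kappa> a0 d"] insert.prems by auto
    \<comment> \<open>The weight of the pivot vector \<open>a0\<close> is chosen so that coordinate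
      \<open>e\<close> cancels; the other coordinates then reproduce the eliminated system solved by
      \<open>w\<close>.\<close>
    define v where "v = (\<lambda>a. if a = a0 then - (\<Sum>a\<in>L - {a0}. w a * \<kappa> a e / \<kappa> a0 e) else w a)"
    have sum: "(\<Sum>a\<in>L. v a * \<kappa> a d) = (\<Sum>a\<in>L - {a0}. w a * (\<kappa> a d - \<kappa> a e / \<kappa> a0 e * \<kappa> a0 d))" for d
    proof -
      have "(\<Sum>a\<in>L. v a * \<kappa> a d) = v a0 * \<kappa> a0 d + (\<Sum>a\<in>L - {a0}. w a * \<kappa> a d)"
        using insert.prems(1) a0(1) by (subst sum.remove[of _ a0]) (auto simp: v_def intro!: sum.cong)
      also have "v a0 * \<kappa> a0 d = (\<Sum>a\<in>L - {a0}. - (w a * \<kappa> a e / \<kappa> a0 e) * \<kappa> a0 d)"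
        by (simp add: v_def sum_distrib_right sum_negf)
      finally show ?thesis
        by (simp add: algebra_simps flip: sum.distrib)
    qed
    show ?thesis
    proof (intro exI[of _ v] conjI ballI)
      show "\<exists>a\<in>L. v a \<noteq> 0"
        using w(1) by (auto simp: v_def)
      fix d assume "d \<in> insert e E"
      then show "(\<Sum>a\<in>L. v a * \<kappa> a d) = 0"
        unfolding sum using w(2) a0 by auto
    qed
  qed
qed

section \<open>Counting monomials on products of SL_2\<close>

type_synonym exponents = "nat \<times> nat \<times> nat \<times> nat"

definition block_monomial :: "exponents \<Rightarrow> 'k :: field ^ 2 ^ 2 \<Rightarrow> 'k" where
  "block_monomial = (\<lambda>(a, b, c, d) m. (m $ 1 $ 1) ^ a * (m $ 1 $ 2) ^ b * (m $ 2 $ 1) ^ c * (m $ 2 $ 2) ^ d)"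

definition monomial :: "nat \<Rightarrow> (nat \<Rightarrow> exponents) \<Rightarrow> (nat \<Rightarrow> 'k :: field ^ 2 ^ 2) \<Rightarrow> 'k" where
  "monomial n e m = (\<Prod>i<n. block_monomial (e i) (m i))"

definition block_exponents :: "nat \<Rightarrow> exponents set" where
  "block_exponents D = {(a, b, c, d). a \<le> D \<and> b \<le> D \<and> c \<le> D \<and> d \<le> D \<and> (a = 0 \<or> d = 0)}"

text \<open>
  Modulo the relation \<open>a d = 1 + b c\<close> on $\mathrm{SL}_2$, monomials divisible by \<open>a d\<close> are redundant. This
  is where the dimension 3 of $\mathrm{PGL}_2$, rather than 4, comes from.
\<close>

definition filtration :: "nat \<Rightarrow> nat \<Rightarrow> ((nat \<Rightarrow> 'k :: field ^ 2 ^ 2) \<Rightarrow> 'k) set" where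
  "filtration n D = {F. \<exists>w. \<forall>m. (\<forall>i. det (m i) = 1) \<longrightarrow>
     F m = (\<Sum>e\<in>{..<n} \<rightarrow>\<^sub>E block_exponents D. w e * monomial n e m)}"

lemma finite_block_exponents: "finite (block_exponents D)"
  and card_block_exponents: "card (block_exponents D) \<le> 2 * (D + 1) ^ 3"
proof -
  let ?A = "{0 :: nat} \<times> {..D} \<times> {..D} \<times> {..D}" and ?B = "{..D} \<times> {..D} \<times> {..D} \<times> {0 :: nat}"
  have sub: "block_exponents D \<subseteq> ?A \<union> ?B"
    by (auto simp: block_exponents_def)
  have fin: "finite (?A \<union> ?B)"
    by simp
  show "finite (block_exponents D)"
    using finite_subset[OF sub fin] .
  have "card (block_exponents D) \<le> card (?A \<union> ?B)"
    by (rule card_mono[OF fin sub])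
  also have "\<dots> \<le> card ?A + card ?B"
    by (rule card_Un_le)
  also have "\<dots> = 2 * (D + 1) ^ 3"
    by (simp add: card_cartesian_product power3_eq_cube)
  finally show "card (block_exponents D) \<le> 2 * (D + 1) ^ 3" .
qed

lemma finite_exponents: "finite ({..<n :: nat} \<rightarrow>\<^sub>E block_exponents D)"
  by (intro finite_PiE finite_block_exponents) simp

lemma filtration_mono_degree:
  assumes "D \<le> D'" "F \<in> filtration n D"
  shows "F \<in> filtration n D'"
proof -
  obtain w where w: "\<And>m. \<forall>i. det (m i) = 1 \<Longrightarrow>
     F m = (\<Sum>e\<in>{..<n} \<rightarrow>\<^sub>E block_exponents D. w e * monomial n e m)"
    using assms(2) unfolding filtration_def by blast
  have sub: "({..<n} \<rightarrow>\<^sub>E block_exponents D) \<subseteq> ({..<n} \<rightarrow>\<^sub>E block_exponents D')"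
    using assms(1) by (intro PiE_mono) (auto simp: block_exponents_def)
  show ?thesis
    unfolding filtration_def
  proof (intro CollectI exI allI impI)
    fix m :: "nat \<Rightarrow> 'a ^ 2 ^ 2" assume "\<forall>i. det (m i) = 1"
    then show "F m = (\<Sum>e\<in>{..<n} \<rightarrow>\<^sub>E block_exponents D'. (if e \<in> {..<n} \<rightarrow>\<^sub>E block_exponents D then w e else 0) * monomial n e m)"
      unfolding w[OF \<open>\<forall>i. det (m i) = 1\<close>] by (intro sum.mono_neutral_cong_left finite_exponents sub) auto
  qed
qed

lemma filtration_add:
  assumes "F \<in> filtration n D" "G \<in> filtration n D"
  shows "(\<lambda>m. F m + G m) \<in> filtration n D"
proof -
  obtain v w where "\<And>m. \<forall>i. det (m i) = 1 \<Longrightarrow> F m = (\<Sum>e\<in>{..<n} \<rightarrow>\<^sub>E block_exponents D. v e * monomial n e m)"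
    "\<And>m. \<forall>i. det (m i) = 1 \<Longrightarrow> G m = (\<Sum>e\<in>{..<n} \<rightarrow>\<^sub>E block_exponents D. w e * monomial n e m)"
    using assms unfolding filtration_def by blast
  then show ?thesis
    unfolding filtration_def
    by (intro CollectI exI[of _ "\<lambda>e. v e + w e"]) (simp add: sum.distrib distrib_right)
qed

lemma filtration_scale:
  assumes "F \<in> filtration n D"
  shows "(\<lambda>m. c * F m) \<in> filtration n D"
proof -
  obtain w where "\<And>m. \<forall>i. det (m i) = 1 \<Longrightarrow> F m = (\<Sum>e\<in>{..<n} \<rightarrow>\<^sub>E block_exponents D. w e * monomial n e m)"
    using assms unfolding filtration_def by blast
  then show ?thesis
    unfolding filtration_def
    by (intro CollectI exI[of _ "\<lambda>e. c * w e"]) (simp add: sum_distrib_left mult.assoc)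
qed

lemma filtration_cong:
  "F \<in> filtration n D \<Longrightarrow> (\<And>m. \<forall>i. det (m i) = 1 \<Longrightarrow> F m = G m) \<Longrightarrow> G \<in> filtration n D"
  unfolding filtration_def by simp

lemma filtration_monomial:
  assumes "e \<in> {..<n} \<rightarrow>\<^sub>E block_exponents D"
  shows "monomial n e \<in> filtration n D"
proof -
  have "(\<Sum>d\<in>{..<n} \<rightarrow>\<^sub>E block_exponents D. (if d = e then 1 else 0) * monomial n d m) = monomial n e m" for m :: "nat \<Rightarrow> 'a ^ 2 ^ 2"
    using assms finite_exponents by (simp add: if_distrib[of "\<lambda>x. x * _"] cong: if_cong)
  then show ?thesis
    unfolding filtration_def by (intro CollectI exI[of _ "\<lambda>d. if d = e then 1 else 0"]) simp
qed

lemma filtration_sum: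
  assumes "\<And>a. a \<in> A \<Longrightarrow> F a \<in> filtration n D"
  shows "(\<lambda>m. \<Sum>a\<in>A. F a m) \<in> filtration n D"
proof -
  have "(\<lambda>_. 0) \<in> filtration n D"
    unfolding filtration_def by (intro CollectI exI[of _ "\<lambda>_. 0"]) simp
  then show ?thesis
    using assms by (induction A rule: infinite_finite_induct) (auto intro: filtration_add)
qed

lemma monomial_upd:
  assumes "i < n"
  shows "monomial n (e(i := t)) m = block_monomial t (m i) * (\<Prod>j\<in>{..<n} - {i}. block_monomial (e j) (m j))"
  unfolding monomial_def using assms by (subst prod.remove[of _ i]) (auto intro!: arg_cong2[where f = "(*)"] prod.cong)

text \<open>The product of a monomial with an entry is a monomial of the allowed kind unless both
  diagonal entries occur. In that case the determinant relation replaces one factor of each by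
  \<open>1 + b c\<close>, which gives two allowed monomials with exponents raised by at most
  1.\<close>

lemma filtration_mult_entry:
  fixes F :: "(nat \<Rightarrow> 'k :: field ^ 2 ^ 2) \<Rightarrow> 'k"
  assumes F: "F \<in> filtration n D" and i: "i < n"
  shows "(\<lambda>m. m i $ j $ k * F m) \<in> filtration n (Suc D)"
proof -
  have entry: "(\<lambda>m :: nat \<Rightarrow> 'k ^ 2 ^ 2. m i $ j $ k * monomial n e m) \<in> filtration n (Suc D)"
    if e: "e \<in> {..<n} \<rightarrow>\<^sub>E block_exponents D" for e
  proof -
    obtain a b c d where abcd: "e i = (a, b, c, d)"
      by (metis prod_cases4)
    have ei: "(a, b, c, d) \<in> block_exponents D"
      using e i abcd by (metis PiE_mem lessThan_iff)
    have le: "a \<le> D" "b \<le> D" "c \<le> D" "d \<le> D" "a = 0 \<or> d = 0"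
      using ei by (auto simp: block_exponents_def)
    have mem: "e(i := t) \<in> {..<n} \<rightarrow>\<^sub>E block_exponents (Suc D)" if "t \<in> block_exponents (Suc D)" for t
    proof -
      have "block_exponents D \<subseteq> block_exponents (Suc D)"
        by (auto simp: block_exponents_def)
      then show ?thesis
        using e that i by (auto simp: PiE_iff extensional_def)
    qed
    define R where "R = (\<lambda>m :: nat \<Rightarrow> 'k ^ 2 ^ 2. \<Prod>j\<in>{..<n} - {i}. block_monomial (e j) (m j))"
    have R: "monomial n (e(i := t)) m = block_monomial t (m i) * R m" for t m
      using monomial_upd[OF i] by (simp add: R_def)
    have Re: "monomial n e m = block_monomial (a, b, c, d) (m i) * R m" for m
      using R[of "e i" m, unfolded fun_upd_triv] unfolding abcd .
    have one: "(\<lambda>m :: nat \<Rightarrow> 'k ^ 2 ^ 2. m i $ j $ k * monomial n e m) \<in> filtration n (Suc D)"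
      if "t \<in> block_exponents (Suc D)" "\<And>m :: 'k ^ 2 ^ 2. det m = 1 \<Longrightarrow> m $ j $ k * block_monomial (a, b, c, d) m = block_monomial t m" for t
    proof (rule filtration_cong[OF filtration_monomial[OF mem[OF that(1)]]])
      fix m :: "nat \<Rightarrow> 'k ^ 2 ^ 2" assume m: "\<forall>i. det (m i) = 1"
      show "monomial n (e(i := t)) m = m i $ j $ k * monomial n e m"
        unfolding R Re mult.assoc[symmetric] that(2)[OF m[rule_format]] ..
    qed
    have two: "(\<lambda>m :: nat \<Rightarrow> 'k ^ 2 ^ 2. m i $ j $ k * monomial n e m) \<in> filtration n (Suc D)"
      if "t \<in> block_exponents (Suc D)" "u \<in> block_exponents (Suc D)"
        "\<And>m :: 'k ^ 2 ^ 2. det m = 1 \<Longrightarrow> m $ j $ k * block_monomial (a, b, c, d) m = block_monomial t m + block_monomial u m" for t u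
    proof (rule filtration_cong[OF filtration_add[OF filtration_monomial[OF mem[OF that(1)]] filtration_monomial[OF mem[OF that(2)]]]])
      fix m :: "nat \<Rightarrow> 'k ^ 2 ^ 2" assume m: "\<forall>i. det (m i) = 1"
      show "monomial n (e(i := t)) m + monomial n (e(i := u)) m = m i $ j $ k * monomial n e m"
        unfolding R Re mult.assoc[symmetric] that(3)[OF m[rule_format]] by (simp add: distrib_right)
    qed
    have rel: "m $ 1 $ 1 * m $ 2 $ 2 = 1 + m $ 1 $ 2 * m $ 2 $ 1" if "det m = 1" for m :: "'k ^ 2 ^ 2"
      using that by (simp add: det_2 algebra_simps)
    consider "j = 1" "k = 1" | "j = 1" "k = 2" | "j = 2" "k = 1" | "j = 2" "k = 2"
      using exhaust_2[of j] exhaust_2[of k] by blast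
    then show ?thesis
    proof cases
      case 1
      show ?thesis
      proof (cases d)
        case 0
        show ?thesis
          by (rule one[of "(Suc a, b, c, d)"]) (use 0 1 le in \<open>auto simp: block_exponents_def block_monomial_def\<close>)
      next
        case (Suc d')
        show ?thesis
        proof (rule two[of "(0, b, c, d')" "(0, Suc b, Suc c, d')"])
          fix m :: "'k ^ 2 ^ 2" assume "det m = 1"
          have "m $ j $ k * block_monomial (a, b, c, d) m
             = (m $ 1 $ 1 * m $ 2 $ 2) * ((m $ 1 $ 2) ^ b * (m $ 2 $ 1) ^ c * (m $ 2 $ 2) ^ d')"
            using 1 Suc le(5) by (simp add: block_monomial_def mult_ac)
          then show "m $ j $ k * block_monomial (a, b, c, d) m = block_monomial (0, b, c, d') m + block_monomial (0, Suc b, Suc c, d') m"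
            unfolding rel[OF \<open>det m = 1\<close>] by (simp add: block_monomial_def algebra_simps)
        qed (use Suc le in \<open>auto simp: block_exponents_def\<close>)
      qed
    next
      case 2
      show ?thesis
        by (rule one[of "(a, Suc b, c, d)"]) (use 2 le in \<open>auto simp: block_exponents_def block_monomial_def mult_ac\<close>)
    next
      case 3
      show ?thesis
        by (rule one[of "(a, b, Suc c, d)"]) (use 3 le in \<open>auto simp: block_exponents_def block_monomial_def mult_ac\<close>)
    next
      case 4
      show ?thesis
      proof (cases a)
        case 0
        show ?thesis
          by (rule one[of "(a, b, c, Suc d)"]) (use 0 4 le in \<open>auto simp: block_exponents_def block_monomial_def mult_ac\<close>)
      next
        case (Suc a')
        show ?thesis
        proof (rule two[of "(a', b, c, 0)" "(a', Suc b, Suc c, 0)"])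
          fix m :: "'k ^ 2 ^ 2" assume "det m = 1"
          have "m $ j $ k * block_monomial (a, b, c, d) m
             = (m $ 1 $ 1 * m $ 2 $ 2) * ((m $ 1 $ 1) ^ a' * (m $ 1 $ 2) ^ b * (m $ 2 $ 1) ^ c)"
            using 4 Suc le(5) by (simp add: block_monomial_def mult_ac)
          then show "m $ j $ k * block_monomial (a, b, c, d) m = block_monomial (a', b, c, 0) m + block_monomial (a', Suc b, Suc c, 0) m"
            unfolding rel[OF \<open>det m = 1\<close>] by (simp add: block_monomial_def algebra_simps)
        qed (use Suc le in \<open>auto simp: block_exponents_def\<close>)
      qed
    qed
  qed
  obtain w where w: "\<And>m. \<forall>i. det (m i) = 1 \<Longrightarrow> F m = (\<Sum>e\<in>{..<n} \<rightarrow>\<^sub>E block_exponents D. w e * monomial n e m)"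
    using F unfolding filtration_def by blast
  have "(\<lambda>m. \<Sum>e\<in>{..<n} \<rightarrow>\<^sub>E block_exponents D. w e * (m i $ j $ k * monomial n e m)) \<in> filtration n (Suc D)"
    by (intro filtration_sum filtration_scale entry)
  then show ?thesis
    by (rule filtration_cong) (simp add: w sum_distrib_left mult.left_commute)
qed

text \<open>A bound \<open>c\<close> for the degree of \<open>F\<close>, stated through its action
  on the filtration. In this form it is additive under products, with no normal form of a product to
  compute.\<close>

definition multiplier :: "nat \<Rightarrow> nat \<Rightarrow> ((nat \<Rightarrow> 'k :: field ^ 2 ^ 2) \<Rightarrow> 'k) \<Rightarrow> bool" where
  "multiplier n c F \<longleftrightarrow> (\<forall>D. \<forall>G\<in>filtration n D. (\<lambda>m. F m * G m) \<in> filtration n (D + c))"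

lemma multiplierD: "multiplier n c F \<Longrightarrow> G \<in> filtration n D \<Longrightarrow> (\<lambda>m. F m * G m) \<in> filtration n (D + c)"
  unfolding multiplier_def by (drule spec, erule bspec)

lemma multiplier_mono: "multiplier n c F \<Longrightarrow> c \<le> d \<Longrightarrow> multiplier n d F"
  unfolding multiplier_def using filtration_mono_degree by (meson add_left_mono)

lemma multiplier_add:
  assumes "multiplier n c F" "multiplier n d G"
  shows "multiplier n (max c d) (\<lambda>m. F m + G m)"
  unfolding multiplier_def
proof (intro allI ballI)
  fix D and H :: "(nat \<Rightarrow> 'a ^ 2 ^ 2) \<Rightarrow> 'a" assume "H \<in> filtration n D"
  then have "(\<lambda>m. F m * H m) \<in> filtration n (D + max c d)" "(\<lambda>m. G m * H m) \<in> filtration n (D + max c d)"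
    using multiplier_mono[OF assms(1), of "max c d"] multiplier_mono[OF assms(2), of "max c d"]
    by (auto simp: multiplier_def)
  from filtration_add[OF this] show "(\<lambda>m. (F m + G m) * H m) \<in> filtration n (D + max c d)"
    by (simp add: distrib_right)
qed

lemma multiplier_mult:
  assumes "multiplier n c F" "multiplier n d G"
  shows "multiplier n (d + c) (\<lambda>m. F m * G m)"
  unfolding multiplier_def
proof (intro allI ballI)
  fix D and H :: "(nat \<Rightarrow> 'a ^ 2 ^ 2) \<Rightarrow> 'a" assume "H \<in> filtration n D"
  from multiplierD[OF assms(2) this]
  have "(\<lambda>m. G m * H m) \<in> filtration n (D + d)" .
  from multiplierD[OF assms(1) this]
  have "(\<lambda>m. F m * (G m * H m)) \<in> filtration n (D + d + c)" .
  then show "(\<lambda>m. F m * G m * H m) \<in> filtration n (D + (d + c))"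
    by (simp add: mult.assoc add.assoc)
qed

lemma multiplier_const: "multiplier n 0 (\<lambda>_. c)"
  by (simp add: multiplier_def filtration_scale)

lemma multiplier_power: "multiplier n c F \<Longrightarrow> multiplier n (k * c) (\<lambda>m. F m ^ k)"
proof (induction k)
  case (Suc k)
  then show ?case
    using multiplier_mult[OF Suc.prems Suc.IH] by (simp add: add.commute)
qed (simp add: multiplier_const)

lemma multiplier_cong:
  assumes "multiplier n c F" "\<And>m. \<forall>i. det (m i) = 1 \<Longrightarrow> F m = G m"
  shows "multiplier n c G"
  unfolding multiplier_def
proof (intro allI ballI)
  fix D and H :: "(nat \<Rightarrow> 'a ^ 2 ^ 2) \<Rightarrow> 'a" assume "H \<in> filtration n D"
  from multiplierD[OF assms(1) this]
  have "(\<lambda>m. F m * H m) \<in> filtration n (D + c)" .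
  then show "(\<lambda>m. G m * H m) \<in> filtration n (D + c)"
    by (rule filtration_cong) (simp add: assms(2))
qed

lemma multiplier_prod:
  "(\<And>a. a \<in> A \<Longrightarrow> multiplier n c (F a)) \<Longrightarrow> multiplier n (card A * c) (\<lambda>m. \<Prod>a\<in>A. F a m)"
proof (induction A rule: infinite_finite_induct)
  case (insert a A)
  then show ?case
    using multiplier_mult[of n c "F a" "card A * c" "\<lambda>m. \<Prod>a\<in>A. F a m"] by (simp add: add.commute)
qed (simp_all add: multiplier_const)

lemma ex_multiplier_regular:
  fixes f :: "(nat \<Rightarrow> ('k :: field ^ 2 ^ 2) set) \<Rightarrow> 'k"
  assumes "f \<in> regular_PGL2_power n"
  shows "\<exists>c. multiplier n c (\<lambda>m. f (tuple_class n m))"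
  using assms unfolding regular_PGL2_power_def
proof (induction rule: generated_algebra.induct)
  case (gen f)
  then obtain u i where u: "u \<in> regular_PGL2" "i < n" "f = (\<lambda>x. u (x i))"
    by blast
  then obtain h where h: "h \<in> regular_GL2" "\<And>m. invertible m \<Longrightarrow> u (pgl_class m) = h m"
    unfolding regular_PGL2_iff agrees_regular_GL2_def by metis
  have "\<exists>c. multiplier n c (\<lambda>m. h (m i))"
    using h(1) unfolding regular_GL2_def
  proof (induction rule: generated_algebra.induct)
    case (gen h)
    then consider "h = (\<lambda>m. inverse (det m))" | j k where "h = (\<lambda>m. m $ j $ k)"
      by blast
    then show ?case
    proof cases
      case 1
      then have "multiplier n 0 (\<lambda>m. h (m i))"
        by (intro multiplier_cong[OF multiplier_const[of n 1]]) simp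
      then show ?thesis
        by blast
    next
      case 2
      have "multiplier n 1 (\<lambda>m. h (m i))"
        unfolding multiplier_def 2
        by (intro allI ballI) (simp, rule filtration_mult_entry[OF _ u(2)], assumption)
      then show ?thesis
        by blast
    qed
  next
    case (const c)
    show ?case
      by (rule exI, rule multiplier_const)
  next
    case (add f g)
    then show ?case
      by (elim exE) (rule exI, rule multiplier_add)
  next
    case (mult f g)
    then show ?case
      by (elim exE) (rule exI, rule multiplier_mult)
  qed
  then obtain c where "multiplier n c (\<lambda>m. h (m i))"
    by blast
  then have "multiplier n c (\<lambda>m. f (tuple_class n m))"
    by (rule multiplier_cong) (simp add: u tuple_class_nth h(2) invertible_det_nz)
  then show ?case
    by blast
next
  case (const c)
  show ?case
    by (rule exI, rule multiplier_const)
next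
  case (add f g)
  then show ?case
    by (elim exE) (rule exI, rule multiplier_add)
next
  case (mult f g)
  then show ?case
    by (elim exE) (rule exI, rule multiplier_mult)
qed

text \<open>Scaling by a square root of the inverse determinant leads to SL_2, where the relation
  between monomials holds.\<close>

lemma carrier_PGL2_power_det_1:
  fixes x :: "nat \<Rightarrow> ('k :: alg_closed_field ^ 2 ^ 2) set"
  assumes "x \<in> carrier (PGL2_power n)"
  obtains m where "\<And>i. det (m i) = 1" "x = tuple_class n m"
proof -
  obtain m where m: "\<And>i. invertible (m i)" "x = tuple_class n m"
    using carrier_PGL2_powerE[OF assms] by blast
  have "\<exists>c. c ^ 2 = inverse (det (m i))" for i
    using nth_root_exists[of 2 "inverse (det (m i))"] by simp
  then obtain c where c: "\<And>i. c i ^ 2 = inverse (det (m i))"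
    by metis
  have c0: "c i \<noteq> 0" for i
    using c[of i] m(1)[of i] by (auto simp: invertible_det_nz)
  show ?thesis
  proof (rule that[of "\<lambda>i. mat (c i) ** m i"])
    show "det (mat (c i) ** m i) = 1" for i
      using m(1)[of i] by (simp add: det_scalar_mult c invertible_det_nz)
    show "x = tuple_class n (\<lambda>i. mat (c i) ** m i)"
      unfolding m(2) by (rule tuple_class_cong) (simp add: pgl_class_scalar c0)
  qed
qed

text \<open>Functions that witness the strictness of a chain of irreducible closed sets are
  algebraically independent on the largest one. A relation is expanded in powers of the last
  function, and its coefficients are relations one step further down the chain.\<close>

lemma chain_monomials_independent:
  fixes f :: "nat \<Rightarrow> (nat \<Rightarrow> ('k :: field ^ 2 ^ 2) set) \<Rightarrow> 'k"
  assumes f: "\<And>i. i < k \<Longrightarrow> f i \<in> regular_PGL2_power n"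
    and irred: "\<And>i g h. i \<le> k \<Longrightarrow> g \<in> regular_PGL2_power n \<Longrightarrow> h \<in> regular_PGL2_power n \<Longrightarrow>
      \<forall>x\<in>c i. g x * h x = 0 \<Longrightarrow> (\<forall>x\<in>c i. g x = 0) \<or> (\<forall>x\<in>c i. h x = 0)"
    and nonempty: "c 0 \<noteq> {}"
    and zero: "\<And>i x. i < k \<Longrightarrow> x \<in> c i \<Longrightarrow> f i x = 0"
    and nonzero: "\<And>i. i < k \<Longrightarrow> \<exists>x\<in>c (Suc i). f i x \<noteq> 0"
    and sub: "\<And>i. i < k \<Longrightarrow> c i \<subseteq> c (Suc i)"
    and w: "\<And>x. x \<in> c k \<Longrightarrow> (\<Sum>\<alpha>\<in>{..<k} \<rightarrow>\<^sub>E {..<N}. w \<alpha> * (\<Prod>i<k. f i x ^ \<alpha> i)) = 0"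
    and \<alpha>: "\<alpha> \<in> {..<k} \<rightarrow>\<^sub>E {..<N :: nat}"
  shows "w \<alpha> = 0"
  using assms
proof (induction k arbitrary: w \<alpha>)
  case 0
  then obtain x where "x \<in> c 0"
    by blast
  with 0(7)[OF this] show ?case
    using 0(8) by simp
next
  case (Suc k)
  \<comment> \<open>The coefficient of \<open>f k ^ l\<close> when the relation is sorted by powers
    of the last function.\<close>
  define Q where "Q = (\<lambda>l x. \<Sum>\<alpha>\<in>{..<k} \<rightarrow>\<^sub>E {..<N}. w (\<alpha>(k := l)) * (\<Prod>i<k. f i x ^ \<alpha> i))"
  have inj: "inj_on (\<lambda>(l, \<alpha>). \<alpha>(k := l)) ({..<N} \<times> ({..<k} \<rightarrow>\<^sub>E {..<N}))"
    using inj_combinator[of k "{..<k}" "\<lambda>_. {..<N}"] by simp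
  have expand: "(\<Sum>\<alpha>\<in>{..<Suc k} \<rightarrow>\<^sub>E {..<N}. w \<alpha> * (\<Prod>i<Suc k. f i x ^ \<alpha> i)) = (\<Sum>l<N. f k x ^ l * Q l x)" for x
  proof -
    have "(\<Sum>\<alpha>\<in>{..<Suc k} \<rightarrow>\<^sub>E {..<N}. w \<alpha> * (\<Prod>i<Suc k. f i x ^ \<alpha> i))
        = (\<Sum>(l, \<alpha>)\<in>{..<N} \<times> ({..<k} \<rightarrow>\<^sub>E {..<N}). w (\<alpha>(k := l)) * (\<Prod>i<Suc k. f i x ^ (\<alpha>(k := l)) i))"
      unfolding lessThan_Suc PiE_insert_eq
      by (subst sum.reindex[OF inj]) (simp add: o_def case_prod_unfold)
    also have "\<dots> = (\<Sum>l<N. \<Sum>\<alpha>\<in>{..<k} \<rightarrow>\<^sub>E {..<N}. w (\<alpha>(k := l)) * (\<Prod>i<Suc k. f i x ^ (\<alpha>(k := l)) i))"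
      by (rule sum.cartesian_product[symmetric])
    also have "\<dots> = (\<Sum>l<N. f k x ^ l * Q l x)"
    proof (rule sum.cong[OF refl])
      fix l
      have "(\<Prod>i<Suc k. f i x ^ (\<alpha>(k := l)) i) = f k x ^ l * (\<Prod>i<k. f i x ^ \<alpha> i)" for \<alpha>
        by (simp add: mult.commute)
      then show "(\<Sum>\<alpha>\<in>{..<k} \<rightarrow>\<^sub>E {..<N}. w (\<alpha>(k := l)) * (\<Prod>i<Suc k. f i x ^ (\<alpha>(k := l)) i)) = f k x ^ l * Q l x"
        by (simp add: Q_def sum_distrib_left mult.left_commute del: prod.lessThan_Suc)
    qed
    finally show ?thesis .
  qed
  have Qreg: "Q l \<in> regular_PGL2_power n" for l
  proof -
    have "(\<lambda>x. \<Prod>i\<in>I. f i x ^ \<alpha> i) \<in> regular_PGL2_power n" if "I \<subseteq> {..<k}" for \<alpha> I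
      using finite_subset[OF that finite_lessThan] that
      by (induction I rule: finite_induct)
        (simp_all add: regular_PGL2_power_intros regular_PGL2_power_power Suc.prems(1))
    then show ?thesis
      unfolding Q_def by (intro regular_PGL2_power_sum regular_PGL2_power_intros) auto
  qed
  \<comment> \<open>Lowest powers first: when the lower coefficients are zero, primality on
    \<open>c (Suc k)\<close> cancels the factor \<open>f k ^ l\<close>, and on \<open>c k\<close>,
    where \<open>f k\<close> vanishes, only \<open>Q l\<close> remains. The induction hypothesis for
    the shorter chain then applies to \<open>Q l\<close>.\<close>
  have coeff0: "\<forall>\<alpha>\<in>{..<k} \<rightarrow>\<^sub>E {..<N}. w (\<alpha>(k := l)) = 0" if "l < N" for l
    using that
  proof (induction l rule: less_induct)
    case (less l)
    have Q0: "Q j x = 0" if "j < l" for j x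
      using less.IH[OF that] less.prems that by (simp add: Q_def del: fun_upd_apply)
    define R where "R = (\<lambda>x. \<Sum>j\<in>{Suc l..<N}. f k x ^ (j - Suc l) * Q j x)"
    have split: "(\<Sum>j<N. f k x ^ j * Q j x) = f k x ^ l * (Q l x + f k x * R x)" for x
    proof -
      have "(\<Sum>j<N. f k x ^ j * Q j x) = (\<Sum>j<l. f k x ^ j * Q j x) + (\<Sum>j\<in>{l..<N}. f k x ^ j * Q j x)"
        using sum.atLeastLessThan_concat[of 0 l N "\<lambda>j. f k x ^ j * Q j x"] less.prems
        by (simp add: atLeast0LessThan)
      also have "(\<Sum>j\<in>{l..<N}. f k x ^ j * Q j x) = f k x ^ l * Q l x + (\<Sum>j\<in>{Suc l..<N}. f k x ^ j * Q j x)"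
        using less.prems by (rule sum.atLeast_Suc_lessThan)
      also have "(\<Sum>j\<in>{Suc l..<N}. f k x ^ j * Q j x) = f k x ^ Suc l * R x"
        unfolding R_def sum_distrib_left by (intro sum.cong refl) (simp flip: power_Suc power_add mult.assoc)
      finally show ?thesis
        by (simp add: Q0 algebra_simps)
    qed
    have prod0: "\<forall>x\<in>c (Suc k). f k x ^ l * (Q l x + f k x * R x) = 0"
    proof
      fix x assume "x \<in> c (Suc k)"
      from Suc.prems(7)[OF this] show "f k x ^ l * (Q l x + f k x * R x) = 0"
        unfolding expand split .
    qed
    have Rreg: "R \<in> regular_PGL2_power n"
      unfolding R_def by (intro regular_PGL2_power_sum regular_PGL2_power_intros regular_PGL2_power_power Qreg Suc.prems(1)) simp
    have fk: "f k \<in> regular_PGL2_power n"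
      by (rule Suc.prems(1)) simp
    have "(\<forall>x\<in>c (Suc k). f k x ^ l = 0) \<or> (\<forall>x\<in>c (Suc k). Q l x + f k x * R x = 0)"
      by (rule Suc.prems(2)[OF order_refl regular_PGL2_power_power[OF fk]
          regular_PGL2_power_intros(3)[OF Qreg regular_PGL2_power_intros(4)[OF fk Rreg]] prod0])
    moreover obtain x0 where "x0 \<in> c (Suc k)" "f k x0 \<noteq> 0"
      using Suc.prems(5)[of k] by blast
    ultimately have sum0: "\<forall>x\<in>c (Suc k). Q l x + f k x * R x = 0"
      by force
    have "Q l x = 0" if "x \<in> c k" for x
    proof -
      have "x \<in> c (Suc k)" "f k x = 0"
        using Suc.prems(6)[of k] Suc.prems(4)[of k x] that by auto
      then show ?thesis
        using sum0 by auto
    qed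
    note Ql = this
    show ?case
    proof
      fix \<alpha> assume \<alpha>: "\<alpha> \<in> {..<k} \<rightarrow>\<^sub>E {..<N}"
      show "w (\<alpha>(k := l)) = 0"
        by (rule Suc.IH[of "\<lambda>\<alpha>. w (\<alpha>(k := l))"])
          (use Suc.prems(1-6) Ql \<alpha> in \<open>auto simp: Q_def less_Suc_eq simp del: fun_upd_apply\<close>)
    qed
  qed
  obtain l \<beta> where "l < N" "\<beta> \<in> {..<k} \<rightarrow>\<^sub>E {..<N}" "\<alpha> = \<beta>(k := l)"
    using Suc.prems(8) unfolding lessThan_Suc PiE_insert_eq by auto
  then show ?case
    using coeff0 by blast
qed

lemma const_1_filtration: "(\<lambda>_. 1) \<in> filtration n 0"
proof -
  have "(\<lambda>i\<in>{..<n}. (0, 0, 0, 0)) \<in> {..<n} \<rightarrow>\<^sub>E block_exponents 0"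
    by (auto simp: block_exponents_def)
  from filtration_monomial[OF this] show ?thesis
    by (rule filtration_cong) (simp add: monomial_def block_monomial_def)
qed

text \<open>A chain of length \<open>k\<close> provides \<open>N ^ k\<close> independent monomials
  of degree at most linear in \<open>N\<close>, while the filtration step of that degree has
  dimension at most a constant times \<open>N ^ (3 * n)\<close>. For large \<open>N\<close> this
  forces \<open>k \<le> 3 * n\<close>.\<close>

theorem algebraic_dim_PGL2_power_le:
  "algebraic_dim (PGL2_power n) (regular_PGL2_power n :: ((nat \<Rightarrow> ('k :: alg_closed_field ^ 2 ^ 2) set) \<Rightarrow> 'k) set)
     \<le> enat (3 * n)"
  unfolding algebraic_dim_def krull_dim_def
proof (rule Sup_least)
  let ?G = "PGL2_power n :: (nat \<Rightarrow> ('k ^ 2 ^ 2) set) monoid"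
  let ?A = "regular_PGL2_power n :: ((nat \<Rightarrow> ('k ^ 2 ^ 2) set) \<Rightarrow> 'k) set"
  let ?cl = "closedin (zariski_topology ?G ?A)"
  fix e assume "e \<in> {enat k | k. \<exists>c :: nat \<Rightarrow> (nat \<Rightarrow> ('k ^ 2 ^ 2) set) set.
            (\<forall>i\<le>k. irreducible_in ?cl (\<subseteq>) (c i) \<and> c i \<subseteq> carrier ?G) \<and>
            (\<forall>i<k. c i \<subseteq> c (Suc i) \<and> \<not> c (Suc i) \<subseteq> c i)}"
  then obtain k c where e: "e = enat k"
    and c': "\<forall>i\<le>k. irreducible_in ?cl (\<subseteq>) (c i) \<and> c i \<subseteq> carrier ?G"
    and chain': "\<forall>i<k. c i \<subseteq> c (Suc i) \<and> \<not> c (Suc i) \<subseteq> c i"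
    by (elim CollectE exE conjE) (rule that)
  have c: "irreducible_in ?cl (\<subseteq>) (c i)" "c i \<subseteq> carrier ?G" if "i \<le> k" for i
    using c'[rule_format, OF that] by (rule conjunct1, rule conjunct2)
  have chain: "c i \<subseteq> c (Suc i)" "\<not> c (Suc i) \<subseteq> c i" if "i < k" for i
    using chain'[rule_format, OF that] by (rule conjunct1, rule conjunct2)
  have closed: "?cl (c i)" and nonempty: "c i \<noteq> {}" if "i \<le> k" for i
    using c(1)[OF that] by (auto simp: irreducible_in_def)
  have irred: "(\<forall>x\<in>c i. g x = 0) \<or> (\<forall>x\<in>c i. h x = 0)"
    if i: "i \<le> k" and gh: "g \<in> ?A" "h \<in> ?A" and prod: "\<forall>x\<in>c i. g x * h x = 0" for i g h
  proof -
    have cl: "?cl {x \<in> carrier ?G. f x = 0}" if "f \<in> ?A" for f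
      unfolding zariski_closed_PGL2_power using that by auto
    have "c i \<subseteq> {x \<in> carrier ?G. g x = 0} \<union> {x \<in> carrier ?G. h x = 0}"
      using prod c(2)[OF i] by auto
    then have "c i \<subseteq> {x \<in> carrier ?G. g x = 0} \<or> c i \<subseteq> {x \<in> carrier ?G. h x = 0}"
      using c(1)[OF i] cl[OF gh(1)] cl[OF gh(2)] unfolding irreducible_in_def by blast
    then show ?thesis
      by blast
  qed
  have "\<forall>i. \<exists>f. i < k \<longrightarrow> f \<in> ?A \<and> (\<forall>x\<in>c i. f x = 0) \<and> (\<exists>x\<in>c (Suc i). f x \<noteq> 0)"
  proof
    fix i
    show "\<exists>f. i < k \<longrightarrow> f \<in> ?A \<and> (\<forall>x\<in>c i. f x = 0) \<and> (\<exists>x\<in>c (Suc i). f x \<noteq> 0)"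
    proof (cases "i < k")
      case True
      then obtain x where x: "x \<in> c (Suc i)" "x \<notin> c i"
        using chain(2) by blast
      have "x \<in> carrier ?G"
        using c(2)[of "Suc i"] True x(1) by auto
      then have "x \<in> carrier ?G - c i"
        using x(2) by simp
      moreover have "\<forall>x\<in>carrier ?G - c i. \<exists>f\<in>?A. f x \<noteq> 0 \<and> (\<forall>y\<in>c i. f y = 0)"
        using closed[of i] True unfolding zariski_closed_PGL2_power by simp
      ultimately obtain f where "f \<in> ?A" "f x \<noteq> 0" "\<forall>y\<in>c i. f y = 0"
        by blast
      then show ?thesis
        using x(1) by blast
    qed simp
  qed
  then obtain f where f: "\<And>i. i < k \<Longrightarrow> f i \<in> ?A" "\<And>i x. i < k \<Longrightarrow> x \<in> c i \<Longrightarrow> f i x = 0"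
    "\<And>i. i < k \<Longrightarrow> \<exists>x\<in>c (Suc i). f i x \<noteq> 0"
    by metis
  have "\<forall>i\<in>{..<k}. \<exists>d. multiplier n d (\<lambda>m. f i (tuple_class n m))"
    using ex_multiplier_regular f(1) by blast
  from bchoice[OF this] obtain d where d: "\<And>i. i < k \<Longrightarrow> multiplier n (d i) (\<lambda>m. f i (tuple_class n m))"
    by blast
  define C where "C = (\<Sum>i<k. d i)"
  have C: "multiplier n C (\<lambda>m. f i (tuple_class n m))" if "i < k" for i
    by (rule multiplier_mono[OF d[OF that]]) (use that in \<open>auto simp: C_def intro: member_le_sum\<close>)
  have bound: "N ^ k \<le> (2 * (k * (N * C) + 1) ^ 3) ^ n" for N
  proof (rule ccontr)
    assume N: "\<not> N ^ k \<le> (2 * (k * (N * C) + 1) ^ 3) ^ n"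
    \<comment> \<open>A monomial is a product of \<open>k\<close> powers, each with exponent below
      \<open>N\<close>, of functions of degree at most \<open>C\<close>.\<close>
    define D where "D = k * (N * C)"
    let ?L = "{..<k} \<rightarrow>\<^sub>E {..<N}" and ?E = "{..<n} \<rightarrow>\<^sub>E block_exponents D"
    have "\<exists>\<kappa>. \<forall>m. (\<forall>i. det (m i) = 1) \<longrightarrow>
       (\<Prod>i<k. f i (tuple_class n m) ^ \<alpha> i) = (\<Sum>e\<in>?E. \<kappa> e * monomial n e m)" if "\<alpha> \<in> ?L" for \<alpha>
    proof -
      have "multiplier n (card {..<k} * (N * C)) (\<lambda>m. \<Prod>i<k. f i (tuple_class n m) ^ \<alpha> i)"
      proof (rule multiplier_prod)
        fix i assume i: "i \<in> {..<k}"
        then have "\<alpha> i < N"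
          using that by (auto simp: PiE_iff)
        then show "multiplier n (N * C) (\<lambda>m. f i (tuple_class n m) ^ \<alpha> i)"
          using i by (intro multiplier_mono[OF multiplier_power[OF C]]) auto
      qed
      from multiplierD[OF this const_1_filtration]
      have "(\<lambda>m. \<Prod>i<k. f i (tuple_class n m) ^ \<alpha> i) \<in> filtration n D"
        by (simp add: D_def)
      then show ?thesis
        unfolding filtration_def by blast
    qed
    then have "\<forall>\<alpha>\<in>?L. \<exists>\<kappa>. \<forall>m. (\<forall>i. det (m i) = 1) \<longrightarrow>
       (\<Prod>i<k. f i (tuple_class n m) ^ \<alpha> i) = (\<Sum>e\<in>?E. \<kappa> e * monomial n e m)"
      by blast
    from bchoice[OF this] obtain \<kappa> where \<kappa>: "\<And>\<alpha> m. \<alpha> \<in> ?L \<Longrightarrow> \<forall>i. det (m i) = 1 \<Longrightarrow>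
       (\<Prod>i<k. f i (tuple_class n m) ^ \<alpha> i) = (\<Sum>e\<in>?E. \<kappa> \<alpha> e * monomial n e m)"
      by blast
    have "card ?E \<le> (2 * (D + 1) ^ 3) ^ n"
      unfolding card_PiE[OF finite_lessThan] using power_mono[OF card_block_exponents[of D], of n] by simp
    then have "card ?E < card ?L"
      using N by (simp add: card_PiE D_def)
    moreover have "finite ?L"
      by (intro finite_PiE) auto
    ultimately have "\<exists>w. (\<exists>\<alpha>\<in>?L. w \<alpha> \<noteq> 0) \<and> (\<forall>e\<in>?E. (\<Sum>\<alpha>\<in>?L. w \<alpha> * \<kappa> \<alpha> e) = 0)"
      by (intro ex_linear_dependence finite_exponents)
    then obtain w where w: "\<exists>\<alpha>\<in>?L. w \<alpha> \<noteq> 0" "\<forall>e\<in>?E. (\<Sum>\<alpha>\<in>?L. w \<alpha> * \<kappa> \<alpha> e) = 0"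
      by (elim exE conjE) (rule that)
    have zero: "(\<Sum>\<alpha>\<in>?L. w \<alpha> * (\<Prod>i<k. f i x ^ \<alpha> i)) = 0" if "x \<in> c k" for x
    proof -
      have "x \<in> carrier ?G"
        using c(2)[OF order_refl] that by blast
      then obtain m where m: "\<And>i. det (m i) = 1" "x = tuple_class n m"
        by (rule carrier_PGL2_power_det_1) (rule that)
      have "(\<Sum>\<alpha>\<in>?L. w \<alpha> * (\<Prod>i<k. f i x ^ \<alpha> i)) = (\<Sum>\<alpha>\<in>?L. \<Sum>e\<in>?E. w \<alpha> * \<kappa> \<alpha> e * monomial n e m)"
        unfolding m(2) using m(1) by (intro sum.cong refl) (simp add: \<kappa> sum_distrib_left mult.assoc)
      also have "\<dots> = (\<Sum>e\<in>?E. (\<Sum>\<alpha>\<in>?L. w \<alpha> * \<kappa> \<alpha> e) * monomial n e m)"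
        by (subst sum.swap) (simp add: sum_distrib_right)
      also have "\<dots> = 0"
        using w(2) by (intro sum.neutral) simp
      finally show ?thesis .
    qed
    have "w \<alpha> = 0" if "\<alpha> \<in> ?L" for \<alpha>
      by (rule chain_monomials_independent[where k = k and f = f and n = n and c = c and N = N and w = w, OF f(1) irred nonempty f(2,3) chain(1) zero that]) simp_all
    then show False
      using w(1) by blast
  qed
  have "k \<le> 3 * n"
  proof (rule ccontr)
    assume k: "\<not> k \<le> 3 * n"
    \<comment> \<open>The part of the bound that does not depend on \<open>N\<close>; the choice
      \<open>N = K + 1\<close> then contradicts
      \<open>N ^ (3 * n + 1) \<le> K * N ^ (3 * n)\<close>.\<close>
    define K where "K = 2 ^ n * (k * C + 1) ^ (3 * n)"
    define N where "N = Suc K"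
    have "k * (N * C) + 1 \<le> N * (k * C + 1)"
      by (simp add: N_def algebra_simps)
    then have "(2 * (k * (N * C) + 1) ^ 3) ^ n \<le> (2 * (N * (k * C + 1)) ^ 3) ^ n"
      by (intro power_mono mult_left_mono) auto
    also have "\<dots> = K * N ^ (3 * n)"
    proof -
      have "(2 * (N * M) ^ 3) ^ n = 2 ^ n * M ^ (3 * n) * N ^ (3 * n)" for M
        by (simp only: power_mult_distrib power_mult) (simp only: ac_simps)
      then show ?thesis
        unfolding K_def .
    qed
    finally have "N ^ k \<le> K * N ^ (3 * n)"
      using bound[of N] by linarith
    moreover have "N ^ Suc (3 * n) \<le> N ^ k"
      using k by (intro power_increasing) (auto simp: N_def)
    ultimately have "N ^ Suc (3 * n) \<le> K * N ^ (3 * n)"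
      by (rule order_trans[rotated])
    then show False
      by (simp add: N_def)
  qed
  then show "e \<le> enat (3 * n)"
    by (simp add: e)
qed

section \<open>Coordinates near the identity\<close>

definition coords :: "nat \<Rightarrow> (nat \<times> 2 \<times> 2) set" where
  "coords n = {..<n} \<times> UNIV"

definition near_matrix :: "(nat \<times> 2 \<times> 2 \<Rightarrow> 'k) \<Rightarrow> nat \<Rightarrow> 'k :: field ^ 2 ^ 2" where
  "near_matrix X i = (\<chi> j k. (if j = k then 1 else 0) + X (i, j, k))"

abbreviation near_point :: "nat \<Rightarrow> (nat \<times> 2 \<times> 2 \<Rightarrow> 'k :: field) \<Rightarrow> nat \<Rightarrow> ('k ^ 2 ^ 2) set" where
  "near_point n X \<equiv> tuple_class n (near_matrix X)"

lemma finite_coords [simp]: "finite (coords n)"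
  by (simp add: coords_def)

lemma coords_iff [simp]: "(i, j, k) \<in> coords n \<longleftrightarrow> i < n"
  by (simp add: coords_def)

lemma near_matrix_nth: "near_matrix X i $ j $ k = (if j = k then 1 else 0) + X (i, j, k)"
  by (simp add: near_matrix_def)

lemma near_matrix_0: "near_matrix (\<lambda>_. 0) i = mat 1"
  by (rule mat2_eqI) (simp_all add: near_matrix_nth mat_nth)

lemma near_point_0: "near_point n (\<lambda>_. 0) = \<one>\<^bsub>PGL2_power n\<^esub>"
  unfolding one_PGL2_power by (rule tuple_class_cong) (simp add: near_matrix_0)

lemma det_near_matrix:
  fixes X :: "nat \<times> 2 \<times> 2 \<Rightarrow> 'k :: {field, ultrametric_field}"
  assumes X: "X \<in> polydisc (coords n) r" and r: "r < 1" and i: "i < n"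
  shows "vabs (det (near_matrix X i) - 1) \<le> r"
proof -
  have le: "vabs (X (i, j, k)) \<le> r" for j k
    using polydiscD[OF X, of "(i, j, k)"] i by simp
  have r0: "r \<ge> 0"
    using le[of 1 1] vabs_ge_0 order_trans by blast
  have le2: "vabs (X (i, j, k) * X (i, j', k')) \<le> r" for j k j' k'
    using mult_mono[OF le[of j k] order_trans[OF le[of j' k'] less_imp_le[OF r]]] r0 by (simp add: vabs_mult)
  have "det (near_matrix X i) - 1 = X (i, 1, 1) + X (i, 2, 2) + X (i, 1, 1) * X (i, 2, 2) - X (i, 1, 2) * X (i, 2, 1)"
    by (simp add: det_2 near_matrix_nth algebra_simps)
  also have "vabs \<dots> \<le> r"
    by (rule vabs_diff_le[OF vabs_add_le[OF vabs_add_le[OF le le] le2] le2])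
  finally show ?thesis .
qed

lemma invertible_near_matrix:
  fixes X :: "nat \<times> 2 \<times> 2 \<Rightarrow> 'k :: {field, ultrametric_field}"
  assumes "X \<in> polydisc (coords n) r" "r < 1" "i < n"
  shows "invertible (near_matrix X i)" "vabs (det (near_matrix X i)) = 1"
proof -
  show v: "vabs (det (near_matrix X i)) = 1"
    using det_near_matrix[OF assms] assms(2) by (intro vabs_eq_1I) simp
  show "invertible (near_matrix X i)"
    unfolding invertible_det_nz using v by auto
qed

lemma near_point_in_carrier:
  fixes X :: "nat \<times> 2 \<times> 2 \<Rightarrow> 'k :: {field, ultrametric_field}"
  shows "X \<in> polydisc (coords n) r \<Longrightarrow> r < 1 \<Longrightarrow> near_point n X \<in> carrier (PGL2_power n)"
  by (intro tuple_class_in_carrier invertible_near_matrix)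

text \<open>The coordinates of the product \<open>(1 + X) (1 + Y)\<close>. They are affine in either
  argument, as \<open>local_group\<close> requires.\<close>

definition near_mult :: "(nat \<times> 2 \<times> 2 \<Rightarrow> 'k :: field) \<Rightarrow> (nat \<times> 2 \<times> 2 \<Rightarrow> 'k) \<Rightarrow> nat \<times> 2 \<times> 2 \<Rightarrow> 'k" where
  "near_mult X Y = (\<lambda>(i, j, k). X (i, j, k) + Y (i, j, k) + (X (i, j, 1) * Y (i, 1, k) + X (i, j, 2) * Y (i, 2, k)))"

definition near_inv :: "(nat \<times> 2 \<times> 2 \<Rightarrow> 'k :: field) \<Rightarrow> nat \<times> 2 \<times> 2 \<Rightarrow> 'k" where
  "near_inv X = (\<lambda>(i, j, k). inv2 (near_matrix X i) $ j $ k - (if j = k then 1 else 0))"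

lemma near_matrix_mult: "near_matrix (near_mult X Y) i = near_matrix X i ** near_matrix Y i"
  by (rule mat2_eqI) (simp_all add: mult2_nth near_matrix_nth near_mult_def algebra_simps)

lemma near_matrix_inv: "near_matrix (near_inv X) i = inv2 (near_matrix X i)"
  by (rule mat2_eqI) (simp_all add: near_matrix_nth near_inv_def)

lemma near_mult_polydisc:
  fixes X :: "nat \<times> 2 \<times> 2 \<Rightarrow> 'k :: {field, ultrametric_field}"
  assumes X: "X \<in> polydisc (coords n) r" and Y: "Y \<in> polydisc (coords n) r" and r: "r \<le> 1"
  shows "near_mult X Y \<in> polydisc (coords n) r"
proof (rule polydiscI)
  fix z assume z: "z \<in> coords n"
  obtain i j k where ijk: "z = (i, j, k)"
    by (cases z) auto
  with z have i: "i < n"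
    by simp
  have le: "vabs (X (i, j, k)) \<le> r" "vabs (Y (i, j, k)) \<le> r" for j k
    using polydiscD[OF X, of "(i, j, k)"] polydiscD[OF Y, of "(i, j, k)"] i by simp_all
  have r0: "r \<ge> 0"
    using le(1)[of 1 1] vabs_ge_0 order_trans by blast
  have le2: "vabs (X (i, j, k) * Y (i, j', k')) \<le> r" for j k j' k'
    using mult_mono[OF le(1)[of j k] order_trans[OF le(2)[of j' k'] r]] r0 by (simp add: vabs_mult)
  show "vabs (near_mult X Y z) \<le> r"
    unfolding ijk near_mult_def by (simp add: vabs_add_le le le2)
qed

lemma near_inv_polydisc:
  fixes X :: "nat \<times> 2 \<times> 2 \<Rightarrow> 'k :: {field, ultrametric_field}"
  assumes X: "X \<in> polydisc (coords n) r" and r: "r < 1"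
  shows "near_inv X \<in> polydisc (coords n) r"
proof (rule polydiscI)
  fix z assume z: "z \<in> coords n"
  obtain i j k where ijk: "z = (i, j, k)"
    by (cases z) auto
  with z have i: "i < n"
    by simp
  define D where "D = det (near_matrix X i)"
  have D: "vabs D = 1" "vabs (D - 1) \<le> r" "D \<noteq> 0"
    using invertible_near_matrix[OF X r i] det_near_matrix[OF X r i] by (auto simp: D_def)
  have le: "vabs (X (i, j, k)) \<le> r" for j k
    using polydiscD[OF X, of "(i, j, k)"] i by simp
  have diag: "vabs (inverse D * (1 + X (i, j, j)) - 1) \<le> r" for j
  proof -
    have "inverse D * (1 + X (i, j, j)) - 1 = inverse D * (X (i, j, j) - (D - 1))"
      using D(3) by (simp add: field_simps)
    also have "vabs \<dots> \<le> r"
      using vabs_diff_le[OF le D(2)] by (simp add: vabs_mult vabs_inverse D(1))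
    finally show ?thesis .
  qed
  have off: "vabs (- (inverse D * X (i, j, k))) \<le> r" for j k
    using le[of j k] by (simp add: vabs_mult vabs_inverse D(1))
  show "vabs (near_inv X z) \<le> r"
    unfolding ijk near_inv_def
    using exhaust_2[of j] exhaust_2[of k] diag off
    by (auto simp: inv2_def near_matrix_nth simp flip: D_def)
qed

lemma near_point_mult:
  fixes X :: "nat \<times> 2 \<times> 2 \<Rightarrow> 'k :: {field, ultrametric_field}"
  assumes "X \<in> polydisc (coords n) r" "Y \<in> polydisc (coords n) r" "r < 1"
  shows "near_point n (near_mult X Y) = near_point n X \<otimes>\<^bsub>PGL2_power n\<^esub> near_point n Y"
  using assms by (subst mult_PGL2_power) (auto simp: near_matrix_mult intro: tuple_class_cong invertible_near_matrix)

lemma near_point_inv: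
  fixes X :: "nat \<times> 2 \<times> 2 \<Rightarrow> 'k :: {field, ultrametric_field}"
  assumes "X \<in> polydisc (coords n) r" "r < 1"
  shows "near_point n (near_inv X) = inv\<^bsub>PGL2_power n\<^esub> (near_point n X)"
  using assms by (subst inv_PGL2_power) (auto simp: near_matrix_inv intro: tuple_class_cong invertible_near_matrix)

section \<open>Analytic functions and germs\<close>

context nonarch_field
begin

text \<open>Determinants within \<open>\<theta> < 1\<close> of 1 turn the inverse determinant into a
  geometric series; everything else is polynomial in the entries.\<close>

lemma regular_convergent:
  fixes f :: "(nat \<Rightarrow> ('k ^ 2 ^ 2) set) \<Rightarrow> 'k"
  assumes f: "f \<in> regular_PGL2_power n"
    and m: "\<And>i j k. i < n \<Longrightarrow> (\<lambda>t. m t i $ j $ k) \<in> convergent_on W s"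
    and det: "\<And>i t. i < n \<Longrightarrow> t \<in> polydisc W s \<Longrightarrow> vabs (det (m t i) - 1) \<le> \<theta>"
    and \<theta>: "\<theta> < 1" and s: "s \<ge> 0"
  shows "(\<lambda>t. f (tuple_class n (m t))) \<in> convergent_on W s"
  using f unfolding regular_PGL2_power_def
proof (induction rule: generated_algebra.induct)
  case (const c)
  show ?case
    by (rule tate_const)
next
  case (gen f)
  then obtain u i where u: "u \<in> regular_PGL2" "i < n" "f = (\<lambda>x. u (x i))"
    by blast
  then obtain h where h: "h \<in> regular_GL2" "\<And>m. invertible m \<Longrightarrow> u (pgl_class m) = h m"
    unfolding regular_PGL2_iff agrees_regular_GL2_def by metis
  have detT: "(\<lambda>t. det (m t i)) \<in> convergent_on W s"
    unfolding det_2 by (intro tate_diff tate_mult m u(2) s)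
  have "(\<lambda>t. h (m t i)) \<in> convergent_on W s"
    using h(1) unfolding regular_GL2_def
  proof (induction rule: generated_algebra.induct)
    case (const c)
    show ?case
      by (rule tate_const)
  next
    case (gen h)
    then consider "h = (\<lambda>m. inverse (det m))" | j k where "h = (\<lambda>m. m $ j $ k)"
      by blast
    then show ?case
    proof cases
      case 1
      show ?thesis
        unfolding 1 by (rule tate_inverse[OF detT det[OF u(2)] \<theta> s])
    next
      case 2
      show ?thesis
        unfolding 2 by (rule m[OF u(2)])
    qed
  next
    case (add f g)
    show ?case
      by (rule tate_add[OF add.IH])
  next
    case (mult f g)
    show ?case
      by (rule tate_mult[OF mult.IH s])
  qed
  then show ?case
  proof (rule tate_cong)
    fix t :: "'a \<Rightarrow> 'k" assume t: "t \<in> polydisc W s"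
    have "vabs (det (m t i)) = 1"
      using det[OF u(2) t] \<theta> by (intro vabs_eq_1I) simp
    then have "invertible (m t i)"
      unfolding invertible_det_nz by auto
    then show "h (m t i) = f (tuple_class n (m t))"
      by (simp add: u(3) tuple_class_nth[OF u(2)] h(2))
  qed
next
  case (add f g)
  show ?case
    by (rule tate_add[OF add.IH])
next
  case (mult f g)
  show ?case
    by (rule tate_mult[OF mult.IH s])
qed

lemma regular_near_point_convergent:
  fixes f :: "(nat \<Rightarrow> ('k ^ 2 ^ 2) set) \<Rightarrow> 'k"
  assumes "f \<in> regular_PGL2_power n" "0 \<le> r" "r < 1"
  shows "(\<lambda>X. f (near_point n X)) \<in> convergent_on (coords n) r"
proof (rule regular_convergent[OF assms(1) _ _ assms(3,2)])
  show "(\<lambda>X. near_matrix X i $ j $ k) \<in> convergent_on (coords n) r" if "i < n" for i j k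
    unfolding near_matrix_nth using that by (intro tate_add tate_const tate_var) simp
  show "vabs (det (near_matrix X i) - 1) \<le> r" if "i < n" "X \<in> polydisc (coords n) r" for i and X :: "nat \<times> 2 \<times> 2 \<Rightarrow> 'k"
    using det_near_matrix[OF that(2) assms(3) that(1)] .
qed

lemma small_values:
  fixes F :: "('j \<Rightarrow> 'k) \<Rightarrow> 'k"
  assumes F: "F \<in> convergent_on W s" and W: "finite W" and s: "radius s" and e: "e > 0"
  obtains r where "radius r" "r \<le> s" "\<And>x. x \<in> polydisc W r \<Longrightarrow> vabs (F x - F (\<lambda>_. 0)) < e"
proof -
  define \<phi> where "\<phi> = (\<lambda>x (_ :: unit). F x - F (\<lambda>_. 0))"
  obtain r where r: "radius r" "r \<le> s" "r < 1" "\<And>x. x \<in> polydisc W r \<Longrightarrow> \<phi> x \<in> polydisc {()} (e / 2)"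
  proof (rule tate_map_continuous_0[of "{()}" \<phi> W s "e / 2" 1])
    show "(\<lambda>t. \<phi> t i) \<in> convergent_on W s" for i
      unfolding \<phi>_def by (intro tate_diff F tate_const)
  qed (use W s e in \<open>auto simp: \<phi>_def\<close>)
  show ?thesis
  proof (rule that[OF r(1,2)])
    fix x :: "'j \<Rightarrow> 'k" assume "x \<in> polydisc W r"
    from r(4)[OF this] have "vabs (F x - F (\<lambda>_. 0)) \<le> e / 2"
      by (simp add: polydisc_def \<phi>_def)
    then show "vabs (F x - F (\<lambda>_. 0)) < e"
      using e by simp
  qed
qed

lemma tuple_class_normalise:
  fixes m :: "nat \<Rightarrow> 'k ^ 2 ^ 2"
  assumes "\<And>i. i < n \<Longrightarrow> m i $ 1 $ 1 \<noteq> 0"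
  shows "tuple_class n m = near_point n (\<lambda>(i, j, k). m i $ j $ k / m i $ 1 $ 1 - (if j = k then 1 else 0))"
proof (rule tuple_class_cong)
  fix i assume "i < n"
  then have nz: "inverse (m i $ 1 $ 1) \<noteq> 0"
    using assms by simp
  have "near_matrix (\<lambda>(i, j, k). m i $ j $ k / m i $ 1 $ 1 - (if j = k then 1 else 0)) i
      = mat (inverse (m i $ 1 $ 1)) ** m i"
    by (rule mat2_eqI) (simp_all add: near_matrix_nth scalar_mult_nth divide_inverse mult.commute)
  then show "pgl_class (m i) = pgl_class (near_matrix (\<lambda>(i, j, k). m i $ j $ k / m i $ 1 $ 1 - (if j = k then 1 else 0)) i)"
    using pgl_class_scalar[OF nz] by simp
qed

lemma one_in_analytic_topspace:
  "\<one>\<^bsub>PGL2_power n\<^esub> \<in> topspace (analytic_topology (PGL2_power n) (regular_PGL2_power n :: ((nat \<Rightarrow> ('k ^ 2 ^ 2) set) \<Rightarrow> 'k) set))"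
proof -
  have "\<one>\<^bsub>PGL2_power n\<^esub> \<in> {x \<in> carrier (PGL2_power n). (\<lambda>_ :: nat \<Rightarrow> ('k ^ 2 ^ 2) set. 0 :: 'k) x \<in> UNIV}"
    using monoid.one_closed[OF group.is_monoid[OF group_PGL2_power]] by blast
  moreover have "{x \<in> carrier (PGL2_power n). (\<lambda>_ :: nat \<Rightarrow> ('k ^ 2 ^ 2) set. 0 :: 'k) x \<in> UNIV}
    \<in> {{x \<in> carrier (PGL2_power n). f x \<in> U} | f U. f \<in> regular_PGL2_power n \<and> open U}"
    by (intro CollectI exI[of _ "\<lambda>_. 0"] exI[of _ UNIV] conjI refl regular_PGL2_power_intros open_UNIV)
  ultimately show ?thesis
    unfolding analytic_topology_def topology_generated_by_topspace by (rule UnionI[rotated])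
qed

text \<open>Statements about germs become statements on polydiscs of matrices. One direction is
  continuity of regular functions in the entries. In the other, conditions on finitely many regular
  functions force a representative of the class to be close to the identity matrix.\<close>

lemma eventually_near_one:
  fixes P :: "(nat \<Rightarrow> ('k ^ 2 ^ 2) set) \<Rightarrow> bool"
  shows "(\<forall>\<^sub>F x in near_one (PGL2_power n) (regular_PGL2_power n). P x) \<longleftrightarrow>
     (\<exists>r. radius r \<and> r < 1 \<and> (\<forall>X\<in>polydisc (coords n) r. P (near_point n X)))"
    (is "?L \<longleftrightarrow> ?R")
proof -
  let ?G = "PGL2_power n :: (nat \<Rightarrow> ('k ^ 2 ^ 2) set) monoid"
  let ?A = "regular_PGL2_power n :: ((nat \<Rightarrow> ('k ^ 2 ^ 2) set) \<Rightarrow> 'k) set"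
  let ?S = "{{x \<in> carrier ?G. f x \<in> U} | f U. f \<in> ?A \<and> open U}"
  have L: "?L \<longleftrightarrow> (\<exists>S. generate_topology_on ?S S \<and> \<one>\<^bsub>?G\<^esub> \<in> S \<and> (\<forall>x\<in>S. P x))"
    using one_in_analytic_topspace
    unfolding near_one_def eventually_nhdsin analytic_topology_def openin_topology_generated_by_iff by simp
  obtain r1 where r1: "radius r1" "r1 < 1"
    using ex_radius_less[of 1] by auto
  have nbhd: "\<exists>r. radius r \<and> r < 1 \<and> (\<forall>X\<in>polydisc (coords n) r. near_point n X \<in> S)"
    if "generate_topology_on ?S S" "\<one>\<^bsub>?G\<^esub> \<in> S" for S
    using that
  proof (induction rule: generate_topology_on.induct)
    case Empty
    then show ?case
      by simp
  next
    case (Int U V)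
    obtain r where r: "radius r" "r < 1" "\<forall>X\<in>polydisc (coords n) r. near_point n X \<in> U"
      using Int.IH(1) Int.prems by blast
    obtain s where s: "radius s" "s < 1" "\<forall>X\<in>polydisc (coords n) s. near_point n X \<in> V"
      using Int.IH(2) Int.prems by blast
    have "near_point n X \<in> U \<inter> V" if "X \<in> polydisc (coords n) (min r s)" for X
      using r(3) s(3) polydisc_mono[OF that subset_refl, of r] polydisc_mono[OF that subset_refl, of s] by simp
    then show ?case
      using radius_min[OF r(1) s(1)] r(2) by (intro exI[of _ "min r s"]) auto
  next
    case (UN K)
    then obtain U where U: "U \<in> K" "\<one>\<^bsub>?G\<^esub> \<in> U"
      by blast
    then obtain r where "radius r" "r < 1" "\<forall>X\<in>polydisc (coords n) r. near_point n X \<in> U"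
      using UN.IH by blast
    then show ?case
      using U(1) by (intro exI[of _ r]) auto
  next
    case (Basis S)
    then obtain f U where f: "S = {x \<in> carrier ?G. f x \<in> U}" "f \<in> ?A" "open U"
      by blast
    then obtain e where e: "e > 0" "\<And>y. dist y (f \<one>\<^bsub>?G\<^esub>) < e \<Longrightarrow> y \<in> U"
      using Basis.prems open_dist[of U] by auto
    define F where "F = (\<lambda>X. f (near_point n X))"
    have F: "F \<in> convergent_on (coords n) r1"
      unfolding F_def using regular_near_point_convergent[OF f(2)] radius_pos[OF r1(1)] r1(2) by simp
    obtain r where r: "radius r" "r \<le> r1"
      "\<And>X. X \<in> polydisc (coords n) r \<Longrightarrow> vabs (F X - F (\<lambda>_. 0)) < e"
      by (rule small_values[OF F finite_coords r1(1) e(1)]) (rule that)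
    have "near_point n X \<in> S" if X: "X \<in> polydisc (coords n) r" for X
    proof -
      have "f (near_point n X) \<in> U"
        using e(2) r(3)[OF X] by (simp add: F_def near_point_0 dist_vabs)
      moreover have "near_point n X \<in> carrier ?G"
        using near_point_in_carrier[OF X] r(2) r1(2) by simp
      ultimately show ?thesis
        using f(1) by simp
    qed
    then show ?case
      using r r1 by (intro exI[of _ r]) auto
  qed
  show ?thesis
  proof
    assume ?L
    then show ?R
      unfolding L using nbhd by blast
  next
    assume ?R
    then obtain r where r: "radius r" "r < 1" "\<And>X. X \<in> polydisc (coords n) r \<Longrightarrow> P (near_point n X)"
      by blast
    have r0: "r > 0"
      using r(1) by (rule radius_pos)
    \<comment> \<open>In terms of the entries: \<open>m11^2 / det\<close>,
      \<open>m11 m12 / det\<close>, \<open>m11 m21 / det\<close> and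
      \<open>m11 (m22 - m11) / det\<close>. The first is kept at distance less than 1 from 1, so it
      has absolute value 1, and division by it yields the entries of the representative with entry
      (1, 1) equal to 1.\<close>
    define g where "g = (\<lambda>(a :: nat) (C :: ('k ^ 2 ^ 2) set).
       if a = 0 then entry_ratio 1 1 1 1 C else if a = 1 then entry_ratio 1 1 1 2 C
       else if a = 2 then entry_ratio 1 1 2 1 C else entry_ratio 1 1 2 2 C + (- 1) * entry_ratio 1 1 1 1 C)"
    define U where "U = (\<lambda>a :: nat. if a = 0 then ball (1 :: 'k) 1 else ball 0 r)"
    define S where "S = carrier ?G \<inter> (\<Inter>(i, a)\<in>{..<n} \<times> {..<4}. {x \<in> carrier ?G. g a (x i) \<in> U a})"
    have gA: "(\<lambda>x. g a (x i)) \<in> ?A" if "i < n" for a i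
    proof -
      have e: "(\<lambda>x. entry_ratio j k l q (x i)) \<in> ?A" for j k l q
        using regular_PGL2_power_intros(2)[OF entry_ratio_regular that] .
      have d: "(\<lambda>x. entry_ratio 1 1 2 2 (x i) + (- 1) * entry_ratio 1 1 1 1 (x i)) \<in> ?A"
        by (intro regular_PGL2_power_intros(1,3,4) e)
      show ?thesis
        unfolding g_def by (cases "a = 0"; cases "a = 1"; cases "a = 2") (simp_all only: e d if_True if_False simp_thms)
    qed
    have car: "generate_topology_on ?S (carrier ?G)"
    proof -
      have "{x \<in> carrier ?G. (\<lambda>_. 0 :: 'k) x \<in> UNIV} \<in> ?S"
        by (intro CollectI exI[of _ "\<lambda>_. 0"] exI[of _ UNIV] conjI refl regular_PGL2_power_intros open_UNIV)
      from generate_topology_on.Basis[OF this] show ?thesis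
        by simp
    qed
    have fin_inter: "generate_topology_on ?S (carrier ?G \<inter> (\<Inter>z\<in>Z. V z))"
      if "finite Z" "\<And>z. z \<in> Z \<Longrightarrow> generate_topology_on ?S (V z)" for Z and V :: "nat \<times> nat \<Rightarrow> (nat \<Rightarrow> ('k ^ 2 ^ 2) set) set"
      using that
    proof (induction Z rule: finite_induct)
      case (insert z Z)
      have "generate_topology_on ?S (V z \<inter> (carrier ?G \<inter> (\<Inter>z\<in>Z. V z)))"
        by (rule generate_topology_on.Int[OF insert.prems insert.IH[OF insert.prems]]) auto
      also have "V z \<inter> (carrier ?G \<inter> (\<Inter>z\<in>Z. V z)) = carrier ?G \<inter> (\<Inter>z\<in>insert z Z. V z)"
        by auto
      finally show ?case .
    qed (simp add: car)
    have "generate_topology_on ?S S"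
      unfolding S_def
    proof (rule fin_inter)
      fix z :: "nat \<times> nat" assume "z \<in> {..<n} \<times> {..<4}"
      then obtain i a where z: "z = (i, a)" "i < n"
        by auto
      have "{x \<in> carrier ?G. g a (x i) \<in> U a} \<in> ?S"
        using gA[OF z(2)] by (intro CollectI exI[of _ "\<lambda>x. g a (x i)"] exI[of _ "U a"] conjI refl) (auto simp: U_def)
      then show "generate_topology_on ?S (case z of (i, a) \<Rightarrow> {x \<in> carrier ?G. g a (x i) \<in> U a})"
        unfolding z(1) by (simp add: generate_topology_on.Basis)
    qed simp
    moreover have "\<one>\<^bsub>?G\<^esub> \<in> S"
    proof -
      have one: "\<one>\<^bsub>?G\<^esub> \<in> carrier ?G"
        by (rule monoid.one_closed[OF group.is_monoid[OF group_PGL2_power]])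
      have "g a (\<one>\<^bsub>?G\<^esub> i) \<in> U a" if "i < n" for a i
        using that r0 by (simp add: one_PGL2_power tuple_class_nth g_def U_def entry_ratio_class mat_nth invertible_det_nz)
      with one show ?thesis
        by (simp add: S_def)
    qed
    moreover have "P x" if x: "x \<in> S" for x
    proof -
      have xG: "x \<in> carrier ?G"
        using x by (simp add: S_def)
      then obtain m where m: "\<And>i. invertible (m i)" "x = tuple_class n m"
        by (rule carrier_PGL2_powerE) (rule that)
      have g: "g a (pgl_class (m i)) \<in> U a" if "i < n" "a < 4" for i a
        using x that unfolding S_def m(2) by (auto simp: tuple_class_nth)
      have v1: "vabs (entry_ratio 1 1 1 1 (pgl_class (m i))) = 1" if i: "i < n" for i
        using g[OF i, of 0] by (intro vabs_eq_1I) (simp add: g_def U_def dist_vabs vabs_minus_commute)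
      have nz: "m i $ 1 $ 1 \<noteq> 0" if i: "i < n" for i
        using v1[OF i] by (auto simp: entry_ratio_class)
      have quot: "entry_ratio 1 1 j k (pgl_class (m i)) / entry_ratio 1 1 1 1 (pgl_class (m i)) = m i $ j $ k / m i $ 1 $ 1"
        if i: "i < n" for i j k
        using nz[OF i] m(1)[of i] by (simp add: entry_ratio_class invertible_det_nz field_simps)
      define X where "X = (\<lambda>(i, j, k). m i $ j $ k / m i $ 1 $ 1 - (if j = k then 1 else 0))"
      have "X \<in> polydisc (coords n) r"
      proof (rule polydiscI)
        fix z assume z: "z \<in> coords n"
        obtain i j k where ijk: "z = (i, j, k)"
          by (cases z) auto
        with z have i: "i < n"
          by simp
        have 12: "vabs (m i $ 1 $ 2 / m i $ 1 $ 1) \<le> r"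
          using g[OF i, of 1] v1[OF i] by (simp add: quot[OF i, symmetric] vabs_divide g_def U_def dist_vabs)
        have 21: "vabs (m i $ 2 $ 1 / m i $ 1 $ 1) \<le> r"
          using g[OF i, of 2] v1[OF i] by (simp add: quot[OF i, symmetric] vabs_divide g_def U_def dist_vabs)
        have "m i $ 2 $ 2 / m i $ 1 $ 1 - 1
            = (entry_ratio 1 1 2 2 (pgl_class (m i)) - entry_ratio 1 1 1 1 (pgl_class (m i))) / entry_ratio 1 1 1 1 (pgl_class (m i))"
          unfolding diff_divide_distrib quot[OF i] using nz[OF i] by simp
        then have 22: "vabs (m i $ 2 $ 2 / m i $ 1 $ 1 - 1) \<le> r"
          using g[OF i, of 3] v1[OF i] by (simp add: vabs_divide g_def U_def dist_vabs vabs_minus_commute)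
        show "vabs (X z) \<le> r"
          unfolding X_def ijk using exhaust_2[of j] exhaust_2[of k] 12 21 22 nz[OF i] r0 by auto
      qed
      then show ?thesis
        using r(3) tuple_class_normalise[OF nz] by (simp add: m(2) X_def)
    qed
    ultimately show ?L
      unfolding L by blast
  qed
qed

text \<open>In the ultrametric setting a tail is no larger than its largest term; both sums are
  compared with a finite sum over a larger index set.\<close>

lemma has_sum_tail_bound:
  fixes g :: "'a \<Rightarrow> 'k"
  assumes g: "(g has_sum s) I" and E: "finite E" "E \<subseteq> I" and \<epsilon>: "\<epsilon> > 0"
    and tail: "\<And>a. a \<in> I - E \<Longrightarrow> vabs (g a) \<le> \<epsilon>"
  shows "vabs (s - sum g E) \<le> \<epsilon>"
proof -
  have "\<forall>\<^sub>F F in finite_subsets_at_top I. dist (sum g F) s < \<epsilon>"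
    using g \<epsilon> unfolding has_sum_def by (rule tendstoD)
  then obtain X where X: "finite X" "X \<subseteq> I" "\<forall>F. finite F \<and> X \<subseteq> F \<and> F \<subseteq> I \<longrightarrow> dist (sum g F) s < \<epsilon>"
    unfolding eventually_finite_subsets_at_top by (elim exE conjE) (rule that)
  have XE: "finite (X \<union> E) \<and> X \<subseteq> X \<union> E \<and> X \<union> E \<subseteq> I"
    using X(1,2) E by simp
  have "dist (sum g (X \<union> E)) s < \<epsilon>"
    using X(3)[rule_format, OF XE] .
  then have 1: "vabs (s - sum g (X \<union> E)) \<le> \<epsilon>"
    by (simp add: dist_vabs vabs_minus_commute)
  have "vabs (sum g (X \<union> E - E)) \<le> \<epsilon>"
    using X(2) tail \<epsilon> by (intro vabs_sum_le) auto
  moreover have "sum g (X \<union> E) = sum g (X \<union> E - E) + sum g E"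
    using X(1) E(1) by (intro sum.subset_diff) auto
  ultimately show ?thesis
    using vabs_add_le[OF 1, of "sum g (X \<union> E - E)"] by (simp add: algebra_simps)
qed

lemma analytic_convergent:
  fixes f :: "(nat \<Rightarrow> ('k ^ 2 ^ 2) set) \<Rightarrow> 'k"
  assumes "analytic_near_one (PGL2_power n) (regular_PGL2_power n) f"
  obtains r where "radius r" "r < 1" "(\<lambda>X. f (near_point n X)) \<in> convergent_on (coords n) r"
proof -
  let ?G = "PGL2_power n :: (nat \<Rightarrow> ('k ^ 2 ^ 2) set) monoid"
  obtain N h c r B where h: "\<forall>i<N. h i \<in> regular_PGL2_power n" and r: "r > 0"
    and B: "\<forall>\<alpha>\<in>{..<N :: nat} \<rightarrow>\<^sub>E (UNIV :: nat set). dist (c \<alpha>) 0 * r ^ (\<Sum>i<N. \<alpha> i) \<le> B"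
    and ev: "\<forall>\<^sub>F x in near_one ?G (regular_PGL2_power n).
           ((\<lambda>\<alpha>. c \<alpha> * (\<Prod>i<N. (h i x - h i \<one>\<^bsub>?G\<^esub>) ^ \<alpha> i)) has_sum f x) ({..<N} \<rightarrow>\<^sub>E UNIV)"
    using assms unfolding analytic_near_one_def by (elim exE conjE) (rule that)
  obtain r1 where r1: "radius r1" "r1 < 1" "\<forall>X\<in>polydisc (coords n) r1.
     ((\<lambda>\<alpha>. c \<alpha> * (\<Prod>i<N. (h i (near_point n X) - h i \<one>\<^bsub>?G\<^esub>) ^ \<alpha> i)) has_sum f (near_point n X)) ({..<N} \<rightarrow>\<^sub>E UNIV)"
    using ev unfolding eventually_near_one by (elim exE conjE) (rule that)
  have r10: "r1 > 0"
    using r1(1) by (rule radius_pos)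
  define H where "H = (\<lambda>X i. h i (near_point n X) - h i \<one>\<^bsub>?G\<^esub>)"
  have H: "(\<lambda>X. H X i) \<in> convergent_on (coords n) r1" if "i < N" for i
    unfolding H_def using that h r10 r1(2) by (intro tate_diff tate_const regular_near_point_convergent) auto
  \<comment> \<open>Arguments of size at most \<open>r / 2\<close>, half of the radius in the
    hypothesis, make a term of degree \<open>D\<close> at most \<open>B / 2 ^ D\<close>, so the
    series converges uniformly.\<close>
  obtain \<sigma> where \<sigma>: "radius \<sigma>" "\<sigma> \<le> r1" "\<sigma> < 1"
    "\<And>X. X \<in> polydisc (coords n) \<sigma> \<Longrightarrow> H X \<in> polydisc {..<N} (r / 2)"
    by (rule tate_map_continuous_0[of "{..<N}" H "coords n" r1 "r / 2" 1])
      (use H r r1(1) that in \<open>auto simp: H_def near_point_0\<close>)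
  have \<sigma>0: "\<sigma> > 0"
    using \<sigma>(1) by (rule radius_pos)
  have "(\<lambda>X. f (near_point n X)) \<in> convergent_on (coords n) \<sigma>"
  proof (rule tate_closed)
    fix \<epsilon> :: real assume \<epsilon>: "\<epsilon> > 0"
    define B' where "B' = max B 1"
    obtain d where d: "(1 / 2) ^ d < \<epsilon> / B'"
      using real_arch_pow_inv[of "\<epsilon> / B'" "1 / 2"] \<epsilon> by (auto simp: B'_def)
    \<comment> \<open>Truncation by total degree leaves a finite sum, and all omitted terms are
      uniformly at most \<open>\<epsilon>\<close>.\<close>
    define E where "E = {\<alpha> \<in> {..<N} \<rightarrow>\<^sub>E (UNIV :: nat set). (\<Sum>i<N. \<alpha> i) < d}"
    have "E \<subseteq> {..<N} \<rightarrow>\<^sub>E {..<d}"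
    proof
      fix \<alpha> assume \<alpha>: "\<alpha> \<in> E"
      have "\<alpha> i < d" if "i < N" for i
        using \<alpha> member_le_sum[of i "{..<N}" \<alpha>] that by (auto simp: E_def)
      then show "\<alpha> \<in> {..<N} \<rightarrow>\<^sub>E {..<d}"
        using \<alpha> by (auto simp: E_def PiE_iff)
    qed
    then have finE: "finite E"
      by (rule finite_subset) (intro finite_PiE; simp)
    define P where "P = (\<lambda>X. \<Sum>\<alpha>\<in>E. c \<alpha> * (\<Prod>i<N. H X i ^ \<alpha> i))"
    have "P \<in> convergent_on (coords n) \<sigma>"
      unfolding P_def using H \<sigma>(2) \<sigma>0
      by (intro tate_sum tate_mult[OF tate_const] tate_prod tate_power) (auto intro: tate_mono)
    moreover have "vabs (f (near_point n X) - P X) \<le> \<epsilon>" if X: "X \<in> polydisc (coords n) \<sigma>" for X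
      unfolding P_def
    proof (rule has_sum_tail_bound[where I = "{..<N} \<rightarrow>\<^sub>E UNIV"])
      have "X \<in> polydisc (coords n) r1"
        using polydisc_mono[OF X subset_refl \<sigma>(2)] .
      with r1(3) show "((\<lambda>\<alpha>. c \<alpha> * (\<Prod>i<N. H X i ^ \<alpha> i)) has_sum f (near_point n X)) ({..<N} \<rightarrow>\<^sub>E UNIV)"
        unfolding H_def by blast
      show "finite E" "\<epsilon> > 0"
        by (fact finE \<epsilon>)+
      show "E \<subseteq> {..<N} \<rightarrow>\<^sub>E UNIV"
        unfolding E_def by (rule Collect_restrict)
      fix \<alpha> :: "nat \<Rightarrow> nat" assume \<alpha>: "\<alpha> \<in> ({..<N} \<rightarrow>\<^sub>E UNIV) - E"
      define D where "D = (\<Sum>i<N. \<alpha> i)"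
      have D: "D \<ge> d"
      proof (rule ccontr)
        assume "\<not> D \<ge> d"
        then have "\<alpha> \<in> E"
          unfolding E_def D_def using \<alpha>[THEN DiffD1] by (intro CollectI conjI) simp_all
        with \<alpha> show False
          by simp
      qed
      have "(\<Prod>i<N. vabs (H X i) ^ \<alpha> i) \<le> (\<Prod>i<N. (r / 2) ^ \<alpha> i)"
        using \<sigma>(4)[OF X] by (intro prod_mono conjI power_mono) (auto simp: polydisc_def)
      also have "\<dots> = r ^ D * (1 / 2) ^ D"
        by (simp add: D_def power_sum power_divide prod_dividef)
      finally have "vabs (c \<alpha>) * (\<Prod>i<N. vabs (H X i) ^ \<alpha> i) \<le> vabs (c \<alpha>) * (r ^ D * (1 / 2) ^ D)"
        by (intro mult_left_mono) auto
      also have "\<dots> = (vabs (c \<alpha>) * r ^ D) * (1 / 2) ^ D"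
        by (simp add: mult.assoc)
      also have "\<dots> \<le> B' * (1 / 2) ^ d"
      proof (rule mult_mono)
        have "vabs (c \<alpha>) * r ^ D \<le> B"
          using B \<alpha> unfolding D_def vabs_def by blast
        then show "vabs (c \<alpha>) * r ^ D \<le> B'"
          by (simp add: B'_def)
        show "(1 / 2 :: real) ^ D \<le> (1 / 2) ^ d"
          using D by (intro power_decreasing) auto
      qed (auto simp: B'_def)
      also have "\<dots> \<le> \<epsilon>"
        using d by (simp add: B'_def field_simps)
      finally show "vabs (c \<alpha> * (\<Prod>i<N. H X i ^ \<alpha> i)) \<le> \<epsilon>"
        by (simp add: vabs_mult vabs_prod vabs_power)
    qed
    ultimately show "\<exists>g\<in>convergent_on (coords n) \<sigma>. \<forall>X\<in>polydisc (coords n) \<sigma>. vabs (f (near_point n X) - g X) \<le> \<epsilon>"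
      by blast
  qed
  with \<sigma>(1,3) show ?thesis
    by (rule that)
qed

lemma analytic_convergent_finite:
  fixes F :: "((nat \<Rightarrow> ('k ^ 2 ^ 2) set) \<Rightarrow> 'k) set"
  assumes "finite F" "\<And>f. f \<in> F \<Longrightarrow> analytic_near_one (PGL2_power n) (regular_PGL2_power n) f"
  obtains r where "radius r" "r < 1" "\<And>f. f \<in> F \<Longrightarrow> (\<lambda>X. f (near_point n X)) \<in> convergent_on (coords n) r"
proof -
  have "\<exists>r. radius r \<and> r < 1 \<and> (\<forall>f\<in>F. (\<lambda>X. f (near_point n X)) \<in> convergent_on (coords n) r)"
    using assms
  proof (induction F rule: finite_induct)
    case empty
    then show ?case
      using ex_radius_less[of 1] by auto
  next
    case (insert f F)
    then obtain r where r: "radius r" "r < 1" "\<forall>f\<in>F. (\<lambda>X. f (near_point n X)) \<in> convergent_on (coords n) r"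
      by auto
    have "analytic_near_one (PGL2_power n) (regular_PGL2_power n) f"
      using insert.prems by simp
    then obtain s where s: "radius s" "s < 1" "(\<lambda>X. f (near_point n X)) \<in> convergent_on (coords n) s"
      by (rule analytic_convergent) (rule that)
    show ?case
    proof (intro exI[of _ "min r s"] conjI ballI)
      fix g assume "g \<in> insert f F"
      then show "(\<lambda>X. g (near_point n X)) \<in> convergent_on (coords n) (min r s)"
        using tate_mono[OF s(3) subset_refl, of "min r s"] tate_mono[OF bspec[OF r(3)] subset_refl, of g "min r s"] by auto
    qed (use r s in \<open>auto simp: radius_min\<close>)
  qed
  then show ?thesis
    by (elim exE conjE) (rule that, assumption+, erule bspec)
qed

lemma regular_analytic_near_one:
  fixes f :: "(nat \<Rightarrow> ('k ^ 2 ^ 2) set) \<Rightarrow> 'k"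
  assumes f: "f \<in> regular_PGL2_power n"
  shows "analytic_near_one (PGL2_power n) (regular_PGL2_power n) f"
proof -
  let ?G = "PGL2_power n :: (nat \<Rightarrow> ('k ^ 2 ^ 2) set) monoid"
  \<comment> \<open>The power series is \<open>f(1) + y\<close> in the single variable
    \<open>y = f - f(1)\<close>, so \<open>N = 1\<close>, and only the multi-indices
    \<open>a 0\<close> and \<open>a 1\<close> contribute.\<close>
  define c where "c = (\<lambda>\<alpha> :: nat \<Rightarrow> nat. if \<alpha> 0 = 0 then f \<one>\<^bsub>?G\<^esub> else if \<alpha> 0 = 1 then 1 else 0)"
  define a where "a = (\<lambda>j :: nat. \<lambda>i\<in>{..<1 :: nat}. j)"
  have sum: "((\<lambda>\<alpha>. c \<alpha> * (\<Prod>i<1. (f x - f \<one>\<^bsub>?G\<^esub>) ^ \<alpha> i)) has_sum f x) ({..<1} \<rightarrow>\<^sub>E UNIV)" for x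
  proof (rule has_sum_finite_neutralI[of "{a 0, a 1}"])
    have "a 0 \<noteq> a 1"
      by (metis a_def lessThan_iff less_numeral_extra(1) restrict_apply' zero_neq_one)
    then show "f x = (\<Sum>\<alpha>\<in>{a 0, a 1}. c \<alpha> * (\<Prod>i<1. (f x - f \<one>\<^bsub>?G\<^esub>) ^ \<alpha> i))"
      by (simp add: c_def a_def)
    fix \<alpha> :: "nat \<Rightarrow> nat" assume \<alpha>: "\<alpha> \<in> ({..<1} \<rightarrow>\<^sub>E UNIV) - {a 0, a 1}"
    have eq: "\<alpha> = a (\<alpha> 0)"
    proof
      show "\<alpha> i = a (\<alpha> 0) i" for i
        using PiE_arb[OF DiffD1[OF \<alpha>], of i] by (cases "i = 0") (simp_all add: a_def)
    qed
    have "\<alpha> \<noteq> a 0" "\<alpha> \<noteq> a 1"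
      using \<alpha> by blast+
    then have "\<alpha> 0 \<noteq> 0" "\<alpha> 0 \<noteq> 1"
      using eq by metis+
    then show "c \<alpha> * (\<Prod>i<1. (f x - f \<one>\<^bsub>?G\<^esub>) ^ \<alpha> i) = 0"
      by (simp add: c_def)
  qed (auto simp: a_def)
  show ?thesis
    unfolding analytic_near_one_def
  proof (intro exI conjI allI impI ballI always_eventually)
    show "(0 :: real) < 1"
      by simp
    show "dist (c \<alpha>) 0 * 1 ^ (\<Sum>i<1. \<alpha> i) \<le> max 1 (vabs (f \<one>\<^bsub>?G\<^esub>))" for \<alpha> :: "nat \<Rightarrow> nat"
      by (simp add: c_def vabs_def[symmetric] le_max_iff_disj)
    show "((\<lambda>\<alpha>. c \<alpha> * (\<Prod>i<1. ((\<lambda>_. f) i x - (\<lambda>_. f) i \<one>\<^bsub>?G\<^esub>) ^ \<alpha> i)) has_sum f x) ({..<1} \<rightarrow>\<^sub>E UNIV)" for x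
      using sum .
  qed (rule f)
qed

lemma analytic_germE:
  fixes Z :: "(nat \<Rightarrow> ('k ^ 2 ^ 2) set) set"
  assumes "analytic_germ (PGL2_power n) (regular_PGL2_power n) Z"
  obtains F :: "((nat \<Rightarrow> ('k ^ 2 ^ 2) set) \<Rightarrow> 'k) set" and r where
    "finite F" "radius r" "r < 1" "\<And>f. f \<in> F \<Longrightarrow> (\<lambda>X. f (near_point n X)) \<in> convergent_on (coords n) r"
    "\<And>X. X \<in> polydisc (coords n) r \<Longrightarrow> near_point n X \<in> Z \<longleftrightarrow> (\<forall>f\<in>F. f (near_point n X) = 0)"
proof -
  obtain F :: "((nat \<Rightarrow> ('k ^ 2 ^ 2) set) \<Rightarrow> 'k) set" where F: "finite F"
      "\<forall>f\<in>F. analytic_near_one (PGL2_power n) (regular_PGL2_power n) f"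
      "\<forall>\<^sub>F x in near_one (PGL2_power n) (regular_PGL2_power n :: ((nat \<Rightarrow> ('k ^ 2 ^ 2) set) \<Rightarrow> 'k) set). x \<in> Z \<longleftrightarrow> (\<forall>f\<in>F. f x = 0)"
    using assms unfolding analytic_germ_def by (elim exE conjE) (rule that)
  obtain r where r: "radius r" "r < 1" "\<forall>X\<in>polydisc (coords n) r. near_point n X \<in> Z \<longleftrightarrow> (\<forall>f\<in>F. f (near_point n X) = 0)"
    using F(3) unfolding eventually_near_one by (elim exE conjE) (rule that)
  obtain s where s: "radius s" "s < 1" "\<And>f. f \<in> F \<Longrightarrow> (\<lambda>X. f (near_point n X)) \<in> convergent_on (coords n) s"
    by (rule analytic_convergent_finite[OF F(1) bspec[OF F(2)]]) (assumption, rule that)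
  show ?thesis
  proof (rule that[of F "min r s"])
    show "(\<lambda>X. f (near_point n X)) \<in> convergent_on (coords n) (min r s)" if "f \<in> F" for f
      using tate_mono[OF s(3)[OF that] subset_refl] by simp
    show "near_point n X \<in> Z \<longleftrightarrow> (\<forall>f\<in>F. f (near_point n X) = 0)" if "X \<in> polydisc (coords n) (min r s)" for X
      using r(3) polydisc_mono[OF that subset_refl, of r] by simp
  qed (use F(1) r(2) radius_min[OF r(1) s(1)] in auto)
qed

text \<open>Passes to the representative with entry (1, 1) equal to 1, which is unique in its class.
  The remaining three entries of each factor are genuine local coordinates.\<close>

definition normalised :: "(nat \<times> 2 \<times> 2 \<Rightarrow> 'k) \<Rightarrow> nat \<times> 2 \<times> 2 \<Rightarrow> 'k" where
  "normalised X = (\<lambda>(i, j, k). near_matrix X i $ j $ k / near_matrix X i $ 1 $ 1 - (if j = k then 1 else 0))"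

lemma vabs_near_matrix_11:
  assumes "X \<in> polydisc (coords n) r" "r < 1" "i < n"
  shows "vabs (near_matrix X i $ 1 $ 1) = 1"
  using polydiscD[OF assms(1), of "(i, 1, 1)"] assms(2,3) by (intro vabs_eq_1I) (simp add: near_matrix_nth)

lemma near_point_normalised:
  assumes "X \<in> polydisc (coords n) r" "r < 1"
  shows "near_point n (normalised X) = near_point n X"
  unfolding normalised_def
  using vabs_near_matrix_11[OF assms] by (intro tuple_class_normalise[symmetric]) force

lemma normalised_polydisc:
  assumes X: "X \<in> polydisc (coords n) r" and r: "r < 1"
  shows "normalised X \<in> polydisc (coords n) r"
proof (rule polydiscI)
  fix z assume z: "z \<in> coords n"
  obtain i j k where ijk: "z = (i, j, k)"
    by (cases z) auto
  with z have i: "i < n"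
    by simp
  have v1: "vabs (near_matrix X i $ 1 $ 1) = 1"
    by (rule vabs_near_matrix_11[OF X r i])
  then have nz: "near_matrix X i $ 1 $ 1 \<noteq> 0"
    by auto
  have le: "vabs (X (i, j, k)) \<le> r" for j k
    using polydiscD[OF X, of "(i, j, k)"] i by simp
  have "normalised X z = (if j = k then X (i, j, j) - X (i, 1, 1) else X (i, j, k)) / near_matrix X i $ 1 $ 1"
    using nz by (simp add: ijk normalised_def near_matrix_nth diff_divide_distrib[symmetric] field_simps)
  also have "vabs \<dots> \<le> r"
    using le vabs_diff_le[OF le le] by (simp add: vabs_divide v1)
  finally show "vabs (normalised X z) \<le> r" .
qed

text \<open>The normalised coordinate multiplied by \<open>m11^2 / det\<close>. The factor clears
  the denominator \<open>m11\<close>, so the function is regular on the whole group, and it has no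
  zeros near the identity.\<close>

definition affine_function :: "nat \<times> 2 \<times> 2 \<Rightarrow> (nat \<Rightarrow> ('k ^ 2 ^ 2) set) \<Rightarrow> 'k" where
  "affine_function = (\<lambda>(i, j, k) x. entry_ratio 1 1 j k (x i) + (if j = k then - 1 else 0) * entry_ratio 1 1 1 1 (x i))"

lemma affine_function_regular: "z \<in> coords n \<Longrightarrow> affine_function z \<in> regular_PGL2_power n"
  unfolding affine_function_def
  by (cases z; hypsubst) (unfold case_prod_conv, intro regular_PGL2_power_intros(1,3,4) regular_PGL2_power_intros(2)[OF entry_ratio_regular]; simp)

lemma affine_function_eq_0_iff:
  assumes X: "X \<in> polydisc (coords n) r" "r < 1" and z: "z \<in> coords n"
  shows "affine_function z (near_point n X) = 0 \<longleftrightarrow> normalised X z = 0"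
proof -
  obtain i j k where ijk: "z = (i, j, k)" "i < n"
    using z by (cases z) auto
  have nz: "near_matrix X i $ 1 $ 1 \<noteq> 0"
    using vabs_near_matrix_11[OF X ijk(2)] by auto
  have d: "det (near_matrix X i) \<noteq> 0"
    using invertible_near_matrix(2)[OF X ijk(2)] by auto
  show ?thesis
    using nz d by (auto simp: ijk affine_function_def normalised_def tuple_class_nth entry_ratio_class field_simps)
qed

definition affine_coords :: "nat \<Rightarrow> (nat \<times> 2 \<times> 2) set" where
  "affine_coords n = {..<n} \<times> (UNIV - {(1, 1)})"

lemma affine_coords_subset: "affine_coords n \<subseteq> coords n"
  by (auto simp: affine_coords_def)

lemma card_affine_coords: "card (affine_coords n) = 3 * n"
proof -
  have "card (UNIV - {(1 :: 2, 1 :: 2)}) = 3"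
    by (subst card_Diff_singleton) (simp_all add: card_cartesian_product flip: UNIV_Times_UNIV)
  then show ?thesis
    by (simp add: affine_coords_def card_cartesian_product)
qed

definition coordinate_germ :: "nat \<Rightarrow> (nat \<times> 2 \<times> 2) set \<Rightarrow> (nat \<Rightarrow> ('k ^ 2 ^ 2) set) set" where
  "coordinate_germ n V = {x. \<forall>z\<in>affine_coords n - V. affine_function z x = 0}"

lemma coordinate_germ_near_point:
  assumes t: "t \<in> polydisc V r" and V: "V \<subseteq> affine_coords n" and r: "0 \<le> r" "r < 1"
  shows "(\<lambda>z. if z \<in> V then t z else 0) \<in> polydisc (coords n) r"
    and "normalised (\<lambda>z. if z \<in> V then t z else 0) = (\<lambda>z. if z \<in> V then t z else 0)"
    and "near_point n (\<lambda>z. if z \<in> V then t z else 0) \<in> coordinate_germ n V"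
proof -
  let ?t = "\<lambda>z. if z \<in> V then t z else 0"
  show D: "?t \<in> polydisc (coords n) r"
    using polydiscD[OF t] r(1) by (intro polydiscI) auto
  show N: "normalised ?t = ?t"
    using V by (intro ext) (auto simp: normalised_def near_matrix_nth affine_coords_def)
  show "near_point n ?t \<in> coordinate_germ n V"
    unfolding coordinate_germ_def
  proof (intro CollectI ballI)
    fix z assume z: "z \<in> affine_coords n - V"
    then have "z \<in> coords n"
      using affine_coords_subset[of n] by blast
    from affine_function_eq_0_iff[OF D r(2) this] z show "affine_function z (near_point n ?t) = 0"
      by (simp add: N)
  qed
qed

lemma coordinate_germE:
  assumes X: "X \<in> polydisc (coords n) r" "r < 1" and V: "V \<subseteq> affine_coords n"
    and x: "near_point n X \<in> coordinate_germ n V"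
  obtains t where "t \<in> polydisc V r" "near_point n X = near_point n (\<lambda>z. if z \<in> V then t z else 0)"
proof (rule that)
  show "normalised X \<in> polydisc V r"
    using normalised_polydisc[OF X] polydisc_mono[OF _ order_trans[OF V affine_coords_subset] order_refl] by blast
  have 0: "normalised X z = 0" if "z \<in> affine_coords n" "z \<notin> V" for z
    using x that affine_coords_subset[of n] affine_function_eq_0_iff[OF X, of z] by (auto simp: coordinate_germ_def)
  have 1: "normalised X (i, 1, 1) = 0" if "i < n" for i
    using vabs_near_matrix_11[OF X that] by (auto simp: normalised_def)
  have "near_point n (normalised X) = near_point n (\<lambda>z. if z \<in> V then normalised X z else 0)"
  proof (rule tuple_class_cong)
    fix i assume i: "i < n"
    have "near_matrix (normalised X) i = near_matrix (\<lambda>z. if z \<in> V then normalised X z else 0) i"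
      using 0 1 i by (intro mat2_eqI) (auto simp: near_matrix_nth affine_coords_def)
    then show "pgl_class (near_matrix (normalised X) i) = pgl_class (near_matrix (\<lambda>z. if z \<in> V then normalised X z else 0) i)"
      by simp
  qed
  then show "near_point n X = near_point n (\<lambda>z. if z \<in> V then normalised X z else 0)"
    by (simp only: near_point_normalised[OF X])
qed

lemma analytic_coordinate_germ:
  "analytic_germ (PGL2_power n) (regular_PGL2_power n) (coordinate_germ n V)"
  unfolding analytic_germ_def
proof (intro exI conjI ballI always_eventually allI)
  show "finite (affine_function ` (affine_coords n - V))"
    using finite_subset[OF affine_coords_subset finite_coords] by simp
  show "analytic_near_one (PGL2_power n) (regular_PGL2_power n) f" if f: "f \<in> affine_function ` (affine_coords n - V)" for f
  proof -
    obtain z where "f = affine_function z" "z \<in> affine_coords n"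
      using f by blast
    then show ?thesis
      using affine_function_regular[of z n] affine_coords_subset[of n] regular_analytic_near_one by blast
  qed
qed (simp add: coordinate_germ_def)

text \<open>The germ is parametrised by a polydisc in the coordinates \<open>V\<close>. Two germs
  that cover it without containing it would give two nonzero convergent power series with product
  zero.\<close>

lemma irreducible_coordinate_germ:
  assumes V: "V \<subseteq> affine_coords n"
  shows "irreducible_in (analytic_germ (PGL2_power n) (regular_PGL2_power n :: ((nat \<Rightarrow> ('k ^ 2 ^ 2) set) \<Rightarrow> 'k) set))
    (germ_le (PGL2_power n) (regular_PGL2_power n :: ((nat \<Rightarrow> ('k ^ 2 ^ 2) set) \<Rightarrow> 'k) set)) (coordinate_germ n V)"
proof -
  let ?G = "PGL2_power n :: (nat \<Rightarrow> ('k ^ 2 ^ 2) set) monoid"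
  let ?A = "regular_PGL2_power n :: ((nat \<Rightarrow> ('k ^ 2 ^ 2) set) \<Rightarrow> 'k) set"
  let ?E = "\<lambda>t z. if z \<in> V then t z else 0"
  have finV: "finite V"
    using finite_subset[OF order_trans[OF V affine_coords_subset]] by simp
  have nonempty: "\<not> germ_le ?G ?A (coordinate_germ n V) {}"
  proof
    assume "germ_le ?G ?A (coordinate_germ n V) {}"
    then obtain r where r: "radius r" "r < 1" "\<forall>X\<in>polydisc (coords n) r. near_point n X \<notin> coordinate_germ n V"
      unfolding germ_le_def eventually_near_one by auto
    have "(\<lambda>_. 0 :: 'k) \<in> polydisc V r"
      using radius_pos[OF r(1)] by (intro polydiscI) simp
    then show False
      using coordinate_germ_near_point[OF _ V _ r(2), of "\<lambda>_. 0"] r(3) radius_pos[OF r(1)] by auto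
  qed
  have key: "germ_le ?G ?A (coordinate_germ n V) Y \<or> germ_le ?G ?A (coordinate_germ n V) Z"
    if Y: "analytic_germ ?G ?A Y" and Z: "analytic_germ ?G ?A Z" and YZ: "germ_le ?G ?A (coordinate_germ n V) (Y \<union> Z)" for Y Z
  proof (rule ccontr)
    assume neg: "\<not> ?thesis"
    obtain F1 r1 where F1: "finite F1" "radius r1" "r1 < 1"
      "\<And>f. f \<in> F1 \<Longrightarrow> (\<lambda>X. f (near_point n X)) \<in> convergent_on (coords n) r1"
      "\<And>X. X \<in> polydisc (coords n) r1 \<Longrightarrow> near_point n X \<in> Y \<longleftrightarrow> (\<forall>f\<in>F1. f (near_point n X) = 0)"
      by (rule analytic_germE[OF Y]) (rule that)
    obtain F2 r2 where F2: "finite F2" "radius r2" "r2 < 1"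
      "\<And>f. f \<in> F2 \<Longrightarrow> (\<lambda>X. f (near_point n X)) \<in> convergent_on (coords n) r2"
      "\<And>X. X \<in> polydisc (coords n) r2 \<Longrightarrow> near_point n X \<in> Z \<longleftrightarrow> (\<forall>f\<in>F2. f (near_point n X) = 0)"
      by (rule analytic_germE[OF Z]) (rule that)
    obtain r3 where r3: "radius r3" "r3 < 1" "\<forall>X\<in>polydisc (coords n) r3. near_point n X \<in> coordinate_germ n V \<longrightarrow> near_point n X \<in> Y \<union> Z"
      using YZ unfolding germ_le_def eventually_near_one by (elim exE conjE) (rule that)
    define r where "r = min r1 (min r2 r3)"
    have r: "radius r" "r \<le> r1" "r \<le> r2" "r \<le> r3" "r < 1"
      using F1(2,3) F2(2) r3(1) by (auto simp: r_def radius_min)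
    have r0: "r > 0"
      using r(1) by (rule radius_pos)
    obtain s where s: "radius s" "s < r"
      using ex_radius_less[OF r0] by blast
    have s0: "s > 0"
      using s(1) by (rule radius_pos)
    have conv: "(\<lambda>t. f (near_point n (?E t))) \<in> convergent_on V r"
      if f: "(\<lambda>X. f (near_point n X)) \<in> convergent_on (coords n) r'" and r': "r \<le> r'" for f :: "_ \<Rightarrow> 'k" and r'
    proof (rule tate_compose[where f = "\<lambda>X. f (near_point n X)" and V = "coords n" and r = r and \<phi> = ?E])
      show "(\<lambda>X. f (near_point n X)) \<in> convergent_on (coords n) r"
        using tate_mono[OF f subset_refl r'] .
      show "(\<lambda>t. if z \<in> V then t z else 0) \<in> convergent_on V r" for z
        by (cases "z \<in> V") (simp_all add: tate_var tate_const)
      show "?E t \<in> polydisc (coords n) r" if "t \<in> polydisc V r" for t :: "nat \<times> 2 \<times> 2 \<Rightarrow> 'k"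
        using coordinate_germ_near_point(1)[OF that V _ r(5)] r0 by simp
    qed (use r0 in simp)
    have ex: "\<exists>f\<in>F. \<exists>t\<in>polydisc V s. f (near_point n (?E t)) \<noteq> 0"
      if W: "\<not> germ_le ?G ?A (coordinate_germ n V) W" and r': "r \<le> r'" "r' < 1"
        and eq: "\<And>X. X \<in> polydisc (coords n) r' \<Longrightarrow> near_point n X \<in> W \<longleftrightarrow> (\<forall>f\<in>F. f (near_point n X) = 0)"
      for W :: "(nat \<Rightarrow> ('k ^ 2 ^ 2) set) set" and F :: "((nat \<Rightarrow> ('k ^ 2 ^ 2) set) \<Rightarrow> 'k) set" and r'
    proof -
      have "s < 1"
        using s(2) r(5) by simp
      then have "\<not> (\<forall>X\<in>polydisc (coords n) s. near_point n X \<in> coordinate_germ n V \<longrightarrow> near_point n X \<in> W)"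
        using W s(1) unfolding germ_le_def eventually_near_one by blast
      then obtain X where X: "X \<in> polydisc (coords n) s" "near_point n X \<in> coordinate_germ n V" "near_point n X \<notin> W"
        by blast
      obtain t where t: "t \<in> polydisc V s" "near_point n X = near_point n (?E t)"
        by (rule coordinate_germE[OF X(1) \<open>s < 1\<close> V X(2)]) (rule that)
      have "X \<in> polydisc (coords n) r'"
        using polydisc_mono[OF X(1) subset_refl] s(2) r'(1) by simp
      from eq[OF this] X(3) obtain f where "f \<in> F" "f (near_point n X) \<noteq> 0"
        by blast
      with t show ?thesis
        by auto
    qed
    obtain f t1 where f: "f \<in> F1" "t1 \<in> polydisc V s" "f (near_point n (?E t1)) \<noteq> 0"
      using ex[OF _ r(2) F1(3,5)] neg by blast
    obtain g t2 where g: "g \<in> F2" "t2 \<in> polydisc V s" "g (near_point n (?E t2)) \<noteq> 0"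
      using ex[OF _ r(3) F2(3,5)] neg by blast
    have prod: "f (near_point n (?E t)) * g (near_point n (?E t)) = 0" if t: "t \<in> polydisc V r" for t
    proof -
      have D: "?E t \<in> polydisc (coords n) r"
        using coordinate_germ_near_point(1)[OF t V _ r(5)] r0 by simp
      have "near_point n (?E t) \<in> coordinate_germ n V"
        using coordinate_germ_near_point(3)[OF t V _ r(5)] r0 by simp
      then have "near_point n (?E t) \<in> Y \<union> Z"
        using r3(3) polydisc_mono[OF D subset_refl r(4)] by blast
      then show ?thesis
        using F1(5)[OF polydisc_mono[OF D subset_refl r(2)]] F2(5)[OF polydisc_mono[OF D subset_refl r(3)]] f(1) g(1)
        by auto
    qed
    have "(\<forall>t\<in>polydisc V s. f (near_point n (?E t)) = 0) \<or> (\<forall>t\<in>polydisc V s. g (near_point n (?E t)) = 0)"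
      using tate_no_zero_divisors[OF conv[OF F1(4)[OF f(1)] r(2)] conv[OF F2(4)[OF g(1)] r(3)] r(1) finV prod _ s(2)] s0
      by simp
    with f g show False
      by blast
  qed
  show ?thesis
    unfolding irreducible_in_def using analytic_coordinate_germ nonempty key by blast
qed

text \<open>The affine coordinates are released one at a time, which gives a full flag of coordinate
  germs. Each inclusion is strict because the coordinate released last takes nonzero values
  arbitrarily close to the identity.\<close>

lemma germ_dim_ge:
  fixes \<Sigma> :: "(nat \<Rightarrow> ('k ^ 2 ^ 2) set) set"
  assumes \<Sigma>: "\<forall>\<^sub>F x in near_one (PGL2_power n) (regular_PGL2_power n :: ((nat \<Rightarrow> ('k ^ 2 ^ 2) set) \<Rightarrow> 'k) set). x \<in> \<Sigma>"
  shows "germ_dim (PGL2_power n) (regular_PGL2_power n :: ((nat \<Rightarrow> ('k ^ 2 ^ 2) set) \<Rightarrow> 'k) set) \<Sigma> \<ge> enat (3 * n)"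
proof -
  let ?G = "PGL2_power n :: (nat \<Rightarrow> ('k ^ 2 ^ 2) set) monoid"
  let ?A = "regular_PGL2_power n :: ((nat \<Rightarrow> ('k ^ 2 ^ 2) set) \<Rightarrow> 'k) set"
  have "finite (affine_coords n)"
    using finite_subset[OF affine_coords_subset finite_coords] .
  then obtain h where h: "bij_betw h {0..<3 * n} (affine_coords n)"
    using ex_bij_betw_nat_finite[of "affine_coords n"] unfolding card_affine_coords by blast
  define c where "c = (\<lambda>k. coordinate_germ n (h ` {0..<k}))"
  have sub: "h ` {0..<k} \<subseteq> affine_coords n" if "k \<le> 3 * n" for k
    using bij_betw_imp_surj_on[OF h] that by auto
  have strict: "\<not> germ_le ?G ?A (c (Suc k)) (c k)" if k: "k < 3 * n" for k
  proof
    assume "germ_le ?G ?A (c (Suc k)) (c k)"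
    then obtain r where r: "radius r" "r < 1" "\<forall>X\<in>polydisc (coords n) r. near_point n X \<in> c (Suc k) \<longrightarrow> near_point n X \<in> c k"
      unfolding germ_le_def eventually_near_one by (elim exE conjE) (rule that)
    have r0: "r > 0"
      using r(1) by (rule radius_pos)
    obtain a :: 'k where a: "a \<noteq> 0" "vabs a \<le> r"
      using ex_small[OF r0] by (meson less_imp_le)
    let ?V = "h ` {0..<Suc k}"
    define t where "t = (\<lambda>_ :: nat \<times> 2 \<times> 2. a)"
    have t: "t \<in> polydisc ?V r"
      using a(2) by (intro polydiscI) (simp add: t_def)
    have V: "?V \<subseteq> affine_coords n"
      using sub[of "Suc k"] k by simp
    let ?t = "\<lambda>z. if z \<in> ?V then t z else 0"
    note E = coordinate_germ_near_point[OF t V less_imp_le[OF r0] r(2)]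
    have "near_point n ?t \<in> c k"
      using bspec[OF r(3) E(1), folded c_def, THEN mp, unfolded c_def, OF E(3)] unfolding c_def .
    moreover have "h k \<in> affine_coords n - h ` {0..<k}"
    proof
      show "h k \<in> affine_coords n"
        using bij_betwE[OF h] k by simp
      show "h k \<notin> h ` {0..<k}"
        using inj_on_image_mem_iff[OF bij_betw_imp_inj_on[OF h], of k "{0..<k}"] k by auto
    qed
    ultimately have "affine_function (h k) (near_point n ?t) = 0"
      unfolding c_def coordinate_germ_def by blast
    moreover have "h k \<in> coords n"
      using bij_betwE[OF h] k affine_coords_subset[of n] by auto
    ultimately have "normalised ?t (h k) = 0"
      using affine_function_eq_0_iff[OF E(1) r(2)] by blast
    then show False
      using a(1) unfolding E(2) by (simp add: t_def split: if_splits)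
  qed
  show ?thesis
    unfolding germ_dim_def krull_dim_def
  proof (rule Sup_upper, intro CollectI exI[of _ "3 * n"] exI[of _ c] conjI refl allI impI)
    fix i assume i: "i \<le> 3 * n"
    show "irreducible_in (analytic_germ ?G ?A) (germ_le ?G ?A) (c i)"
      unfolding c_def using irreducible_coordinate_germ[OF sub[OF i]] .
    show "germ_le ?G ?A (c i) \<Sigma>"
      unfolding germ_le_def using \<Sigma> by (rule eventually_mono) blast
  next
    fix i assume i: "i < 3 * n"
    show "germ_le ?G ?A (c i) (c (Suc i))"
      unfolding germ_le_def c_def coordinate_germ_def by (intro always_eventually) auto
    show "\<not> germ_le ?G ?A (c (Suc i)) (c i)"
      using strict[OF i] .
  qed
qed

end

section \<open>Conjugation and Frobenius maps in matrix coordinates\<close>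

definition block :: "(nat \<times> 2 \<times> 2 \<Rightarrow> 'k) \<Rightarrow> nat \<Rightarrow> 'k ^ 2 ^ 2" where
  "block v i = (\<chi> j k. v (i, j, k))"

definition block_conj :: "(nat \<Rightarrow> 'k :: field ^ 2 ^ 2) \<Rightarrow> (nat \<times> 2 \<times> 2 \<Rightarrow> 'k) \<Rightarrow> nat \<times> 2 \<times> 2 \<Rightarrow> 'k" where
  "block_conj g v = (\<lambda>(i, j, k). (g i ** block v i ** inv2 (g i)) $ j $ k)"

lemma block_nth [simp]: "block v i $ j $ k = v (i, j, k)"
  by (simp add: block_def)

lemma near_matrix_block_conj:
  assumes "invertible (near_matrix a i)"
  shows "near_matrix (block_conj (near_matrix a) X) i = near_matrix a i ** near_matrix X i ** inv2 (near_matrix a i)"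
proof -
  let ?A = "near_matrix a i"
  have "near_matrix X i = mat 1 + block X i" "near_matrix (block_conj (near_matrix a) X) i = mat 1 + ?A ** block X i ** inv2 ?A"
    by (rule mat2_eqI; simp add: near_matrix_nth mat_nth block_conj_def)+
  moreover have "(A + B) ** C = A ** C + B ** C" for A B C :: "'a ^ 2 ^ 2"
    by (rule mat2_eqI) (simp_all add: mult2_nth algebra_simps)
  ultimately show ?thesis
    by (simp add: matrix_add_ldistrib inv2_right[OF assms])
qed

context nonarch_field
begin

text \<open>The product of Frobenius endomorphisms with an exponent of its own for each factor. As
  the Frobenius map is additive and fixes 1, powers of the coordinates amount to powers of the
  matrix entries.\<close>

definition frob :: "(nat \<Rightarrow> nat) \<Rightarrow> (nat \<times> 2 \<times> 2 \<Rightarrow> 'k) \<Rightarrow> nat \<times> 2 \<times> 2 \<Rightarrow> 'k" where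
  "frob m X = (\<lambda>(i, j, k). X (i, j, k) ^ (p ^ m i))"

lemma pow_frob_pos [simp]: "p ^ e > 0"
  by simp

lemma frob_apply: "frob m X (i, j, k) = X (i, j, k) ^ (p ^ m i)"
  by (simp add: frob_def)

lemma near_matrix_frob: "near_matrix (frob m X) i $ j $ k = (near_matrix X i $ j $ k) ^ (p ^ m i)"
  by (simp add: near_matrix_nth frob_apply frob_pow_add)

lemma det_frob: "det (\<chi> j k. (A $ j $ k) ^ (p ^ e)) = det (A :: 'k ^ 2 ^ 2) ^ (p ^ e)"
  by (simp add: det_2 frob_pow_diff power_mult_distrib)

lemma det_near_matrix_frob: "det (near_matrix (frob m X) i) = det (near_matrix X i) ^ (p ^ m i)"
  by (simp add: det_2 near_matrix_frob frob_pow_diff power_mult_distrib)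

lemma frob_near_mult: "frob m (near_mult X Y) = near_mult (frob m X) (frob m Y)"
  by (auto simp: fun_eq_iff frob_def near_mult_def frob_pow_add power_mult_distrib)

lemma frob_near_inv: "frob m (near_inv X) = near_inv (frob m X)"
proof
  fix z :: "nat \<times> 2 \<times> 2"
  obtain i j k where z: "z = (i, j, k)"
    by (cases z) auto
  have neg: "(- x) ^ (p ^ e) = - (x ^ (p ^ e))" for x :: 'k and e
    using frob_pow_diff[of 0 x e] by simp
  have "(inv2 (near_matrix X i) $ j $ k) ^ (p ^ m i) = inv2 (near_matrix (frob m X) i) $ j $ k"
    using exhaust_2[of j] exhaust_2[of k]
    by (auto simp: inv2_def det_near_matrix_frob near_matrix_frob power_mult_distrib power_inverse neg)
  then show "frob m (near_inv X) z = near_inv (frob m X) z"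
    by (simp add: z frob_apply near_inv_def frob_pow_diff)
qed

lemma frob_0 [simp]: "frob m (\<lambda>_. 0) = (\<lambda>_. 0)"
  by (auto simp: frob_def fun_eq_iff)

lemma frob_polydisc:
  assumes "X \<in> polydisc (coords n) r" "0 \<le> r" "r \<le> 1"
  shows "frob m X \<in> polydisc (coords n) r"
proof (rule polydiscI)
  fix z assume z: "z \<in> coords n"
  obtain i j k where ijk: "z = (i, j, k)"
    by (cases z) auto
  have "vabs (X z) ^ (p ^ m i) \<le> r ^ (p ^ m i)"
    using polydiscD[OF assms(1) z] by (intro power_mono) auto
  also have "\<dots> \<le> r ^ 1"
    using assms(2,3) by (intro power_decreasing) (auto simp: Suc_le_eq)
  finally show "vabs (frob m X z) \<le> r"
    by (simp add: ijk frob_apply vabs_power)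
qed

text \<open>Frobenius maps are bijective on points, but inverting them enlarges small radii; an
  image radius of \<open>r ^ (p ^ M)\<close> compensates for this in every factor at once.\<close>

lemma frob_root:
  assumes r: "radius r" "r \<le> 1"
  obtains \<rho> where "radius \<rho>" "\<rho> \<le> r"
    "\<And>X. X \<in> polydisc (coords n) \<rho> \<Longrightarrow> \<exists>a\<in>polydisc (coords n) r. frob m a = X"
proof
  \<comment> \<open>A common upper bound for the exponents \<open>m i\<close>.\<close>
  define M where "M = (\<Sum>i<n. m i)"
  have r0: "r > 0"
    using r(1) by (rule radius_pos)
  show "radius (r ^ (p ^ M))"
    using r(1) by (rule radius_power)
  have "r ^ (p ^ M) \<le> r ^ 1"
    using r(2) r0 by (intro power_decreasing) (auto simp: Suc_le_eq)
  then show "r ^ (p ^ M) \<le> r"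
    by simp
  fix X :: "nat \<times> 2 \<times> 2 \<Rightarrow> 'k" assume X: "X \<in> polydisc (coords n) (r ^ (p ^ M))"
  have "\<forall>z. \<exists>y. y ^ (p ^ m (fst z)) = X z"
    using ex_root[OF pow_frob_pos] by blast
  then obtain a where a: "\<And>z. a z ^ (p ^ m (fst z)) = X z"
    by metis
  show "\<exists>a\<in>polydisc (coords n) r. frob m a = X"
  proof (rule bexI[of _ a])
    show "frob m a = X"
      using a by (auto simp: frob_def fun_eq_iff)
    show "a \<in> polydisc (coords n) r"
    proof (rule polydiscI)
      fix z assume z: "z \<in> coords n"
      obtain i j k where ijk: "z = (i, j, k)"
        by (cases z) auto
      have "m i \<le> M"
        unfolding M_def using z by (intro member_le_sum) (auto simp: ijk)
      then have "p ^ m i \<le> p ^ M"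
        by (intro power_increasing) (auto simp: Suc_le_eq)
      have "vabs (a z) ^ (p ^ m i) = vabs (X z)"
        using a[of z] by (simp add: ijk vabs_power[symmetric])
      also have "\<dots> \<le> r ^ (p ^ M)"
        using polydiscD[OF X z] .
      also have "\<dots> \<le> r ^ (p ^ m i)"
        using r(2) r0 by (intro power_decreasing[OF \<open>p ^ m i \<le> p ^ M\<close>]) auto
      finally show "vabs (a z) \<le> r"
        using r0 by (simp add: power_mono_iff)
    qed
  qed
qed

end

section \<open>Subgroups of small polydiscs\<close>

text \<open>Matrices in a polydisc of radius less than 1 around the identity form a group, so the
  trace of \<open>\<Sigma>\<close> on this polydisc is a genuine subgroup. From here on sets of
  points replace germs.\<close>

locale small_subgroup = nonarch_field field_type p
  for field_type :: "'k :: {alg_closed_field, ultrametric_field} itself" and p +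
  fixes n :: nat and r0 :: real and \<Sigma> :: "(nat \<Rightarrow> ('k ^ 2 ^ 2) set) set"
  assumes radius_r0: "radius r0" and r0_less_1: "r0 < 1"
    and one_in: "\<one>\<^bsub>PGL2_power n\<^esub> \<in> \<Sigma>"
    and closed: "\<And>X Y. X \<in> polydisc (coords n) r0 \<Longrightarrow> Y \<in> polydisc (coords n) r0 \<Longrightarrow>
      near_point n X \<in> \<Sigma> \<Longrightarrow> near_point n Y \<in> \<Sigma> \<Longrightarrow>
      inv\<^bsub>PGL2_power n\<^esub> (near_point n X) \<otimes>\<^bsub>PGL2_power n\<^esub> near_point n Y \<in> \<Sigma>"
begin

lemma r0_pos: "r0 > 0"
  using radius_r0 by (rule radius_pos)

text \<open>
  The group operations commute with \<open>frob m\<close>, so the inverse image of a local group under \<open>frob m\<close> is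
  again a local group.
\<close>

definition lift :: "(nat \<Rightarrow> nat) \<Rightarrow> (nat \<times> 2 \<times> 2 \<Rightarrow> 'k) set" where
  "lift m = {X. frob m X \<in> polydisc (coords n) r0 \<and> near_point n (frob m X) \<in> \<Sigma>}"

lemma lift_0: "(\<lambda>_. 0) \<in> lift m"
  using r0_pos one_in by (simp add: lift_def near_point_0 polydisc_def)

lemma lift_inv_mult: "X \<in> lift m \<Longrightarrow> Y \<in> lift m \<Longrightarrow> near_mult (near_inv X) Y \<in> lift m"
  unfolding lift_def mem_Collect_eq frob_near_mult frob_near_inv
  using near_mult_polydisc[OF near_inv_polydisc[OF _ r0_less_1] _ less_imp_le[OF r0_less_1]]
    near_point_mult[OF near_inv_polydisc[OF _ r0_less_1] _ r0_less_1]
    near_point_inv[OF _ r0_less_1] closed by metis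

text \<open>Coordinates outside \<open>coords n\<close> carry no information, and identities such as
  \<open>near_inv_inv\<close> hold on \<open>coords n\<close> only; this bridges the
  difference.\<close>

lemma lift_cong:
  assumes "X \<in> lift m" "\<And>z. z \<in> coords n \<Longrightarrow> X z = Y z"
  shows "Y \<in> lift m"
proof -
  have eq: "frob m X z = frob m Y z" if "z \<in> coords n" for z
    using assms(2)[OF that] by (cases z) (simp add: frob_def)
  have "near_point n (frob m X) = near_point n (frob m Y)"
  proof (rule tuple_class_cong)
    fix i assume "i < n"
    then have "near_matrix (frob m X) i = near_matrix (frob m Y) i"
      using eq by (intro mat2_eqI) (simp_all add: near_matrix_nth)
    then show "pgl_class (near_matrix (frob m X) i) = pgl_class (near_matrix (frob m Y) i)"
      by simp
  qed
  moreover have "frob m Y \<in> polydisc (coords n) r0"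
    using assms(1) eq polydisc_cong[of "frob m X" "coords n" r0 "frob m Y"] by (simp add: lift_def)
  ultimately show ?thesis
    using assms(1) by (simp add: lift_def)
qed

lemma near_mult_0: "near_mult X (\<lambda>_. 0) = X" "near_mult (\<lambda>_. 0) X = X"
  by (auto simp: near_mult_def fun_eq_iff)

lemma invertible_lift:
  assumes "X \<in> lift m" "i < n"
  shows "invertible (near_matrix X i)"
proof -
  have "det (near_matrix (frob m X) i) \<noteq> 0"
    using assms invertible_near_matrix(1)[OF _ r0_less_1 assms(2)] by (auto simp: lift_def invertible_det_nz)
  then show ?thesis
    by (auto simp: det_near_matrix_frob invertible_det_nz)
qed

lemma near_inv_inv:
  assumes "X \<in> lift m" "i < n"
  shows "near_inv (near_inv X) (i, j, k) = X (i, j, k)"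
proof -
  have inv: "invertible (near_matrix X i)"
    by (rule invertible_lift[OF assms])
  have "inv2 (inv2 (near_matrix X i)) = inv2 (inv2 (near_matrix X i)) ** (inv2 (near_matrix X i) ** near_matrix X i)"
    by (simp add: inv2_left[OF inv])
  also have "\<dots> = near_matrix X i"
    by (simp add: matrix_mul_assoc inv2_left[OF invertible_inv2[OF inv]])
  finally have "inv2 (near_matrix (near_inv X) i) = near_matrix X i"
    by (simp add: near_matrix_inv)
  then show ?thesis
    by (subst near_inv_def) (simp add: near_matrix_nth)
qed

lemma lift_inv: "X \<in> lift m \<Longrightarrow> near_inv X \<in> lift m"
  using lift_inv_mult[OF _ lift_0] by (simp add: near_mult_0)

lemma lift_mult:
  assumes X: "X \<in> lift m" and Y: "Y \<in> lift m"
  shows "near_mult X Y \<in> lift m"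
proof (rule lift_cong[OF lift_inv_mult[OF lift_inv[OF X] Y]])
  fix z assume z: "z \<in> coords n"
  obtain i j k where ijk: "z = (i, j, k)" "i < n"
    using z by (cases z) auto
  show "near_mult (near_inv (near_inv X)) Y z = near_mult X Y z"
    by (simp add: ijk near_mult_def near_inv_inv[OF X ijk(2)])
qed

lemma lift_conj:
  assumes a: "a \<in> lift m" and X: "X \<in> lift m"
  shows "block_conj (near_matrix a) X \<in> lift m"
proof (rule lift_cong[OF lift_mult[OF lift_mult[OF a X] lift_inv[OF a]]])
  fix z assume z: "z \<in> coords n"
  obtain i j k where ijk: "z = (i, j, k)" "i < n"
    using z by (cases z) auto
  have "near_matrix (near_mult (near_mult a X) (near_inv a)) i = near_matrix (block_conj (near_matrix a) X) i"
    by (simp add: near_matrix_mult near_matrix_inv near_matrix_block_conj[OF invertible_lift[OF a ijk(2)]])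
  from arg_cong[OF this, of "\<lambda>A. A $ j $ k"]
  show "near_mult (near_mult a X) (near_inv a) z = block_conj (near_matrix a) X z"
    by (simp add: ijk near_matrix_nth)
qed

text \<open>The matrix of the linear map \<open>x \<mapsto> a x\<close> given by blockwise
  multiplication, that is, the bilinear part of \<open>near_mult\<close>. Its nonzero entries are
  entries of \<open>a\<close>, hence small.\<close>

definition right_mult :: "(nat \<times> 2 \<times> 2 \<Rightarrow> 'k) \<Rightarrow> nat \<times> 2 \<times> 2 \<Rightarrow> nat \<times> 2 \<times> 2 \<Rightarrow> 'k" where
  "right_mult a = (\<lambda>(i, j, k) (i', l, m). if i' = i \<and> m = k then a (i, j, l) else 0)"

lemma sum_right_mult:
  assumes "i < n"
  shows "(\<Sum>z\<in>coords n. right_mult a (i, j, k) z * x z) = a (i, j, 1) * x (i, 1, k) + a (i, j, 2) * x (i, 2, k)"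
proof -
  have "(\<Sum>z\<in>coords n. right_mult a (i, j, k) z * x z)
      = (\<Sum>z\<in>{(i, 1, k), (i, 2, k)}. right_mult a (i, j, k) z * x z)"
  proof (rule sum.mono_neutral_right)
    show "\<forall>z\<in>coords n - {(i, 1, k), (i, 2, k)}. right_mult a (i, j, k) z * x z = 0"
    proof
      fix z assume z: "z \<in> coords n - {(i, 1, k), (i, 2, k)}"
      obtain i' l k' where "z = (i', l, k')"
        by (cases z) auto
      with z show "right_mult a (i, j, k) z * x z = 0"
        using exhaust_2[of l] by (auto simp: right_mult_def)
    qed
  qed (use assms in auto)
  also have "\<dots> = a (i, j, 1) * x (i, 1, k) + a (i, j, 2) * x (i, 2, k)"
    by (simp add: right_mult_def)
  finally show ?thesis .
qed

lemma local_group_lift: "local_group (coords n) r (lift m) right_mult"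
  unfolding local_group_def
proof (intro conjI allI impI ballI)
  fix s :: real and a assume a: "a \<in> lift m \<inter> polydisc (coords n) s"
  show "vabs (right_mult a z z') \<le> s" if z: "z \<in> coords n" "z' \<in> coords n" for z z'
  proof -
    obtain i j k i' l k' where ijk: "z = (i, j, k)" "z' = (i', l, k')" "i < n"
      using z by (cases z, cases z') auto
    have "vabs (a (i, j, l)) \<le> s"
      using a ijk(3) polydiscD[of a "coords n" s "(i, j, l)"] by simp
    moreover have "0 \<le> s"
      using calculation vabs_ge_0 order_trans by blast
    ultimately show ?thesis
      by (simp add: ijk right_mult_def)
  qed
  fix x assume x: "x \<in> lift m \<inter> polydisc (coords n) s"
  show "(\<lambda>z. a z + x z + (\<Sum>z'\<in>coords n. right_mult a z z' * x z')) \<in> lift m"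
  proof (rule lift_cong[OF lift_mult[of a m x]])
    fix z assume z: "z \<in> coords n"
    obtain i j k where ijk: "z = (i, j, k)" "i < n"
      using z by (cases z) auto
    show "near_mult a x z = a z + x z + (\<Sum>z'\<in>coords n. right_mult a z z' * x z')"
      unfolding ijk(1) sum_right_mult[OF ijk(2)] by (simp add: near_mult_def)
  qed (use a x in auto)
qed (rule lift_0)

end

section \<open>Tangent spaces\<close>

text \<open>For \<open>2 \<noteq> 0\<close> the matrices of trace zero form an irreducible module
  under conjugation that meets the scalars trivially; explicit matrices replace the representation
  theory. Only the differences \<open>g V g^-1 - V\<close> are assumed to lie in \<open>N\<close>,
  because \<open>V\<close> will be one block of a tangent vector with further blocks, which cancel
  in such differences.\<close>

lemma conj_stable_eq_UNIV:
  fixes N :: "('k :: field ^ 2 ^ 2) set"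
  assumes add: "\<And>A B c. A \<in> N \<Longrightarrow> B \<in> N \<Longrightarrow> A + mat c ** B \<in> N"
    and conj: "\<And>g A. invertible g \<Longrightarrow> A \<in> N \<Longrightarrow> g ** A ** inv2 g \<in> N"
    and one: "mat 1 \<in> N"
    and V: "\<And>g. invertible g \<Longrightarrow> g ** V ** inv2 g - V \<in> N" "\<And>c. V \<noteq> mat c"
    and two: "(2 :: 'k) \<noteq> 0"
  shows "A \<in> N"
proof -
  \<comment> \<open>Conjugation by \<open>t\<close> negates the off-diagonal entries, by
    \<open>w\<close> it exchanges the rows and the columns, and \<open>u\<close> is the unipotent
    element whose conjugation shifts weights upwards.\<close>
  define u t w where "u = (mat2 1 1 0 1 :: 'k ^ 2 ^ 2)" and "t = (mat2 (-1) 0 0 1 :: 'k ^ 2 ^ 2)"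
    and "w = (mat2 0 1 1 0 :: 'k ^ 2 ^ 2)"
  have inv: "invertible u" "invertible t" "invertible w"
    by (simp_all add: u_def t_def w_def invertible_det_nz det_2)
  have cu: "u ** mat2 a b c d ** inv2 u = mat2 (a + c) (b + d - a - c) c (d - c)" for a b c d
    by (rule mat2_eqI) (simp_all add: u_def inv2_def mult2_nth det_2)
  have ct: "t ** mat2 a b c d ** inv2 t = mat2 a (- b) (- c) d" for a b c d
    by (rule mat2_eqI) (simp_all add: t_def inv2_def mult2_nth det_2)
  have cw: "w ** mat2 a b c d ** inv2 w = mat2 d c b a" for a b c d
    by (rule mat2_eqI) (simp_all add: w_def inv2_def mult2_nth det_2)
  have lin: "mat2 (a + r * a') (b + r * b') (c + r * c') (d + r * d') \<in> N"
    if "mat2 a b c d \<in> N" "mat2 a' b' c' d' \<in> N" for a b c d r a' b' c' d'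
  proof -
    have "mat2 a b c d + mat r ** mat2 a' b' c' d' = mat2 (a + r * a') (b + r * b') (c + r * c') (d + r * d')"
      by (rule mat2_eqI) (simp_all add: scalar_mult_nth)
    then show ?thesis
      using add[OF that, of r] by simp
  qed
  have "(mat 1 :: 'k ^ 2 ^ 2) = mat2 1 0 0 1"
    by (rule mat2_eqI) (simp_all add: mat_nth)
  with one have one': "mat2 1 0 0 1 \<in> N"
    by simp
  have "mat2 0 0 0 0 \<in> N"
    using lin[OF one' one', of "-1"] by simp
  note scale = lin[OF this, simplified]
  obtain a b c d where V_eq: "V = mat2 a b c d"
    using mat2_eqI[of V "mat2 (V $ 1 $ 1) (V $ 1 $ 2) (V $ 2 $ 1) (V $ 2 $ 2)"] by auto
  have diff: "mat2 a b c d - mat2 a' b' c' d' = mat2 (a - a') (b - b') (c - c') (d - d')" for a b c d a' b' c' d' :: 'k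
    by (rule mat2_eqI) simp_all
  \<comment> \<open>A nonzero upper triangular nilpotent is produced in each case: from a nonscalar
    diagonal \<open>V\<close> by \<open>u\<close>, from an upper triangular one by \<open>t\<close>,
    and otherwise by taking the off-diagonal part with \<open>t\<close> and applying conjugation by
    \<open>u\<close> minus the identity twice.\<close>
  have "\<exists>\<beta>. \<beta> \<noteq> 0 \<and> mat2 0 \<beta> 0 0 \<in> N"
  proof (cases "c = 0")
    case True
    show ?thesis
    proof (cases "b = 0")
      case b: True
      have "V \<noteq> mat a"
        by (rule V(2))
      then have "d - a \<noteq> 0"
        using True b mat2_eqI[of V "mat a"] by (auto simp: V_eq mat_nth)
      moreover have "mat2 0 (d - a) 0 0 \<in> N"
        using V(1)[OF inv(1)] by (simp add: V_eq cu diff True b)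
      ultimately show ?thesis
        by blast
    next
      case b: False
      have "mat2 0 (- b - b) 0 0 \<in> N"
        using V(1)[OF inv(2)] by (simp add: V_eq ct diff True)
      moreover have "- b - b \<noteq> 0"
        using b two by (simp flip: mult_2)
      ultimately show ?thesis
        by blast
    qed
  next
    case False
    define \<gamma> where "\<gamma> = - c - c"
    have \<gamma>: "\<gamma> \<noteq> 0"
      using False two by (simp add: \<gamma>_def flip: mult_2)
    have w1: "mat2 0 (- b - b) \<gamma> 0 \<in> N"
      using V(1)[OF inv(2)] by (simp add: V_eq ct diff \<gamma>_def)
    have "mat2 \<gamma> (- b - b - \<gamma>) \<gamma> (- \<gamma>) \<in> N"
      using conj[OF inv(1) w1] by (simp add: cu)
    from lin[OF this w1, of "-1"] have w2: "mat2 \<gamma> (- \<gamma>) 0 (- \<gamma>) \<in> N"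
      by simp
    have "mat2 \<gamma> (- \<gamma> - \<gamma> - \<gamma>) 0 (- \<gamma>) \<in> N"
      using conj[OF inv(1) w2] by (simp add: cu)
    from lin[OF this w2, of "-1"] have "mat2 0 (- \<gamma> - \<gamma>) 0 0 \<in> N"
      by simp
    moreover have "- \<gamma> - \<gamma> \<noteq> 0"
      using \<gamma> two by (simp flip: mult_2)
    ultimately show ?thesis
      by blast
  qed
  then obtain \<beta> where \<beta>: "\<beta> \<noteq> 0" "mat2 0 \<beta> 0 0 \<in> N"
    by blast
  have e12: "mat2 0 x 0 0 \<in> N" for x
    using scale[OF \<beta>(2), of "x / \<beta>"] \<beta>(1) by simp
  have e21: "mat2 0 0 x 0 \<in> N" for x
    using conj[OF inv(3) e12[of x]] by (simp add: cw)
  \<comment> \<open>Removing the off-diagonal part leaves the diagonal matrix with entries 1 and -1,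
    and adding the identity gives twice an elementary matrix, which is where division by 2
    occurs.\<close>
  have "mat2 1 (- 1) 1 (- 1) \<in> N"
    using conj[OF inv(1) e21[of 1]] by (simp add: cu)
  from lin[OF lin[OF lin[OF this e12[of 1], of 1] e21[of 1], of "-1"] one', of 1]
  have "mat2 2 0 0 0 \<in> N"
    by simp
  from scale[OF this, of "x / 2" for x] have e11: "mat2 x 0 0 0 \<in> N" for x
    using two by simp
  have e22: "mat2 0 0 0 x \<in> N" for x
    using conj[OF inv(3) e11[of x]] by (simp add: cw)
  have "mat2 (A $ 1 $ 1) (A $ 1 $ 2) (A $ 2 $ 1) (A $ 2 $ 2) \<in> N"
    using lin[OF lin[OF lin[OF e11[of "A $ 1 $ 1"] e12[of "A $ 1 $ 2"], of 1] e21[of "A $ 2 $ 1"], of 1] e22[of "A $ 2 $ 2"], of 1]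
    by simp
  moreover have "A = mat2 (A $ 1 $ 1) (A $ 1 $ 2) (A $ 2 $ 1) (A $ 2 $ 2)"
    by (rule mat2_eqI) simp_all
  ultimately show ?thesis
    by simp
qed

lemma sum_coords: "(\<Sum>z\<in>coords n. F z) = (\<Sum>i<n. \<Sum>j\<in>UNIV. \<Sum>k\<in>UNIV. F (i, j, k))"
proof -
  have "(\<Sum>z\<in>coords n. F z) = (\<Sum>i<n. \<Sum>jk\<in>UNIV. F (i, jk))"
    by (simp add: coords_def sum.cartesian_product)
  moreover have "(\<Sum>jk\<in>UNIV. F (i, jk)) = (\<Sum>j\<in>UNIV. \<Sum>k\<in>UNIV. F (i, j, k))" for i
    by (simp add: sum.cartesian_product flip: UNIV_Times_UNIV)
  ultimately show ?thesis
    by simp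
qed

text \<open>The matrix of the adjoint action of \<open>g\<close>, block diagonal in the
  factors.\<close>

definition conj_coeff :: "(nat \<Rightarrow> 'k :: field ^ 2 ^ 2) \<Rightarrow> nat \<times> 2 \<times> 2 \<Rightarrow> nat \<times> 2 \<times> 2 \<Rightarrow> 'k" where
  "conj_coeff g = (\<lambda>(i, j, k) (i', a, b). if i' = i then g i $ j $ a * inv2 (g i) $ b $ k else 0)"

lemma block_conj_eq_sum:
  assumes "i < n"
  shows "block_conj g v (i, j, k) = (\<Sum>z\<in>coords n. conj_coeff g (i, j, k) z * v z)"
proof -
  have "(\<Sum>z\<in>coords n. conj_coeff g (i, j, k) z * v z)
     = (\<Sum>i'<n. if i' = i then \<Sum>a\<in>UNIV. \<Sum>b\<in>UNIV. g i $ j $ a * inv2 (g i) $ b $ k * v (i, a, b) else 0)"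
    unfolding sum_coords by (intro sum.cong refl) (simp add: conj_coeff_def)
  also have "\<dots> = (\<Sum>a\<in>UNIV. \<Sum>b\<in>UNIV. g i $ j $ a * inv2 (g i) $ b $ k * v (i, a, b))"
    using assms by (simp add: sum.delta)
  also have "\<dots> = block_conj g v (i, j, k)"
    by (simp add: sum_2 block_conj_def mult2_nth algebra_simps)
  finally show ?thesis ..
qed

context nonarch_field
begin

lemma conj_coeff_bound:
  fixes a :: "nat \<times> 2 \<times> 2 \<Rightarrow> 'k"
  assumes a: "a \<in> polydisc (coords n) r" "r < 1" and z: "z \<in> coords n"
  shows "vabs (conj_coeff (near_matrix a) z z') \<le> 1"
proof -
  obtain i j k i' l m where ijk: "z = (i, j, k)" "z' = (i', l, m)" "i < n"
    using z by (cases z, cases z') auto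
  have le: "vabs (near_matrix X i $ j $ k) \<le> 1" if "X \<in> polydisc (coords n) r" for X :: "nat \<times> 2 \<times> 2 \<Rightarrow> 'k" and j k
  proof -
    have "vabs (X (i, j, k)) \<le> 1"
      using polydiscD[OF that, of "(i, j, k)"] ijk(3) a(2) by simp
    then show ?thesis
      unfolding near_matrix_nth by (intro vabs_add_le) auto
  qed
  have "vabs (near_matrix a i $ j $ l * inv2 (near_matrix a i) $ m $ k) \<le> 1 * 1"
    unfolding vabs_mult near_matrix_inv[symmetric]
    by (intro mult_mono le[OF a(1)] le[OF near_inv_polydisc[OF a]]) auto
  then show ?thesis
    by (simp add: ijk conj_coeff_def)
qed

lemma block_conj_polydisc:
  fixes a :: "nat \<times> 2 \<times> 2 \<Rightarrow> 'k"
  assumes a: "a \<in> polydisc (coords n) r" "r < 1" and h: "h \<in> polydisc (coords n) s" and s: "s \<ge> 0"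
  shows "block_conj (near_matrix a) h \<in> polydisc (coords n) s"
proof (rule polydiscI)
  fix z assume z: "z \<in> coords n"
  obtain i j k where ijk: "z = (i, j, k)" "i < n"
    using z by (cases z) auto
  have "vabs (\<Sum>z'\<in>coords n. conj_coeff (near_matrix a) z z' * h z') \<le> s"
  proof (rule vabs_sum_le[OF _ s])
    fix z' assume "z' \<in> coords n"
    then have "vabs (conj_coeff (near_matrix a) z z') * vabs (h z') \<le> 1 * s"
      using conj_coeff_bound[OF a z] polydiscD[OF h] by (intro mult_mono) auto
    then show "vabs (conj_coeff (near_matrix a) z z' * h z') \<le> s"
      by (simp add: vabs_mult)
  qed
  then show "vabs (block_conj (near_matrix a) h z) \<le> s"
    unfolding ijk(1) block_conj_eq_sum[OF ijk(2)] .
qed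

end

context small_subgroup
begin

text \<open>The tangent space at the identity of the local group after extraction of Frobenius
  roots, in the redundant coordinates.\<close>

definition lie :: "(nat \<Rightarrow> nat) \<Rightarrow> (nat \<times> 2 \<times> 2 \<Rightarrow> 'k) set" where
  "lie m = {v. \<forall>l\<in>conormal (coords n) (lift m) r0. (\<Sum>z\<in>coords n. l z * v z) = 0}"

lemma lie_add:
  assumes "v \<in> lie m" "w \<in> lie m"
  shows "(\<lambda>z. v z + c * w z) \<in> lie m"
proof -
  have "(\<Sum>z\<in>coords n. l z * (v z + c * w z)) = (\<Sum>z\<in>coords n. l z * v z) + c * (\<Sum>z\<in>coords n. l z * w z)" for l
    by (simp add: sum.distrib sum_distrib_left algebra_simps)
  then show ?thesis
    using assms by (simp add: lie_def)
qed

text \<open>Group elements that agree with \<open>c v\<close> up to an error of order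
  \<open>c^2\<close> suffice: a function vanishing at them has a linear part whose value at
  \<open>c v\<close> is of quadratic size, hence zero.\<close>

lemma tangent_in_lie:
  assumes \<delta>: "\<delta> > 0" and C: "C \<ge> 0"
    and tangent: "\<And>c. c \<noteq> 0 \<Longrightarrow> vabs c \<le> \<delta> \<Longrightarrow> \<exists>X\<in>lift m. \<forall>z\<in>coords n. vabs (X z - c * v z) \<le> C * vabs c ^ 2"
  shows "v \<in> lie m"
  unfolding lie_def
proof (intro CollectI ballI)
  fix l assume "l \<in> conormal (coords n) (lift m) r0"
  then obtain r f where r: "radius r" and f: "f \<in> vanishing_ideal (coords n) (lift m) r" "linear_part (coords n) r f l"
    unfolding conormal_def by blast
  have r_pos: "r > 0"
    using r by (rule radius_pos)
  obtain D where D: "\<And>s h. 0 \<le> s \<Longrightarrow> s \<le> r \<Longrightarrow> h \<in> polydisc (coords n) s \<Longrightarrow>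
     vabs (f h - f (\<lambda>_. 0) - (\<Sum>i\<in>coords n. l i * h i)) \<le> D * s\<^sup>2"
    using f(2) unfolding linear_part_def by blast
  \<comment> \<open>Large enough for the approximating elements \<open>X\<close> to have size at
    most \<open>K * |c|\<close>; the summand \<open>C * \<delta>\<close> absorbs the quadratic
    error.\<close>
  define K where "K = 1 + C * \<delta> + (\<Sum>z\<in>coords n. vabs (v z))"
  define L where "L = (\<Sum>z\<in>coords n. vabs (l z))"
  have K: "K \<ge> 1" "C * \<delta> \<le> K" "\<And>z. z \<in> coords n \<Longrightarrow> vabs (v z) \<le> K"
  proof -
    have S0: "0 \<le> (\<Sum>z\<in>coords n. vabs (v z))" and "0 \<le> C * \<delta>"
      using C \<delta> by (auto intro: sum_nonneg)
    then show "K \<ge> 1" "C * \<delta> \<le> K"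
      by (auto simp: K_def)
    show "vabs (v z) \<le> K" if "z \<in> coords n" for z
      using member_le_sum[of z "coords n" "\<lambda>z. vabs (v z)"] that \<open>0 \<le> C * \<delta>\<close> by (simp add: K_def)
  qed
  have L: "L \<ge> 0" "\<And>z. z \<in> coords n \<Longrightarrow> vabs (l z) \<le> L"
    using member_le_sum[of _ "coords n" "\<lambda>z. vabs (l z)"] by (auto simp: L_def intro: sum_nonneg)
  show "(\<Sum>z\<in>coords n. l z * v z) = 0"
  proof (rule eq_0_if_small_bound)
    show "min \<delta> (r / K) > 0"
      using \<delta> r_pos K(1) by simp
    fix c :: 'k assume c: "c \<noteq> 0" "vabs c \<le> min \<delta> (r / K)"
    obtain X where X: "X \<in> lift m" "\<And>z. z \<in> coords n \<Longrightarrow> vabs (X z - c * v z) \<le> C * vabs c ^ 2"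
      using tangent[OF c(1)] c(2) by auto
    define s where "s = K * vabs c"
    have s: "0 \<le> s" "s \<le> r"
      using c(2) K(1) by (auto simp: s_def field_simps)
    have "X \<in> polydisc (coords n) s"
    proof (rule polydiscI)
      fix z assume z: "z \<in> coords n"
      have "C * vabs c ^ 2 \<le> (C * \<delta>) * vabs c"
        using c(2) C unfolding power2_eq_square mult.assoc by (intro mult_left_mono mult_right_mono) auto
      also have "\<dots> \<le> s"
        unfolding s_def using K(2) by (intro mult_right_mono) auto
      finally have 1: "vabs (X z - c * v z) \<le> s"
        using X(2)[OF z] by simp
      have "vabs (c * v z) \<le> s"
        using mult_right_mono[OF K(3)[OF z], of "vabs c"] by (simp add: s_def vabs_mult mult.commute)
      from vabs_add_le[OF 1 this] show "vabs (X z) \<le> s"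
        by simp
    qed
    moreover from this have "X \<in> polydisc (coords n) r" "(\<lambda>_. 0) \<in> polydisc (coords n) r"
      using polydisc_mono[OF _ subset_refl s(2)] r_pos by (auto simp: polydisc_def)
    then have "f X = 0" "f (\<lambda>_. 0) = 0"
      using f(1) X(1) lift_0 by (auto simp: vanishing_ideal_def)
    ultimately have "vabs (\<Sum>z\<in>coords n. l z * X z) \<le> D * s\<^sup>2"
      using D[OF s] by force
    then have 1: "vabs (\<Sum>z\<in>coords n. l z * X z) \<le> max (D * K\<^sup>2) (L * C) * vabs c ^ 2"
      using mult_right_mono[of "D * K\<^sup>2" "max (D * K\<^sup>2) (L * C)" "vabs c ^ 2"]
      by (simp add: s_def power_mult_distrib mult.assoc)
    have 2: "vabs (\<Sum>z\<in>coords n. l z * (X z - c * v z)) \<le> max (D * K\<^sup>2) (L * C) * vabs c ^ 2"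
    proof (rule vabs_sum_le)
      fix z assume z: "z \<in> coords n"
      have "vabs (l z * (X z - c * v z)) \<le> L * (C * vabs c ^ 2)"
        unfolding vabs_mult using L(1) L(2)[OF z] X(2)[OF z] by (intro mult_mono) auto
      also have "\<dots> \<le> max (D * K\<^sup>2) (L * C) * vabs c ^ 2"
        unfolding mult.assoc[symmetric] by (intro mult_right_mono) auto
      finally show "vabs (l z * (X z - c * v z)) \<le> max (D * K\<^sup>2) (L * C) * vabs c ^ 2" .
    qed (use L(1) C in \<open>auto simp: le_max_iff_disj\<close>)
    have "c * (\<Sum>z\<in>coords n. l z * v z) = (\<Sum>z\<in>coords n. l z * X z) - (\<Sum>z\<in>coords n. l z * (X z - c * v z))"
      by (simp add: sum_subtractf[symmetric] sum_distrib_left algebra_simps)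
    then show "vabs (c * (\<Sum>z\<in>coords n. l z * v z)) \<le> max (D * K\<^sup>2) (L * C) * vabs c ^ 2"
      using vabs_diff_le[OF 1 2] by simp
  qed
qed

text \<open>Rescaling the matrix of one factor does not move the point of the group, so these
  vectors are tangent to curves inside the inverse image of the identity. The curves are linear,
  whence the error constant 0.\<close>

lemma scalar_in_lie:
  assumes "i0 < n"
  shows "(\<lambda>(i, j, k). if i = i0 \<and> j = k then 1 else 0) \<in> lie m"
proof (rule tangent_in_lie[OF r0_pos, of 0])
  fix c :: 'k assume c: "c \<noteq> 0" "vabs c \<le> r0"
  define X where "X = (\<lambda>z :: nat \<times> 2 \<times> 2. c * (case z of (i, j, k) \<Rightarrow> if i = i0 \<and> j = k then 1 else 0))"
  have "X \<in> polydisc (coords n) r0"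
    using c(2) r0_pos by (intro polydiscI) (auto simp: X_def split: prod.splits)
  then have D: "frob m X \<in> polydisc (coords n) r0"
    using frob_polydisc[of X n r0] r0_pos r0_less_1 by simp
  have "near_point n (frob m X) = \<one>\<^bsub>PGL2_power n\<^esub>"
    unfolding one_PGL2_power
  proof (rule tuple_class_cong)
    fix i assume i: "i < n"
    define e where "e = near_matrix (frob m X) i $ 1 $ 1"
    have "e \<noteq> 0"
      using vabs_near_matrix_11[OF D r0_less_1 i] by (auto simp: e_def)
    moreover have "near_matrix (frob m X) i = mat e ** mat 1"
      unfolding e_def by (rule mat2_eqI) (simp_all add: near_matrix_nth frob_apply X_def scalar_mult_nth mat_nth)
    ultimately show "pgl_class (near_matrix (frob m X) i) = pgl_class (mat 1)"
      by (simp add: pgl_class_scalar del: matrix_mul_rid)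
  qed
  then have "X \<in> lift m"
    using D one_in by (simp add: lift_def)
  then show "\<exists>X\<in>lift m. \<forall>z\<in>coords n. vabs (X z - c * (case z of (i, j, k) \<Rightarrow> if i = i0 \<and> j = k then 1 else 0)) \<le> 0 * (vabs c)\<^sup>2"
    by (rule bexI[rotated]) (simp add: X_def)
qed simp

text \<open>Conjugation by \<open>a\<close> is linear in the coordinates and maps both
  \<open>lift m\<close> and all polydiscs into themselves, so composition with it preserves the
  functions vanishing on \<open>lift m\<close>.\<close>

lemma lie_conj_lift:
  assumes v: "v \<in> lie m" and a: "a \<in> lift m" "a \<in> polydisc (coords n) r0"
  shows "block_conj (near_matrix a) v \<in> lie m"
  unfolding lie_def
proof (intro CollectI ballI)
  fix l assume "l \<in> conormal (coords n) (lift m) r0"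
  then obtain r f where r: "radius r" "r \<le> r0" and f: "f \<in> vanishing_ideal (coords n) (lift m) r" "linear_part (coords n) r f l"
    unfolding conormal_def by blast
  have r_pos: "r \<ge> 0"
    using radius_pos[OF r(1)] by simp
  let ?c = "block_conj (near_matrix a)"
  define l' where "l' = (\<lambda>z'. \<Sum>z\<in>coords n. l z * conj_coeff (near_matrix a) z z')"
  have conj_sum: "?c h z = (\<Sum>z'\<in>coords n. conj_coeff (near_matrix a) z z' * h z')" if "z \<in> coords n" for z h
    using that by (cases z) (simp add: block_conj_eq_sum)
  have l': "(\<Sum>z\<in>coords n. l z * ?c h z) = (\<Sum>z\<in>coords n. l' z * h z)" for h
  proof -
    have "(\<Sum>z\<in>coords n. l z * ?c h z) = (\<Sum>z\<in>coords n. \<Sum>z'\<in>coords n. l z * conj_coeff (near_matrix a) z z' * h z')"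
      by (intro sum.cong refl) (simp add: conj_sum sum_distrib_left mult.assoc)
    also have "\<dots> = (\<Sum>z\<in>coords n. l' z * h z)"
      by (subst sum.swap) (simp add: l'_def sum_distrib_right)
    finally show ?thesis .
  qed
  have maps: "?c h \<in> polydisc (coords n) s" if "h \<in> polydisc (coords n) s" "s \<ge> 0" for h s
    using block_conj_polydisc[OF a(2) r0_less_1 that] .
  have "(\<lambda>X. f (?c X)) \<in> vanishing_ideal (coords n) (lift m) r"
    unfolding vanishing_ideal_def
  proof (intro CollectI conjI ballI)
    show "(\<lambda>X. f (?c X)) \<in> convergent_on (coords n) r"
    proof (rule tate_compose[where f = f and \<phi> = ?c and V = "coords n" and r = r])
      show "f \<in> convergent_on (coords n) r"
        using f(1) by (simp add: vanishing_ideal_def)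
      fix z assume z: "z \<in> coords n"
      show "(\<lambda>X. ?c X z) \<in> convergent_on (coords n) r"
        unfolding conj_sum[OF z] by (intro tate_sum tate_mult tate_const tate_var r_pos)
    qed (use maps r_pos in auto)
    fix X assume X: "X \<in> lift m \<inter> polydisc (coords n) r"
    then have "?c X \<in> lift m \<inter> polydisc (coords n) r"
      using lift_conj[OF a(1)] maps r_pos by simp
    then show "f (?c X) = 0"
      using f(1) by (simp add: vanishing_ideal_def)
  qed
  moreover have "linear_part (coords n) r (\<lambda>X. f (?c X)) l'"
  proof -
    obtain D where D: "\<And>s h. 0 \<le> s \<Longrightarrow> s \<le> r \<Longrightarrow> h \<in> polydisc (coords n) s \<Longrightarrow>
       vabs (f h - f (\<lambda>_. 0) - (\<Sum>i\<in>coords n. l i * h i)) \<le> D * s\<^sup>2"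
      using f(2) unfolding linear_part_def by blast
    have "?c (\<lambda>_. 0) = (\<lambda>_. 0)"
      by (auto simp: fun_eq_iff block_conj_def mult2_nth)
    then show ?thesis
      unfolding linear_part_def using D maps by (intro exI[of _ D]) (simp add: l'[symmetric])
  qed
  ultimately have "l' \<in> conormal (coords n) (lift m) r0"
    using conormalI[OF r] by blast
  then show "(\<Sum>z\<in>coords n. l z * ?c v z) = 0"
    using v unfolding l' by (simp add: lie_def)
qed

end

section \<open>From conjugation by the local group to conjugation by the whole group\<close>

context nonarch_field
begin

lemma entry_ratio_frob:
  "entry_ratio j a k b (pgl_class (\<chi> j k. (A $ j $ k) ^ (p ^ e))) = entry_ratio j a k b (pgl_class (A :: 'k ^ 2 ^ 2)) ^ (p ^ e)"
  unfolding entry_ratio_class det_frob by (simp add: power_mult_distrib power_inverse)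

end

definition swap2 :: "2 \<Rightarrow> 2" where
  "swap2 j = (if j = 1 then 2 else 1)"

lemma inv2_nth: "inv2 A $ b $ k = (if b = k then 1 else - 1) * (A $ swap2 k $ swap2 b * inverse (det A))"
  using exhaust_2[of b] exhaust_2[of k] by (auto simp: inv2_def swap2_def mult.commute)

definition conj_ratio :: "nat \<times> 2 \<times> 2 \<Rightarrow> 2 \<times> 2 \<Rightarrow> (nat \<Rightarrow> ('k :: field ^ 2 ^ 2) set) \<Rightarrow> 'k" where
  "conj_ratio = (\<lambda>(i, j, k) (a, b) x. entry_ratio j a (swap2 k) (swap2 b) (x i))"

text \<open>The inverse matrix is the adjugate over the determinant, so the entries of
  \<open>g v g^-1\<close> are linear combinations of entry ratios of \<open>g\<close>. The adjoint
  action is thereby exhibited as regular on the projective group.\<close>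

lemma block_conj_eq_ratio:
  assumes "i < n"
  shows "block_conj g v (i, j, k) = (\<Sum>(a, b)\<in>UNIV. (if b = k then 1 else - 1) * v (i, a, b) * conj_ratio (i, j, k) (a, b) (tuple_class n g))"
proof -
  have "block_conj g v (i, j, k) = (\<Sum>a\<in>UNIV. \<Sum>b\<in>UNIV. (if b = k then 1 else - 1) * v (i, a, b) * conj_ratio (i, j, k) (a, b) (tuple_class n g))"
    by (simp add: sum_2 block_conj_def mult2_nth conj_ratio_def tuple_class_nth[OF assms] entry_ratio_class inv2_nth algebra_simps)
  then show ?thesis
    by (simp add: sum.cartesian_product)
qed

context small_subgroup
begin

text \<open>Density is demanded of the traces on all smaller polydiscs as well, because the passage
  through Frobenius roots shrinks the polydisc.\<close>

definition zariski_dense :: "real \<Rightarrow> bool" where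
  "zariski_dense s \<longleftrightarrow> (\<forall>\<rho> f. radius \<rho> \<longrightarrow> \<rho> \<le> s \<longrightarrow> f \<in> regular_PGL2_power n \<longrightarrow>
     (\<forall>X\<in>lift (\<lambda>_. 0) \<inter> polydisc (coords n) \<rho>. f (near_point n X) = (0 :: 'k)) \<longrightarrow>
     (\<forall>x\<in>carrier (PGL2_power n). f x = 0))"

lemma lift_frob: "frob m X \<in> lift (\<lambda>_. 0) \<longleftrightarrow> X \<in> lift m"
proof -
  have "frob (\<lambda>_. 0) Y = Y" for Y
    by (auto simp: frob_def fun_eq_iff)
  then show ?thesis
    by (simp add: lift_def)
qed

text \<open>
  The claim is that a regular function \<open>R\<close> vanishes. It does so on the image of \<open>lift m\<close>, whereas the
  density is that of the image of \<open>lift (\<lambda>_. 0)\<close> under \<open>near_point\<close>. But a power of \<open>R\<close> is the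
  composition of a regular function \<open>\<psi>\<close> with the Frobenius powers of the factors.
\<close>

lemma lie_conj:
  assumes dense: "zariski_dense s" and s: "radius s"
    and v: "v \<in> lie m" and g: "\<And>i. invertible (g i)"
  shows "block_conj g v \<in> lie m"
  unfolding lie_def
proof (intro CollectI ballI)
  fix l assume l: "l \<in> conormal (coords n) (lift m) r0"
  define I where "I = coords n \<times> (UNIV :: (2 \<times> 2) set)"
  define \<kappa> where "\<kappa> = (\<lambda>(z :: nat \<times> 2 \<times> 2, ab :: 2 \<times> 2). l z * ((if snd ab = snd (snd z) then 1 else - 1) * v (fst z, ab)))"
  define R where "R = (\<lambda>x. \<Sum>t\<in>I. \<kappa> t * conj_ratio (fst t) (snd t) x)"
  have R: "R (tuple_class n h) = (\<Sum>z\<in>coords n. l z * block_conj h v z)" for h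
  proof -
    have "(\<Sum>z\<in>coords n. l z * block_conj h v z) = (\<Sum>z\<in>coords n. \<Sum>ab\<in>UNIV. \<kappa> (z, ab) * conj_ratio z ab (tuple_class n h))"
    proof (intro sum.cong refl)
      fix z assume z: "z \<in> coords n"
      obtain i j k where ijk: "z = (i, j, k)" "i < n"
        using z by (cases z) auto
      show "l z * block_conj h v z = (\<Sum>ab\<in>UNIV. \<kappa> (z, ab) * conj_ratio z ab (tuple_class n h))"
        unfolding ijk(1) block_conj_eq_ratio[OF ijk(2)]
        by (simp add: sum_distrib_left \<kappa>_def case_prod_unfold mult.assoc)
    qed
    also have "\<dots> = R (tuple_class n h)"
      unfolding R_def I_def by (simp add: sum.cartesian_product case_prod_unfold)
    finally show ?thesis ..
  qed
  define M where "M = (\<Sum>i<n. m i)"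
  have M: "m i \<le> M" if "i < n" for i
    unfolding M_def using that by (intro member_le_sum) auto
  \<comment> \<open>At a Frobenius image, the ratios of factor \<open>i\<close> already are
    \<open>p ^ m i\<close>-th powers. The exponent \<open>M - m i\<close> tops them up to the common
    \<open>M\<close>, so that the sum becomes the \<open>p ^ M\<close>-th power of
    \<open>R\<close>.\<close>
  define \<psi> where "\<psi> = (\<lambda>x. \<Sum>t\<in>I. \<kappa> t ^ (p ^ M) * conj_ratio (fst t) (snd t) x ^ (p ^ (M - m (fst (fst t)))))"
  have ratio_regular: "conj_ratio z ab \<in> regular_PGL2_power n" if "z \<in> coords n" for z ab
    using that by (cases z, cases ab) (auto simp: conj_ratio_def intro: regular_PGL2_power_intros(2)[OF entry_ratio_regular])
  have \<psi>: "\<psi> \<in> regular_PGL2_power n"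
    unfolding \<psi>_def
    by (intro regular_PGL2_power_sum regular_PGL2_power_intros(1,4) regular_PGL2_power_power ratio_regular) (auto simp: I_def)
  have \<psi>_frob: "\<psi> (tuple_class n (\<lambda>i. \<chi> j k. (h i $ j $ k) ^ (p ^ m i))) = R (tuple_class n h) ^ (p ^ M)" for h
  proof -
    have "conj_ratio (fst t) (snd t) (tuple_class n (\<lambda>i. \<chi> j k. (h i $ j $ k) ^ (p ^ m i))) ^ (p ^ (M - m (fst (fst t))))
        = conj_ratio (fst t) (snd t) (tuple_class n h) ^ (p ^ M)" if "t \<in> I" for t
    proof -
      obtain i j k a b where t: "t = ((i, j, k), (a, b))"
        by (cases t) auto
      have i: "i < n"
        using \<open>t \<in> I\<close> by (simp add: t I_def)
      have "p ^ m i * p ^ (M - m i) = p ^ M"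
        using M[OF i] by (simp flip: power_add)
      then show ?thesis
        by (simp add: t conj_ratio_def tuple_class_nth[OF i] entry_ratio_frob flip: power_mult)
    qed
    then show ?thesis
      unfolding \<psi>_def R_def frob_pow_sum by (intro sum.cong refl) (simp add: power_mult_distrib)
  qed
  \<comment> \<open>Every point of the local group close enough to the identity is the Frobenius
    image of a small point of \<open>lift m\<close>, to which \<open>lie_conj_lift\<close>
    applies.\<close>
  obtain \<rho> where \<rho>: "radius \<rho>" "\<rho> \<le> r0" "\<And>X. X \<in> polydisc (coords n) \<rho> \<Longrightarrow> \<exists>a\<in>polydisc (coords n) r0. frob m a = X"
    by (rule frob_root[OF radius_r0 less_imp_le[OF r0_less_1]]) (rule that)
  have "\<psi> (near_point n X) = 0" if X: "X \<in> lift (\<lambda>_. 0) \<inter> polydisc (coords n) (min \<rho> s)" for X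
  proof -
    have "X \<in> polydisc (coords n) \<rho>"
      using polydisc_mono[of X "coords n" "min \<rho> s" "coords n" \<rho>] X by simp
    then obtain a where a: "a \<in> polydisc (coords n) r0" "frob m a = X"
      using \<rho>(3) by blast
    have aL: "a \<in> lift m"
      using X lift_frob[of m a] by (simp add: a(2))
    have "block_conj (near_matrix a) v \<in> lie m"
      using lie_conj_lift[OF v aL a(1)] .
    then have "R (near_point n a) = 0"
      using l by (simp add: R lie_def)
    moreover have "near_matrix X i = (\<chi> j k. (near_matrix a i $ j $ k) ^ (p ^ m i))" for i
      unfolding a(2)[symmetric] by (rule mat2_eqI) (simp_all add: near_matrix_frob)
    then have "near_point n X = tuple_class n (\<lambda>i. \<chi> j k. (near_matrix a i $ j $ k) ^ (p ^ m i))"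
      by (intro tuple_class_cong) simp
    ultimately show ?thesis
      by (simp add: \<psi>_frob)
  qed
  then have \<psi>_0: "\<forall>x\<in>carrier (PGL2_power n). \<psi> x = 0"
    using dense[unfolded zariski_dense_def, rule_format, OF radius_min[OF \<rho>(1) s] min.cobounded2 \<psi>] by blast
  have "tuple_class n (\<lambda>i. \<chi> j k. (g i $ j $ k) ^ (p ^ m i)) \<in> carrier (PGL2_power n)"
  proof (rule tuple_class_in_carrier)
    fix i
    show "invertible (\<chi> j k. (g i $ j $ k) ^ (p ^ m i))"
      using g[of i] unfolding invertible_det_nz det_frob by simp
  qed
  with \<psi>_0 have "R (tuple_class n g) ^ (p ^ M) = 0"
    by (simp add: \<psi>_frob[symmetric])
  then show "(\<Sum>z\<in>coords n. l z * block_conj g v z) = 0"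
    unfolding R[symmetric] by simp
qed

text \<open>Conjugation by an element that is trivial outside factor \<open>i\<close> changes a
  tangent vector in block \<open>i\<close> only, so the difference of the two vectors lies in that
  single factor. This isolates the factors from each other, and each is then filled by
  \<open>conj_stable_eq_UNIV\<close>.\<close>

lemma lie_eq_UNIV:
  assumes dense: "zariski_dense s" "radius s" and two: "(2 :: 'k) \<noteq> 0"
    and V: "\<And>i. i < n \<Longrightarrow> \<exists>v\<in>lie m. \<forall>c. block v i \<noteq> mat c"
  shows "v \<in> lie m"
proof -
  define emb where "emb = (\<lambda>(i :: nat) (A :: 'k ^ 2 ^ 2) (i' :: nat, j, k). if i' = i then A $ j $ k else 0)"
  have emb: "emb i A \<in> lie m" if i: "i < n" for i A
  proof -
    obtain v where v: "v \<in> lie m" "\<And>c. block v i \<noteq> mat c"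
      using V[OF i] by blast
    define G where "G = (\<lambda>g i'. if i' = i then g else (mat 1 :: 'k ^ 2 ^ 2))"
    have G: "invertible (G g i')" if "invertible g" for g i'
      using that by (simp add: G_def invertible_det_nz)
    have one: "inv2 (mat 1 :: 'k ^ 2 ^ 2) = mat 1"
      using inv2_left[of "mat 1 :: 'k ^ 2 ^ 2"] by (simp add: invertible_det_nz)
    have "A \<in> {A. emb i A \<in> lie m}"
    proof (rule conj_stable_eq_UNIV[where V = "block v i"])
      show "A + mat c ** B \<in> {A. emb i A \<in> lie m}" if "A \<in> {A. emb i A \<in> lie m}" "B \<in> {A. emb i A \<in> lie m}" for A B c
      proof -
        have "emb i (A + mat c ** B) = (\<lambda>z. emb i A z + c * emb i B z)"
          by (auto simp: emb_def fun_eq_iff scalar_mult_nth)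
        then show ?thesis
          using lie_add[of "emb i A" m "emb i B" c] that by simp
      qed
      show "g ** A ** inv2 g \<in> {A. emb i A \<in> lie m}" if "invertible g" "A \<in> {A. emb i A \<in> lie m}" for g A
      proof -
        have "block_conj (G g) (emb i A) (i', j, k) = emb i (g ** A ** inv2 g) (i', j, k)" for i' j k
        proof -
          have "block (emb i A) i' = (if i' = i then A else 0)"
            by (rule mat2_eqI) (simp_all add: emb_def)
          then show ?thesis
            by (auto simp: block_conj_def G_def emb_def)
        qed
        then have "block_conj (G g) (emb i A) = emb i (g ** A ** inv2 g)"
          by (auto simp: fun_eq_iff)
        then show ?thesis
          using lie_conj[where g = "G g", OF dense _ G[OF that(1)], of "emb i A" m] that(2) by simp
      qed
      show "mat 1 \<in> {A. emb i A \<in> lie m}"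
      proof -
        have "emb i (mat 1) = (\<lambda>(i', j, k). if i' = i \<and> j = k then 1 else 0)"
          by (auto simp: emb_def fun_eq_iff mat_nth)
        then show ?thesis
          using scalar_in_lie[OF i] by simp
      qed
      show "g ** block v i ** inv2 g - block v i \<in> {A. emb i A \<in> lie m}" if "invertible g" for g
      proof -
        have "block_conj (G g) v (i', j, k) + (- 1) * v (i', j, k) = emb i (g ** block v i ** inv2 g - block v i) (i', j, k)" for i' j k
          by (simp add: block_conj_def G_def emb_def one)
        then have "(\<lambda>z. block_conj (G g) v z + (- 1) * v z) = emb i (g ** block v i ** inv2 g - block v i)"
          by (auto simp: fun_eq_iff)
        then show ?thesis
          using lie_add[OF lie_conj[where g = "G g", OF dense v(1) G[OF that]] v(1), of "- 1"] by simp
      qed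
    qed (use v(2) two in auto)
    then show ?thesis
      by simp
  qed
  show ?thesis
    unfolding lie_def
  proof (intro CollectI ballI)
    fix l assume l: "l \<in> conormal (coords n) (lift m) r0"
    have "(\<Sum>j\<in>UNIV. \<Sum>k\<in>UNIV. l (i, j, k) * v (i, j, k)) = 0" if i: "i < n" for i
    proof -
      have "(\<Sum>i'<n. \<Sum>j\<in>UNIV. \<Sum>k\<in>UNIV. l (i', j, k) * emb i (block v i) (i', j, k)) = 0"
        using emb[OF i, of "block v i"] l unfolding lie_def sum_coords by blast
      moreover have "(\<Sum>j\<in>UNIV. \<Sum>k\<in>UNIV. l (i', j, k) * emb i (block v i) (i', j, k))
          = (if i' = i then \<Sum>j\<in>UNIV. \<Sum>k\<in>UNIV. l (i, j, k) * v (i, j, k) else 0)" for i'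
        by (simp add: emb_def)
      ultimately show ?thesis
        using i by (simp add: sum.delta)
    qed
    then show "(\<Sum>z\<in>coords n. l z * v z) = 0"
      unfolding sum_coords by (intro sum.neutral) auto
  qed
qed

text \<open>Without conormal vectors there are no pivots and the parametrization of
  \<open>lift m\<close> is the identity, so a function vanishing on \<open>lift m\<close> vanishes
  near the origin. This is applied to \<open>f\<close> composed with \<open>frob m\<close>, and
  surjectivity of \<open>frob m\<close> onto small polydiscs returns to \<open>f\<close>.\<close>

lemma vanishing_of_lie_UNIV:
  assumes lie: "\<And>v. v \<in> lie m"
    and f: "f \<in> convergent_on (coords n) r0" "\<And>X. X \<in> lift (\<lambda>_. 0) \<Longrightarrow> f X = 0"
  shows "\<exists>\<rho>. radius \<rho> \<and> \<rho> < 1 \<and> (\<forall>X\<in>polydisc (coords n) \<rho>. f X = 0)"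
proof -
  have conormal: "l z = 0" if "l \<in> conormal (coords n) (lift m) r0" "z \<in> coords n" for l z
  proof -
    have "(\<Sum>z'\<in>coords n. l z' * (if z' = z then 1 else 0)) = 0"
      using lie[of "\<lambda>z'. if z' = z then 1 else 0"] that(1) unfolding lie_def by blast
    also have "(\<Sum>z'\<in>coords n. l z' * (if z' = z then 1 else 0)) = (\<Sum>z'\<in>coords n. if z' = z then l z' else 0)"
      by (intro sum.cong refl) simp
    finally show ?thesis
      using that(2) by (simp add: sum.delta)
  qed
  obtain Y \<phi> s where Y: "Y \<subseteq> coords n" "\<And>y. y \<in> Y \<Longrightarrow> \<exists>l\<in>conormal (coords n) (lift m) r0. l y \<noteq> 0"
    and "radius s" "s \<le> r0" and \<phi>: "\<And>t i. i \<notin> Y \<Longrightarrow> \<phi> t i = t i"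
    and "\<And>i. i \<in> coords n \<Longrightarrow> (\<lambda>t. \<phi> t i) \<in> convergent_on (coords n - Y) s"
    and "\<And>t. t \<in> polydisc (coords n - Y) s \<Longrightarrow> \<phi> t \<in> polydisc (coords n) r0"
    and "\<And>x i. x \<in> lift m \<inter> polydisc (coords n) s \<Longrightarrow> \<phi> x i = x i"
    and van: "\<And>r f. radius r \<Longrightarrow> r \<le> r0 \<Longrightarrow> f \<in> vanishing_ideal (coords n) (lift m) r \<Longrightarrow>
       \<exists>d>0. \<forall>t\<in>polydisc (coords n - Y) d. f (\<phi> t) = 0"
    by (rule local_group_parametrization[OF local_group_lift finite_coords radius_r0, of m]) (rule that)
  have Y_empty: "Y = {}"
    using Y conormal by blast
  have \<phi>_id: "\<phi> t = t" for t
    using \<phi> by (auto simp: Y_empty)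
  have "(\<lambda>X. f (frob m X)) \<in> vanishing_ideal (coords n) (lift m) r0"
    unfolding vanishing_ideal_def
  proof (intro CollectI conjI ballI)
    show "(\<lambda>X. f (frob m X)) \<in> convergent_on (coords n) r0"
    proof (rule tate_compose[where f = f and \<phi> = "frob m" and V = "coords n" and r = r0])
      fix z assume z: "z \<in> coords n"
      show "(\<lambda>X. frob m X z) \<in> convergent_on (coords n) r0"
        using z r0_pos by (cases z) (auto simp: frob_apply intro!: tate_power tate_var)
    qed (use f(1) r0_pos r0_less_1 frob_polydisc in auto)
    show "f (frob m X) = 0" if "X \<in> lift m \<inter> polydisc (coords n) r0" for X
      using that f(2) by (simp add: lift_frob)
  qed
  from van[OF radius_r0 order_refl this] obtain d where d: "d > 0" "\<And>t. t \<in> polydisc (coords n) d \<Longrightarrow> f (frob m t) = 0"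
    unfolding \<phi>_id Y_empty by auto
  obtain r where r: "radius r" "r < min d 1"
    using ex_radius_less[of "min d 1"] d(1) by auto
  obtain \<rho> where \<rho>: "radius \<rho>" "\<rho> \<le> r" "\<And>X. X \<in> polydisc (coords n) \<rho> \<Longrightarrow> \<exists>a\<in>polydisc (coords n) r. frob m a = X"
    by (rule frob_root[OF r(1)]) (use r(2) in simp, rule that)
  have "f X = 0" if X: "X \<in> polydisc (coords n) \<rho>" for X
  proof -
    obtain a where "a \<in> polydisc (coords n) r" "frob m a = X"
      using \<rho>(3)[OF X] by blast
    then show ?thesis
      using d(2)[of a] polydisc_mono[of a "coords n" r "coords n" d] r(2) by simp
  qed
  with \<rho>(1,2) r(2) show ?thesis
    by (intro exI[of _ \<rho>]) auto
qed

end

section \<open>Density and Frobenius roots\<close>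

context nonarch_field
begin

text \<open>The exponents for which all \<open>w z\<close> have convergent roots are bounded,
  because \<open>w z0\<close> is not zero and \<open>tate_pow_root_decay\<close> limits its decay.
  At a step where the next exponent fails, some root is not a \<open>p\<close>-th power, so one of
  its derivatives is nonzero.\<close>

lemma maximal_p_power_root:
  fixes w :: "'z \<Rightarrow> ('i \<Rightarrow> 'k) \<Rightarrow> 'k"
  assumes w: "\<And>z. z \<in> Z \<Longrightarrow> w z \<in> convergent_on W s" and W: "finite W" and s: "radius s"
    and z0: "z0 \<in> Z" "w z0 (\<lambda>_. 0) = 0" "\<And>t. t \<in> polydisc W s \<Longrightarrow> vabs (w z0 t) \<le> 1"
    and t: "t \<in> polydisc W s'" "s' < s" "w z0 t \<noteq> 0"
  obtains m h z y g where "\<And>z. z \<in> Z \<Longrightarrow> h z \<in> convergent_on W s"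
    "\<And>z t. z \<in> Z \<Longrightarrow> t \<in> polydisc W s \<Longrightarrow> w z t = h z t ^ (p ^ m)"
    "z \<in> Z" "y \<in> W" "g \<in> convergent_on W s" "partial W s y (h z) g" "\<exists>t\<in>polydisc W s. g t \<noteq> 0"
proof -
  have s_pos: "s > 0"
    using s by (rule radius_pos)
  define P where "P = (\<lambda>m. \<forall>z\<in>Z. \<exists>h\<in>convergent_on W s. \<forall>t\<in>polydisc W s. w z t = h t ^ (p ^ m))"
  have "P 0"
    unfolding P_def using w by (intro ballI) (auto intro!: bexI[of _ "w _"])
  have "\<exists>m. \<not> P m"
  proof -
    \<comment> \<open>The decay estimate needs a nonnegative radius, which is not assumed of
      \<open>s'\<close>.\<close>
    define b where "b = max s' 0"
    have b: "0 \<le> b" "b < s" "t \<in> polydisc W b"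
      using t(2) s_pos polydisc_mono[OF t(1) subset_refl, of b] by (auto simp: b_def)
    have "b / s < 1"
      using b(2) s_pos by simp
    then obtain m where m: "(b / s) ^ m < vabs (w z0 t)"
      using real_arch_pow_inv[of "vabs (w z0 t)" "b / s"] t(3) by auto
    have "\<not> P m"
    proof
      assume "P m"
      then obtain h where h: "h \<in> convergent_on W s" "\<And>t. t \<in> polydisc W s \<Longrightarrow> w z0 t = h t ^ (p ^ m)"
        unfolding P_def using z0(1) by blast
      have "vabs (w z0 t) \<le> (b / s) ^ m"
        by (rule tate_pow_root_decay[OF h s W z0(2,3) b(1) less_imp_le[OF b(2)] b(3)])
      with m show False
        by simp
    qed
    then show ?thesis ..
  qed
  with \<open>P 0\<close> obtain m where m: "P m" "\<not> P (Suc m)"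
    using nat_induct[of P] by blast
  obtain h where h: "\<And>z. z \<in> Z \<Longrightarrow> h z \<in> convergent_on W s"
    "\<And>z t. z \<in> Z \<Longrightarrow> t \<in> polydisc W s \<Longrightarrow> w z t = h z t ^ (p ^ m)"
  proof -
    have "\<forall>z. \<exists>h. z \<in> Z \<longrightarrow> h \<in> convergent_on W s \<and> (\<forall>t\<in>polydisc W s. w z t = h t ^ (p ^ m))"
      using m(1) unfolding P_def by blast
    then obtain h where h: "\<forall>z. z \<in> Z \<longrightarrow> h z \<in> convergent_on W s \<and> (\<forall>t\<in>polydisc W s. w z t = h z t ^ (p ^ m))"
      by (rule choice[THEN exE])
    show ?thesis
      by (rule that[of h]) (use h in blast)+
  qed
  have "\<exists>z\<in>Z. \<exists>y\<in>W. \<not> partial W s y (h z) (\<lambda>_. 0)"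
  proof (rule ccontr)
    assume "\<not> ?thesis"
    then have 0: "partial W s y (h z) (\<lambda>_. 0)" if "z \<in> Z" "y \<in> W" for z y
      using that by blast
    have "P (Suc m)"
      unfolding P_def
    proof
      fix z assume z: "z \<in> Z"
      obtain k where k: "k \<in> convergent_on W s" "\<And>t. t \<in> polydisc W s \<Longrightarrow> h z t = k t ^ p"
        by (rule tate_pth_root_of_partials_0[OF h(1)[OF z] s W 0[OF z]]) (assumption, rule that)
      show "\<exists>h\<in>convergent_on W s. \<forall>t\<in>polydisc W s. w z t = h t ^ (p ^ Suc m)"
      proof (rule bexI[OF _ k(1)], rule ballI)
        fix t :: "'i \<Rightarrow> 'k" assume t: "t \<in> polydisc W s"
        show "w z t = k t ^ (p ^ Suc m)"
          using h(2)[OF z t] k(2)[OF t] by (simp add: power_mult)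
      qed
    qed
    with m(2) show False ..
  qed
  then obtain z y where zy: "z \<in> Z" "y \<in> W" "\<not> partial W s y (h z) (\<lambda>_. 0)"
    by blast
  obtain g where g: "g \<in> convergent_on W s" "partial W s y (h z) g"
    by (rule ex_partial[OF h(1)[OF zy(1)] W s zy(2)]) (rule that)
  have "\<exists>t\<in>polydisc W s. g t \<noteq> 0"
  proof (rule ccontr)
    assume "\<not> ?thesis"
    then have "partial W s y (h z) (\<lambda>_. 0)"
      using partial_cong[OF g(2), of "h z" "\<lambda>_. 0"] by simp
    with zy(3) show False ..
  qed
  with that[of h m z y g, OF h zy(1,2) g] show ?thesis
    by blast
qed

end

context small_subgroup
begin

text \<open>Now that the local group is cut out by finitely many power series, the graph also lies
  inside it: each equation holds on the graph near the origin, and by the identity theorem on every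
  strictly smaller polydisc, which is why the radius shrinks to \<open>s'\<close>.\<close>

lemma ex_parametrization:
  assumes F: "finite F" "\<And>f. f \<in> F \<Longrightarrow> f \<in> convergent_on (coords n) r0"
    and eq: "\<And>X. X \<in> polydisc (coords n) r0 \<Longrightarrow> near_point n X \<in> \<Sigma> \<longleftrightarrow> (\<forall>f\<in>F. f X = 0)"
  obtains W \<phi> s where "W \<subseteq> coords n" "radius s" "s \<le> r0"
    "\<And>z. z \<in> coords n \<Longrightarrow> (\<lambda>t. \<phi> t z) \<in> convergent_on W s"
    "\<And>t. t \<in> polydisc W s \<Longrightarrow> \<phi> t \<in> lift (\<lambda>_. 0)"
    "\<And>X. X \<in> lift (\<lambda>_. 0) \<inter> polydisc (coords n) s \<Longrightarrow> \<phi> X = X"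
    "\<And>r f. radius r \<Longrightarrow> r \<le> r0 \<Longrightarrow> f \<in> vanishing_ideal (coords n) (lift (\<lambda>_. 0)) r \<Longrightarrow>
       \<exists>d>0. \<forall>t\<in>polydisc W d. f (\<phi> t) = 0"
proof -
  obtain Y \<phi> s where Y: "Y \<subseteq> coords n" "\<And>y. y \<in> Y \<Longrightarrow> \<exists>l\<in>conormal (coords n) (lift (\<lambda>_. 0)) r0. l y \<noteq> 0"
    and s: "radius s" "s \<le> r0" and \<phi>: "\<And>t i. i \<notin> Y \<Longrightarrow> \<phi> t i = t i"
    and conv: "\<And>i. i \<in> coords n \<Longrightarrow> (\<lambda>t. \<phi> t i) \<in> convergent_on (coords n - Y) s"
    and maps: "\<And>t. t \<in> polydisc (coords n - Y) s \<Longrightarrow> \<phi> t \<in> polydisc (coords n) r0"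
    and id: "\<And>x i. x \<in> lift (\<lambda>_. 0) \<inter> polydisc (coords n) s \<Longrightarrow> \<phi> x i = x i"
    and van: "\<And>r f. radius r \<Longrightarrow> r \<le> r0 \<Longrightarrow> f \<in> vanishing_ideal (coords n) (lift (\<lambda>_. 0)) r \<Longrightarrow>
       \<exists>d>0. \<forall>t\<in>polydisc (coords n - Y) d. f (\<phi> t) = 0"
    by (rule local_group_parametrization[OF local_group_lift finite_coords radius_r0, of "\<lambda>_. 0"]) (rule that)
  let ?W = "coords n - Y"
  have s_pos: "s > 0"
    using s(1) by (rule radius_pos)
  obtain s' where s': "radius s'" "s' < s"
    using ex_radius_less[OF s_pos] by blast
  have s'_pos: "s' > 0"
    using s'(1) by (rule radius_pos)
  have frob_id: "frob (\<lambda>_. 0) X = X" for X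
    by (auto simp: frob_def fun_eq_iff)
  show ?thesis
  proof (rule that[of ?W s' \<phi>])
    show "?W \<subseteq> coords n" "radius s'" "s' \<le> r0"
      using s s' by auto
    show "(\<lambda>t. \<phi> t z) \<in> convergent_on ?W s'" if "z \<in> coords n" for z
      using tate_mono[OF conv[OF that] subset_refl] s'(2) by simp
    show "\<phi> X = X" if X: "X \<in> lift (\<lambda>_. 0) \<inter> polydisc (coords n) s'" for X
    proof
      have "X \<in> polydisc (coords n) s"
        using polydisc_mono[of X "coords n" s' "coords n" s] X s'(2) by simp
      then show "\<phi> X z = X z" for z
        using id[of X z] X by simp
    qed
    fix t :: "nat \<times> 2 \<times> 2 \<Rightarrow> 'k" assume t: "t \<in> polydisc ?W s'"
    have D: "\<phi> t \<in> polydisc (coords n) r0"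
      using maps polydisc_mono[OF t subset_refl] s'(2) by simp
    have "f (\<phi> t) = 0" if f: "f \<in> F" for f
    proof -
      have "f \<in> vanishing_ideal (coords n) (lift (\<lambda>_. 0)) r0"
        using F(2)[OF f] eq f by (auto simp: vanishing_ideal_def lift_def frob_id)
      from van[OF radius_r0 order_refl this] obtain d where d: "d > 0" "\<forall>t\<in>polydisc ?W d. f (\<phi> t) = 0"
        by blast
      have "(\<lambda>t. f (\<phi> t)) \<in> convergent_on ?W s"
        by (rule tate_compose[where f = f and \<phi> = \<phi> and V = "coords n" and r = r0])
          (use F(2)[OF f] conv maps s_pos in auto)
      then show ?thesis
        by (rule tate_identity[OF _ s(1) _ d(1) _ less_imp_le[OF s'_pos] s'(2) t]) (use d(2) in auto)
    qed
    then show "\<phi> t \<in> lift (\<lambda>_. 0)"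
      using D eq by (simp add: lift_def frob_id)
  qed (rule van)
qed

lemma mem_lift_0: "X \<in> lift (\<lambda>_. 0) \<longleftrightarrow> X \<in> polydisc (coords n) r0 \<and> near_point n X \<in> \<Sigma>"
proof -
  have "frob (\<lambda>_. 0) X = X"
    by (auto simp: frob_def fun_eq_iff)
  then show ?thesis
    by (simp add: lift_def)
qed

text \<open>A trace \<open>B\<close> on a polydisc is a group, so its Zariski closure is an
  algebraic subgroup; it is irreducible because power series on the parameter polydisc have no zero
  divisors. A proper closure would contain all points of \<open>\<Sigma>\<close> in this polydisc,
  against \<open>no_H\<close>.\<close>

lemma dense_or_algebraic_subgroup:
  assumes W: "W \<subseteq> coords n" and s: "radius s" "s \<le> r0"
    and conv: "\<And>z. z \<in> coords n \<Longrightarrow> (\<lambda>t. \<phi> t z) \<in> convergent_on W s"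
    and maps: "\<And>t. t \<in> polydisc W s \<Longrightarrow> \<phi> t \<in> lift (\<lambda>_. 0)"
    and id: "\<And>X. X \<in> lift (\<lambda>_. 0) \<inter> polydisc (coords n) s \<Longrightarrow> \<phi> X = X"
    and van: "\<And>r f. radius r \<Longrightarrow> r \<le> r0 \<Longrightarrow> f \<in> vanishing_ideal (coords n) (lift (\<lambda>_. 0)) r \<Longrightarrow>
       \<exists>d>0. \<forall>t\<in>polydisc W d. f (\<phi> t) = 0"
    and s': "s' < s"
    and no_H: "\<And>H \<rho>. connected_algebraic_subgroup (PGL2_power n) (regular_PGL2_power n :: ((nat \<Rightarrow> ('k ^ 2 ^ 2) set) \<Rightarrow> 'k) set) H \<Longrightarrow>
       H \<noteq> carrier (PGL2_power n) \<Longrightarrow> radius \<rho> \<Longrightarrow> \<rho> < 1 \<Longrightarrow> \<exists>X\<in>polydisc (coords n) \<rho>. near_point n X \<in> \<Sigma> - H"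
  shows "zariski_dense s'"
  unfolding zariski_dense_def
proof (intro allI impI ballI)
  fix \<rho> f and x :: "nat \<Rightarrow> ('k ^ 2 ^ 2) set"
  assume \<rho>: "radius \<rho>" "\<rho> \<le> s'" and f: "f \<in> regular_PGL2_power n"
    and f0: "\<forall>X\<in>lift (\<lambda>_. 0) \<inter> polydisc (coords n) \<rho>. f (near_point n X) = (0 :: 'k)"
    and x: "x \<in> carrier (PGL2_power n)"
  have finW: "finite W"
    using finite_subset[OF W] by simp
  have \<rho>_pos: "\<rho> > 0"
    using \<rho>(1) by (rule radius_pos)
  have \<rho>_less: "\<rho> < s" "\<rho> < 1" "\<rho> \<le> r0"
    using \<rho>(2) s' s(2) r0_less_1 by simp_all
  have s_pos: "s > 0"
    using s(1) by (rule radius_pos)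
  define B where "B = near_point n ` (lift (\<lambda>_. 0) \<inter> polydisc (coords n) \<rho>)"
  have B: "B \<subseteq> carrier (PGL2_power n)"
    using near_point_in_carrier[OF _ \<rho>_less(2)] by (auto simp: B_def)
  have one: "\<one>\<^bsub>PGL2_power n\<^esub> \<in> B"
    unfolding B_def near_point_0[symmetric] using lift_0 \<rho>_pos by (intro imageI) simp
  have sub: "inv\<^bsub>PGL2_power n\<^esub> a \<otimes>\<^bsub>PGL2_power n\<^esub> b \<in> B" if ab: "a \<in> B" "b \<in> B" for a b
  proof -
    obtain X Y where XY: "a = near_point n X" "X \<in> lift (\<lambda>_. 0)" "X \<in> polydisc (coords n) \<rho>"
      "b = near_point n Y" "Y \<in> lift (\<lambda>_. 0)" "Y \<in> polydisc (coords n) \<rho>"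
      using ab unfolding B_def by blast
    have I: "near_inv X \<in> polydisc (coords n) \<rho>"
      using near_inv_polydisc[OF XY(3) \<rho>_less(2)] .
    have "inv\<^bsub>PGL2_power n\<^esub> a \<otimes>\<^bsub>PGL2_power n\<^esub> b = near_point n (near_mult (near_inv X) Y)"
      by (simp only: XY(1,4) near_point_mult[OF I XY(6) \<rho>_less(2)] near_point_inv[OF XY(3) \<rho>_less(2)])
    moreover have "near_mult (near_inv X) Y \<in> lift (\<lambda>_. 0) \<inter> polydisc (coords n) \<rho>"
      using lift_inv_mult[OF XY(2,5)] near_mult_polydisc[OF I XY(6)] \<rho>_less(2) by simp
    ultimately show ?thesis
      unfolding B_def by blast
  qed
  have conv_f: "(\<lambda>t. f (near_point n (\<phi> t))) \<in> convergent_on W s"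
    if f: "f \<in> regular_PGL2_power n" for f :: "_ \<Rightarrow> 'k"
    by (rule tate_compose[where f = "\<lambda>X. f (near_point n X)" and \<phi> = \<phi> and V = "coords n" and r = r0])
      (use regular_near_point_convergent[OF f, of r0] r0_pos r0_less_1 conv maps s_pos in \<open>auto simp: mem_lift_0\<close>)
  have irred: "(\<forall>b\<in>B. f b = 0) \<or> (\<forall>b\<in>B. g b = 0)"
    if f: "f \<in> regular_PGL2_power n" and g: "g \<in> regular_PGL2_power n" and fg: "\<forall>b\<in>B. f b * g b = 0"
    for f g :: "_ \<Rightarrow> 'k"
  proof -
    have "(\<lambda>X. f (near_point n X) * g (near_point n X)) \<in> vanishing_ideal (coords n) (lift (\<lambda>_. 0)) \<rho>"
      unfolding vanishing_ideal_def
    proof (intro CollectI conjI ballI)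
      show "(\<lambda>X. f (near_point n X) * g (near_point n X)) \<in> convergent_on (coords n) \<rho>"
        using regular_near_point_convergent[OF f] regular_near_point_convergent[OF g] \<rho>_pos \<rho>_less(2)
        by (intro tate_mult) auto
      show "f (near_point n X) * g (near_point n X) = 0" if "X \<in> lift (\<lambda>_. 0) \<inter> polydisc (coords n) \<rho>" for X
        using fg that unfolding B_def by blast
    qed
    \<comment> \<open>The product is known to vanish only on some small polydisc of parameters. One
      factor vanishes there, and the identity theorem carries this back to all of
      \<open>B\<close>.\<close>
    from van[OF \<rho>(1) \<rho>_less(3) this] obtain d where d: "d > 0"
      "\<forall>t\<in>polydisc W d. f (near_point n (\<phi> t)) * g (near_point n (\<phi> t)) = 0"
      by blast
    obtain d1 where d1: "radius d1" "d1 < min d s"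
      using ex_radius_less[of "min d s"] d(1) s_pos by auto
    obtain d2 where d2: "radius d2" "d2 < d1"
      using ex_radius_less[OF radius_pos[OF d1(1)]] by blast
    have d2_pos: "d2 > 0"
      using d2(1) by (rule radius_pos)
    have "(\<forall>t\<in>polydisc W d2. f (near_point n (\<phi> t)) = 0) \<or> (\<forall>t\<in>polydisc W d2. g (near_point n (\<phi> t)) = 0)"
    proof (rule tate_no_zero_divisors[OF _ _ d1(1) finW _ less_imp_le[OF d2_pos] d2(2)])
      show "(\<lambda>t. f (near_point n (\<phi> t))) \<in> convergent_on W d1" "(\<lambda>t. g (near_point n (\<phi> t))) \<in> convergent_on W d1"
        using tate_mono[OF conv_f[OF f] subset_refl, of d1] tate_mono[OF conv_f[OF g] subset_refl, of d1] d1(2) by simp_all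
      show "f (near_point n (\<phi> t)) * g (near_point n (\<phi> t)) = 0" if "t \<in> polydisc W d1" for t
        using d(2) polydisc_mono[OF that subset_refl, of d] d1(2) by simp
    qed
    moreover have "\<forall>b\<in>B. h b = 0" if h: "h \<in> regular_PGL2_power n" and h0: "\<forall>t\<in>polydisc W d2. h (near_point n (\<phi> t)) = 0" for h :: "_ \<Rightarrow> 'k"
    proof
      fix b assume "b \<in> B"
      then obtain X where X: "X \<in> lift (\<lambda>_. 0)" "X \<in> polydisc (coords n) \<rho>" "b = near_point n X"
        unfolding B_def by blast
      have "\<phi> X = X"
        using id[of X] X(1) polydisc_mono[OF X(2) subset_refl, of s] \<rho>_less(1) by simp
      moreover have "h (near_point n (\<phi> X)) = 0"
        by (rule tate_identity[OF conv_f[OF h] s(1) finW d2_pos _ less_imp_le[OF \<rho>_pos] \<rho>_less(1) polydisc_mono[OF X(2) W order_refl]])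
          (use h0 in auto)
      ultimately show "h b = 0"
        by (simp add: X(3))
    qed
    ultimately show ?thesis
      using f g by blast
  qed
  show "f x = 0"
  proof (rule ccontr)
    assume "f x \<noteq> 0"
    then have "x \<notin> zariski_closure n B"
      using f f0 by (auto simp: zariski_closure_def B_def)
    then have ne: "zariski_closure n B \<noteq> carrier (PGL2_power n)"
      using x by blast
    have "connected_algebraic_subgroup (PGL2_power n) (regular_PGL2_power n :: ((nat \<Rightarrow> ('k ^ 2 ^ 2) set) \<Rightarrow> 'k) set) (zariski_closure n B)"
      unfolding connected_algebraic_subgroup_def
      by (rule conjI[OF subgroup_zariski_closure[OF B one sub] conjI[OF closedin_zariski_closure[OF B] connectedin_zariski_closure[OF B irred]]])
    from no_H[OF this ne \<rho>(1) \<rho>_less(2)] obtain X where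
      X: "X \<in> polydisc (coords n) \<rho>" "near_point n X \<in> \<Sigma>" "near_point n X \<notin> zariski_closure n B"
      by blast
    have "X \<in> polydisc (coords n) r0"
      using polydisc_mono[OF X(1) subset_refl \<rho>_less(3)] .
    then have "near_point n X \<in> B"
      using X(1,2) unfolding B_def by (intro imageI) (simp add: mem_lift_0)
    with B X(3) show False
      by (auto simp: zariski_closure_def)
  qed
qed

section \<open>Normalised parametrizations and their logarithmic derivatives\<close>

lemma normalised_convergent:
  assumes conv: "\<And>z. z \<in> coords n \<Longrightarrow> (\<lambda>t. \<phi> t z) \<in> convergent_on W s" and s: "s \<ge> 0"
    and maps: "\<And>t. t \<in> polydisc W s \<Longrightarrow> \<phi> t \<in> polydisc (coords n) r0" and z: "z \<in> coords n"
  shows "(\<lambda>t. normalised (\<phi> t) z) \<in> convergent_on W s"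
proof -
  obtain i j k where ijk: "z = (i, j, k)" "i < n"
    using z by (cases z) auto
  have entry: "(\<lambda>t. near_matrix (\<phi> t) i $ j $ k) \<in> convergent_on W s" for j k
    unfolding near_matrix_nth using ijk(2) by (intro tate_add tate_const conv) simp
  have "vabs (near_matrix (\<phi> t) i $ 1 $ 1 - 1) \<le> r0" if "t \<in> polydisc W s" for t
    using polydiscD[OF maps[OF that], of "(i, 1, 1)"] ijk(2) by (simp add: near_matrix_nth)
  from tate_inverse[OF entry this r0_less_1 s] show ?thesis
    unfolding ijk(1) normalised_def case_prod_conv divide_inverse
    by (intro tate_diff tate_mult entry tate_const s) auto
qed

text \<open>A coordinate that is not identically zero on the group cannot vanish on a Zariski dense
  trace. The entry (1, 2) is zero at the identity, which is what the decay of Frobenius roots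
  requires.\<close>

lemma normalised_nonzero:
  assumes dense: "zariski_dense s'" and s': "radius s'" and W: "W \<subseteq> coords n"
    and id: "\<And>X. X \<in> lift (\<lambda>_. 0) \<inter> polydisc (coords n) s' \<Longrightarrow> \<phi> X = X"
    and i: "i < n"
  obtains t where "t \<in> polydisc W s'" "normalised (\<phi> t) (i, 1, 2) \<noteq> 0"
proof -
  let ?z = "(i, 1, 2) :: nat \<times> 2 \<times> 2"
  have z: "?z \<in> coords n" "{?z} \<subseteq> affine_coords n"
    using i by (simp_all add: affine_coords_def)
  obtain c :: 'k where c: "c \<noteq> 0" "vabs c < r0"
    using ex_small[OF r0_pos] by blast
  \<comment> \<open>An upper unipotent matrix in factor \<open>i\<close>, as a witness that the
    coordinate is not identically zero on the group.\<close>
  define X where "X = (\<lambda>z. if z \<in> {?z} then c else 0)"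
  have t: "(\<lambda>_. c) \<in> polydisc {?z} r0"
    using c(2) by (intro polydiscI) simp
  note E = coordinate_germ_near_point[OF t z(2) less_imp_le[OF r0_pos] r0_less_1, folded X_def]
  have "affine_function ?z (near_point n X) \<noteq> 0"
    using affine_function_eq_0_iff[OF E(1) r0_less_1 z(1)] c(1) unfolding E(2) by (simp add: X_def)
  moreover have "near_point n X \<in> carrier (PGL2_power n)"
    using near_point_in_carrier[OF E(1) r0_less_1] .
  ultimately have "\<not> (\<forall>X\<in>lift (\<lambda>_. 0) \<inter> polydisc (coords n) s'. affine_function ?z (near_point n X) = (0 :: 'k))"
    using dense s' affine_function_regular[OF z(1)] unfolding zariski_dense_def by blast
  then obtain X where X: "X \<in> lift (\<lambda>_. 0)" "X \<in> polydisc (coords n) s'" "affine_function ?z (near_point n X) \<noteq> 0"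
    by blast
  have "X \<in> polydisc (coords n) r0"
    using X(1) by (simp add: mem_lift_0)
  then have "normalised X ?z \<noteq> 0"
    using X(3) affine_function_eq_0_iff[OF _ r0_less_1 z(1)] by blast
  then show ?thesis
    using that[of X] polydisc_mono[OF X(2) W order_refl] id[of X] X(1,2) by simp
qed

text \<open>
  The block \<open>i\<close> of the tangent vector is the logarithmic derivative of a normalised matrix, whose
  entry \<open>(1, 1)\<close> is constant, and therefore it is not scalar.
\<close>

lemma nonscalar_in_lie:
  assumes W: "finite W" and s: "radius s"
    and conv: "\<And>z. z \<in> coords n \<Longrightarrow> (\<lambda>t. \<Psi> t z) \<in> convergent_on W s"
    and maps: "\<And>t. t \<in> polydisc W s \<Longrightarrow> \<Psi> t \<in> lift m"
    and i: "i < n" and norm: "\<And>t. t \<in> polydisc W s \<Longrightarrow> \<Psi> t (i, 1, 1) = 0"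
    and g: "y \<in> W" "partial W s y (\<lambda>t. \<Psi> t (i, j0, k0)) g" "t0 \<in> polydisc W s" "g t0 \<noteq> 0"
  shows "\<exists>v\<in>lie m. \<forall>c. block v i \<noteq> mat c"
proof -
  have s_pos: "s > 0"
    using s by (rule radius_pos)
  have "\<exists>D. partial W s y (\<lambda>t. \<Psi> t z) D" if "z \<in> coords n" for z
    by (rule ex_partial[OF conv[OF that] W s g(1)]) blast
  then obtain D where D: "\<And>z. z \<in> coords n \<Longrightarrow> partial W s y (\<lambda>t. \<Psi> t z) (D z)"
    by metis
  have "\<exists>C\<ge>0. \<forall>c. vabs c \<le> s \<longrightarrow> vabs (\<Psi> (t0(y := t0 y + c)) z - \<Psi> t0 z - c * D z t0) \<le> C * vabs c ^ 2" if z: "z \<in> coords n" for z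
  proof -
    obtain C where "C \<ge> 0" "\<And>t c. t \<in> polydisc W s \<Longrightarrow> vabs c \<le> s \<Longrightarrow>
       vabs (\<Psi> (t(y := t y + c)) z - \<Psi> t z - c * D z t) \<le> C * vabs c ^ 2"
      by (rule partialE[OF D[OF z]]) (rule that)
    then show ?thesis
      using g(3) by blast
  qed
  then obtain C where C: "\<And>z. z \<in> coords n \<Longrightarrow> C z \<ge> 0"
    "\<And>z c. z \<in> coords n \<Longrightarrow> vabs c \<le> s \<Longrightarrow> vabs (\<Psi> (t0(y := t0 y + c)) z - \<Psi> t0 z - c * D z t0) \<le> C z * vabs c ^ 2"
    by metis
  \<comment> \<open>Left translation by \<open>N\<close> moves the tangent vector \<open>d\<close>
    of the parametrization at \<open>t0\<close> to the identity.\<close>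
  define N where "N = (\<lambda>i. inv2 (near_matrix (\<Psi> t0) i))"
  define d where "d = (\<lambda>z. D z t0)"
  define v where "v = (\<lambda>(i, j, k). (N i ** block d i) $ j $ k)"
  define L where "L = (\<Sum>z\<in>coords n. vabs (N (fst z) $ fst (snd z) $ snd (snd z)))"
  have L: "vabs (N i $ j $ k) \<le> L" if "i < n" for i j k
    unfolding L_def using member_le_sum[of "(i, j, k)" "coords n" "\<lambda>z. vabs (N (fst z) $ fst (snd z) $ snd (snd z))"] that by simp
  have L0: "L \<ge> 0"
    unfolding L_def by (intro sum_nonneg) simp
  define K where "K = sum C (coords n)"
  have K: "C z \<le> K" if "z \<in> coords n" for z
    unfolding K_def using that C(1) by (intro member_le_sum) auto
  have K0: "K \<ge> 0"
    unfolding K_def using C(1) by (intro sum_nonneg) auto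
  have "v \<in> lie m"
  proof (rule tangent_in_lie[OF s_pos, of "L * K"])
    show "0 \<le> L * K"
      using L0 K0 by simp
    fix c :: 'k assume c: "c \<noteq> 0" "vabs c \<le> s"
    define t1 where "t1 = t0(y := t0 y + c)"
    have t1: "t1 \<in> polydisc W s"
      using polydiscD[OF g(3)] c(2) unfolding t1_def by (intro polydiscI) (auto intro: vabs_add_le)
    \<comment> \<open>A quotient of two points of the local group, hence again one of its points;
      its first-order term in \<open>c\<close> is \<open>c * v\<close>.\<close>
    define X where "X = near_mult (near_inv (\<Psi> t0)) (\<Psi> t1)"
    have "vabs (X z - c * v z) \<le> L * K * vabs c ^ 2" if z: "z \<in> coords n" for z
    proof -
      obtain i j k where ijk: "z = (i, j, k)" "i < n"
        using z by (cases z) auto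
      define e where "e = (\<lambda>l. \<Psi> t1 (i, l, k) - \<Psi> t0 (i, l, k) - c * d (i, l, k))"
      have inv: "N i ** near_matrix (\<Psi> t0) i = mat 1"
        unfolding N_def using inv2_left[OF invertible_lift[OF maps[OF g(3)] ijk(2)]] .
      have 1: "near_matrix X i $ j $ k = N i $ j $ 1 * near_matrix (\<Psi> t1) i $ 1 $ k + N i $ j $ 2 * near_matrix (\<Psi> t1) i $ 2 $ k"
        by (simp add: X_def near_matrix_mult near_matrix_inv N_def mult2_nth)
      have 2: "mat 1 $ j $ k = N i $ j $ 1 * near_matrix (\<Psi> t0) i $ 1 $ k + N i $ j $ 2 * near_matrix (\<Psi> t0) i $ 2 $ k"
        by (simp add: inv[symmetric] mult2_nth)
      have 3: "near_matrix (\<Psi> t1) i $ l $ k - near_matrix (\<Psi> t0) i $ l $ k = e l + c * d (i, l, k)" for l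
        by (simp add: e_def near_matrix_nth)
      have "X z = near_matrix X i $ j $ k - mat 1 $ j $ k"
        by (simp add: ijk near_matrix_nth mat_nth)
      also have "\<dots> = N i $ j $ 1 * (near_matrix (\<Psi> t1) i $ 1 $ k - near_matrix (\<Psi> t0) i $ 1 $ k)
          + N i $ j $ 2 * (near_matrix (\<Psi> t1) i $ 2 $ k - near_matrix (\<Psi> t0) i $ 2 $ k)"
        unfolding 1 2 by (simp only: right_diff_distrib add_diff_add)
      also have "\<dots> = N i $ j $ 1 * (e 1 + c * d (i, 1, k)) + N i $ j $ 2 * (e 2 + c * d (i, 2, k))"
        unfolding 3 ..
      finally have "X z = N i $ j $ 1 * (e 1 + c * d (i, 1, k)) + N i $ j $ 2 * (e 2 + c * d (i, 2, k))" .
      then have eq: "X z - c * v z = N i $ j $ 1 * e 1 + N i $ j $ 2 * e 2"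
        by (simp add: ijk v_def mult2_nth algebra_simps)
      have "vabs (N i $ j $ l * e l) \<le> L * (K * vabs c ^ 2)" for l
      proof -
        have "vabs (e l) \<le> C (i, l, k) * vabs c ^ 2"
          using C(2)[of "(i, l, k)" c] ijk(2) c(2) by (simp add: e_def t1_def d_def)
        also have "\<dots> \<le> K * vabs c ^ 2"
          using K[of "(i, l, k)"] ijk(2) by (intro mult_right_mono) auto
        finally show ?thesis
          unfolding vabs_mult using L[OF ijk(2)] L0 by (intro mult_mono) auto
      qed
      then show ?thesis
        unfolding eq mult.assoc by (intro vabs_add_le)
    qed
    moreover have "X \<in> lift m"
      unfolding X_def by (rule lift_inv_mult[OF maps[OF g(3)] maps[OF t1]])
    ultimately show "\<exists>X\<in>lift m. \<forall>z\<in>coords n. vabs (X z - c * v z) \<le> L * K * vabs c ^ 2"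
      by blast
  qed
  moreover have "block v i \<noteq> mat c" for c
  proof
    assume c: "block v i = mat c"
    \<comment> \<open>A scalar block would make \<open>d\<close> equal to \<open>c\<close> times the
      matrix at \<open>t0\<close>, whose entry (1, 1) is 1. But this entry is constant along the
      parametrization, so \<open>c = 0\<close> and the whole block of \<open>d\<close> vanishes,
      against \<open>g t0 \<noteq> 0\<close>.\<close>
    have "block v i = N i ** block d i"
      by (rule mat2_eqI) (simp_all add: v_def)
    then have "near_matrix (\<Psi> t0) i ** (N i ** block d i) = near_matrix (\<Psi> t0) i ** mat c"
      using c by simp
    then have eq: "block d i = near_matrix (\<Psi> t0) i ** mat c"
      by (simp add: matrix_mul_assoc N_def inv2_right[OF invertible_lift[OF maps[OF g(3)] i]])
    have "partial W s y (\<lambda>_. 0) (D (i, 1, 1))"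
      using partial_cong[OF D[of "(i, 1, 1)"], of "\<lambda>_. 0" "D (i, 1, 1)"] i norm by simp
    from partial_unique[OF this partial_const g(3) s_pos] have "d (i, 1, 1) = 0"
      by (simp add: d_def)
    moreover have "block d i $ 1 $ 1 = c"
      unfolding eq using norm[OF g(3)] by (simp add: mult2_nth mat_nth near_matrix_nth)
    ultimately have "c = 0"
      by simp
    then have "block d i $ j0 $ k0 = 0"
      unfolding eq by (simp add: mult2_nth mat_nth)
    moreover have "d (i, j0, k0) = g t0"
      unfolding d_def using partial_unique[OF D[of "(i, j0, k0)"] g(2,3) s_pos] i by simp
    ultimately show False
      using g(4) by simp
  qed
  ultimately show ?thesis
    by blast
qed

text \<open>The hypothesis \<open>no_H\<close> yields density of all small traces, density yields a
  nonconstant entry in every factor, and the Frobenius root of maximal exponent in each factor has a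
  derivative that is not scalar.\<close>

theorem algebraic_subgroup_or_vanishing:
  assumes F: "finite F" "\<And>f. f \<in> F \<Longrightarrow> f \<in> convergent_on (coords n) r0"
    and eq: "\<And>X. X \<in> polydisc (coords n) r0 \<Longrightarrow> near_point n X \<in> \<Sigma> \<longleftrightarrow> (\<forall>f\<in>F. f X = 0)"
    and two: "(2 :: 'k) \<noteq> 0"
    and no_H: "\<And>H \<rho>. connected_algebraic_subgroup (PGL2_power n) (regular_PGL2_power n :: ((nat \<Rightarrow> ('k ^ 2 ^ 2) set) \<Rightarrow> 'k) set) H \<Longrightarrow>
       H \<noteq> carrier (PGL2_power n) \<Longrightarrow> radius \<rho> \<Longrightarrow> \<rho> < 1 \<Longrightarrow> \<exists>X\<in>polydisc (coords n) \<rho>. near_point n X \<in> \<Sigma> - H"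
    and f: "f \<in> F"
  shows "\<exists>\<rho>. radius \<rho> \<and> \<rho> < 1 \<and> (\<forall>X\<in>polydisc (coords n) \<rho>. f X = 0)"
proof -
  obtain W \<phi> s where W: "W \<subseteq> coords n" and s: "radius s" "s \<le> r0"
    and conv: "\<And>z. z \<in> coords n \<Longrightarrow> (\<lambda>t. \<phi> t z) \<in> convergent_on W s"
    and maps: "\<And>t. t \<in> polydisc W s \<Longrightarrow> \<phi> t \<in> lift (\<lambda>_. 0)"
    and id: "\<And>X. X \<in> lift (\<lambda>_. 0) \<inter> polydisc (coords n) s \<Longrightarrow> \<phi> X = X"
    and van: "\<And>r f. radius r \<Longrightarrow> r \<le> r0 \<Longrightarrow> f \<in> vanishing_ideal (coords n) (lift (\<lambda>_. 0)) r \<Longrightarrow>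
       \<exists>d>0. \<forall>t\<in>polydisc W d. f (\<phi> t) = 0"
    by (rule ex_parametrization[OF F eq]) (assumption, assumption, rule that)
  have s_pos: "s > 0"
    using s(1) by (rule radius_pos)
  have finW: "finite W"
    using finite_subset[OF W] by simp
  obtain s' where s': "radius s'" "s' < s"
    using ex_radius_less[OF s_pos] by blast
  have dense: "zariski_dense s'"
    by (rule dense_or_algebraic_subgroup[OF W s conv maps id van s'(2) no_H])
  have maps': "\<phi> t \<in> polydisc (coords n) r0" if "t \<in> polydisc W s" for t
    using maps[OF that] by (simp add: mem_lift_0)
  \<comment> \<open>Normalisation precedes the extraction of roots: a derivative of an unnormalised
    entry could stem from rescaling the matrix and would say nothing about the point of the
    group.\<close>
  define w where "w = (\<lambda>z t. normalised (\<phi> t) z)"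
  have w: "w z \<in> convergent_on W s" if "z \<in> coords n" for z
    unfolding w_def by (rule normalised_convergent[OF conv less_imp_le[OF s_pos] maps' that])
  have w_lift: "(\<lambda>z. w z t) \<in> lift (\<lambda>_. 0)" if t: "t \<in> polydisc W s" for t
    using maps[OF t] normalised_polydisc[OF maps'[OF t] r0_less_1] near_point_normalised[OF maps'[OF t] r0_less_1]
    by (simp add: w_def mem_lift_0)
  have w_11: "w (i, 1, 1) t = 0" if "t \<in> polydisc W s" "i < n" for i t
    using vabs_near_matrix_11[OF maps'[OF that(1)] r0_less_1 that(2)] by (auto simp: w_def normalised_def)
  have "\<phi> (\<lambda>_. 0) = (\<lambda>_. 0)"
    using id[of "\<lambda>_. 0"] lift_0 s_pos by simp
  then have w_0: "w (i, 1, 2) (\<lambda>_. 0) = 0" for i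
    by (simp add: w_def normalised_def near_matrix_0 mat_nth)
  \<comment> \<open>All data of one factor are packed into a tuple, so that they can be chosen for
    all factors at once. One exponent \<open>m\<close> serves the four entries of factor
    \<open>i\<close>, as a Frobenius map of this factor must.\<close>
  define Q where "Q = (\<lambda>i (m, h, z, y, g, t). (\<forall>z\<in>{i :: nat} \<times> UNIV. h z \<in> convergent_on W s) \<and>
      (\<forall>z\<in>{i} \<times> UNIV. \<forall>t\<in>polydisc W s. w z t = h z t ^ (p ^ m)) \<and>
      z \<in> {i} \<times> UNIV \<and> y \<in> W \<and> partial W s y (h z) g \<and> t \<in> polydisc W s \<and> g t \<noteq> 0)"
  have "\<exists>u. Q i u" if i: "i < n" for i
  proof -
    obtain t where t: "t \<in> polydisc W s'" "normalised (\<phi> t) (i, 1, 2) \<noteq> 0"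
      by (rule normalised_nonzero[OF dense s'(1) W _ i, of \<phi>])
        (use id polydisc_mono[OF _ subset_refl less_imp_le[OF s'(2)]] in blast, rule that)
    have le1: "vabs (w (i, 1, 2) t) \<le> 1" if "t \<in> polydisc W s" for t
      using polydiscD[OF w_lift[OF that, unfolded mem_lift_0, THEN conjunct1], of "(i, 1, 2)"] i r0_less_1 by simp
    show ?thesis
    proof (rule maximal_p_power_root[of "{i} \<times> UNIV" w W s "(i, 1, 2)" t s'])
      show "w z \<in> convergent_on W s" if "z \<in> {i} \<times> UNIV" for z
        using w[of z] that i by auto
      show "w (i, 1, 2) t \<noteq> 0"
        using t(2) by (simp add: w_def)
      fix m h z y g
      assume A: "\<And>z. z \<in> {i} \<times> UNIV \<Longrightarrow> h z \<in> convergent_on W s"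
        "\<And>z t. z \<in> {i} \<times> UNIV \<Longrightarrow> t \<in> polydisc W s \<Longrightarrow> w z t = h z t ^ (p ^ m)"
        "z \<in> {i} \<times> UNIV" "y \<in> W" "g \<in> convergent_on W s" "partial W s y (h z) g" "\<exists>t\<in>polydisc W s. g t \<noteq> 0"
      obtain t where t: "t \<in> polydisc W s" "g t \<noteq> 0"
        using A(7) by blast
      show ?thesis
        unfolding Q_def by (rule exI[of _ "(m, h, z, y, g, t)"], unfold case_prod_conv) (intro conjI ballI A t)
    qed (use finW s(1) w_0 le1 t(1) s'(2) in auto)
  qed
  then have "\<forall>i. \<exists>u. i < n \<longrightarrow> Q i u"
    by blast
  then obtain u where u: "\<forall>i. i < n \<longrightarrow> Q i (u i)"
    by (rule choice[THEN exE])
  define m h z y g t where "m = (\<lambda>i. fst (u i))" and "h = (\<lambda>i. fst (snd (u i)))" and "z = (\<lambda>i. fst (snd (snd (u i))))"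
    and "y = (\<lambda>i. fst (snd (snd (snd (u i)))))" and "g = (\<lambda>i. fst (snd (snd (snd (snd (u i))))))"
    and "t = (\<lambda>i. snd (snd (snd (snd (snd (u i))))))"
  have Q: "Q i (m i, h i, z i, y i, g i, t i)" if "i < n" for i
    using u that by (simp add: m_def h_def z_def y_def g_def t_def)
  have h: "\<forall>z\<in>{i} \<times> UNIV. h i z \<in> convergent_on W s"
      "\<forall>z\<in>{i} \<times> UNIV. \<forall>t\<in>polydisc W s. w z t = h i z t ^ (p ^ m i)" if "i < n" for i
    using Q[OF that] unfolding Q_def case_prod_conv by - (elim conjE, assumption)+
  have g: "z i \<in> {i} \<times> UNIV" "y i \<in> W" "partial W s (y i) (h i (z i)) (g i)" "t i \<in> polydisc W s" "g i (t i) \<noteq> 0"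
    if "i < n" for i
    using Q[OF that] unfolding Q_def case_prod_conv by - (elim conjE, assumption)+
  \<comment> \<open>The roots of all factors together parametrise \<open>lift m\<close>, since
    \<open>frob m\<close> maps them back to the normalised points \<open>w\<close>.\<close>
  define \<Psi> where "\<Psi> = (\<lambda>t z. h (fst z) z t)"
  have \<Psi>_conv: "(\<lambda>t. \<Psi> t z) \<in> convergent_on W s" if "z \<in> coords n" for z
    using that h(1)[of "fst z"] by (cases z) (simp add: \<Psi>_def)
  have frob_\<Psi>: "frob m (\<Psi> t) z = w z t" if "z \<in> coords n" "t \<in> polydisc W s" for z t
    using that h(2)[of "fst z"] by (cases z) (simp add: \<Psi>_def frob_apply)
  have \<Psi>_lift: "\<Psi> t \<in> lift m" if t: "t \<in> polydisc W s" for t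
    using lift_cong[OF w_lift[OF t], of "frob m (\<Psi> t)"] frob_\<Psi>[OF _ t] by (simp add: lift_frob)
  have "\<exists>v\<in>lie m. \<forall>c. block v i \<noteq> mat c" if i: "i < n" for i
  proof -
    obtain j0 k0 where z: "z i = (i, j0, k0)"
      using g(1)[OF i] by auto
    have "\<Psi> t (i, 1, 1) = 0" if "t \<in> polydisc W s" for t
      using w_11[OF that i] frob_\<Psi>[of "(i, 1, 1)", OF _ that] i by (simp add: frob_apply)
    from nonscalar_in_lie[OF finW s(1) \<Psi>_conv \<Psi>_lift i this g(2)[OF i], of j0 k0 "g i" "t i"] g(3,4,5)[OF i]
    show ?thesis
      by (simp add: \<Psi>_def z)
  qed
  from lie_eq_UNIV[OF dense s'(1) two this] have lie: "v \<in> lie m" for v .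
  show ?thesis
  proof (rule vanishing_of_lie_UNIV[OF lie F(2)[OF f]])
    show "f X = 0" if "X \<in> lift (\<lambda>_. 0)" for X
      using that eq f by (auto simp: mem_lift_0)
  qed
qed

end

context nonarch_field
begin

text \<open>If no proper connected algebraic subgroup contains the germ, each of its finitely many
  equations vanishes near the identity. The germ is then a full neighbourhood, of dimension at least
  \<open>3 * n\<close>, which the dimension of the group does not exceed.\<close>

theorem p_sparse_PGL2_power:
  assumes two: "(2 :: 'k) \<noteq> 0"
  shows "p_sparse (PGL2_power n) (regular_PGL2_power n :: ((nat \<Rightarrow> ('k ^ 2 ^ 2) set) \<Rightarrow> 'k) set)"
  unfolding p_sparse_def
proof (intro allI impI, elim conjE)
  let ?G = "PGL2_power n :: (nat \<Rightarrow> ('k ^ 2 ^ 2) set) monoid"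
  let ?A = "regular_PGL2_power n :: ((nat \<Rightarrow> ('k ^ 2 ^ 2) set) \<Rightarrow> 'k) set"
  fix \<Sigma> assume \<Sigma>: "subgroup_germ ?G ?A \<Sigma>" and dim: "germ_dim ?G ?A \<Sigma> < algebraic_dim ?G ?A"
  have germ: "analytic_germ ?G ?A \<Sigma>" and nonempty: "\<not> germ_le ?G ?A \<Sigma> {}"
    and ev: "\<forall>\<^sub>F (a, b) in near_one ?G ?A \<times>\<^sub>F near_one ?G ?A. a \<in> \<Sigma> \<longrightarrow> b \<in> \<Sigma> \<longrightarrow> inv\<^bsub>?G\<^esub> a \<otimes>\<^bsub>?G\<^esub> b \<in> \<Sigma>"
    using \<Sigma> by (auto simp: subgroup_germ_def irreducible_in_def)
  obtain F r1 where F: "finite F" "radius r1" "r1 < 1"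
    "\<And>f. f \<in> F \<Longrightarrow> (\<lambda>X. f (near_point n X)) \<in> convergent_on (coords n) r1"
    "\<And>X. X \<in> polydisc (coords n) r1 \<Longrightarrow> near_point n X \<in> \<Sigma> \<longleftrightarrow> (\<forall>f\<in>F. f (near_point n X) = 0)"
    by (rule analytic_germE[OF germ]) (rule that)
  obtain P Q where PQ: "eventually P (near_one ?G ?A)" "eventually Q (near_one ?G ?A)"
    "\<And>a b. P a \<Longrightarrow> Q b \<Longrightarrow> a \<in> \<Sigma> \<longrightarrow> b \<in> \<Sigma> \<longrightarrow> inv\<^bsub>?G\<^esub> a \<otimes>\<^bsub>?G\<^esub> b \<in> \<Sigma>"
    using ev unfolding eventually_prod_filter by auto
  obtain r2 where r2: "radius r2" "\<forall>X\<in>polydisc (coords n) r2. P (near_point n X)"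
    using PQ(1) unfolding eventually_near_one by (elim exE conjE) (rule that)
  obtain r3 where r3: "radius r3" "\<forall>X\<in>polydisc (coords n) r3. Q (near_point n X)"
    using PQ(2) unfolding eventually_near_one by (elim exE conjE) (rule that)
  \<comment> \<open>One polydisc on which the equations converge and cut out
    \<open>\<Sigma>\<close>, and on which both arguments of the closure condition may range.\<close>
  define r0 where "r0 = min r1 (min r2 r3)"
  have r0: "radius r0" "r0 < 1" "r0 \<le> r1" "r0 \<le> r2" "r0 \<le> r3"
    using F(2,3) r2(1) r3(1) by (auto simp: r0_def radius_min)
  have closed: "inv\<^bsub>?G\<^esub> near_point n X \<otimes>\<^bsub>?G\<^esub> near_point n Y \<in> \<Sigma>"
    if "X \<in> polydisc (coords n) r0" "Y \<in> polydisc (coords n) r0" "near_point n X \<in> \<Sigma>" "near_point n Y \<in> \<Sigma>" for X Y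
    using PQ(3)[OF bspec[OF r2(2) polydisc_mono[OF that(1) subset_refl r0(4)]]
        bspec[OF r3(2) polydisc_mono[OF that(2) subset_refl r0(5)]]] that(3,4) by blast
  \<comment> \<open>A nonempty germ has some point in the polydisc, and the quotient of this point
    by itself is the identity.\<close>
  have one: "\<one>\<^bsub>?G\<^esub> \<in> \<Sigma>"
  proof -
    have "\<not> (\<forall>X\<in>polydisc (coords n) r0. near_point n X \<notin> \<Sigma>)"
      using nonempty r0(1,2) unfolding germ_le_def eventually_near_one by auto
    then obtain X where X: "X \<in> polydisc (coords n) r0" "near_point n X \<in> \<Sigma>"
      by blast
    have "inv\<^bsub>?G\<^esub> near_point n X \<otimes>\<^bsub>?G\<^esub> near_point n X = \<one>\<^bsub>?G\<^esub>"
      by (rule group.l_inv[OF group_PGL2_power near_point_in_carrier[OF X(1) r0(2)]])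
    then show ?thesis
      using closed[OF X(1,1,2,2)] by simp
  qed
  interpret small_subgroup field_type p n r0 \<Sigma>
    by unfold_locales (fact r0(1) r0(2) one closed)+
  show "\<exists>H. connected_algebraic_subgroup ?G ?A H \<and> H \<noteq> carrier ?G \<and> germ_le ?G ?A \<Sigma> H"
  proof (rule ccontr)
    assume "\<not> ?thesis"
    then have no_H: "\<not> germ_le ?G ?A \<Sigma> H" if "connected_algebraic_subgroup ?G ?A H" "H \<noteq> carrier ?G" for H
      using that by blast
    have "\<forall>\<^sub>F x in near_one ?G ?A. f x = 0" if f: "f \<in> F" for f
      unfolding eventually_near_one
    proof (rule algebraic_subgroup_or_vanishing[of "(\<lambda>f X. f (near_point n X)) ` F"])
      show "g \<in> convergent_on (coords n) r0" if "g \<in> (\<lambda>f X. f (near_point n X)) ` F" for g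
        using that tate_mono[OF F(4) subset_refl r0(3)] by auto
      show "near_point n X \<in> \<Sigma> \<longleftrightarrow> (\<forall>g\<in>(\<lambda>f X. f (near_point n X)) ` F. g X = 0)"
        if "X \<in> polydisc (coords n) r0" for X
        using F(5)[OF polydisc_mono[OF that subset_refl r0(3)]] by simp
      show "\<exists>X\<in>polydisc (coords n) \<rho>. near_point n X \<in> \<Sigma> - H"
        if "connected_algebraic_subgroup ?G ?A H" "H \<noteq> carrier ?G" "radius \<rho>" "\<rho> < 1" for H \<rho>
        using no_H[OF that(1,2)] that(3,4) unfolding germ_le_def eventually_near_one by blast
    qed (use F(1) f two in auto)
    then have "\<forall>\<^sub>F x in near_one ?G ?A. \<forall>f\<in>F. f x = 0"
      using F(1) by (intro eventually_ball_finite) auto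
    moreover have "\<forall>\<^sub>F x in near_one ?G ?A. x \<in> \<Sigma> \<longleftrightarrow> (\<forall>f\<in>F. f x = 0)"
      unfolding eventually_near_one using F(2,3,5) by blast
    ultimately have "\<forall>\<^sub>F x in near_one ?G ?A. x \<in> \<Sigma>"
      by eventually_elim simp
    from germ_dim_ge[OF this] have "algebraic_dim ?G ?A \<le> germ_dim ?G ?A \<Sigma>"
      using algebraic_dim_PGL2_power_le order_trans by blast
    with dim show False
      by simp
  qed
qed

end

section \<open>The characteristic of $\mathbb{C}_\infty$\<close>

text \<open>Translation by 1 permutes the ring, so it does not change the sum of all elements, yet
  it adds \<open>CARD('a)\<close> times 1 to it.\<close>

lemma CHAR_dvd_card: "CHAR('a :: {ring_1, finite}) dvd CARD('a)"
proof -
  have "(\<Sum>x\<in>UNIV. x + 1 :: 'a) = \<Sum>UNIV"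
    by (rule sum.reindex_bij_witness[of _ "\<lambda>x. x - 1" "\<lambda>x. x + 1"]) auto
  then have "of_nat CARD('a) = (0 :: 'a)"
    by (simp add: sum.distrib)
  then show ?thesis
    by (simp add: of_nat_eq_0_iff_char_dvd)
qed

context C_infinity
begin

lemma embed_of_nat: "\<iota> (of_nat m) = of_nat m"
proof (induction m)
  case 0
  have "\<iota> 0 + 0 = \<iota> 0 + \<iota> 0"
    unfolding embed_add[symmetric] by (simp only: add_0_right)
  then have "\<iota> 0 = 0"
    unfolding add_left_cancel by (rule sym)
  then show ?case
    by simp
qed (simp add: embed_add embed_one)

text \<open>The formula for absolute values makes \<open>\<iota>\<close> injective, so a multiple of
  1 vanishes in \<open>'k\<close> only if it does in \<open>'f\<close>.\<close>

lemma char_eq: "CHAR('k) = CHAR('f)"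
proof (rule CHAR_eqI)
  show "of_nat CHAR('f) = (0 :: 'k)"
    using embed_of_nat[of "CHAR('f)"] embed_of_nat[of 0] by (simp add: fls_of_nat)
  show "CHAR('f) dvd m" if m: "of_nat m = (0 :: 'k)" for m
  proof (rule ccontr)
    assume "\<not> CHAR('f) dvd m"
    then have "(of_nat m :: 'f fls) \<noteq> 0"
      unfolding fls_of_nat by (intro fls_const_nonzero) (simp add: of_nat_eq_0_iff_char_dvd)
    from embed_abs[OF this] m show False
      by (simp add: embed_of_nat)
  qed
qed

lemma nonarch_field: "nonarch_field TYPE('k) CHAR('f)"
proof
  show "CHAR('k) = CHAR('f)"
    by (rule char_eq)
  show "prime CHAR('f)"
    by (rule prime_CHAR_semidom) (rule finite_imp_CHAR_pos, simp)
  have "q \<ge> 2"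
    using card_mono[of UNIV "{0, 1 :: 'f}"] by (simp flip: card_eq)
  \<comment> \<open>The image of the uniformiser has absolute value \<open>1 / q\<close>.\<close>
  then have "vabs (\<iota> fls_X) < 1"
    using embed_abs[of fls_X] by (simp add: vabs_def power_int_minus inverse_less_1_iff)
  moreover have "\<iota> fls_X \<noteq> 0"
    using embed_abs[of fls_X] \<open>q \<ge> 2\<close> by auto
  ultimately show "\<exists>c :: 'k. c \<noteq> 0 \<and> vabs c < 1"
    by blast
qed

lemma two_neq_0:
  assumes "odd q"
  shows "(2 :: 'k) \<noteq> 0"
proof
  assume "(2 :: 'k) = 0"
  then have "CHAR('f) dvd 2"
    using of_nat_eq_0_iff_char_dvd[of 2, where 'a = 'k] by (simp add: char_eq)
  moreover have "CHAR('f) dvd q"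
    using CHAR_dvd_card card_eq by metis
  moreover have "coprime 2 q"
    using assms by simp
  ultimately have "CHAR('f) = 1"
    using coprime_common_divisor_nat[of 2 q "CHAR('f)"] by simp
  then show False
    by simp
qed

end

theorem lemma3p27:
  fixes \<iota> :: "'f :: {field, finite} fls \<Rightarrow> 'k :: {alg_closed_field, ultrametric_field}"
    and q n :: nat
  assumes "C_infinity q \<iota>" and "odd q" and "n \<ge> 1"
  shows "p_sparse (PGL2_power n) (regular_PGL2_power n :: ((nat \<Rightarrow> ('k ^ 2 ^ 2) set) \<Rightarrow> 'k) set)"
  by (rule nonarch_field.p_sparse_PGL2_power[OF C_infinity.nonarch_field[OF assms(1)] C_infinity.two_neq_0[OF assms(1,2)]])

end
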